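(* Let $n\ge 3$ be an integer, let $k$ be the largest integer such that $k\le (n+1)/3$, and let $$u_1=\cos\frac{2\pi k}{n+1},\quad u_2=\cos\frac{2\pi(k+1)}{n+1},\quad D_1=\frac{-2u_1u_2-1}{2(1-u_1)(1-u_2)},\quad D_2=\frac{-1}{2(1-u_1)(1-u_2)},$$ $$D_3=(-1-4D_1-3D_1^2+2D_2^2)/2,$$ $$D_4=(3D_1-4D_2+3D_1^2-2D_1D_2-6D_2^2)/2,$$ $$D_5=(2+4D_1+5D_2+2D_1^2+4D_1D_2+3D_2^2)/2,$$ $$D_6=(2D_2+2D_1D_2+3D_2^2)/2,$$ $$D=D_3n+D_4+D_5/n+D_6/n^2.$$ If $n=3$ or $n=5$ let $\alpha=3/2$; otherwise let $\alpha=2$. If $n=5$ let $\Delta=7/225$; otherwise let $\Delta=0$. Then for $\beta$ sufficiently close to $1$, $$r_{n+1}(\beta)=1+(D_1+D_2/n)(1-\beta)+(D+\Delta)(1-\beta)^2+\mathcal O\big((1-\beta)^{\alpha+1}\big).$$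
   Context: $\beta$ denotes a real number with $0\le\beta\le 1$. For an integer $m\ge2$, $S(m,\beta)$ is the set of complex polynomials of degree $m$ with all roots in the closed unit disk and at least one root at $\beta$. For a polynomial $P$, $|P|_\beta$ is the distance between $\beta$ and the closest root of the derivative $P'$. Define $r_m(\beta)=\sup\{|P|_\beta: P\in S(m,\beta)\}$. The notation $\mathcal O((1-\beta)^s)$ denotes a quantity bounded in modulus by $C(1-\beta)^s$ for all $\beta\in(\beta_0,1)$, where $C$ and $\beta_0<1$ depend only on $n$. *)

theory Defs
  imports "HOL-Analysis.Analysis" "HOL-Computational_Algebra.Polynomial"
begin

definition sendov_polys :: "nat \<Rightarrow> real \<Rightarrow> complex poly set" where
  "sendov_polys m \<beta> =
     {P. degree P = m \<and> (\<forall>z. poly P z = 0 \<longrightarrow> norm z \<le> 1) \<and> poly P (complex_of_real \<beta>) = 0}"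

text \<open>
  For a polynomial of degree at least 2 the set of critical points is finite and nonempty, so the
  infimum in \<^const>\<open>infdist\<close> is the distance to a closest critical point.
\<close>

definition crit_dist :: "real \<Rightarrow> complex poly \<Rightarrow> real" where
  "crit_dist \<beta> P = infdist (complex_of_real \<beta>) {z. poly (pderiv P) z = 0}"

text \<open>
  For \<open>m \<ge> 2\<close> and \<open>0 \<le> \<beta> \<le> 1\<close> the supremum is over a nonempty set that is bounded above
  (critical points lie in the closed unit disk by the Gauss--Lucas theorem), so it is a genuine
  real supremum.
\<close>

definition sendov_radius :: "nat \<Rightarrow> real \<Rightarrow> real" where
  "sendov_radius m \<beta> = (SUP P\<in>sendov_polys m \<beta>. crit_dist \<beta> P)"

end

theory Submission
  imports Defs "HOL-Computational_Algebra.Fundamental_Theorem_Algebra"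
begin

text \<open>
  Write \<open>r\<close> for the distance from \<open>\<beta>\<close> to the nearest critical point \<open>\<zeta>\<^sub>j\<close> of a
  polynomial of degree \<open>n + 1\<close> that vanishes at \<open>\<beta>\<close>, put
  \<open>v\<^sub>j = r / (\<beta> - \<zeta>\<^sub>j)\<close>, so that \<open>\<bar>v\<^sub>j\<bar> \<le> 1\<close>, and write the other zeros as
  \<open>\<beta> + r / s\<close>. Integrating the product \<open>\<Prod>(1 + v\<^sub>j x)\<close>, to which the derivative is
  proportional, the zeros become the zeros \<open>s\<close> of \<open>Qfun n v\<close>, and the
  unit disk becomes the set \<open>Phi \<beta> r s \<le> 0\<close>. The question is therefore how large \<open>r\<close> can be if
  some \<open>v\<close> in the polydisk is to be \<open>admissible\<close>; conversely, admissible \<open>v\<^sub>j\<close> on the unit circle come from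
  a polynomial (\<open>sendov_poly_of_admissible\<close>, \<open>admissible_of_sendov_poly\<close>).

  At \<open>\<beta> = 1\<close> the only admissible choice with \<open>r = 1\<close> is \<open>v\<^sub>j = 1\<close>, and the zeros are
  \<open>1 / (w - 1)\<close> for the \<open>n\<close> roots of unity \<open>w \<noteq> 1\<close> of order dividing \<open>n + 1\<close>; each of them lies on
  the boundary \<open>Phi = 0\<close>. So there are \<open>n\<close> constraints, one for each \<open>w\<close>, all of them tight at
  \<open>\<beta> = 1\<close>. With \<open>h = sqrt (1 - \<beta>)\<close>, a near-optimal \<open>v\<close> lies within \<open>O(h)\<close> of
  \<open>(1, \<dots>, 1)\<close> because the zeros satisfy a sum rule (Vieta). Write \<open>v\<^sub>j = c (1 + \<xi>\<^sub>j)\<close> with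
  \<open>\<Sum>\<xi>\<^sub>j = 0\<close>. In the variable \<open>q = 1 + 1 / s\<close>, up to the factor \<open>c\<close>, the zero that belongs to \<open>w\<close> has an expansion in
  the elementary symmetric functions of the \<open>\<xi>\<^sub>j\<close> (\<open>perturbed_inverse_root\<close>), which turns each
  constraint into an inequality between power sums of the \<open>\<xi>\<^sub>j\<close>.

  First order (\<open>first_order_Phi\<close>). With \<open>S = \<Sum>\<bar>\<xi>\<^sub>j\<bar>\<^sup>2\<close> and \<open>u = Re w\<close> the constraint is
  \<open>(r - 1) + h\<^sup>2 + S \<eta>(u) + slack + odd \<le> h\<^sup>2 / (1 - u) + O(h\<^sup>4)\<close>, where \<open>\<eta>\<close> is affine in \<open>u\<close>, the
  slack \<open>\<Sum>(1 - \<bar>v\<^sub>j\<bar>\<^sup>2)\<close> is nonnegative, and the odd part changes sign under conjugation of \<open>w\<close>.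
  The best \<open>r\<close> and \<open>S\<close> are those for which the line \<open>(r - 1) + h\<^sup>2 + S \<eta>(u)\<close> passes through the points of
  the convex curve \<open>h\<^sup>2 / (1 - u)\<close> over the two consecutive values \<open>u1\<close> and \<open>u2\<close> that enclose the
  zero of \<open>\<eta>\<close> (\<open>secant_line\<close>). This gives \<open>r = 1 + c1 h\<^sup>2 + \<dots>\<close> and \<open>S = S1 h\<^sup>2 + \<dots>\<close>, and
  shows that only the roots of unity over \<open>u1\<close> and \<open>u2\<close> matter from there on.

  Second order (\<open>second_order_Phi\<close>). Averaging the two active constraints with the weights
  \<open>l1, l2\<close> for which \<open>l1 \<eta>(u1) + l2 \<eta>(u2) = 0\<close> removes \<open>S\<close>, and averaging over conjugate roots removes
  the odd part. The remaining free quantity is the fourth moment of the imaginary parts of the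
  \<open>\<xi>\<^sub>j\<close>, whose coefficient makes a large fourth moment favourable when \<open>n \<ge> 4\<close> (\<open>Wc_nonpos\<close>). Its largest value
  depends on the third moment. If both active roots of unity are nonreal, that is, if \<open>n\<close> is
  neither 3 nor 5, the vanishing of both odd parts forces the third moment to be of higher
  order, and then the fourth moment is at most half the square of the second moment, up to a negligible term
  (\<open>fourth_moment\<close>), with equality for a pair of opposite values. For \<open>n = 3\<close> this is an identity. For
  \<open>n = 5\<close> the second active root of unity is \<open>-1\<close>, whose constraint has no odd part; a rotation of
  \<open>c\<close> compensates the third moment, and the values \<open>(4, -1, -1, -1, -1)\<close> give the ratio \<open>13/20\<close>
  in place of \<open>1/2\<close>. This accounts for \<open>\<Delta> = 7/225\<close>. For \<open>n = 3\<close> and \<open>n = 5\<close> the third moment is only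
  of order \<open>h\<^sup>3\<close>, whence the weaker error term.

  The lower bound takes these optimal values on the unit circle, adjusts \<open>S\<close> to second order so that
  both active constraints give the same \<open>r\<close>, and decreases \<open>r\<close> by a large multiple of the
  error term.
\<close>

section \<open>Orders of smallness along a filter\<close>

text \<open>One calculus along a filter serves both directions of the theorem. For the upper bound the filter runs over all pairs of a point \<open>\<beta>\<close> near 1
  and a near-optimal polynomial, so that the estimates are uniform in the polynomial; for the lower bound
  it is the filter of a single real parameter.\<close>

locale small_scale =
  fixes F :: "'a filter" and h :: "'a \<Rightarrow> real"
  assumes h_pos: "eventually (\<lambda>x. 0 < h x) F"
    and h_tendsto: "(h \<longlongrightarrow> 0) F"
begin

definition Oh :: "nat \<Rightarrow> ('a \<Rightarrow> 'b::real_normed_field) \<Rightarrow> bool" where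
  "Oh k f \<longleftrightarrow> (\<exists>C. eventually (\<lambda>x. norm (f x) \<le> C * h x ^ k) F)"

lemma OhI: "eventually (\<lambda>x. norm (f x) \<le> C * h x ^ k) F \<Longrightarrow> Oh k f"
  by (auto simp: Oh_def)

lemma OhE:
  assumes "Oh k f"
  obtains C where "C > 0" "eventually (\<lambda>x. norm (f x) \<le> C * h x ^ k) F"
proof -
  obtain C where C: "eventually (\<lambda>x. norm (f x) \<le> C * h x ^ k) F"
    using assms by (auto simp: Oh_def)
  have "eventually (\<lambda>x. norm (f x) \<le> (\<bar>C\<bar> + 1) * h x ^ k) F"
    using C h_pos
  proof eventually_elim
    case (elim x)
    have "C * h x ^ k \<le> (\<bar>C\<bar> + 1) * h x ^ k"
      using elim by (intro mult_right_mono) auto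
    then show ?case using elim by linarith
  qed
  then show thesis by (intro that[of "\<bar>C\<bar> + 1"]) auto
qed

lemma h_less: "c > 0 \<Longrightarrow> eventually (\<lambda>x. h x < c) F"
  using order_tendstoD(2)[OF h_tendsto] by blast

lemma Oh_mono:
  assumes "Oh k f" "l \<le> k"
  shows "Oh l f"
proof -
  obtain C where C: "C > 0" "eventually (\<lambda>x. norm (f x) \<le> C * h x ^ k) F"
    using assms(1) by (rule OhE)
  have "eventually (\<lambda>x. norm (f x) \<le> C * h x ^ l) F"
    using C(2) h_pos h_less[OF zero_less_one]
  proof eventually_elim
    case (elim x)
    have "h x ^ k \<le> h x ^ l"
      using elim assms(2) by (intro power_decreasing) auto
    then show ?case using elim C(1) by (meson mult_left_mono order_trans less_imp_le)
  qed
  then show ?thesis by (rule OhI)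
qed

lemma Oh_cong_ev:
  assumes "Oh k f" "eventually (\<lambda>x. f x = g x) F"
  shows "Oh k g"
proof -
  obtain C where C: "C > 0" "eventually (\<lambda>x. norm (f x) \<le> C * h x ^ k) F"
    using assms(1) by (rule OhE)
  show ?thesis
    by (rule OhI[of _ C]) (use C(2) assms(2) in eventually_elim, auto)
qed

lemma Oh_cong: "Oh k f \<Longrightarrow> (\<And>x. g x = f x) \<Longrightarrow> Oh k g"
  by (rule Oh_cong_ev) auto

lemma Oh_le_ev:
  assumes "Oh k f" "eventually (\<lambda>x. norm (g x) \<le> norm (f x)) F"
  shows "Oh k g"
proof -
  obtain C where C: "C > 0" "eventually (\<lambda>x. norm (f x) \<le> C * h x ^ k) F"
    using assms(1) by (rule OhE)
  show ?thesis
    by (rule OhI[of _ C]) (use C(2) assms(2) in eventually_elim, auto)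
qed

lemma Oh_le: "Oh k f \<Longrightarrow> (\<And>x. norm (g x) \<le> norm (f x)) \<Longrightarrow> Oh k g"
  by (rule Oh_le_ev) auto

lemma Oh_zero: "Oh k (\<lambda>x. 0)"
  by (rule OhI[of _ 0]) auto

lemma Oh_const: "Oh 0 (\<lambda>x. c)"
  by (rule OhI[of _ "norm c"]) auto

lemma Oh_h_power: "Oh k (\<lambda>x. h x ^ k)"
  by (rule OhI[of _ 1]) (use h_pos in eventually_elim, auto)

lemma Oh_h2: "Oh 2 (\<lambda>x. h x ^ 2)" and Oh_h4: "Oh 4 (\<lambda>x. h x ^ 4)"
  using Oh_h_power by blast+

lemma Oh_add:
  assumes "Oh k f" "Oh k g"
  shows "Oh k (\<lambda>x. f x + g x)"
proof -
  obtain C D where "eventually (\<lambda>x. norm (f x) \<le> C * h x ^ k) F"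
     "eventually (\<lambda>x. norm (g x) \<le> D * h x ^ k) F"
    using assms unfolding Oh_def by blast
  then have "eventually (\<lambda>x. norm (f x + g x) \<le> (C + D) * h x ^ k) F"
  proof eventually_elim
    case (elim x)
    then show ?case
      using norm_triangle_ineq[of "f x" "g x"] by (simp add: distrib_right)
  qed
  then show ?thesis by (rule OhI)
qed

lemma Oh_uminus: "Oh k f \<Longrightarrow> Oh k (\<lambda>x. - f x)"
  by (erule Oh_le) auto

lemma Oh_diff: "Oh k f \<Longrightarrow> Oh k g \<Longrightarrow> Oh k (\<lambda>x. f x - g x)"
  using Oh_add[of k f "\<lambda>x. - g x"] Oh_uminus[of k g] by simp

lemma Oh_mult:
  assumes "Oh k f" "Oh l g" "m \<le> k + l"
  shows "Oh m (\<lambda>x. f x * g x)"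
proof -
  obtain C where C: "C > 0" "eventually (\<lambda>x. norm (f x) \<le> C * h x ^ k) F"
    using assms(1) by (rule OhE)
  obtain D where D: "D > 0" "eventually (\<lambda>x. norm (g x) \<le> D * h x ^ l) F"
    using assms(2) by (rule OhE)
  have "eventually (\<lambda>x. norm (f x * g x) \<le> (C * D) * h x ^ (k + l)) F"
    using C(2) D(2) h_pos
  proof eventually_elim
    case (elim x)
    have "norm (f x) * norm (g x) \<le> (C * h x ^ k) * (D * h x ^ l)"
      using elim C(1) by (intro mult_mono) auto
    then show ?case by (simp add: norm_mult power_add mult_ac)
  qed
  then have "Oh (k + l) (\<lambda>x. f x * g x)" by (rule OhI)
  then show ?thesis using assms(3) by (rule Oh_mono)
qed

lemma Oh_cmult: "Oh k f \<Longrightarrow> Oh k (\<lambda>x. c * f x)"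
  using Oh_mult[OF Oh_const, of k f k c] by simp

lemma Oh_cmult_right: "Oh k f \<Longrightarrow> Oh k (\<lambda>x. f x * c)"
  using Oh_mult[OF _ Oh_const, of k f k c] by simp

lemma Oh_divide_const: "Oh k f \<Longrightarrow> Oh k (\<lambda>x. f x / c)"
  using Oh_cmult_right[of k f "inverse c"] by (simp add: divide_inverse)

lemma Oh_power:
  assumes "Oh k f" "m \<le> k * p"
  shows "Oh m (\<lambda>x. f x ^ p)"
proof -
  have "Oh (k * p) (\<lambda>x. f x ^ p)"
  proof (induction p)
    case 0
    then show ?case using Oh_const[of 1] by simp
  next
    case (Suc p)
    show ?case using Oh_mult[OF assms(1) Suc, of "k * Suc p"] by simp
  qed
  then show ?thesis using assms(2) by (rule Oh_mono)
qed

lemma Oh_sum: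
  assumes "\<And>i. i \<in> I \<Longrightarrow> Oh k (f i)"
  shows "Oh k (\<lambda>x. \<Sum>i\<in>I. f i x)"
  using assms
  by (induction I rule: infinite_finite_induct) (auto simp: Oh_zero intro!: Oh_add)

lemma Oh_of_real: "Oh k f \<Longrightarrow> Oh k (\<lambda>x. of_real (f x))"
  by (simp add: Oh_def)

lemma Oh_Re: "Oh k f \<Longrightarrow> Oh k (\<lambda>x. Re (f x))"
  by (erule Oh_le) (simp add: abs_Re_le_cmod)

lemma Oh_Im: "Oh k f \<Longrightarrow> Oh k (\<lambda>x. Im (f x))"
  by (erule Oh_le) (simp add: abs_Im_le_cmod)

lemma Oh_cnj: "Oh k f \<Longrightarrow> Oh k (\<lambda>x. cnj (f x))"
  by (simp add: Oh_def)

lemma Oh_norm: "Oh k f \<Longrightarrow> Oh k (\<lambda>x. norm (f x))"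
  by (simp add: Oh_def)

lemma Oh_complexI:
  assumes "Oh k (\<lambda>x. Re (f x))" "Oh k (\<lambda>x. Im (f x))"
  shows "Oh k f"
proof -
  have "Oh k (\<lambda>x. of_real (Re (f x)) + \<i> * of_real (Im (f x)))"
    using assms by (intro Oh_add Oh_cmult Oh_of_real)
  then show ?thesis by (simp add: complex_eq[symmetric])
qed

lemma Oh_tendsto_0:
  assumes "Oh k f" "0 < k"
  shows "(f \<longlongrightarrow> 0) F"
proof -
  have "Oh 1 f" using assms by (intro Oh_mono[OF assms(1)]) auto
  then obtain C where C: "C > 0" "eventually (\<lambda>x. norm (f x) \<le> C * h x ^ 1) F"
    by (rule OhE)
  have "((\<lambda>x. C * h x) \<longlongrightarrow> 0) F"
    using tendsto_mult_right_zero[OF h_tendsto] .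
  then show ?thesis
    by (rule Lim_null_comparison[rotated]) (use C in simp)
qed

lemma Oh_tendsto: "Oh k (\<lambda>x. f x - c) \<Longrightarrow> 0 < k \<Longrightarrow> (f \<longlongrightarrow> c) F"
  using Oh_tendsto_0 Lim_null by blast

lemma Oh_bounded: "(f \<longlongrightarrow> c) F \<Longrightarrow> Oh 0 f"
proof -
  assume "(f \<longlongrightarrow> c) F"
  then have "((\<lambda>x. norm (f x)) \<longlongrightarrow> norm c) F" by (rule tendsto_norm)
  then have "eventually (\<lambda>x. norm (f x) < norm c + 1) F"
    by (rule order_tendstoD) simp
  then show ?thesis
    by (intro OhI[of _ "norm c + 1"]) (auto elim!: eventually_mono)
qed

text \<open>A factor with a nonzero limit may be cancelled.\<close>

lemma Oh_cancel:
  assumes "Oh k (\<lambda>x. f x * g x)" "(g \<longlongrightarrow> c) F" "c \<noteq> 0"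
  shows "Oh k f"
proof -
  have "((\<lambda>x. inverse (g x)) \<longlongrightarrow> inverse c) F"
    using assms(2,3) by (rule tendsto_inverse)
  then have "Oh 0 (\<lambda>x. inverse (g x))" by (rule Oh_bounded)
  then have "Oh k (\<lambda>x. (f x * g x) * inverse (g x))"
    using Oh_mult[OF assms(1)] by simp
  moreover have "eventually (\<lambda>x. g x \<noteq> 0) F"
    using assms(2,3) tendsto_imp_eventually_ne by blast
  ultimately show ?thesis
    by (elim Oh_cong_ev) (auto elim!: eventually_mono)
qed

lemma Oh_sandwich:
  fixes f :: "'a \<Rightarrow> real"
  assumes "Oh k l" "Oh k u" "eventually (\<lambda>x. l x \<le> f x) F" "eventually (\<lambda>x. f x \<le> u x) F"
  shows "Oh k f"
proof -
  have "Oh k (\<lambda>x. \<bar>l x\<bar> + \<bar>u x\<bar>)"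
    using Oh_add[OF Oh_norm[OF assms(1)] Oh_norm[OF assms(2)]] by simp
  then show ?thesis
    by (rule Oh_le_ev) (use assms(3,4) in eventually_elim, auto)
qed

end

section \<open>Elementary symmetric functions\<close>

text \<open>The elementary symmetric function of degree \<open>k\<close> in \<open>y 0, \<dots>, y (n - 1)\<close>.\<close>

fun esym :: "(nat \<Rightarrow> 'a::comm_ring_1) \<Rightarrow> nat \<Rightarrow> nat \<Rightarrow> 'a" where
  "esym y n 0 = 1"
| "esym y 0 (Suc k) = 0"
| "esym y (Suc n) (Suc k) = esym y n (Suc k) + y n * esym y n k"

lemma esym_eq_0: "n < k \<Longrightarrow> esym y n k = 0"
  by (induction y n k rule: esym.induct) auto

lemma esym_top: "esym y n n = (\<Prod>j<n. y j)"
  by (induction n) (auto simp: esym_eq_0 mult.commute)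

lemma prod_linear_eq_esym:
  "(\<Prod>j<n. q + y j * t) = (\<Sum>k\<le>n. esym y n k * t ^ k * q ^ (n - k))"
proof (induction n)
  case (Suc n)
  have "(\<Prod>j<Suc n. q + y j * t) = (\<Sum>k\<le>n. esym y n k * t ^ k * q ^ (n - k)) * (q + y n * t)"
    using Suc by simp
  also have "\<dots> = (\<Sum>k\<le>n. esym y n k * t ^ k * q ^ (Suc n - k))
       + (\<Sum>k\<le>n. y n * esym y n k * t ^ Suc k * q ^ (n - k))"
    by (simp add: sum_distrib_right distrib_left sum.distrib Suc_diff_le mult_ac sum_distrib_left)
  also have "(\<Sum>k\<le>n. esym y n k * t ^ k * q ^ (Suc n - k)) =
      (\<Sum>k\<le>Suc n. esym y n k * t ^ k * q ^ (Suc n - k))"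
    by (simp add: esym_eq_0)
  also have "\<dots> = q ^ Suc n + (\<Sum>k\<le>n. esym y n (Suc k) * t ^ Suc k * q ^ (n - k))"
    by (subst sum.atMost_Suc_shift) simp
  also have "q ^ Suc n + (\<Sum>k\<le>n. esym y n (Suc k) * t ^ Suc k * q ^ (n - k))
       + (\<Sum>k\<le>n. y n * esym y n k * t ^ Suc k * q ^ (n - k))
     = q ^ Suc n + (\<Sum>k\<le>n. esym y (Suc n) (Suc k) * t ^ Suc k * q ^ (n - k))"
    by (simp add: sum.distrib distrib_right distrib_left add.assoc)
  also have "\<dots> = (\<Sum>k\<le>Suc n. esym y (Suc n) k * t ^ k * q ^ (Suc n - k))"
    by (subst sum.atMost_Suc_shift) simp
  finally show ?case .
qed simp

lemma esym_scale: "esym (\<lambda>j. c * y j) n k = c ^ k * esym y n k"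
  by (induction y n k rule: esym.induct) (auto simp: algebra_simps)

lemma esym_cong: "(\<And>j. j < n \<Longrightarrow> y j = z j) \<Longrightarrow> esym y n k = esym z n k"
  by (induction y n k rule: esym.induct) auto

text \<open>The coefficients of \<open>Qfun\<close> are bounded through those of \<open>\<Prod>(1 + \<bar>v\<^sub>j\<bar>)\<close>.\<close>

lemma norm_esym_le: "norm (esym (y :: nat \<Rightarrow> complex) n k) \<le> esym (\<lambda>j. norm (y j)) n k"
proof (induction y n k rule: esym.induct)
  case (3 y n k)
  have "norm (esym y (Suc n) (Suc k)) \<le> norm (esym y n (Suc k)) + norm (y n) * norm (esym y n k)"
    using norm_triangle_ineq by (metis esym.simps(3) norm_mult)
  also have "\<dots> \<le> esym (\<lambda>j. norm (y j)) n (Suc k) + norm (y n) * esym (\<lambda>j. norm (y j)) n k"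
    using 3 by (intro add_mono mult_left_mono) auto
  finally show ?case by simp
qed auto

text \<open>Newton's identities; the recursive definition makes each of them an induction on \<open>n\<close>.\<close>

lemma esym_1: "esym y n (Suc 0) = (\<Sum>j<n. y j)"
  by (induction n) (auto simp: algebra_simps)

lemma esym_2: "2 * esym y n 2 = (\<Sum>j<n. y j)^2 - (\<Sum>j<n. y j ^ 2)"
proof (induction n)
  case (Suc n)
  have "2 * esym y (Suc n) 2 = 2 * esym y n 2 + 2 * y n * esym y n (Suc 0)"
    by (simp add: numeral_2_eq_2 algebra_simps)
  then show ?case unfolding Suc esym_1
    by (simp add: power2_eq_square algebra_simps)
qed (simp add: numeral_2_eq_2)

lemma esym_3: "6 * esym y n 3 =
  (\<Sum>j<n. y j)^3 - 3 * (\<Sum>j<n. y j) * (\<Sum>j<n. y j ^ 2) + 2 * (\<Sum>j<n. y j ^ 3)"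
proof (induction n)
  case (Suc n)
  have "6 * esym y (Suc n) 3 = 6 * esym y n 3 + 3 * y n * (2 * esym y n 2)"
    by (simp add: numeral_3_eq_3 numeral_2_eq_2 algebra_simps)
  then show ?case unfolding Suc esym_2
    by (simp add: power2_eq_square power3_eq_cube algebra_simps)
qed (simp add: numeral_3_eq_3)

lemma esym_4: "24 * esym y n 4 =
  (\<Sum>j<n. y j)^4 - 6 * (\<Sum>j<n. y j)^2 * (\<Sum>j<n. y j ^ 2) + 3 * (\<Sum>j<n. y j ^ 2)^2
  + 8 * (\<Sum>j<n. y j) * (\<Sum>j<n. y j ^ 3) - 6 * (\<Sum>j<n. y j ^ 4)"
proof (induction n)
  case (Suc n)
  have "24 * esym y (Suc n) 4 = 24 * esym y n 4 + 4 * y n * (6 * esym y n 3)"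
    by (simp add: eval_nat_numeral algebra_simps)
  then show ?case unfolding Suc esym_3
    by (simp add: power2_eq_square power3_eq_cube power4_eq_xxxx algebra_simps)
qed (simp add: eval_nat_numeral)

lemma (in small_scale) esym_order:
  fixes \<xi> :: "nat \<Rightarrow> 'a \<Rightarrow> complex"
  assumes "\<And>j. j < n \<Longrightarrow> Oh 1 (\<xi> j)"
  shows "Oh k (\<lambda>x. esym (\<lambda>j. \<xi> j x) n k)"
  using assms
proof (induction n arbitrary: k)
  case 0
  then show ?case by (cases k) (auto intro: Oh_zero Oh_const)
next
  case (Suc m)
  show ?case
  proof (cases k)
    case 0
    then show ?thesis by (auto intro: Oh_const)
  next
    case k: (Suc l)
    have "Oh (Suc l) (\<lambda>x. esym (\<lambda>j. \<xi> j x) m (Suc l) + \<xi> m x * esym (\<lambda>j. \<xi> j x) m l)"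
      using Suc.prems by (intro Oh_add Oh_mult[OF Suc.prems[of m] Suc.IH[of l]] Suc.IH) auto
    then show ?thesis using k by simp
  qed
qed

section \<open>Roots near an approximate root\<close>

lemma logarithmic_derivative_prod:
  fixes z :: "'a::field_char_0"
  assumes "finite I" "\<And>i. i \<in> I \<Longrightarrow> r i \<noteq> z"
  shows "poly (pderiv (\<Prod>i\<in>I. [:-r i, 1:])) z =
         poly (\<Prod>i\<in>I. [:-r i, 1:]) z * (\<Sum>i\<in>I. 1 / (z - r i))"
  using assms
proof (induction I rule: finite_induct)
  case (insert a I)
  have ne: "z - r a \<noteq> 0" using insert.prems[of a] by auto
  have IH: "poly (pderiv (\<Prod>i\<in>I. [:-r i, 1:])) z =
      poly (\<Prod>i\<in>I. [:-r i, 1:]) z * (\<Sum>i\<in>I. 1 / (z - r i))"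
    using insert by auto
  have step: "poly (pderiv ([:-r a, 1:] * p)) z = (z - r a) * poly (pderiv p) z + poly p z" for p
    by (simp only: pderiv_mult poly_add poly_mult) (simp add: pderiv_pCons)
  have "(z - r a) * (p * s) + p = (z - r a) * p * (1 / (z - r a) + s)" for p s
    using ne by (simp add: distrib_left)
  then show ?case
    unfolding prod.insert[OF insert.hyps] sum.insert[OF insert.hyps] step IH poly_mult by simp
qed simp

text \<open>The logarithmic derivative is a sum of \<open>degree P\<close> terms \<open>1 / (z - r)\<close>, so one of them is as large as
  the average. This replaces the implicit function theorem: no continuity in parameters has to
  be arranged, and the residual alone controls the distance to a genuine root.\<close>

lemma root_near_approximate_root:
  fixes P :: "complex poly"
  assumes nz: "poly (pderiv P) z \<noteq> 0"
  shows "\<exists>w. poly P w = 0 \<and>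
    norm (z - w) * norm (poly (pderiv P) z) \<le> degree P * norm (poly P z)"
proof (cases "poly P z = 0")
  case True
  then show ?thesis by (intro exI[of _ z]) simp
next
  case False
  obtain r where r: "smult (lead_coeff P) (\<Prod>i<degree P. [:-r i, 1:]) = P"
    by (rule complex_poly_decompose')
  define Q where "Q = (\<Prod>i<degree P. [:-r i, 1:])"
  define B where "B = norm (poly (pderiv P) z)"
  define A where "A = norm (poly P z)"
  have PQ: "P = smult (lead_coeff P) Q" using r by (simp add: Q_def)
  have root: "poly P (r i) = 0" if "i < degree P" for i
    by (subst PQ) (use that in \<open>auto simp: Q_def poly_prod\<close>)
  have ne: "r i \<noteq> z" if "i < degree P" for i
    using root[OF that] False by auto
  have "poly (pderiv Q) z = poly Q z * (\<Sum>i<degree P. 1 / (z - r i))"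
    unfolding Q_def by (rule logarithmic_derivative_prod) (use ne in auto)
  then have eq: "poly (pderiv P) z = poly P z * (\<Sum>i<degree P. 1 / (z - r i))"
    by (subst (1 2) PQ) (simp add: pderiv_smult)
  have pos: "A > 0" "B > 0" "degree P > 0"
    using False nz by (auto simp: A_def B_def pderiv_eq_0_iff[symmetric] intro!: Nat.gr0I)
  show ?thesis
  proof (rule ccontr)
    assume no: "\<not> ?thesis"
    then have far: "degree P * A < norm (z - r i) * B" if "i < degree P" for i
      using root[OF that] by (force simp: A_def B_def)
    have "norm (\<Sum>i<degree P. 1 / (z - r i)) \<le> (\<Sum>i<degree P. norm (1 / (z - r i)))"
      by (rule norm_sum)
    also have "\<dots> < (\<Sum>i<degree P. B / (degree P * A))"
    proof (rule sum_strict_mono)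
      fix i assume i: "i \<in> {..<degree P}"
      then have "norm (z - r i) > 0" using ne by auto
      then show "norm (1 / (z - r i)) < B / (degree P * A)"
        using far[of i] i pos by (simp add: norm_divide field_simps)
    qed (use pos in auto)
    also have "\<dots> = B / A" using pos by simp
    finally have "A * norm (\<Sum>i<degree P. 1 / (z - r i)) < B"
      using pos by (simp add: field_simps)
    then show False using eq by (simp add: A_def B_def norm_mult)
  qed
qed

section \<open>The primitives of \<open>(t - 1)\<^sup>k t\<^sup>n\<^sup>-\<^sup>k\<close>\<close>

text \<open>\<open>Jprim n k q\<close> is the integral of \<open>(t - 1)\<^sup>k t\<^sup>n\<^sup>-\<^sup>k\<close> from 1 to \<open>q\<close>, expanded by the binomial
  theorem. In the variable \<open>q = 1 + x\<close> the integral of \<open>\<Prod>(1 + (1 + \<xi>\<^sub>j) x)\<close> is a combination of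
  these primitives with the elementary symmetric functions of the \<open>\<xi>\<^sub>j\<close> as coefficients.\<close>

definition Jprim :: "nat \<Rightarrow> nat \<Rightarrow> complex \<Rightarrow> complex" where
  "Jprim n k q = (\<Sum>i\<le>k. of_nat (k choose i) * (-1)^i * (q ^ (n + 1 - i) - 1) / of_nat (n + 1 - i))"

definition Jpoly :: "nat \<Rightarrow> nat \<Rightarrow> complex poly" where
  "Jpoly n k = (\<Sum>i\<le>k. smult (of_nat (k choose i) * (-1)^i / of_nat (n + 1 - i))
                          (monom 1 (n + 1 - i) - 1))"

lemma poly_Jpoly: "poly (Jpoly n k) q = Jprim n k q"
  by (auto simp: Jpoly_def Jprim_def poly_sum poly_monom field_simps intro!: sum.cong)

lemma Jprim_1 [simp]: "Jprim n k 1 = 0"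
  by (simp add: Jprim_def)

lemma pderiv_sum': "pderiv (\<Sum>i\<in>I. f i) = (\<Sum>i\<in>I. pderiv (f i))"
  by (induction I rule: infinite_finite_induct) (auto simp: pderiv_add)

lemma Jprim_derivative_sum:
  assumes "k \<le> n"
  shows "(\<Sum>i\<le>k. of_nat (k choose i) * (-1)^i / of_nat (n + 1 - i) * (of_nat (n + 1 - i) * q ^ (n - i)))
       = (q - 1) ^ k * (q :: complex) ^ (n - k)"
proof -
  have "(\<Sum>i\<le>k. of_nat (k choose i) * (-1)^i / of_nat (n + 1 - i) * (of_nat (n + 1 - i) * q ^ (n - i)))
      = (\<Sum>i\<le>k. of_nat (k choose i) * (-1)^i * q ^ (k - i)) * q ^ (n - k)"
    unfolding sum_distrib_right
  proof (intro sum.cong refl)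
    fix i assume "i \<in> {..k}"
    then have i: "i \<le> k" by simp
    then have nz: "(of_nat (n + 1 - i) :: complex) \<noteq> 0"
      unfolding of_nat_eq_0_iff using assms by simp
    have "q ^ (n - i) = q ^ (k - i) * q ^ (n - k)"
      using i assms by (simp flip: power_add)
    moreover have "a / c * (c * (x * y)) = a * x * y" if "c \<noteq> 0" for a c x y :: complex
      using that by simp
    ultimately show "of_nat (k choose i) * (-1)^i / of_nat (n + 1 - i) * (of_nat (n + 1 - i) * q ^ (n - i))
        = of_nat (k choose i) * (-1)^i * q ^ (k - i) * q ^ (n - k)"
      using nz by metis
  qed
  also have "(\<Sum>i\<le>k. of_nat (k choose i) * (-1)^i * q ^ (k - i)) = (-1 + q) ^ k"
    by (subst binomial_ring) simp
  finally show ?thesis by (simp add: add.commute)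
qed

lemma poly_pderiv_Jpoly:
  assumes "k \<le> n"
  shows "poly (pderiv (Jpoly n k)) q = (q - 1) ^ k * q ^ (n - k)"
proof -
  have "poly (pderiv (Jpoly n k)) q =
      (\<Sum>i\<le>k. of_nat (k choose i) * (-1)^i / of_nat (n + 1 - i) * (of_nat (n + 1 - i) * q ^ (n - i)))"
    unfolding Jpoly_def
    by (simp add: pderiv_sum' poly_sum pderiv_smult pderiv_diff pderiv_monom poly_monom pderiv_1)
  then show ?thesis using Jprim_derivative_sum[OF assms] by simp
qed

lemma Jprim_cnj: "Jprim n k (cnj q) = cnj (Jprim n k q)"
  by (simp add: Jprim_def)

lemma degree_Jpoly_le: "degree (Jpoly n k) \<le> n + 1"
  unfolding Jpoly_def
  by (intro degree_sum_le order.trans[OF degree_smult_le] order.trans[OF degree_diff_le_max])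
     (auto intro: order.trans[OF degree_monom_le])

context small_scale
begin

lemma power_expansion:
  fixes d :: "'a \<Rightarrow> complex"
  assumes "Oh 2 d"
  shows "Oh 6 (\<lambda>x. (w + d x) ^ m - (w ^ m + of_nat m * w ^ (m - 1) * d x
            + of_nat (m * (m - 1)) / 2 * w ^ (m - 2) * d x ^ 2))"
proof (induction m)
  case (Suc m)
  define R where "R = (\<lambda>x. (w + d x) ^ m - (w ^ m + of_nat m * w ^ (m - 1) * d x
            + of_nat (m * (m - 1)) / 2 * w ^ (m - 2) * d x ^ 2))"
  have "Oh 0 d" using assms Oh_mono by blast
  have d3: "Oh 6 (\<lambda>x. d x ^ 3)" using assms by (rule Oh_power) simp
  have "Oh 6 (\<lambda>x. (w + d x) * R x + of_nat (m * (m - 1)) / 2 * w ^ (m - 2) * d x ^ 3)"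
    using Suc \<open>Oh 0 d\<close> Oh_const[of w] d3 unfolding R_def[symmetric]
    by (intro Oh_add Oh_cmult Oh_mult[where k=0 and l=6]) auto
  then show ?case
  proof (rule Oh_cong)
    fix x
    have a: "w * (of_nat m * w ^ (m - 1)) = of_nat m * w ^ m"
      by (cases m) auto
    have b: "w * (of_nat (m * (m - 1)) * w ^ (m - 2)) = of_nat (m * (m - 1)) * w ^ (m - 1)"
    proof (cases "m \<le> 1")
      case False
      then obtain l where "m = Suc (Suc l)" by (metis not_less_eq_eq One_nat_def Suc_le_D)
      then show ?thesis by simp
    qed (cases m; auto)
    have c: "of_nat (Suc m * (Suc m - 1)) = (of_nat (m * (m - 1)) + 2 * of_nat m :: complex)"
      by (cases m) (auto simp: algebra_simps)
    have d: "Suc m - 2 = m - 1" by simp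
    define M where "M = (of_nat (m * (m - 1)) :: complex)"
    have "(w + d x) * R x = (w + d x) ^ Suc m - (w ^ Suc m + (w * (of_nat m * w ^ (m - 1))) * d x
       + (w * (M * w ^ (m - 2))) / 2 * d x ^ 2
       + w ^ m * d x + of_nat m * w ^ (m - 1) * d x ^ 2 + M / 2 * w ^ (m - 2) * d x ^ 3)"
      unfolding R_def M_def[symmetric] by (simp add: power2_eq_square power3_eq_cube algebra_simps)
    then have e: "(w + d x) ^ Suc m = (w + d x) * R x + (w ^ Suc m + (w * (of_nat m * w ^ (m - 1))) * d x
       + (w * (M * w ^ (m - 2))) / 2 * d x ^ 2
       + w ^ m * d x + of_nat m * w ^ (m - 1) * d x ^ 2 + M / 2 * w ^ (m - 2) * d x ^ 3)"
      by (simp add: algebra_simps)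
    show "(w + d x) ^ Suc m - (w ^ Suc m + of_nat (Suc m) * w ^ (Suc m - 1) * d x
            + of_nat (Suc m * (Suc m - 1)) / 2 * w ^ (Suc m - 2) * d x ^ 2)
         = (w + d x) * R x + of_nat (m * (m - 1)) / 2 * w ^ (m - 2) * d x ^ 3"
      unfolding e a b[folded M_def] c d M_def[symmetric] by (simp add: field_simps)
  qed
qed (simp add: Oh_zero)

lemma Jprim_Lipschitz:
  assumes "Oh l d" "0 < l"
  shows "Oh l (\<lambda>x. Jprim n k (w + d x) - Jprim n k w)"
proof -
  have pw: "Oh l (\<lambda>x. (w + d x) ^ m - w ^ m)" for m
  proof (induction m)
    case (Suc m)
    have "((\<lambda>x. w + d x) \<longlongrightarrow> w + 0) F"
      using Oh_tendsto_0[OF assms] by (intro tendsto_intros)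
    then have "Oh 0 (\<lambda>x. w + d x)" by (rule Oh_bounded)
    then have "Oh l (\<lambda>x. (w + d x) * ((w + d x) ^ m - w ^ m) + d x * w ^ m)"
      by (intro Oh_add[OF Oh_mult[OF _ Suc] Oh_cmult_right[OF assms(1)]]) auto
    then show ?case by (rule Oh_cong) (simp add: algebra_simps)
  qed (simp add: Oh_zero)
  have "Oh l (\<lambda>x. \<Sum>i\<le>k. of_nat (k choose i) * (-1)^i / of_nat (n + 1 - i)
                     * ((w + d x) ^ (n + 1 - i) - w ^ (n + 1 - i)))"
    by (intro Oh_sum Oh_cmult pw)
  then show ?thesis
    by (rule Oh_cong)
       (simp add: Jprim_def sum_subtractf[symmetric] diff_divide_distrib right_diff_distrib)
qed

lemma Jprim_first_order:
  assumes d: "Oh 2 d" and "k \<le> n"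
  shows "Oh 4 (\<lambda>x. Jprim n k (w + d x) - Jprim n k w - (w - 1) ^ k * w ^ (n - k) * d x)"
proof -
  have pw: "Oh 4 (\<lambda>x. (w + d x) ^ m - w ^ m - of_nat m * w ^ (m - 1) * d x)" for m
  proof -
    have "Oh 4 (\<lambda>x. ((w + d x) ^ m - (w ^ m + of_nat m * w ^ (m - 1) * d x
            + of_nat (m * (m - 1)) / 2 * w ^ (m - 2) * d x ^ 2))
           + of_nat (m * (m - 1)) / 2 * w ^ (m - 2) * d x ^ 2)"
      by (intro Oh_add Oh_cmult Oh_mono[OF power_expansion[OF d]] Oh_power[OF d]) auto
    then show ?thesis by (rule Oh_cong) simp
  qed
  have "Oh 4 (\<lambda>x. \<Sum>i\<le>k. of_nat (k choose i) * (-1)^i / of_nat (n + 1 - i)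
         * ((w + d x) ^ (n + 1 - i) - w ^ (n + 1 - i) - of_nat (n + 1 - i) * w ^ (n + 1 - i - 1) * d x))"
    by (intro Oh_sum Oh_cmult pw)
  then show ?thesis
  proof (rule Oh_cong)
    fix x
    have "(w - 1) ^ k * w ^ (n - k) * d x = (\<Sum>i\<le>k. of_nat (k choose i) * (-1)^i / of_nat (n + 1 - i)
            * (of_nat (n + 1 - i) * w ^ (n + 1 - i - 1) * d x))"
      unfolding Jprim_derivative_sum[OF assms(2), symmetric] sum_distrib_right
      by (intro sum.cong refl) (simp add: mult.assoc)
    then show "Jprim n k (w + d x) - Jprim n k w - (w - 1) ^ k * w ^ (n - k) * d x =
       (\<Sum>i\<le>k. of_nat (k choose i) * (-1)^i / of_nat (n + 1 - i)
         * ((w + d x) ^ (n + 1 - i) - w ^ (n + 1 - i) - of_nat (n + 1 - i) * w ^ (n + 1 - i - 1) * d x))"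
      by (simp add: Jprim_def sum_subtractf[symmetric] diff_divide_distrib right_diff_distrib)
  qed
qed

end

section \<open>Second-order expansion of the roots near the roots of unity\<close>

text \<open>The first- and second-order coefficients of \<open>1 / (q - 1)\<close> as a function of the coefficients \<open>E k\<close> of the
  perturbed equation \<open>Jprim n 0 q + (\<Sum>k=2..n. E k * Jprim n k q) = 0\<close>.\<close>

definition bcoef :: "nat \<Rightarrow> nat \<Rightarrow> complex \<Rightarrow> complex" where
  "bcoef n k w = w / (w - 1)^2 * Jprim n k w"

definition kcoef :: "nat \<Rightarrow> complex \<Rightarrow> complex" where
  "kcoef n w = w / (w - 1)^2 * (of_nat n / 2 * Jprim n 2 w ^ 2 - (w - 1)^2 / w^2 * Jprim n 2 w)
      + w^2 / (w - 1)^3 * Jprim n 2 w ^ 2"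

context small_scale
begin

text \<open>One Newton step from \<open>w\<close>, corrected by the term of order \<open>E 2 ^ 2\<close>, has a residual of order
  \<open>\<mu> + 2\<close>, since every product other than \<open>E 2 ^ 2\<close> is at least of that order. The derivative of the equation at
  \<open>w\<close> tends to \<open>w\<^sup>n \<noteq> 0\<close>, so a genuine root is equally close.\<close>

lemma perturbed_root:
  fixes E :: "nat \<Rightarrow> 'a \<Rightarrow> complex"
  assumes n: "3 \<le> n" and mu: "3 \<le> \<mu>" "\<mu> \<le> 4" and w: "w ^ (n + 1) = 1"
    and E2: "Oh 2 (E 2)" and E3: "\<And>k. k \<in> {3..n} \<Longrightarrow> Oh \<mu> (E k)"
  shows "\<exists>q. eventually (\<lambda>x. Jprim n 0 (q x) + (\<Sum>k=2..n. E k x * Jprim n k (q x)) = 0) F \<and>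
     Oh (\<mu> + 2) (\<lambda>x. q x - (w - w * (\<Sum>k=2..n. E k x * Jprim n k w)
        - w * (of_nat n / 2 * Jprim n 2 w ^ 2 - (w - 1)^2 / w^2 * Jprim n 2 w) * E 2 x ^ 2))"
proof -
  define J where "J = Jprim n 2 w"
  define L where "L = w * (of_nat n / 2 * J ^ 2 - (w - 1)^2 / w^2 * J)"
  define R where "R = (\<lambda>x. \<Sum>k=3..n. E k x * Jprim n k w)"
  define d where "d = (\<lambda>x. - w * (E 2 x * J + R x) - L * E 2 x ^ 2)"
  define G where "G = (\<lambda>x. Jpoly n 0 + (\<Sum>k=2..n. smult (E k x) (Jpoly n k)))"
  have w0: "w \<noteq> 0" using w by (intro notI) simp
  have wn: "w ^ n = 1 / w" using w w0 by (simp add: field_simps)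
  have wn1: "w ^ (n - 1) = 1 / w^2" "w ^ (n - 2) = 1 / w^3"
  proof -
    obtain m where m: "n = Suc (Suc m)" using n that[of "n - 2"] by simp
    have "w ^ m * w ^ 3 = 1" using w unfolding m by (simp add: power3_eq_cube mult_ac)
    moreover have "w * w ^ m = w ^ m * w ^ 3 / w ^ 2" using w0 by (simp add: field_simps eval_nat_numeral)
    moreover have "w ^ m = w ^ m * w ^ 3 / w ^ 3" using w0 by simp
    ultimately show "w ^ (n - 1) = 1 / w^2" "w ^ (n - 2) = 1 / w^3"
      by (simp_all add: m)
  qed
  have split: "(\<Sum>k=2..n. f k) = f 2 + (\<Sum>k=3..n. f k)" for f :: "nat \<Rightarrow> 'c::comm_monoid_add"
    using n by (subst sum.atLeast_Suc_atMost) (auto simp: numeral_3_eq_3 numeral_2_eq_2)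
  have R: "Oh \<mu> R" unfolding R_def by (intro Oh_sum Oh_cmult_right E3)
  have d2: "Oh 2 d" unfolding d_def
    by (intro Oh_diff Oh_add Oh_cmult Oh_cmult_right E2 Oh_mono[OF R] Oh_power[OF E2])
       (use mu in auto)
  have dw: "Oh \<mu> (\<lambda>x. d x + w * E 2 x * J)"
  proof -
    have "Oh \<mu> (\<lambda>x. - w * R x - L * E 2 x ^ 2)"
      by (intro Oh_diff Oh_cmult R Oh_power[OF E2]) (use mu in auto)
    then show ?thesis by (rule Oh_cong) (simp add: d_def algebra_simps)
  qed
  \<comment> \<open>The residual of the approximate root \<open>w + d\<close>.\<close>
  have res: "Oh (\<mu> + 2) (\<lambda>x. poly (G x) (w + d x))"
  proof -
    define A0 where "A0 = (\<lambda>x. (w + d x) ^ (n + 1) - (w ^ (n + 1) + of_nat (n + 1) * w ^ (n + 1 - 1) * d x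
            + of_nat ((n + 1) * (n + 1 - 1)) / 2 * w ^ (n + 1 - 2) * d x ^ 2))"
    define A2 where "A2 = (\<lambda>x. Jprim n 2 (w + d x) - Jprim n 2 w - (w - 1) ^ 2 * w ^ (n - 2) * d x)"
    define A3 where "A3 = (\<lambda>x. \<Sum>k=3..n. E k x * (Jprim n k (w + d x) - Jprim n k w))"
    have 0: "Oh (\<mu> + 2) A0" unfolding A0_def using power_expansion[OF d2, of w "n + 1"] mu
      by (elim Oh_mono) auto
    have 2: "Oh (\<mu> + 2) (\<lambda>x. E 2 x * A2 x)" unfolding A2_def
      by (rule Oh_mult[OF E2 Jprim_first_order[OF d2]]) (use n mu in auto)
    have 3: "Oh (\<mu> + 2) A3" unfolding A3_def
      by (intro Oh_sum Oh_mult[OF E3 Jprim_Lipschitz[OF d2]]) auto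
    have 4: "Oh (\<mu> + 2) (\<lambda>x. (d x + w * E 2 x * J) * (d x - w * E 2 x * J))"
      by (rule Oh_mult[OF dw Oh_diff[OF d2 Oh_cmult_right[OF Oh_cmult[OF E2]]]]) simp
    have 5: "Oh (\<mu> + 2) (\<lambda>x. E 2 x * (d x + w * E 2 x * J))"
      by (intro Oh_mult[OF E2 dw]) auto
    \<comment> \<open>The terms linear in the \<open>E k\<close> cancel by the Newton step, those in \<open>E 2 ^ 2\<close> by the choice of \<open>L\<close>.\<close>
    have "Oh (\<mu> + 2) (\<lambda>x. A0 x / of_nat (n + 1) + E 2 x * A2 x + A3 x
        + of_nat n / (2 * w^2) * ((d x + w * E 2 x * J) * (d x - w * E 2 x * J))
        + (w - 1)^2 / w^3 * (E 2 x * (d x + w * E 2 x * J)))"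
      by (intro Oh_add Oh_cmult Oh_divide_const 0 2 3 4 5)
    then show ?thesis
    proof (rule Oh_cong)
      fix x
      have nn: "(of_nat n + 1 :: complex) \<noteq> 0" using of_nat_neq_0[of n, where 'a = complex] by (simp add: add.commute)
      have J0: "Jprim n 0 (w + d x) = A0 x / of_nat (n + 1) + d x / w + of_nat n / (2 * w^2) * d x ^ 2"
      proof -
        have e12: "n + 1 - 1 = n" "n + 1 - 2 = n - 1" by simp_all
        have "(w + d x) ^ (n + 1) - 1
            = A0 x + (of_nat n + 1) * (d x / w + of_nat n / (2 * w^2) * d x ^ 2)"
          unfolding A0_def w e12 wn wn1 using w0 by (simp add: field_simps del: power_Suc)
        moreover have "X / N = A / N + y" if "X = A + N * y" "N \<noteq> 0" for X A N y :: complex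
          using that by (simp add: field_simps)
        ultimately have "((w + d x) ^ (n + 1) - 1) / (of_nat n + 1)
            = A0 x / (of_nat n + 1) + (d x / w + of_nat n / (2 * w^2) * d x ^ 2)"
          using nn by blast
        then show ?thesis by (simp add: Jprim_def add.commute del: power_Suc)
      qed
      have J2: "Jprim n 2 (w + d x) = A2 x + J + (w - 1)^2 / w^3 * d x"
        unfolding A2_def J_def wn1 by simp
      have J3: "(\<Sum>k=3..n. E k x * Jprim n k (w + d x)) = A3 x + R x"
        unfolding A3_def R_def by (simp add: right_diff_distrib sum_subtractf)
      have dx: "d x / w = - (E 2 x * J + R x) - L / w * E 2 x ^ 2"
        unfolding d_def using w0 by (simp add: field_simps)
      have Lw: "L / w = of_nat n / 2 * J ^ 2 - (w - 1)^2 / w^2 * J"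
        unfolding L_def using w0 by simp
      have "poly (G x) (w + d x) = A0 x / of_nat (n + 1) + d x / w + of_nat n / (2 * w^2) * d x ^ 2
         + E 2 x * (A2 x + J + (w - 1)^2 / w^3 * d x) + (A3 x + R x)"
        unfolding G_def by (simp add: poly_sum poly_Jpoly split J0 J2 J3)
      also have "\<dots> = A0 x / of_nat (n + 1) + E 2 x * A2 x + A3 x
         + (of_nat n / (2 * w^2) * (d x ^ 2 - w^2 * E 2 x ^ 2 * J^2))
         + (w - 1)^2 / w^3 * (E 2 x * (d x + w * E 2 x * J))"
        unfolding dx Lw using w0 by (simp add: field_simps power2_eq_square power3_eq_cube)
      finally show "poly (G x) (w + d x) = A0 x / of_nat (n + 1) + E 2 x * A2 x + A3 x
        + of_nat n / (2 * w^2) * ((d x + w * E 2 x * J) * (d x - w * E 2 x * J))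
        + (w - 1)^2 / w^3 * (E 2 x * (d x + w * E 2 x * J))"
        by (simp add: algebra_simps power2_eq_square)
    qed
  qed
  have dlim: "((\<lambda>x. w + d x) \<longlongrightarrow> w) F"
    using tendsto_add[OF tendsto_const Oh_tendsto_0[OF d2], of w] by simp
  have Elim: "(E k \<longlongrightarrow> 0) F" if "k \<in> {2..n}" for k
  proof (cases "k = 2")
    case True
    then show ?thesis using Oh_tendsto_0[OF E2] by simp
  next
    case False
    then show ?thesis using that mu Oh_tendsto_0[OF E3[of k]] by simp
  qed
  have slope: "((\<lambda>x. poly (pderiv (G x)) (w + d x)) \<longlongrightarrow> w ^ n) F"
  proof -
    have "poly (pderiv (G x)) (w + d x) =
       (w + d x) ^ n + (\<Sum>k=2..n. E k x * ((w + d x - 1) ^ k * (w + d x) ^ (n - k)))" for x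
      unfolding G_def
      by (simp add: pderiv_add pderiv_sum' pderiv_smult poly_sum poly_pderiv_Jpoly)
    moreover have "((\<lambda>x. (w + d x) ^ n + (\<Sum>k=2..n. E k x * ((w + d x - 1) ^ k * (w + d x) ^ (n - k))))
        \<longlongrightarrow> w ^ n + (\<Sum>k=2..n. 0 * ((w - 1) ^ k * w ^ (n - k)))) F"
      by (intro tendsto_intros dlim Elim)
    ultimately show ?thesis by simp
  qed
  define q where "q = (\<lambda>x. SOME z. poly (G x) z = 0 \<and>
    norm (w + d x - z) * norm (poly (pderiv (G x)) (w + d x)) \<le> degree (G x) * norm (poly (G x) (w + d x)))"
  have nz: "eventually (\<lambda>x. poly (pderiv (G x)) (w + d x) \<noteq> 0) F"
    using tendsto_imp_eventually_ne[OF slope] w0 by simp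
  have q: "poly (G x) (q x) = 0 \<and>
    norm (w + d x - q x) * norm (poly (pderiv (G x)) (w + d x)) \<le> degree (G x) * norm (poly (G x) (w + d x))"
    if "poly (pderiv (G x)) (w + d x) \<noteq> 0" for x
    unfolding q_def using someI_ex[OF root_near_approximate_root[OF that]] .
  have deg: "degree (G x) \<le> n + 1" for x
    unfolding G_def
    by (intro degree_add_le degree_sum_le order.trans[OF degree_smult_le] degree_Jpoly_le) auto
  have "Oh (\<mu> + 2) (\<lambda>x. (q x - (w + d x)) * poly (pderiv (G x)) (w + d x))"
  proof (rule Oh_le_ev[OF Oh_cmult[OF res, of "of_nat (n + 1)"]])
    show "eventually (\<lambda>x. norm ((q x - (w + d x)) * poly (pderiv (G x)) (w + d x))
      \<le> norm (of_nat (n + 1) * poly (G x) (w + d x))) F"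
      using nz
    proof eventually_elim
      case (elim x)
      have "norm ((q x - (w + d x)) * poly (pderiv (G x)) (w + d x))
         \<le> degree (G x) * norm (poly (G x) (w + d x))"
        using q[OF elim] by (simp add: norm_mult norm_minus_commute)
      also have "\<dots> \<le> (n + 1) * norm (poly (G x) (w + d x))"
        using deg[of x] by (intro mult_right_mono) (auto simp: of_nat_le_iff simp del: of_nat_add)
      finally show ?case by (simp only: norm_mult norm_of_nat)
    qed
  qed
  then have "Oh (\<mu> + 2) (\<lambda>x. q x - (w + d x))"
    by (rule Oh_cancel[OF _ slope]) (use w0 in simp)
  moreover have "w + d x = w - w * (\<Sum>k=2..n. E k x * Jprim n k w)
        - w * (of_nat n / 2 * Jprim n 2 w ^ 2 - (w - 1)^2 / w^2 * Jprim n 2 w) * E 2 x ^ 2" for x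
    unfolding d_def R_def J_def[symmetric] L_def split by simp
  moreover have "eventually (\<lambda>x. Jprim n 0 (q x) + (\<Sum>k=2..n. E k x * Jprim n k (q x)) = 0) F"
    using nz
  proof eventually_elim
    case (elim x)
    then have "poly (G x) (q x) = 0" using q by blast
    then show ?case by (simp add: G_def poly_sum poly_Jpoly)
  qed
  ultimately show ?thesis by (intro exI[of _ q]) simp
qed

lemma perturbed_inverse_root:
  fixes E :: "nat \<Rightarrow> 'a \<Rightarrow> complex"
  assumes n: "3 \<le> n" and mu: "3 \<le> \<mu>" "\<mu> \<le> 4" and w: "w ^ (n + 1) = 1" "w \<noteq> 1"
    and E2: "Oh 2 (E 2)" and E3: "\<And>k. k \<in> {3..n} \<Longrightarrow> Oh \<mu> (E k)"
  obtains q where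
    "eventually (\<lambda>x. Jprim n 0 (q x) + (\<Sum>k=2..n. E k x * Jprim n k (q x)) = 0) F"
    "(q \<longlongrightarrow> w) F"
    "Oh (\<mu> + 2) (\<lambda>x. 1 / (q x - 1)
        - (1 / (w - 1) + (\<Sum>k=2..n. bcoef n k w * E k x) + kcoef n w * E 2 x ^ 2))"
proof -
  define J where "J = Jprim n 2 w"
  define L where "L = w * (of_nat n / 2 * J ^ 2 - (w - 1)^2 / w^2 * J)"
  define T where "T = (\<lambda>x. \<Sum>k=2..n. E k x * Jprim n k w)"
  obtain q where q: "eventually (\<lambda>x. Jprim n 0 (q x) + (\<Sum>k=2..n. E k x * Jprim n k (q x)) = 0) F"
    and e: "Oh (\<mu> + 2) (\<lambda>x. q x - (w - w * T x - L * E 2 x ^ 2))"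
    using perturbed_root[where n=n and \<mu>=\<mu> and w=w and E=E, OF n mu w(1) E2 E3] unfolding J_def L_def T_def by blast
  define e where "e = (\<lambda>x. q x - (w - w * T x - L * E 2 x ^ 2))"
  define D where "D = (\<lambda>x. q x - w)"
  have w1: "w - 1 \<noteq> 0" using w by simp
  have eO: "Oh (\<mu> + 2) e" using e by (simp add: e_def)
  have split: "(\<Sum>k=2..n. f k) = f 2 + (\<Sum>k=3..n. f k)" for f :: "nat \<Rightarrow> 'c::comm_monoid_add"
    using n by (subst sum.atLeast_Suc_atMost) (auto simp: numeral_3_eq_3 numeral_2_eq_2)
  have TJ: "Oh \<mu> (\<lambda>x. T x - E 2 x * J)"
    unfolding T_def J_def split by (simp, intro Oh_sum Oh_cmult_right E3) 
  have T: "Oh 2 T"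
    using Oh_add[OF Oh_mono[OF TJ, of 2] Oh_cmult_right[OF E2, of J]] mu by simp
  have De: "D x = e x - w * T x - L * E 2 x ^ 2" for x by (simp add: D_def e_def)
  have D: "Oh 2 D" unfolding De
    by (intro Oh_diff Oh_cmult T Oh_mono[OF eO] Oh_power[OF E2]) auto
  have DwT: "Oh \<mu> (\<lambda>x. D x + w * E 2 x * J)"
  proof -
    have "Oh \<mu> (\<lambda>x. e x - w * (T x - E 2 x * J) - L * E 2 x ^ 2)"
      by (intro Oh_diff Oh_cmult TJ Oh_mono[OF eO] Oh_power[OF E2]) (use mu in auto)
    then show ?thesis by (rule Oh_cong) (simp add: De algebra_simps)
  qed
  have qlim: "(q \<longlongrightarrow> w) F"
    using D unfolding D_def by (rule Oh_tendsto) simp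
  have q1: "((\<lambda>x. q x - 1) \<longlongrightarrow> w - 1) F" by (intro tendsto_intros qlim)
  have q1ne: "eventually (\<lambda>x. q x - 1 \<noteq> 0) F"
    using tendsto_imp_eventually_ne[OF q1 w1] .
  have main: "Oh (\<mu> + 2) (\<lambda>x. 1 / (q x - 1) - (1 / (w - 1) - D x / (w - 1)^2 + D x ^ 2 / (w - 1)^3))"
  proof (rule Oh_cancel[OF _ q1 w1])
    have "Oh (\<mu> + 2) (\<lambda>x. - (D x ^ 3) / (w - 1)^3)"
      by (intro Oh_divide_const Oh_uminus Oh_power[OF D]) (use mu in auto)
    then show "Oh (\<mu> + 2) (\<lambda>x. (1 / (q x - 1) - (1 / (w - 1) - D x / (w - 1)^2 + D x ^ 2 / (w - 1)^3))
        * (q x - 1))"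
    proof (rule Oh_cong_ev)
      show "eventually (\<lambda>x. - (D x ^ 3) / (w - 1)^3 =
       (1 / (q x - 1) - (1 / (w - 1) - D x / (w - 1)^2 + D x ^ 2 / (w - 1)^3)) * (q x - 1)) F"
        using q1ne
      proof eventually_elim
        case (elim x)
        define a b where "a = w - 1" and "b = q x - 1"
        have a: "a \<noteq> 0" "b \<noteq> 0" "D x = b - a"
          using w1 elim by (auto simp: a_def b_def D_def)
        show ?case unfolding a(3) a_def[symmetric] b_def[symmetric] using a(1,2)
          by (simp add: field_simps power2_eq_square power3_eq_cube)
      qed
    qed
  qed
  have "Oh (\<mu> + 2) (\<lambda>x. (D x + w * E 2 x * J) * (D x - w * E 2 x * J))"
    by (rule Oh_mult[OF DwT Oh_diff[OF D Oh_cmult_right[OF Oh_cmult[OF E2]]]]) simp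
  then have "Oh (\<mu> + 2) (\<lambda>x. (1 / (q x - 1) - (1 / (w - 1) - D x / (w - 1)^2 + D x ^ 2 / (w - 1)^3))
     - e x / (w - 1)^2 + (D x + w * E 2 x * J) * (D x - w * E 2 x * J) / (w - 1)^3)"
    by (intro Oh_add Oh_diff Oh_divide_const main eO)
  then have "Oh (\<mu> + 2) (\<lambda>x. 1 / (q x - 1)
        - (1 / (w - 1) + (\<Sum>k=2..n. bcoef n k w * E k x) + kcoef n w * E 2 x ^ 2))"
  proof (rule Oh_cong)
    fix x
    have b: "(\<Sum>k=2..n. bcoef n k w * E k x) = w / (w - 1)^2 * T x"
      unfolding bcoef_def T_def sum_distrib_left by (simp add: mult_ac)
    have k: "kcoef n w = L / (w - 1)^2 + w^2 / (w - 1)^3 * J ^ 2"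
      unfolding kcoef_def L_def J_def by simp
    have "D x / (w - 1)^2 = e x / (w - 1)^2 - w / (w - 1)^2 * T x - L / (w - 1)^2 * E 2 x ^ 2"
      unfolding De by (simp add: diff_divide_distrib)
    moreover have "(D x + w * E 2 x * J) * (D x - w * E 2 x * J) / (w - 1)^3
       = D x ^ 2 / (w - 1)^3 - w^2 / (w - 1)^3 * J^2 * E 2 x ^ 2"
      by (simp add: algebra_simps power2_eq_square diff_divide_distrib)
    ultimately show "1 / (q x - 1)
        - (1 / (w - 1) + (\<Sum>k=2..n. bcoef n k w * E k x) + kcoef n w * E 2 x ^ 2)
      = (1 / (q x - 1) - (1 / (w - 1) - D x / (w - 1)^2 + D x ^ 2 / (w - 1)^3))
     - e x / (w - 1)^2 + (D x + w * E 2 x * J) * (D x - w * E 2 x * J) / (w - 1)^3"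
      unfolding b k by (simp add: algebra_simps)
  qed
  then show thesis using that q qlim by blast
qed

end

section \<open>Second-order relations among the moments of a configuration\<close>

text \<open>The numbers \<open>v\<^sub>j = c (1 + \<xi>\<^sub>j)\<close> near \<open>1\<close>, with their mean \<open>c\<close> separated off. The assumption
  \<open>slack2\<close> says that \<open>1 - \<bar>v\<^sub>j\<bar>\<^sup>2\<close> is of second order.\<close>

locale configuration = small_scale F h for F :: "'a filter" and h :: "'a \<Rightarrow> real" +
  fixes n :: nat and c :: "'a \<Rightarrow> complex" and \<xi> :: "nat \<Rightarrow> 'a \<Rightarrow> complex"
  assumes n3: "3 \<le> n"
    and sum0: "eventually (\<lambda>x. (\<Sum>j<n. \<xi> j x) = 0) F"
    and xi1: "j < n \<Longrightarrow> Oh 1 (\<xi> j)"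
    and slack2: "j < n \<Longrightarrow> Oh 2 (\<lambda>x. 1 - norm (c x) ^ 2 * norm (1 + \<xi> j x) ^ 2)"
    and Im_c2: "Oh 2 (\<lambda>x. Im (c x))"
    and Re_c: "Oh 2 (\<lambda>x. Re (c x) - 1)"
begin

definition sl where "sl j x = 1 - norm (c x) ^ 2 * norm (1 + \<xi> j x) ^ 2"
definition Lam where "Lam x = (\<Sum>j<n. sl j x)"
definition S where "S x = (\<Sum>j<n. norm (\<xi> j x) ^ 2)"
definition p4 where "p4 x = (\<Sum>j<n. Im (\<xi> j x) ^ 4)"
definition p3 where "p3 x = (\<Sum>j<n. Im (\<xi> j x) ^ 3)"
definition X where "X x = (\<Sum>j<n. Re (\<xi> j x) ^ 2)"
definition E where "E k x = esym (\<lambda>j. \<xi> j x) n k"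

lemma sl2: "j < n \<Longrightarrow> Oh 2 (sl j)"
  using slack2[of j] by (rule Oh_cong) (auto simp: sl_def)

lemma Lam2: "Oh 2 Lam"
  unfolding Lam_def by (intro Oh_sum sl2) auto

lemma S2: "Oh 2 S"
  unfolding S_def by (intro Oh_sum Oh_power[OF Oh_norm[OF xi1]]) auto

lemma p4_4: "Oh 4 p4"
  unfolding p4_def by (intro Oh_sum Oh_power[OF Oh_Im[OF xi1]]) auto

lemma p3_3: "Oh 3 p3"
  unfolding p3_def by (intro Oh_sum Oh_power[OF Oh_Im[OF xi1]]) auto

lemma c_lim: "(c \<longlongrightarrow> 1) F"
proof -
  have "Oh 2 (\<lambda>x. c x - 1)"
    by (rule Oh_complexI) (use Re_c Im_c2 in auto)
  then show ?thesis by (rule Oh_tendsto) simp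
qed

lemma norm_1_plus: "norm (1 + z) ^ 2 = 1 + 2 * Re z + norm z ^ 2"
  unfolding cmod_power2 by (simp add: power2_eq_square algebra_simps)

text \<open>The mean of the \<open>\<bar>v\<^sub>j\<bar>\<^sup>2\<close> ties the modulus of \<open>c\<close> to the variance \<open>S\<close> and the total slack.\<close>

lemma mean_square: "eventually (\<lambda>x. norm (c x) ^ 2 * (of_nat n + S x) = of_nat n - Lam x) F"
  using sum0
proof eventually_elim
  case (elim x)
  have "(\<Sum>j<n. norm (1 + \<xi> j x) ^ 2) = of_nat n + 2 * (\<Sum>j<n. Re (\<xi> j x)) + S x"
    unfolding norm_1_plus S_def by (simp add: sum.distrib sum_distrib_left)
  also have "(\<Sum>j<n. Re (\<xi> j x)) = 0"
    using elim by (metis Re_sum zero_complex.sel(1))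
  finally have A: "(\<Sum>j<n. norm (1 + \<xi> j x) ^ 2) = of_nat n + S x" by simp
  have "norm (c x) ^ 2 * (of_nat n + S x) = (\<Sum>j<n. norm (c x) ^ 2 * norm (1 + \<xi> j x) ^ 2)"
    unfolding A[symmetric] sum_distrib_left ..
  also have "\<dots> = of_nat n - Lam x"
    unfolding Lam_def sl_def by (simp add: sum_subtractf)
  finally show ?case .
qed

text \<open>Since the \<open>v\<^sub>j\<close> lie close to the unit circle, twice the real part of \<open>\<xi>\<^sub>j\<close> is \<open>S / n - \<bar>\<xi>\<^sub>j\<bar>\<^sup>2\<close> up to slack; in particular it is an order smaller than the imaginary part.\<close>

lemma Re_xi_exact:
  "j < n \<Longrightarrow> eventually (\<lambda>x. of_nat n * (2 * Re (\<xi> j x) + norm (\<xi> j x) ^ 2)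
     = S x - of_nat n * sl j x - S x * sl j x + Lam x * norm (1 + \<xi> j x) ^ 2) F"
  using mean_square
proof eventually_elim
  case (elim x)
  have "(1 - sl j x) * (of_nat n + S x) = norm (1 + \<xi> j x) ^ 2 * (norm (c x) ^ 2 * (of_nat n + S x))"
    by (simp add: sl_def)
  also have "\<dots> = norm (1 + \<xi> j x) ^ 2 * (of_nat n - Lam x)"
    using elim by simp
  finally show ?case
    unfolding norm_1_plus by (simp add: algebra_simps)
qed

lemma norm_1_xi_bounded: "j < n \<Longrightarrow> Oh 0 (\<lambda>x. norm (1 + \<xi> j x) ^ 2)"
  by (rule Oh_power[OF Oh_norm[OF Oh_add[OF Oh_const Oh_mono[OF xi1]]]]) auto

lemma Re_xi2:
  assumes j: "j < n"
  shows "Oh 2 (\<lambda>x. Re (\<xi> j x))"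
proof -
  have "Oh 2 (\<lambda>x. (S x - of_nat n * sl j x - S x * sl j x + Lam x * norm (1 + \<xi> j x) ^ 2
      - of_nat n * norm (\<xi> j x) ^ 2) / (2 * of_nat n))"
    by (intro Oh_divide_const Oh_diff Oh_add Oh_cmult S2 sl2 j Oh_mult[OF S2 sl2]
        Oh_mult[OF Lam2 norm_1_xi_bounded] Oh_power[OF Oh_norm[OF xi1]]) auto
  then show ?thesis
  proof (rule Oh_cong_ev)
    show "eventually (\<lambda>x. (S x - of_nat n * sl j x - S x * sl j x + Lam x * norm (1 + \<xi> j x) ^ 2
      - of_nat n * norm (\<xi> j x) ^ 2) / (2 * of_nat n) = Re (\<xi> j x)) F"
      using Re_xi_exact[OF j]
    proof eventually_elim
      case (elim x)
      have nz: "real n \<noteq> 0" using n3 by simp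
      show ?case unfolding elim[symmetric] using nz by (simp add: field_simps)
    qed
  qed
qed

lemma X4: "Oh 4 X"
  unfolding X_def by (intro Oh_sum Oh_power[OF Re_xi2]) auto

lemma E_order: "Oh k (E k)"
  unfolding E_def[abs_def] by (rule esym_order) (rule xi1)

text \<open>The real parts of \<open>\<xi>\<close> are an order smaller than the imaginary parts, hence \<open>E k\<close> is
  \<open>\<i>^k\<close> times a real number up to relative order \<open>h\<close>.\<close>

lemma E_phase: "Oh (Suc k) (\<lambda>x. E k x - \<i> ^ k * of_real (esym (\<lambda>j. Im (\<xi> j x)) n k))"
proof -
  have "m \<le> n \<Longrightarrow> Oh (Suc k) (\<lambda>x. esym (\<lambda>j. \<xi> j x) m k - \<i> ^ k * of_real (esym (\<lambda>j. Im (\<xi> j x)) m k))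
      \<and> Oh k (\<lambda>x. esym (\<lambda>j. \<xi> j x) m k)" for m k
  proof (induction m arbitrary: k)
    case 0
    then show ?case by (cases k) (auto intro: Oh_zero Oh_const)
  next
    case (Suc m)
    show ?case
    proof (cases k)
      case 0
      then show ?thesis by (auto intro: Oh_zero Oh_const)
    next
      case k: (Suc l)
      have IH: "Oh (Suc k) (\<lambda>x. esym (\<lambda>j. \<xi> j x) m k - \<i> ^ k * of_real (esym (\<lambda>j. Im (\<xi> j x)) m k))"
         "Oh k (\<lambda>x. esym (\<lambda>j. \<xi> j x) m k)" for k using Suc.IH[of k] Suc.prems by auto
      have m: "m < n" using Suc.prems by simp
      have "Oh (Suc l) (\<lambda>x. esym (\<lambda>j. \<xi> j x) m (Suc l) + \<xi> m x * esym (\<lambda>j. \<xi> j x) m l)"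
        using m by (intro Oh_add Oh_mult[OF xi1[of m] IH(2)] IH) auto
      moreover
      have "Oh (Suc (Suc l)) (\<lambda>x. (esym (\<lambda>j. \<xi> j x) m (Suc l) - \<i> ^ Suc l * of_real (esym (\<lambda>j. Im (\<xi> j x)) m (Suc l)))
         + of_real (Re (\<xi> m x)) * esym (\<lambda>j. \<xi> j x) m l
         + (\<i> * of_real (Im (\<xi> m x))) * (esym (\<lambda>j. \<xi> j x) m l - \<i> ^ l * of_real (esym (\<lambda>j. Im (\<xi> j x)) m l)))"
        using m by (intro Oh_add IH Oh_mult[OF Oh_of_real[OF Re_xi2] IH(2)]
            Oh_mult[OF Oh_cmult[OF Oh_of_real[OF Oh_Im[OF xi1]]] IH(1)]) auto
      then have "Oh (Suc (Suc l)) (\<lambda>x. esym (\<lambda>j. \<xi> j x) (Suc m) (Suc l)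
           - \<i> ^ Suc l * of_real (esym (\<lambda>j. Im (\<xi> j x)) (Suc m) (Suc l)))"
      proof (rule Oh_cong)
        fix x
        have 1: "\<xi> m x * e = of_real (Re (\<xi> m x)) * e + \<i> * (of_real (Im (\<xi> m x)) * e)" for e
          by (metis complex_eq distrib_right mult.assoc)
        show "esym (\<lambda>j. \<xi> j x) (Suc m) (Suc l)
           - \<i> ^ Suc l * of_real (esym (\<lambda>j. Im (\<xi> j x)) (Suc m) (Suc l))
          = (esym (\<lambda>j. \<xi> j x) m (Suc l) - \<i> ^ Suc l * of_real (esym (\<lambda>j. Im (\<xi> j x)) m (Suc l)))
         + of_real (Re (\<xi> m x)) * esym (\<lambda>j. \<xi> j x) m l
         + (\<i> * of_real (Im (\<xi> m x))) * (esym (\<lambda>j. \<xi> j x) m l - \<i> ^ l * of_real (esym (\<lambda>j. Im (\<xi> j x)) m l))"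
          using 1[of "esym (\<lambda>j. \<xi> j x) m l"] by (simp add: algebra_simps)
      qed
      ultimately show ?thesis using k by simp
    qed
  qed
  then show ?thesis by (simp add: E_def[abs_def])
qed

text \<open>For odd \<open>k\<close> the leading term of \<open>E k\<close> is purely imaginary, so \<open>k = 5\<close> gains an order.\<close>

lemma Re_E_high:
  assumes "5 \<le> k"
  shows "Oh 6 (\<lambda>x. Re (E k x))"
proof (cases "k = 5")
  case True
  have "Oh 6 (\<lambda>x. Re (E 5 x - \<i> ^ 5 * of_real (esym (\<lambda>j. Im (\<xi> j x)) n 5)))"
    using Oh_Re[OF E_phase[of 5]] by simp
  moreover have "\<i> ^ 5 = \<i>" by (simp add: eval_nat_numeral)
  ultimately show ?thesis using True by simp
next
  case False
  then show ?thesis using assms by (intro Oh_Re Oh_mono[OF E_order]) auto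
qed

lemma E_eqs:
  "eventually (\<lambda>x. E 2 x = - (\<Sum>j<n. \<xi> j x ^ 2) / 2) F"
  "eventually (\<lambda>x. E 3 x = (\<Sum>j<n. \<xi> j x ^ 3) / 3) F"
  "eventually (\<lambda>x. E 4 x = (\<Sum>j<n. \<xi> j x ^ 2)^2 / 8 - (\<Sum>j<n. \<xi> j x ^ 4) / 4) F"
proof -
  show "eventually (\<lambda>x. E 2 x = - (\<Sum>j<n. \<xi> j x ^ 2) / 2) F"
    using sum0
  proof eventually_elim
    case (elim x)
    then show ?case using esym_2[of "\<lambda>j. \<xi> j x" n] by (simp add: E_def field_simps)
  qed
  show "eventually (\<lambda>x. E 3 x = (\<Sum>j<n. \<xi> j x ^ 3) / 3) F"
    using sum0
  proof eventually_elim
    case (elim x)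
    then show ?case using esym_3[of "\<lambda>j. \<xi> j x" n] by (simp add: E_def field_simps)
  qed
  show "eventually (\<lambda>x. E 4 x = (\<Sum>j<n. \<xi> j x ^ 2)^2 / 8 - (\<Sum>j<n. \<xi> j x ^ 4) / 4) F"
    using sum0
  proof eventually_elim
    case (elim x)
    then have "24 * E 4 x = 3 * (\<Sum>j<n. \<xi> j x ^ 2)^2 - 6 * (\<Sum>j<n. \<xi> j x ^ 4)"
      using esym_4[of "\<lambda>j. \<xi> j x" n] by (simp add: E_def)
    then have "E 4 x = (3 * (\<Sum>j<n. \<xi> j x ^ 2)^2 - 6 * (\<Sum>j<n. \<xi> j x ^ 4)) / 24"
      by (simp add: eq_divide_eq mult.commute)
    then show ?case by (simp add: diff_divide_distrib)
  qed
qed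

lemma Im_sum0: "eventually (\<lambda>x. (\<Sum>j<n. Im (\<xi> j x)) = 0) F"
  using sum0 by eventually_elim (metis Im_sum zero_complex.sel(2))

lemma Re_E2: "eventually (\<lambda>x. Re (E 2 x) = S x / 2 - X x) F"
  using E_eqs(1)
proof eventually_elim
  case (elim x)
  have "Re (\<xi> j x ^ 2) = 2 * Re (\<xi> j x) ^ 2 - norm (\<xi> j x) ^ 2" for j
    by (simp add: cmod_power2) (simp add: power2_eq_square)
  then have 1: "Re (\<Sum>j<n. \<xi> j x ^ 2) = 2 * X x - S x"
    by (simp add: X_def S_def sum_subtractf sum_distrib_left)
  have "Re (E 2 x) = - Re (\<Sum>j<n. \<xi> j x ^ 2) / 2"
    unfolding elim by (simp del: Re_sum)
  then show ?case unfolding 1 by (simp add: field_simps)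
qed

lemma S_Im: "Oh 4 (\<lambda>x. S x - (\<Sum>j<n. Im (\<xi> j x) ^ 2))"
  using X4 by (rule Oh_cong) (simp add: S_def X_def cmod_power2 sum.distrib)

lemma E2_2: "Oh 2 (E 2)" using E_order .

lemma E4_4: "k \<in> {4..n} \<Longrightarrow> Oh 4 (E k)"
  using Oh_mono[OF E_order] by auto

end

text \<open>At an optimal configuration the slack is of fourth order, which determines every moment that enters the second-order expansion through \<open>S\<close>, \<open>p3\<close> and \<open>p4\<close>.\<close>

locale tight_configuration = configuration F h n c \<xi>
  for F :: "'a filter" and h :: "'a \<Rightarrow> real" and n c \<xi> +
  assumes slack4: "j < n \<Longrightarrow> Oh 4 (\<lambda>x. 1 - norm (c x) ^ 2 * norm (1 + \<xi> j x) ^ 2)"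
begin

lemma sl4: "j < n \<Longrightarrow> Oh 4 (sl j)"
  using slack4[of j] by (rule Oh_cong) (auto simp: sl_def)

lemma Lam4: "Oh 4 Lam"
  unfolding Lam_def by (intro Oh_sum sl4) auto

lemma Re_xi4:
  assumes j: "j < n"
  shows "Oh 4 (\<lambda>x. Re (\<xi> j x) - (S x / (2 * of_nat n) - Im (\<xi> j x) ^ 2 / 2))"
proof -
  have "Oh 4 (\<lambda>x. (- of_nat n * sl j x - S x * sl j x + Lam x * norm (1 + \<xi> j x) ^ 2
      - of_nat n * Re (\<xi> j x) ^ 2) / (2 * of_nat n))"
    by (intro Oh_divide_const Oh_diff Oh_add Oh_cmult S2 sl4 j Oh_mult[OF S2 sl4]
        Oh_mult[OF Lam4 norm_1_xi_bounded] Oh_power[OF Re_xi2]) auto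
  then show ?thesis
  proof (rule Oh_cong_ev)
    show "eventually (\<lambda>x. (- of_nat n * sl j x - S x * sl j x + Lam x * norm (1 + \<xi> j x) ^ 2
      - of_nat n * Re (\<xi> j x) ^ 2) / (2 * of_nat n)
       = Re (\<xi> j x) - (S x / (2 * of_nat n) - Im (\<xi> j x) ^ 2 / 2)) F"
      using Re_xi_exact[OF j]
    proof eventually_elim
      case (elim x)
      have nz: "real n \<noteq> 0" using n3 by simp
      have "- of_nat n * sl j x - S x * sl j x + Lam x * norm (1 + \<xi> j x) ^ 2 - of_nat n * Re (\<xi> j x) ^ 2
         = of_nat n * (2 * Re (\<xi> j x)) + of_nat n * Im (\<xi> j x) ^ 2 - S x"
        using elim unfolding cmod_power2[of "\<xi> j x"] by (simp add: algebra_simps)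
      then show ?case using nz by (simp add: field_simps)
    qed
  qed
qed

text \<open>The variance of the numbers \<open>Im(\<xi>\<^sub>j)\<^sup>2\<close>, up to a factor \<open>n\<close> and terms of order six; by \<open>Re_xi4\<close> it governs the real parts.\<close>

definition m4 where "m4 x = p4 x - S x ^ 2 / of_nat n"

lemma moment_replace:
  "Oh 6 (\<lambda>x. S x * (\<Sum>j<n. Im (\<xi> j x) ^ 2) - S x ^ 2)"
proof -
  have "Oh 6 (\<lambda>x. S x * (- (S x - (\<Sum>j<n. Im (\<xi> j x) ^ 2))))"
    by (rule Oh_mult[OF S2 Oh_uminus[OF S_Im]]) simp
  then show ?thesis by (rule Oh_cong) (simp add: algebra_simps power2_eq_square)
qed

lemma X6: "Oh 6 (\<lambda>x. X x - m4 x / 4)"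
proof -
  have d: "Oh 6 (\<lambda>x. (Re (\<xi> j x) - (S x / (2 * of_nat n) - Im (\<xi> j x) ^ 2 / 2))
         * (Re (\<xi> j x) + (S x / (2 * of_nat n) - Im (\<xi> j x) ^ 2 / 2)))" if "j < n" for j
    using that
    by (intro Oh_mult[OF Re_xi4, where l=2] Oh_add Oh_diff Oh_divide_const S2 Re_xi2 Oh_power[OF Oh_Im[OF xi1]]) auto
  have "Oh 6 (\<lambda>x. (\<Sum>j<n. (Re (\<xi> j x) - (S x / (2 * of_nat n) - Im (\<xi> j x) ^ 2 / 2))
         * (Re (\<xi> j x) + (S x / (2 * of_nat n) - Im (\<xi> j x) ^ 2 / 2)))
         - (S x * (\<Sum>j<n. Im (\<xi> j x) ^ 2) - S x ^ 2) / (2 * of_nat n))"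
    by (intro Oh_diff Oh_divide_const Oh_sum moment_replace d) auto
  then show ?thesis
  proof (rule Oh_cong)
    fix x
    have nz: "real n \<noteq> 0" using n3 by simp
    have "(\<Sum>j<n. (Re (\<xi> j x) - (S x / (2 * of_nat n) - Im (\<xi> j x) ^ 2 / 2))
         * (Re (\<xi> j x) + (S x / (2 * of_nat n) - Im (\<xi> j x) ^ 2 / 2)))
      = (\<Sum>j<n. Re (\<xi> j x) ^ 2 - (S x ^ 2 / (4 * of_nat n ^ 2)
             - S x / (2 * of_nat n) * Im (\<xi> j x) ^ 2 + Im (\<xi> j x) ^ 4 / 4))"
      using nz by (intro sum.cong refl) (simp add: field_simps power2_eq_square power4_eq_xxxx)
    also have "\<dots> = X x - (S x ^ 2 / (4 * of_nat n) - S x / (2 * of_nat n) * (\<Sum>j<n. Im (\<xi> j x) ^ 2) + p4 x / 4)"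
      using nz
      by (simp add: X_def p4_def sum_subtractf sum.distrib sum_distrib_left sum_divide_distrib power2_eq_square)
    finally have 1: "(\<Sum>j<n. (Re (\<xi> j x) - (S x / (2 * of_nat n) - Im (\<xi> j x) ^ 2 / 2))
         * (Re (\<xi> j x) + (S x / (2 * of_nat n) - Im (\<xi> j x) ^ 2 / 2)))
       = X x - (S x ^ 2 / (4 * of_nat n) - S x / (2 * of_nat n) * (\<Sum>j<n. Im (\<xi> j x) ^ 2) + p4 x / 4)" .
    show "X x - m4 x / 4 = (\<Sum>j<n. (Re (\<xi> j x) - (S x / (2 * of_nat n) - Im (\<xi> j x) ^ 2 / 2))
         * (Re (\<xi> j x) + (S x / (2 * of_nat n) - Im (\<xi> j x) ^ 2 / 2)))
         - (S x * (\<Sum>j<n. Im (\<xi> j x) ^ 2) - S x ^ 2) / (2 * of_nat n)"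
      unfolding 1 m4_def using nz by (simp add: field_simps)
  qed
qed

lemma Re_Im2_sum: "Oh 6 (\<lambda>x. (\<Sum>j<n. Re (\<xi> j x) * Im (\<xi> j x) ^ 2) + m4 x / 2)"
proof -
  have d: "Oh 6 (\<lambda>x. (Re (\<xi> j x) - (S x / (2 * of_nat n) - Im (\<xi> j x) ^ 2 / 2)) * Im (\<xi> j x) ^ 2)" if "j < n" for j
    using that by (intro Oh_mult[OF Re_xi4, where l=2] Oh_power[OF Oh_Im[OF xi1]]) auto
  have "Oh 6 (\<lambda>x. (\<Sum>j<n. (Re (\<xi> j x) - (S x / (2 * of_nat n) - Im (\<xi> j x) ^ 2 / 2)) * Im (\<xi> j x) ^ 2)
         + (S x * (\<Sum>j<n. Im (\<xi> j x) ^ 2) - S x ^ 2) / (2 * of_nat n))"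
    by (intro Oh_add Oh_divide_const Oh_sum moment_replace d) auto
  then show ?thesis
  proof (rule Oh_cong)
    fix x
    have "(\<Sum>j<n. (Re (\<xi> j x) - (S x / (2 * of_nat n) - Im (\<xi> j x) ^ 2 / 2)) * Im (\<xi> j x) ^ 2)
      = (\<Sum>j<n. Re (\<xi> j x) * Im (\<xi> j x) ^ 2 - S x / (2 * of_nat n) * Im (\<xi> j x) ^ 2 + Im (\<xi> j x) ^ 4 / 2)"
      by (intro sum.cong refl) (simp add: field_simps power2_eq_square power4_eq_xxxx)
    also have "\<dots> = (\<Sum>j<n. Re (\<xi> j x) * Im (\<xi> j x) ^ 2)
         - S x / (2 * of_nat n) * (\<Sum>j<n. Im (\<xi> j x) ^ 2) + p4 x / 2"
      by (simp add: p4_def sum_subtractf sum.distrib sum_distrib_left sum_divide_distrib)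
    finally show "(\<Sum>j<n. Re (\<xi> j x) * Im (\<xi> j x) ^ 2) + m4 x / 2
        = (\<Sum>j<n. (Re (\<xi> j x) - (S x / (2 * of_nat n) - Im (\<xi> j x) ^ 2 / 2)) * Im (\<xi> j x) ^ 2)
         + (S x * (\<Sum>j<n. Im (\<xi> j x) ^ 2) - S x ^ 2) / (2 * of_nat n)"
      unfolding m4_def by (simp add: diff_divide_distrib)
  qed
qed

lemma Re_E3: "Oh 6 (\<lambda>x. Re (E 3 x) - m4 x / 2)"
proof -
  have r3: "Oh 6 (\<lambda>x. \<Sum>j<n. Re (\<xi> j x) ^ 3)"
    by (intro Oh_sum Oh_power[OF Re_xi2]) auto
  have "Oh 6 (\<lambda>x. (\<Sum>j<n. Re (\<xi> j x) ^ 3) / 3 - ((\<Sum>j<n. Re (\<xi> j x) * Im (\<xi> j x) ^ 2) + m4 x / 2))"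
    by (intro Oh_diff Oh_divide_const r3 Re_Im2_sum)
  then show ?thesis
  proof (rule Oh_cong_ev)
    show "eventually (\<lambda>x. (\<Sum>j<n. Re (\<xi> j x) ^ 3) / 3 - ((\<Sum>j<n. Re (\<xi> j x) * Im (\<xi> j x) ^ 2) + m4 x / 2)
        = Re (E 3 x) - m4 x / 2) F"
      using E_eqs(2)
    proof eventually_elim
      case (elim x)
      have "Re (\<xi> j x ^ 3) = Re (\<xi> j x) ^ 3 - 3 * (Re (\<xi> j x) * Im (\<xi> j x) ^ 2)" for j
        by (simp add: power3_eq_cube power2_eq_square algebra_simps)
      then have 1: "Re (\<Sum>j<n. \<xi> j x ^ 3) = (\<Sum>j<n. Re (\<xi> j x) ^ 3) - 3 * (\<Sum>j<n. Re (\<xi> j x) * Im (\<xi> j x) ^ 2)"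
        by (simp add: sum_subtractf sum_distrib_left)
      have "Re (E 3 x) = Re (\<Sum>j<n. \<xi> j x ^ 3) / 3"
        unfolding elim by (simp del: Re_sum)
      then show ?case unfolding 1 by (simp add: diff_divide_distrib)
    qed
  qed
qed

lemma Im_E3: "Oh 5 (\<lambda>x. Im (E 3 x) + p3 x / 3)"
proof -
  have r: "Oh 5 (\<lambda>x. \<Sum>j<n. Re (\<xi> j x) ^ 2 * Im (\<xi> j x))"
    by (intro Oh_sum Oh_mult[OF Oh_power[OF Re_xi2, where m=4] Oh_Im[OF xi1]]) auto
  then show ?thesis
  proof (rule Oh_cong_ev)
    show "eventually (\<lambda>x. (\<Sum>j<n. Re (\<xi> j x) ^ 2 * Im (\<xi> j x)) = Im (E 3 x) + p3 x / 3) F"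
      using E_eqs(2)
    proof eventually_elim
      case (elim x)
      have "Im (\<xi> j x ^ 3) = 3 * (Re (\<xi> j x) ^ 2 * Im (\<xi> j x)) - Im (\<xi> j x) ^ 3" for j
        by (simp add: power3_eq_cube power2_eq_square algebra_simps)
      then have 1: "Im (\<Sum>j<n. \<xi> j x ^ 3) = 3 * (\<Sum>j<n. Re (\<xi> j x) ^ 2 * Im (\<xi> j x)) - p3 x"
        by (simp add: sum_subtractf sum_distrib_left p3_def)
      have "Im (E 3 x) = Im (\<Sum>j<n. \<xi> j x ^ 3) / 3"
        unfolding elim by (simp del: Im_sum)
      then show ?case unfolding 1 by (simp add: diff_divide_distrib)
    qed
  qed
qed

lemma Im_E2: "Oh 5 (\<lambda>x. Im (E 2 x) - p3 x / 2)"
proof -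
  have "Oh 5 (\<lambda>x. - (\<Sum>j<n. (Re (\<xi> j x) - (S x / (2 * of_nat n) - Im (\<xi> j x) ^ 2 / 2)) * Im (\<xi> j x)))"
    by (intro Oh_uminus Oh_sum Oh_mult[OF Re_xi4 Oh_Im[OF xi1]]) auto
  then show ?thesis
  proof (rule Oh_cong_ev)
    show "eventually (\<lambda>x. - (\<Sum>j<n. (Re (\<xi> j x) - (S x / (2 * of_nat n) - Im (\<xi> j x) ^ 2 / 2)) * Im (\<xi> j x))
       = Im (E 2 x) - p3 x / 2) F"
      using E_eqs(1) Im_sum0
    proof eventually_elim
      case (elim x)
      have "(\<Sum>j<n. (Re (\<xi> j x) - (S x / (2 * of_nat n) - Im (\<xi> j x) ^ 2 / 2)) * Im (\<xi> j x))
        = (\<Sum>j<n. Re (\<xi> j x) * Im (\<xi> j x) - S x / (2 * of_nat n) * Im (\<xi> j x) + Im (\<xi> j x) ^ 3 / 2)"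
        by (intro sum.cong refl) (simp add: field_simps power2_eq_square power3_eq_cube)
      also have "\<dots> = (\<Sum>j<n. Re (\<xi> j x) * Im (\<xi> j x)) + p3 x / 2"
      proof -
        have "(\<Sum>j<n. S x / (2 * of_nat n) * Im (\<xi> j x)) = 0"
          unfolding sum_distrib_left[symmetric] elim(2) by simp
        then show ?thesis
          unfolding sum.distrib sum_subtractf by (simp add: sum_divide_distrib p3_def)
      qed
      finally have 1: "(\<Sum>j<n. (Re (\<xi> j x) - (S x / (2 * of_nat n) - Im (\<xi> j x) ^ 2 / 2)) * Im (\<xi> j x))
         = (\<Sum>j<n. Re (\<xi> j x) * Im (\<xi> j x)) + p3 x / 2" .
      have 2: "Im (\<Sum>j<n. \<xi> j x ^ 2) = 2 * (\<Sum>j<n. Re (\<xi> j x) * Im (\<xi> j x))"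
      proof -
        have "Im (\<xi> j x ^ 2) = 2 * (Re (\<xi> j x) * Im (\<xi> j x))" for j
          by (simp add: power2_eq_square)
        then show ?thesis by (simp add: sum_distrib_left)
      qed
      have "Im (E 2 x) = - Im (\<Sum>j<n. \<xi> j x ^ 2) / 2"
        unfolding elim(1) by (simp del: Im_sum)
      then show ?case unfolding 1 2 by simp
    qed
  qed
qed

lemma Re_E4: "Oh 6 (\<lambda>x. Re (E 4 x) - (S x ^ 2 / 8 - p4 x / 4))"
proof -
  define Q where "Q x = (\<Sum>j<n. \<xi> j x ^ 2)" for x
  have Q2: "Oh 2 Q" unfolding Q_def[abs_def] by (intro Oh_sum Oh_power[OF xi1]) auto
  have ReQ: "Re (Q x) = 2 * X x - S x" for x
  proof -
    have "Re (\<xi> j x ^ 2) = 2 * Re (\<xi> j x) ^ 2 - norm (\<xi> j x) ^ 2" for j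
      by (simp add: cmod_power2) (simp add: power2_eq_square)
    then show ?thesis by (simp add: Q_def X_def S_def sum_subtractf sum_distrib_left)
  qed
  have ImQ: "Im (Q x) = 2 * (\<Sum>j<n. Re (\<xi> j x) * Im (\<xi> j x))" for x
  proof -
    have "Im (\<xi> j x ^ 2) = 2 * (Re (\<xi> j x) * Im (\<xi> j x))" for j
      by (simp add: power2_eq_square)
    then show ?thesis by (simp add: Q_def sum_distrib_left)
  qed
  have "Oh 3 (\<lambda>x. Im (Q x))" unfolding ImQ
    by (intro Oh_cmult Oh_sum Oh_mult[OF Re_xi2 Oh_Im[OF xi1]]) auto
  then have a: "Oh 6 (\<lambda>x. Im (Q x) ^ 2)" by (rule Oh_power) simp
  have b: "Oh 6 (\<lambda>x. X x * (X x - S x))"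
    by (rule Oh_mult[OF X4 Oh_diff[OF Oh_mono[OF X4] S2]]) auto
  have c: "Oh 6 (\<lambda>x. \<Sum>j<n. Re (\<xi> j x) ^ 4 - 6 * (Re (\<xi> j x) ^ 2 * Im (\<xi> j x) ^ 2))"
    by (intro Oh_sum Oh_diff Oh_cmult Oh_power[OF Re_xi2] Oh_mult[OF Oh_power[OF Re_xi2, where m=4]
         Oh_power[OF Oh_Im[OF xi1], where m=2]]) auto
  have "Oh 6 (\<lambda>x. X x * (X x - S x) / 2 - Im (Q x) ^ 2 / 8
       - (\<Sum>j<n. Re (\<xi> j x) ^ 4 - 6 * (Re (\<xi> j x) ^ 2 * Im (\<xi> j x) ^ 2)) / 4)"
    by (intro Oh_diff Oh_divide_const a b c)
  then show ?thesis
  proof (rule Oh_cong_ev)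
    show "eventually (\<lambda>x. X x * (X x - S x) / 2 - Im (Q x) ^ 2 / 8
       - (\<Sum>j<n. Re (\<xi> j x) ^ 4 - 6 * (Re (\<xi> j x) ^ 2 * Im (\<xi> j x) ^ 2)) / 4
       = Re (E 4 x) - (S x ^ 2 / 8 - p4 x / 4)) F"
      using E_eqs(3)
    proof eventually_elim
      case (elim x)
      have "Re (\<xi> j x ^ 4) = Re (\<xi> j x) ^ 4 - 6 * (Re (\<xi> j x) ^ 2 * Im (\<xi> j x) ^ 2) + Im (\<xi> j x) ^ 4" for j
        by (simp add: power4_eq_xxxx power2_eq_square algebra_simps)
      then have 1: "Re (\<Sum>j<n. \<xi> j x ^ 4) =
         (\<Sum>j<n. Re (\<xi> j x) ^ 4 - 6 * (Re (\<xi> j x) ^ 2 * Im (\<xi> j x) ^ 2)) + p4 x"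
        by (simp add: sum.distrib p4_def)
      have 2: "Re (Q x ^ 2) = (2 * X x - S x)^2 - Im (Q x) ^ 2"
        unfolding ReQ[symmetric] by (simp add: power2_eq_square)
      have "E 4 x = Q x ^ 2 / 8 - (\<Sum>j<n. \<xi> j x ^ 4) / 4" using elim by (simp add: Q_def)
      then have "Re (E 4 x) = Re (Q x ^ 2) / 8 - Re (\<Sum>j<n. \<xi> j x ^ 4) / 4" by simp
      then show ?case unfolding 1 2 by (simp add: field_simps power2_eq_square)
    qed
  qed
qed

end

section \<open>The expansion coefficients in terms of the real part of the root of unity\<close>

text \<open>The real parts of \<open>bcoef n 2\<close>, \<open>bcoef n 3\<close>, \<open>bcoef n 4\<close>, of \<open>kcoef\<close> and of the ratio \<open>bcoef n 2 w * (w - 1)\<close>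
  at a root of unity \<open>w\<close> with \<open>u = Re w\<close>. They are polynomials in \<open>u\<close> because the real parts of the
  powers of \<open>w\<close> are.\<close>

definition B2 :: "nat \<Rightarrow> real \<Rightarrow> real" where
  "B2 n u = - 1 / n + (1 + u) / (real n - 1)"

definition B3 :: "nat \<Rightarrow> real \<Rightarrow> real" where
  "B3 n u = - (3 / n - 6 * (1 + u) / (real n - 1) + (1 + 2 * u)^2 / (real n - 2)) / 2"

definition B4 :: "nat \<Rightarrow> real \<Rightarrow> real" where
  "B4 n u = - (4 / n - 12 * (1 + u) / (real n - 1) + 4 * (1 + 2 * u)^2 / (real n - 2)
      - 8 * (1 + u) * u^2 / (real n - 3)) / 2"

definition K2 :: "nat \<Rightarrow> real \<Rightarrow> real" where
  "K2 n u = (let A = 2 / real n - 1 / (real n - 1); B = 1 / (real n - 1) in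
     real n / 2 * (A^2 * u - 2 * A * B * (2 * u^2 - 1) + B^2 * (4 * u^3 - 3 * u))
     + (A + B) * (2 * u^2 - 1) - A * u - B * (4 * u^3 - 3 * u)
     - (A^2 - 2 * A * B * (2 * u + 1) + B^2 * (4 * u^2 + 2 * u - 1)) / 2)"

definition G1 :: "nat \<Rightarrow> real \<Rightarrow> real" where
  "G1 n u = 2 / n - (1 + u) / (real n - 1)"

locale unity_root =
  fixes n :: nat and w :: complex
  assumes n3: "3 \<le> n" and w: "w ^ (n + 1) = 1" and w1: "w \<noteq> 1"
begin

abbreviation "u \<equiv> Re w"
abbreviation "v \<equiv> Im w"

lemma norm_w: "norm w = 1"
  using w by (metis add_is_0 norm_one norm_power one_neq_zero power_eq_1_iff norm_ge_zero)

lemma uv: "u^2 + v^2 = 1"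
  using norm_w by (metis cmod_power2 one_power2)

lemma u_less: "u < 1"
proof -
  have "u \<le> 1" using complex_Re_le_cmod[of w] norm_w by simp
  moreover have "u \<noteq> 1"
  proof
    assume "u = 1"
    then have "v = 0" using uv by simp
    with \<open>u = 1\<close> show False using w1 by (simp add: complex_eq_iff)
  qed
  ultimately show ?thesis by simp
qed

lemma w_cnj: "w * cnj w = 1"
  using norm_w complex_norm_square[of w] by simp

lemma power_cnj: "i \<le> n + 1 \<Longrightarrow> w ^ (n + 1 - i) = cnj w ^ i"
proof -
  assume "i \<le> n + 1"
  then have "w ^ (n + 1 - i) * w ^ i = 1" using w by (simp flip: power_add del: power_Suc)
  then have "w ^ (n + 1 - i) * (w ^ i * cnj w ^ i) = cnj w ^ i"
    by (simp flip: mult.assoc)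
  then show ?thesis using w_cnj by (simp flip: power_mult_distrib)
qed

lemma w0: "w \<noteq> 0" using norm_w by auto

text \<open>\<open>(w - 1)\<^sup>2\<close> is a real multiple of \<open>w\<close>, so the factor \<open>w / (w - 1)\<^sup>2\<close> in \<open>bcoef\<close> is real.\<close>

lemma one_minus_sq: "(w - 1)^2 = - (2 * (1 - u)) * w"
proof -
  have "w + cnj w = 2 * u" by (simp add: complex_eq_iff)
  then have "w * (w + cnj w) = w * (2 * u)" by simp
  then have "w^2 + 1 = 2 * u * w" using w_cnj by (simp add: algebra_simps power2_eq_square)
  then show ?thesis by (simp add: algebra_simps power2_eq_square)
qed

lemma prefactor: "w / (w - 1)^2 = of_real (- 1 / (2 * (1 - u)))"
proof -
  have "(of_real (1 - u) :: complex) \<noteq> 0" unfolding of_real_eq_0_iff using u_less by simp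
  then show ?thesis unfolding one_minus_sq using w0 by (simp add: field_simps)
qed

lemma bcoef_eq: "bcoef n k w = of_real (- 1 / (2 * (1 - u))) * Jprim n k w"
  unfolding bcoef_def prefactor ..

lemma s0_eq: "1 / (w - 1) = (cnj w - 1) / of_real (2 * (1 - u))"
proof -
  have "(w - 1) * (cnj w - 1) = 2 - (w + cnj w)"
    using w_cnj by (simp add: algebra_simps)
  also have "w + cnj w = 2 * u" by (simp add: complex_eq_iff)
  finally have "(w - 1) * (cnj w - 1) = of_real (2 * (1 - u))" by simp
  moreover have "w - 1 \<noteq> 0" "(of_real (2 * (1 - u)) :: complex) \<noteq> 0"
    using w1 u_less by (auto simp del: of_real_mult of_real_diff)
  ultimately show ?thesis by (simp add: field_simps del: of_real_mult of_real_diff)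
qed

lemma s0_Re: "Re (1 / (w - 1)) = - 1 / 2"
  unfolding s0_eq Re_divide_of_real using u_less by (simp add: field_simps)

lemma s0_Im: "Im (1 / (w - 1)) = - v / (2 * (1 - u))"
  unfolding s0_eq Im_divide_of_real by simp

lemma s0_norm: "norm (1 / (w - 1)) ^ 2 = 1 / (2 * (1 - u))"
proof -
  have "norm (w - 1) ^ 2 = (u - 1)^2 + v^2" by (simp add: cmod_power2)
  also have "\<dots> = 2 * (1 - u)" using uv by (simp add: power2_eq_square algebra_simps)
  finally show ?thesis by (simp add: norm_divide power_divide)
qed

lemma Re_cnj_powers:
  "Re (cnj w) = u" "Re (cnj w ^ 2) = 2 * u^2 - 1" "Re (cnj w ^ 3) = 4 * u^3 - 3 * u"
  "Re (cnj w ^ 4) = 8 * u^4 - 8 * u^2 + 1"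
  "Im (cnj w) = - v" "Im (cnj w ^ 2) = - 2 * u * v" "Im (cnj w ^ 3) = - (4 * u^2 - 1) * v"
proof -
  have vv: "v * v = 1 - u * u" using uv by (simp add: power2_eq_square)
  have vv': "v * (v * z) = (1 - u * u) * z" for z unfolding vv[symmetric] by simp
  show "Re (cnj w) = u" "Re (cnj w ^ 2) = 2 * u^2 - 1" "Re (cnj w ^ 3) = 4 * u^3 - 3 * u"
  "Re (cnj w ^ 4) = 8 * u^4 - 8 * u^2 + 1"
  "Im (cnj w) = - v" "Im (cnj w ^ 2) = - 2 * u * v" "Im (cnj w ^ 3) = - (4 * u^2 - 1) * v"
    by (simp_all add: power2_eq_square power3_eq_cube power4_eq_xxxx algebra_simps vv vv')
qed

lemma Jprim_unity:
  "k \<le> n \<Longrightarrow> Jprim n k w = (\<Sum>i\<le>k. of_nat (k choose i) * (-1)^i * (cnj w ^ i - 1) / of_nat (n + 1 - i))"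
  unfolding Jprim_def by (intro sum.cong refl, subst power_cnj) auto

lemma Jprim_2: "Jprim n 2 w = of_real (- 2 / n) * (cnj w - 1) + of_real (1 / (real n - 1)) * (cnj w ^ 2 - 1)"
  using n3 by (subst Jprim_unity) (simp_all add: numeral_2_eq_2 of_nat_diff divide_inverse algebra_simps)

lemma Jprim_3: "Jprim n 3 w = of_real (- 3 / n) * (cnj w - 1) + of_real (3 / (real n - 1)) * (cnj w ^ 2 - 1)
    - of_real (1 / (real n - 2)) * (cnj w ^ 3 - 1)"
  using n3 by (subst Jprim_unity) (simp_all add: eval_nat_numeral of_nat_diff divide_inverse algebra_simps)

lemma Jprim_4: "4 \<le> n \<Longrightarrow> Jprim n 4 w = of_real (- 4 / n) * (cnj w - 1) + of_real (6 / (real n - 1)) * (cnj w ^ 2 - 1)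
    - of_real (4 / (real n - 2)) * (cnj w ^ 3 - 1) + of_real (1 / (real n - 3)) * (cnj w ^ 4 - 1)"
  by (subst Jprim_unity) (simp_all add: eval_nat_numeral of_nat_diff divide_inverse algebra_simps)

lemma Re_of_real_mult: "Re (of_real a * z) = a * Re z" "Im (of_real a * z) = a * Im z"
  by simp_all

lemma cancel_prefactor: "- 1 / (2 * (1 - u)) * (- (1 - u) * X) = X / 2"
  using u_less by (simp add: field_simps)

lemma Re_bcoef_2: "Re (bcoef n 2 w) = B2 n u"
proof -
  have e: "u - 1 = - (1 - u)" "2 * u^2 - 1 - 1 = - (1 - u) * (2 * (1 + u))"
    by (simp_all add: power2_eq_square algebra_simps)
  have "Re (Jprim n 2 w) = - (1 - u) * (- 2 / n + 2 * (1 + u) / (real n - 1))"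
    unfolding Jprim_2 by (simp only: plus_complex.sel minus_complex.sel one_complex.sel Re_of_real_mult Re_cnj_powers e)
       (simp add: divide_inverse algebra_simps)
  then have "Re (bcoef n 2 w) = (- 2 / n + 2 * (1 + u) / (real n - 1)) / 2"
    unfolding bcoef_eq Re_of_real_mult by (simp only: cancel_prefactor)
  then show ?thesis unfolding B2_def by (simp add: add_divide_distrib)
qed

lemma Re_bcoef_3: "Re (bcoef n 3 w) = B3 n u"
proof -
  have e: "u - 1 = - (1 - u)" "2 * u^2 - 1 - 1 = - (1 - u) * (2 * (1 + u))"
    "4 * u^3 - 3 * u - 1 = - (1 - u) * (1 + 2 * u)^2"
    by (simp_all add: power2_eq_square power3_eq_cube algebra_simps)
  have "Re (Jprim n 3 w) = - (1 - u) * (- 3 / n + 6 * (1 + u) / (real n - 1) - (1 + 2 * u)^2 / (real n - 2))"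
    unfolding Jprim_3 by (simp only: plus_complex.sel minus_complex.sel one_complex.sel Re_of_real_mult Re_cnj_powers e)
       (simp add: divide_inverse algebra_simps)
  then have "Re (bcoef n 3 w) = (- 3 / n + 6 * (1 + u) / (real n - 1) - (1 + 2 * u)^2 / (real n - 2)) / 2"
    unfolding bcoef_eq Re_of_real_mult by (simp only: cancel_prefactor)
  then show ?thesis unfolding B3_def by simp
qed

lemma Re_bcoef_4: "4 \<le> n \<Longrightarrow> Re (bcoef n 4 w) = B4 n u"
proof -
  assume n: "4 \<le> n"
  have e: "u - 1 = - (1 - u)" "2 * u^2 - 1 - 1 = - (1 - u) * (2 * (1 + u))"
    "4 * u^3 - 3 * u - 1 = - (1 - u) * (1 + 2 * u)^2"
    "8 * u^4 - 8 * u^2 + 1 - 1 = - (1 - u) * (8 * (1 + u) * u^2)"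
    by (simp_all add: power2_eq_square power3_eq_cube power4_eq_xxxx algebra_simps)
  have "Re (Jprim n 4 w) = - (1 - u) * (- 4 / n + 12 * (1 + u) / (real n - 1) - 4 * (1 + 2 * u)^2 / (real n - 2)
        + 8 * (1 + u) * u^2 / (real n - 3))"
    unfolding Jprim_4[OF n] by (simp only: plus_complex.sel minus_complex.sel one_complex.sel Re_of_real_mult Re_cnj_powers e)
       (simp add: divide_inverse algebra_simps)
  then have "Re (bcoef n 4 w) = (- 4 / n + 12 * (1 + u) / (real n - 1) - 4 * (1 + 2 * u)^2 / (real n - 2)
        + 8 * (1 + u) * u^2 / (real n - 3)) / 2"
    unfolding bcoef_eq Re_of_real_mult by (simp only: cancel_prefactor)
  then show ?thesis unfolding B4_def by simp
qed

lemma Im_bcoef_2: "Im (bcoef n 2 w) = - v / (2 * (1 - u)) * (2 / n - 2 * u / (real n - 1))"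
proof -
  have "Im (Jprim n 2 w) = v * (2 / n - 2 * u / (real n - 1))"
    unfolding Jprim_2 by (simp only: plus_complex.sel minus_complex.sel one_complex.sel Re_of_real_mult Re_cnj_powers)
       (simp add: divide_inverse algebra_simps)
  then show ?thesis unfolding bcoef_eq Re_of_real_mult by simp
qed

lemma Im_bcoef_3: "Im (bcoef n 3 w) = - v / (2 * (1 - u)) * (3 / n - 6 * u / (real n - 1) + (4 * u^2 - 1) / (real n - 2))"
proof -
  have "Im (Jprim n 3 w) = v * (3 / n - 6 * u / (real n - 1) + (4 * u^2 - 1) / (real n - 2))"
    unfolding Jprim_3 by (simp only: plus_complex.sel minus_complex.sel one_complex.sel Re_of_real_mult Re_cnj_powers)
       (simp add: divide_inverse algebra_simps)
  then show ?thesis unfolding bcoef_eq Re_of_real_mult by simp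
qed

definition g where "g = of_real (2 / n - 1 / (real n - 1)) - of_real (1 / (real n - 1)) * cnj w"

lemma Re_g: "Re g = G1 n u"
  unfolding g_def G1_def
  by (simp only: minus_complex.sel Re_of_real_mult Re_complex_of_real Re_cnj_powers)
     (simp add: divide_inverse algebra_simps)

lemma J_g: "Jprim n 2 w = - (cnj w - 1) * g"
  unfolding Jprim_2 g_def by (simp add: divide_inverse algebra_simps power2_eq_square)

lemma bcoef_2_g: "bcoef n 2 w = 1 / (w - 1) * g"
  unfolding bcoef_eq J_g s0_eq by (simp add: divide_inverse algebra_simps)

lemma kcoef_g: "kcoef n w = of_real (real n / 2) * (g^2 * cnj w) + g * cnj w * (cnj w - 1) + g^2 * (1 / (w - 1))"
proof -
  have w1': "w - 1 \<noteq> 0" using w1 by simp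
  have c: "cnj w = 1 / w" using w_cnj w0 by (simp add: field_simps)
  have c1: "cnj w - 1 = - (w - 1) / w" unfolding c using w0 by (simp add: field_simps)
  define a where "a = w - 1"
  have J: "Jprim n 2 w = a / w * g" unfolding J_g c1 a_def by (simp add: divide_inverse algebra_simps)
  show ?thesis unfolding kcoef_def J c1 unfolding c a_def[symmetric]
    using w0 w1'[folded a_def] by (simp add: field_simps power2_eq_square power3_eq_cube)
qed

lemma Re_kcoef: "Re (kcoef n w) = K2 n u"
proof -
  define A B where "A = 2 / real n - 1 / (real n - 1)" and "B = 1 / (real n - 1)"
  have g: "g = of_real A - of_real B * cnj w" unfolding g_def A_def B_def ..
  have 1: "g^2 * cnj w = of_real (A^2) * cnj w - of_real (2 * A * B) * cnj w ^ 2 + of_real (B^2) * cnj w ^ 3"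
    unfolding g by (simp add: power2_eq_square power3_eq_cube algebra_simps)
  have 2: "g * cnj w * (cnj w - 1) = of_real (A + B) * cnj w ^ 2 - of_real A * cnj w - of_real B * cnj w ^ 3"
    unfolding g by (simp add: power2_eq_square power3_eq_cube algebra_simps)
  have 3: "g^2 * (cnj w - 1) = of_real (A^2) * (cnj w - 1) - of_real (2 * A * B) * (cnj w ^ 2 - cnj w)
      + of_real (B^2) * (cnj w ^ 3 - cnj w ^ 2)"
    unfolding g by (simp add: power2_eq_square power3_eq_cube algebra_simps)
  have e: "u - 1 = - (1 - u)" "2 * u^2 - 1 - u = - (1 - u) * (2 * u + 1)"
     "4 * u^3 - 3 * u - (2 * u^2 - 1) = - (1 - u) * (4 * u^2 + 2 * u - 1)"
    by (simp_all add: power2_eq_square power3_eq_cube algebra_simps)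
  have "Re (g^2 * (cnj w - 1)) = - (1 - u) * (A^2 - 2 * A * B * (2 * u + 1) + B^2 * (4 * u^2 + 2 * u - 1))"
    unfolding 3 by (simp only: plus_complex.sel minus_complex.sel one_complex.sel Re_of_real_mult Re_cnj_powers e)
      (simp add: algebra_simps)
  then have 4: "Re (g^2 * (1 / (w - 1))) = - (A^2 - 2 * A * B * (2 * u + 1) + B^2 * (4 * u^2 + 2 * u - 1)) / 2"
    unfolding s0_eq times_divide_eq_right Re_divide_of_real using u_less by (simp add: field_simps)
  have K: "K2 n u = real n / 2 * (A^2 * u - 2 * A * B * (2 * u^2 - 1) + B^2 * (4 * u^3 - 3 * u))
     + (A + B) * (2 * u^2 - 1) - A * u - B * (4 * u^3 - 3 * u)
     - (A^2 - 2 * A * B * (2 * u + 1) + B^2 * (4 * u^2 + 2 * u - 1)) / 2"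
    unfolding K2_def Let_def A_def B_def ..
  show ?thesis
    unfolding kcoef_g K plus_complex.sel 4 Re_of_real_mult 1 2
    by (simp only: plus_complex.sel minus_complex.sel Re_of_real_mult Re_cnj_powers)
qed

end

lemma unity_root_cnj: "unity_root n w \<Longrightarrow> unity_root n (cnj w)"
  unfolding unity_root_def by (metis complex_cnj_cancel_iff complex_cnj_one complex_cnj_power)

lemma bcoef_cnj: "bcoef n k (cnj w) = cnj (bcoef n k w)"
  by (simp add: bcoef_def Jprim_cnj)

section \<open>Expansion of the root condition\<close>

text \<open>For \<open>s = r / (z - b)\<close> this is \<open>\<bar>s\<bar>\<^sup>2 (\<bar>z\<bar>\<^sup>2 - 1)\<close>.\<close>

definition Phi :: "real \<Rightarrow> real \<Rightarrow> complex \<Rightarrow> real" where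
  "Phi b r s = r^2 + 2 * b * r * Re s - (1 - b^2) * norm s ^ 2"

text \<open>\<open>second\<close> is the fourth-order part of \<open>Re (c s)\<close> as a function of the variance \<open>S\<close> and the fourth moment
  \<open>p\<close>; \<open>etac\<close> and \<open>Wc\<close> are the coefficients in \<open>Phi\<close> of the variance and of the fourth moment,
  and \<open>Zc\<close> is the coefficient of \<open>h\<^sup>4\<close> in \<open>Phi\<close> at an active root of unity, once \<open>r = 1 + c1 h\<^sup>2\<close>, \<open>S = S1 h\<^sup>2\<close> and
  \<open>p4 = p h\<^sup>4\<close> are inserted.\<close>

definition second :: "nat \<Rightarrow> real \<Rightarrow> real \<Rightarrow> real \<Rightarrow> real" where
  "second n u S p = - 3 * S^2 / (16 * real n ^ 2) - S^2 * B2 n u / (4 * real n)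
     + (B3 n u / 2 - B2 n u / 4) * (p - S^2 / real n) + B4 n u * (S^2 / 8 - p / 4) + K2 n u * S^2 / 4"

definition etac :: "nat \<Rightarrow> real \<Rightarrow> real" where
  "etac n u = 1 / (2 * real n) + B2 n u"

definition Wc :: "nat \<Rightarrow> real \<Rightarrow> real" where
  "Wc n u = 2 * (B3 n u / 2 - B2 n u / 4 - B4 n u / 4)"

definition Zc :: "nat \<Rightarrow> real \<Rightarrow> real \<Rightarrow> real \<Rightarrow> real \<Rightarrow> real" where
  "Zc n u c1 S1 p = c1 * (c1 + 1) + (c1 - 1) * S1 * etac n u
      - (G1 n u - 1 / real n) * S1 / (1 - u) + 1 / (2 * (1 - u)) + 2 * second n u S1 p"

context configuration
begin

text \<open>The part of \<open>Re (c s)\<close> that is odd under conjugation of \<open>w\<close>. It comes from the imaginary parts of \<open>c\<close> and of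
  the symmetric functions, and the two conjugate constraints force it to be negligible.\<close>

definition odd_part where
  "odd_part w x = - Re (c x) * (\<Sum>k=2..n. Im (bcoef n k w) * Im (E k x)) - Im (c x) * Im (1 / (w - 1))"

definition approx where
  "approx w x = 1 / (w - 1) + (\<Sum>k=2..n. bcoef n k w * E k x) + kcoef n w * E 2 x ^ 2"

definition even_part where
  "even_part w x = (\<Sum>k=2..n. Re (bcoef n k w) * Re (E k x)) + Re (kcoef n w * E 2 x ^ 2)"

lemma odd_part_cnj: "odd_part (cnj w) x = - odd_part w x"
proof -
  have "1 / (cnj w - 1) = cnj (1 / (w - 1))" by simp
  then have "Im (1 / (cnj w - 1)) = - Im (1 / (w - 1))" by (simp only: cnj.sel)
  then show ?thesis
    unfolding odd_part_def bcoef_cnj by (simp add: sum_negf)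
qed

lemma split2: "(\<Sum>k=2..n. f k) = f 2 + (\<Sum>k=3..n. f k)" for f :: "nat \<Rightarrow> 'c::comm_monoid_add"
  using n3 by (subst sum.atLeast_Suc_atMost) (auto simp: numeral_3_eq_3 numeral_2_eq_2)

lemma E2_k: "k \<in> {2..n} \<Longrightarrow> Oh 2 (E k)"
  using Oh_mono[OF E_order] by auto

lemma Re_c_bounded: "Oh 0 (\<lambda>x. Re (c x))"
  by (rule Oh_bounded[OF tendsto_Re[OF c_lim]])

text \<open>The square root of \<open>mean_square\<close>, the contribution of \<open>Im (c x)\<close> being of fourth order.\<close>

lemma Re_c_first: "Oh 4 (\<lambda>x. Re (c x) - (1 - S x / (2 * n) - Lam x / (2 * n)))"
proof -
  define sg l where "sg x = S x / n" and "l x = Lam x / n" for x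
  have sg: "Oh 2 sg" unfolding sg_def by (intro Oh_divide_const S2)
  have l: "Oh 2 l" unfolding l_def by (intro Oh_divide_const Lam2)
  define t where "t x = 1 - sg x / 2 - l x / 2" for x
  have nz: "real n \<noteq> 0" using n3 by simp
  have "Oh 4 (\<lambda>x. - ((1 + sg x) * Im (c x) ^ 2)
      + (sg x + l x) * sg x - (sg x + l x)^2 / 4 - sg x * (sg x + l x)^2 / 4)"
    by (intro Oh_diff Oh_add Oh_uminus Oh_divide_const Oh_mult[where k=0 and l=4] Oh_add
        Oh_power[OF Im_c2] Oh_mult[OF Oh_add[OF sg l] sg] Oh_power[OF Oh_add[OF sg l]]
        Oh_mult[OF sg Oh_power[OF Oh_add[OF sg l], where m=2]] Oh_const Oh_mono[OF sg]) auto
  then have "Oh 4 (\<lambda>x. (Re (c x) - t x) * ((Re (c x) + t x) * (1 + sg x)))"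
  proof (rule Oh_cong_ev)
    show "eventually (\<lambda>x. - ((1 + sg x) * Im (c x) ^ 2)
      + (sg x + l x) * sg x - (sg x + l x)^2 / 4 - sg x * (sg x + l x)^2 / 4
       = (Re (c x) - t x) * ((Re (c x) + t x) * (1 + sg x))) F"
      using mean_square
    proof eventually_elim
      case (elim x)
      then have "(Re (c x) ^ 2 + Im (c x) ^ 2) * (1 + sg x) = 1 - l x"
        using nz unfolding cmod_power2 sg_def l_def by (simp add: field_simps)
      then have "(Re (c x) - t x) * ((Re (c x) + t x) * (1 + sg x))
          = 1 - l x - Im (c x) ^ 2 * (1 + sg x) - t x ^ 2 * (1 + sg x)"
        by (simp add: algebra_simps power2_eq_square)
      then show ?case unfolding t_def by (simp add: field_simps power2_eq_square)
    qed
  qed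
  moreover have "((\<lambda>x. (Re (c x) + t x) * (1 + sg x)) \<longlongrightarrow> (Re 1 + (1 - 0 / 2 - 0 / 2)) * (1 + 0)) F"
    unfolding t_def by (intro tendsto_intros c_lim Oh_tendsto_0[OF sg] Oh_tendsto_0[OF l]) auto
  ultimately have "Oh 4 (\<lambda>x. Re (c x) - t x)"
    by (rule Oh_cancel) simp
  then show ?thesis by (rule Oh_cong) (simp add: t_def sg_def l_def)
qed

lemma Re_E3_4: "Oh 4 (\<lambda>x. Re (E 3 x))"
proof -
  have "Oh 4 (\<lambda>x. Re (E 3 x - \<i> ^ 3 * of_real (esym (\<lambda>j. Im (\<xi> j x)) n 3)))"
    using Oh_Re[OF E_phase[of 3]] by simp
  then show ?thesis by (simp add: power3_eq_cube)
qed

lemma Re_high_sum_4: "Oh 4 (\<lambda>x. \<Sum>k=3..n. Re (bcoef n k w) * Re (E k x))"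
proof (intro Oh_sum Oh_cmult)
  fix k assume k: "k \<in> {3..n}"
  show "Oh 4 (\<lambda>x. Re (E k x))"
  proof (cases "k = 3")
    case True
    then show ?thesis using Re_E3_4 by simp
  next
    case False
    then show ?thesis using k by (intro Oh_Re E4_4) auto
  qed
qed

lemma even_first:
  assumes "unity_root n w"
  shows "Oh 4 (\<lambda>x. even_part w x - B2 n (Re w) * S x / 2)"
proof -
  interpret unity_root n w by fact
  have "Oh 4 (\<lambda>x. - B2 n (Re w) * X x + (\<Sum>k=3..n. Re (bcoef n k w) * Re (E k x)) + Re (kcoef n w * E 2 x ^ 2))"
    by (intro Oh_add Oh_cmult X4 Re_high_sum_4 Oh_Re Oh_power[OF E2_2]) auto
  then show ?thesis
  proof (rule Oh_cong_ev)
    show "eventually (\<lambda>x. - B2 n (Re w) * X x + (\<Sum>k=3..n. Re (bcoef n k w) * Re (E k x)) + Re (kcoef n w * E 2 x ^ 2)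
       = even_part w x - B2 n (Re w) * S x / 2) F"
      using Re_E2
    proof eventually_elim
      case (elim x)
      show ?case unfolding even_part_def split2 elim Re_bcoef_2
        by (simp add: right_diff_distrib)
    qed
  qed
qed

lemma even_2:
  assumes "unity_root n w"
  shows "Oh 2 (even_part w)"
proof -
  have "Oh 2 (\<lambda>x. (even_part w x - B2 n (Re w) * S x / 2) + B2 n (Re w) * S x / 2)"
    by (intro Oh_add Oh_mono[OF even_first[OF assms]] Oh_divide_const Oh_cmult S2) auto
  then show ?thesis by (rule Oh_cong) simp
qed

text \<open>An exact identity, from which both the first- and the second-order expansions are read off.\<close>

lemma Re_cs_exact:
  assumes "unity_root n w"
  shows "Re (c x * s) = - Re (c x) / 2 + Re (c x) * even_part w x + odd_part w x
     + Re (c x) * Re (s - approx w x) - Im (c x) * Im (s - 1 / (w - 1))"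
proof -
  interpret unity_root n w by fact
  define e where "e = Re (s - approx w x)"
  define i0 i where "i0 = Im (1 / (w - 1))" and "i = Im (s - 1 / (w - 1))"
  have "Re s = Re (approx w x) + e" by (simp add: e_def)
  also have "Re (approx w x) = - 1 / 2 + even_part w x - (\<Sum>k=2..n. Im (bcoef n k w) * Im (E k x))"
    unfolding approx_def even_part_def plus_complex.sel s0_Re Re_sum
    by (simp add: sum_subtractf)
  finally have 1: "Re s = - 1 / 2 + even_part w x - (\<Sum>k=2..n. Im (bcoef n k w) * Im (E k x)) + e" .
  have "Re (c x * s) = Re (c x) * Re s - Im (c x) * (i0 + i)"
    by (simp add: i0_def i_def)
  then show ?thesis
    unfolding odd_part_def 1 e_def[symmetric] i_def[symmetric] i0_def[symmetric]
    by (simp add: algebra_simps)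
qed

lemma odd_2: "Oh 2 (odd_part w)"
  unfolding odd_part_def
  by (intro Oh_diff Oh_mult[where k=0 and l=2] Oh_uminus Re_c_bounded Oh_sum Oh_cmult Oh_Im E2_k
      Oh_cmult_right Im_c2) auto

lemma s_first:
  assumes "Oh 5 (\<lambda>x. s x - approx w x)"
  shows "Oh 2 (\<lambda>x. s x - 1 / (w - 1))"
proof -
  have "Oh 2 (\<lambda>x. (s x - approx w x) + (\<Sum>k=2..n. bcoef n k w * E k x) + kcoef n w * E 2 x ^ 2)"
    by (intro Oh_add Oh_mono[OF assms] Oh_sum Oh_cmult E2_k Oh_power[OF E2_2]) auto
  then show ?thesis by (rule Oh_cong) (simp add: approx_def)
qed

lemma first_order_Re:
  assumes ur: "unity_root n w" and s: "Oh 5 (\<lambda>x. s x - approx w x)"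
  shows "Oh 4 (\<lambda>x. Re (c x * s x) - (- 1 / 2 + S x / (4 * n) + Lam x / (4 * n) + B2 n (Re w) * S x / 2 + odd_part w x))"
proof -
  have "Oh 4 (\<lambda>x. - (Re (c x) - (1 - S x / (2 * n) - Lam x / (2 * n))) / 2
     + (Re (c x) - 1) * even_part w x + (even_part w x - B2 n (Re w) * S x / 2)
     + Re (c x) * Re (s x - approx w x) - Im (c x) * Im (s x - 1 / (w - 1)))"
    by (intro Oh_add Oh_diff[OF _ Oh_mult[OF Im_c2 Oh_Im[OF s_first[OF s]]]] Oh_divide_const Oh_uminus Re_c_first
        Oh_mult[OF Re_c even_2[OF ur]] even_first[OF ur] Oh_mult[OF Re_c_bounded Oh_Re[OF s]]) auto
  then show ?thesis
  proof (rule Oh_cong)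
    fix x
    show "Re (c x * s x) - (- 1 / 2 + S x / (4 * n) + Lam x / (4 * n) + B2 n (Re w) * S x / 2 + odd_part w x)
     = - (Re (c x) - (1 - S x / (2 * n) - Lam x / (2 * n))) / 2
     + (Re (c x) - 1) * even_part w x + (even_part w x - B2 n (Re w) * S x / 2)
     + Re (c x) * Re (s x - approx w x) - Im (c x) * Im (s x - 1 / (w - 1))"
      unfolding Re_cs_exact[OF ur] by (simp add: field_simps)
  qed
qed

lemma cs_first:
  assumes s: "Oh 5 (\<lambda>x. s x - approx w x)"
  shows "Oh 2 (\<lambda>x. c x * s x - 1 / (w - 1))"
proof -
  have c1: "Oh 2 (\<lambda>x. c x - 1)" by (rule Oh_complexI) (use Re_c Im_c2 in auto)
  have "Oh 2 (\<lambda>x. (c x - 1) * (s x - 1 / (w - 1)) + (c x - 1) * (1 / (w - 1)) + (s x - 1 / (w - 1)))"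
    by (intro Oh_add Oh_mult[OF c1 s_first[OF s]] Oh_cmult_right c1 s_first[OF s]) auto
  then show ?thesis by (rule Oh_cong) (simp add: algebra_simps)
qed

lemma norm_sq_diff:
  assumes "Oh k (\<lambda>x. f x - g x)" "Oh 0 f" "Oh 0 g"
  shows "Oh k (\<lambda>x. norm (f x :: complex) ^ 2 - norm (g x :: complex) ^ 2)"
proof -
  have "Oh k (\<lambda>x. Re ((f x - g x) * cnj (f x + g x)))"
    by (intro Oh_Re Oh_mult[OF assms(1), where l=0] Oh_cnj Oh_add assms) auto
  then show ?thesis
    by (rule Oh_cong) (unfold cmod_power2, simp add: algebra_simps power2_eq_square)
qed

lemma norm_cs_first:
  assumes ur: "unity_root n w" and s: "Oh 5 (\<lambda>x. s x - approx w x)"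
  shows "Oh 2 (\<lambda>x. norm (c x * s x) ^ 2 - 1 / (2 * (1 - Re w)))"
proof -
  interpret unity_root n w by fact
  have "Oh 0 (\<lambda>x. c x * s x)"
    by (rule Oh_bounded[OF Oh_tendsto[OF cs_first[OF s]]]) simp
  then have "Oh 2 (\<lambda>x. norm (c x * s x) ^ 2 - norm (1 / (w - 1)) ^ 2)"
    by (intro norm_sq_diff cs_first[OF s] Oh_const)
  then show ?thesis unfolding s0_norm .
qed

text \<open>At first order only the deviation of \<open>Re (c s)\<close> from \<open>- 1 / 2\<close> matters; \<open>\<bar>c s\<bar>\<^sup>2\<close> enters through its limit
  \<open>1 / (2 (1 - Re w))\<close>, since \<open>Phi\<close> multiplies it by \<open>1 - b\<^sup>2 = O(h\<^sup>2)\<close>.\<close>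

lemma first_order_Phi:
  assumes ur: "unity_root n w" and s: "Oh 5 (\<lambda>x. s x - approx w x)" and r: "Oh 2 (\<lambda>x. r x - 1)"
  shows "Oh 4 (\<lambda>x. Phi (1 - h x ^ 2) (r x) (c x * s x)
     - ((r x - 1) + h x ^ 2 + S x * etac n (Re w) + Lam x / (2 * n) + 2 * odd_part w x - h x ^ 2 / (1 - Re w)))"
proof -
  interpret unity_root n w by fact
  define N where "N x = norm (c x * s x) ^ 2" for x
  define N0 where "N0 = 1 / (2 * (1 - Re w))"
  define y where "y x = Re (c x * s x) + 1 / 2" for x
  define y1 where "y1 x = S x / (4 * n) + Lam x / (4 * n) + B2 n (Re w) * S x / 2 + odd_part w x" for x
  have yy: "Oh 4 (\<lambda>x. y x - y1 x)"
    using first_order_Re[OF ur s] by (rule Oh_cong) (simp add: y_def y1_def)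
  have N: "Oh 2 (\<lambda>x. N x - N0)" using norm_cs_first[OF ur s] by (simp add: N_def N0_def)
  have Nb: "Oh 0 N" by (rule Oh_bounded[OF Oh_tendsto[OF N]]) simp
  have y1: "Oh 2 y1" unfolding y1_def by (intro Oh_add Oh_divide_const Oh_cmult S2 Lam2 odd_2)
  have y: "Oh 2 y"
    using Oh_add[OF Oh_mono[OF yy] y1] by simp
  have br: "Oh 2 (\<lambda>x. (1 - h x ^ 2) * r x - 1)"
  proof -
    have "Oh 2 (\<lambda>x. (r x - 1) - h x ^ 2 * (r x - 1) - h x ^ 2)"
      by (intro Oh_diff r Oh_mult[OF Oh_h2 r] Oh_h2) auto
    then show ?thesis by (rule Oh_cong) (simp add: algebra_simps)
  qed
  have "Oh 4 (\<lambda>x. (r x - 1) * (r x - 1 + h x ^ 2) + 2 * (y x - y1 x) + 2 * (((1 - h x ^ 2) * r x - 1) * y x)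
      - 2 * (h x ^ 2 * (N x - N0)) + h x ^ 4 * N x)"
    by (intro Oh_add Oh_diff Oh_cmult Oh_mult[OF r Oh_add[OF r Oh_h2]] yy Oh_mult[OF br y]
        Oh_mult[OF Oh_h2 N] Oh_mult[OF Oh_h4 Nb]) auto
  then show ?thesis
  proof (rule Oh_cong)
    fix x
    have "1 - Re w \<noteq> 0" using u_less by simp
    then have 0: "h x ^ 2 / (1 - Re w) = 2 * N0 * h x ^ 2" by (simp add: N0_def field_simps)
    have R: "Re (c x * s x) = y x - 1 / 2" by (simp add: y_def)
    have 1: "S x * etac n (Re w) + Lam x / (2 * n) + 2 * odd_part w x = 2 * y1 x"
      unfolding etac_def y1_def using n3 by (simp add: field_simps)
    show "Phi (1 - h x ^ 2) (r x) (c x * s x)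
     - ((r x - 1) + h x ^ 2 + S x * etac n (Re w) + Lam x / (2 * n) + 2 * odd_part w x - h x ^ 2 / (1 - Re w))
      = (r x - 1) * (r x - 1 + h x ^ 2) + 2 * (y x - y1 x) + 2 * (((1 - h x ^ 2) * r x - 1) * y x)
      - 2 * (h x ^ 2 * (N x - N0)) + h x ^ 4 * N x"
      unfolding Phi_def R N_def[symmetric] 0 using 1
      by (simp add: algebra_simps power2_eq_square power4_eq_xxxx)
  qed
qed

end

text \<open>The exponent \<open>\<mu>\<close> is the order to which the antisymmetric quantities (third moment, \<open>Im c\<close>) vanish. It is 4 in
  general and 3 in the two exceptional degrees, and it determines the error term \<open>\<mu> + 2\<close> of the expansion.\<close>

locale graded_configuration = tight_configuration F h n c \<xi>
  for F :: "'a filter" and h :: "'a \<Rightarrow> real" and n c \<xi> +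
  fixes \<mu> :: nat
  assumes mu: "3 \<le> \<mu>" "\<mu> \<le> 4"
    and E3mu: "Oh \<mu> (E 3)"
    and Im_c_mu: "Oh \<mu> (\<lambda>x. Im (c x))"
begin

lemma p3_mu: "Oh \<mu> p3"
proof -
  have "Oh \<mu> (\<lambda>x. 3 * ((Im (E 3 x) + p3 x / 3) - Im (E 3 x)))"
    by (intro Oh_cmult Oh_diff Oh_mono[OF Im_E3] Oh_Im E3mu) (use mu in auto)
  then show ?thesis by (rule Oh_cong) simp
qed

lemma Im_E2_mu: "Oh \<mu> (\<lambda>x. Im (E 2 x))"
proof -
  have "Oh \<mu> (\<lambda>x. (Im (E 2 x) - p3 x / 2) + p3 x / 2)"
    by (intro Oh_add Oh_divide_const p3_mu Oh_mono[OF Im_E2]) (use mu in auto)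
  then show ?thesis by (rule Oh_cong) simp
qed

lemma E_mu: "k \<in> {3..n} \<Longrightarrow> Oh \<mu> (E k)"
  using E3mu Oh_mono[OF E_order, of \<mu> k] mu by (cases "k = 3") auto

lemma Im_E_mu: "k \<in> {2..n} \<Longrightarrow> Oh \<mu> (\<lambda>x. Im (E k x))"
  using Im_E2_mu Oh_Im[OF E_mu] by (cases "k = 2") auto

lemma odd_mu: "Oh \<mu> (odd_part w)"
  unfolding odd_part_def
  by (intro Oh_diff Oh_mult[where k=0 and l=\<mu>] Oh_uminus Re_c_bounded Oh_sum Oh_cmult Im_E_mu
      Oh_cmult_right Im_c_mu) auto

lemma Re_c_second: "Oh 6 (\<lambda>x. Re (c x) - (1 - S x / (2 * n) + 3 * S x ^ 2 / (8 * real n ^ 2) - Lam x / (2 * n)))"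
proof -
  define sg l where "sg x = S x / n" and "l x = Lam x / n" for x
  have sg: "Oh 2 sg" unfolding sg_def by (intro Oh_divide_const S2)
  have sgb: "Oh 0 (\<lambda>x. 1 + sg x)" by (intro Oh_add Oh_const Oh_mono[OF sg]) auto
  have l: "Oh 4 l" unfolding l_def by (intro Oh_divide_const Lam4)
  define t where "t x = 1 - sg x / 2 + 3 * sg x ^ 2 / 8 - l x / 2" for x
  have nz: "real n \<noteq> 0" using n3 by simp
  have 1: "Oh 6 (\<lambda>x. (1 + sg x) * Im (c x) ^ 2)"
    by (rule Oh_mult[OF sgb Oh_power[OF Im_c_mu, where m=6]]) (use mu in auto)
  have 3: "Oh 6 (\<lambda>x. sg x ^ 3 * (5/8 - 15/64 * sg x + 9/64 * sg x ^ 2))"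
    by (intro Oh_mult[OF Oh_power[OF sg, where m=6], where l=0] Oh_add Oh_diff Oh_cmult Oh_const
        Oh_mono[OF sg] Oh_power[OF sg]) auto
  have 4: "Oh 6 (\<lambda>x. l x * (sg x * (1/2 - 1/8 * sg x + 3/8 * sg x ^ 2)))"
    by (intro Oh_mult[OF l, where l=2] Oh_mult[OF sg, where l=0] Oh_add Oh_diff Oh_cmult Oh_const
        Oh_mono[OF sg] Oh_power[OF sg]) auto
  have 5: "Oh 6 (\<lambda>x. (1 + sg x) * l x ^ 2 / 4)"
    by (intro Oh_divide_const Oh_mult[OF sgb Oh_power[OF l, where m=6]]) auto
  have "Oh 6 (\<lambda>x. - ((1 + sg x) * Im (c x) ^ 2) - sg x ^ 3 * (5/8 - 15/64 * sg x + 9/64 * sg x ^ 2)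
      + l x * (sg x * (1/2 - 1/8 * sg x + 3/8 * sg x ^ 2)) - (1 + sg x) * l x ^ 2 / 4)"
    by (intro Oh_diff Oh_add Oh_uminus 1 3 4 5)
  then have "Oh 6 (\<lambda>x. (Re (c x) - t x) * ((Re (c x) + t x) * (1 + sg x)))"
  proof (rule Oh_cong_ev)
    show "eventually (\<lambda>x. - ((1 + sg x) * Im (c x) ^ 2) - sg x ^ 3 * (5/8 - 15/64 * sg x + 9/64 * sg x ^ 2)
      + l x * (sg x * (1/2 - 1/8 * sg x + 3/8 * sg x ^ 2)) - (1 + sg x) * l x ^ 2 / 4
       = (Re (c x) - t x) * ((Re (c x) + t x) * (1 + sg x))) F"
      using mean_square
    proof eventually_elim
      case (elim x)
      then have "(Re (c x) ^ 2 + Im (c x) ^ 2) * (1 + sg x) = 1 - l x"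
        using nz unfolding cmod_power2 sg_def l_def by (simp add: field_simps)
      then have "(Re (c x) - t x) * ((Re (c x) + t x) * (1 + sg x))
          = 1 - l x - Im (c x) ^ 2 * (1 + sg x) - t x ^ 2 * (1 + sg x)"
        by (simp add: algebra_simps power2_eq_square)
      then show ?case unfolding t_def by (simp add: field_simps power2_eq_square power3_eq_cube)
    qed
  qed
  moreover have "((\<lambda>x. (Re (c x) + t x) * (1 + sg x)) \<longlongrightarrow> (Re 1 + (1 - 0 / 2 + 3 * 0 ^ 2 / 8 - 0 / 2)) * (1 + 0)) F"
    unfolding t_def by (intro tendsto_intros c_lim Oh_tendsto_0[OF sg] Oh_tendsto_0[OF l]) auto
  ultimately have "Oh 6 (\<lambda>x. Re (c x) - t x)"
    by (rule Oh_cancel) simp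
  then show ?thesis by (rule Oh_cong) (simp add: t_def sg_def l_def power_divide)
qed

lemma Re_high_sum_6:
  assumes "unity_root n w"
  shows "Oh 6 (\<lambda>x. (\<Sum>k=3..n. Re (bcoef n k w) * Re (E k x)) - B3 n (Re w) * Re (E 3 x) - B4 n (Re w) * Re (E 4 x))"
proof -
  interpret unity_root n w by fact
  show ?thesis
  proof (cases "n = 3")
    case True
    then have "E 4 x = 0" for x unfolding E_def by (intro esym_eq_0) simp
    moreover have "(\<Sum>k=3..n. f k) = f 3" for f :: "nat \<Rightarrow> real" using True by simp
    ultimately show ?thesis by (simp add: Re_bcoef_3 Oh_zero)
  next
    case False
    then have n4: "4 \<le> n" using n3 by simp
    have "(\<Sum>k=3..n. f k) = f 3 + (f 4 + (\<Sum>k=5..n. f k))" for f :: "nat \<Rightarrow> real"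
    proof -
      have "(\<Sum>k=3..n. f k) = f 3 + (\<Sum>k=Suc 3..n. f k)" using n4 by (subst sum.atLeast_Suc_atMost) auto
      also have "(\<Sum>k=Suc 3..n. f k) = f 4 + (\<Sum>k=Suc 4..n. f k)"
        using n4 by (subst sum.atLeast_Suc_atMost) auto
      finally show ?thesis by simp
    qed
    moreover have "Oh 6 (\<lambda>x. \<Sum>k=5..n. Re (bcoef n k w) * Re (E k x))"
      by (intro Oh_sum Oh_cmult Re_E_high) auto
    ultimately show ?thesis by (simp add: Re_bcoef_3 Re_bcoef_4[OF n4])
  qed
qed

definition even_main where
  "even_main u x = B2 n u * (S x / 2 - m4 x / 4) + B3 n u * m4 x / 2 + B4 n u * (S x ^ 2 / 8 - p4 x / 4) + K2 n u * S x ^ 2 / 4"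

lemma even_second:
  assumes "unity_root n w"
  shows "Oh (\<mu> + 2) (\<lambda>x. even_part w x - even_main (Re w) x)"
proof -
  interpret unity_root n w by fact
  define H where "H x = (\<Sum>k=3..n. Re (bcoef n k w) * Re (E k x)) - B3 n (Re w) * Re (E 3 x) - B4 n (Re w) * Re (E 4 x)" for x
  have m: "\<mu> + 2 \<le> 6" using mu by simp
  have "Oh (\<mu> + 2) (\<lambda>x. - B2 n (Re w) * (X x - m4 x / 4) + H x + B3 n (Re w) * (Re (E 3 x) - m4 x / 2)
       + B4 n (Re w) * (Re (E 4 x) - (S x ^ 2 / 8 - p4 x / 4))
       + K2 n (Re w) * (X x * (X x - S x) - Im (E 2 x) ^ 2)
       - 2 * Im (kcoef n w) * (Re (E 2 x) * Im (E 2 x)))"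
    by (intro Oh_add Oh_diff Oh_cmult Oh_mono[OF X6 m] Oh_mono[OF Re_E3 m] Oh_mono[OF Re_E4 m]
        Oh_mono[OF Re_high_sum_6[OF assms, folded H_def] m]
        Oh_mult[OF X4 Oh_diff[OF Oh_mono[OF X4] S2]] Oh_power[OF Im_E2_mu] Oh_mult[OF Oh_Re[OF E2_2] Im_E2_mu])
      (use mu in auto)
  then show ?thesis
  proof (rule Oh_cong_ev)
    show "eventually (\<lambda>x. - B2 n (Re w) * (X x - m4 x / 4) + H x + B3 n (Re w) * (Re (E 3 x) - m4 x / 2)
       + B4 n (Re w) * (Re (E 4 x) - (S x ^ 2 / 8 - p4 x / 4))
       + K2 n (Re w) * (X x * (X x - S x) - Im (E 2 x) ^ 2)
       - 2 * Im (kcoef n w) * (Re (E 2 x) * Im (E 2 x)) = even_part w x - even_main (Re w) x) F"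
      using Re_E2
    proof eventually_elim
      case (elim x)
      have "Re (kcoef n w * E 2 x ^ 2) = K2 n (Re w) * (Re (E 2 x) ^ 2 - Im (E 2 x) ^ 2)
          - 2 * Im (kcoef n w) * (Re (E 2 x) * Im (E 2 x))"
        unfolding Re_kcoef[symmetric] by (simp add: power2_eq_square)
      moreover have "Re (E 2 x) ^ 2 = S x ^ 2 / 4 + X x * (X x - S x)"
        unfolding elim by (simp add: power2_eq_square field_simps)
      ultimately have k: "Re (kcoef n w * E 2 x ^ 2) = K2 n (Re w) * (S x ^ 2 / 4 + X x * (X x - S x) - Im (E 2 x) ^ 2)
          - 2 * Im (kcoef n w) * (Re (E 2 x) * Im (E 2 x))" by simp
      have s: "(\<Sum>k=2..n. Re (bcoef n k w) * Re (E k x)) = B2 n (Re w) * (S x / 2 - X x)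
          + (H x + B3 n (Re w) * Re (E 3 x) + B4 n (Re w) * Re (E 4 x))"
        unfolding split2 Re_bcoef_2 H_def elim by simp
      show ?case unfolding even_part_def even_main_def k s by (simp add: algebra_simps)
    qed
  qed
qed

lemma second_order_Re:
  assumes ur: "unity_root n w" and s: "Oh (\<mu> + 2) (\<lambda>x. s x - approx w x)"
  shows "Oh (\<mu> + 2) (\<lambda>x. Re (c x * s x) - (- 1 / 2 + S x * etac n (Re w) / 2 + Lam x / (4 * n) + odd_part w x
       + second n (Re w) (S x) (p4 x)))"
proof -
  have s5: "Oh 5 (\<lambda>x. s x - approx w x)" using s by (rule Oh_mono) (use mu in auto)
  have m: "\<mu> + 2 \<le> 6" using mu by simp
  define t where "t x = 1 - S x / (2 * n) + 3 * S x ^ 2 / (8 * real n ^ 2) - Lam x / (2 * n)" for x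
  have c4: "Oh 4 (\<lambda>x. Re (c x) - 1 + S x / (2 * n))"
  proof -
    have "Oh 4 (\<lambda>x. (Re (c x) - (1 - S x / (2 * n) - Lam x / (2 * n))) - Lam x / (2 * n))"
      by (intro Oh_diff Re_c_first Oh_divide_const Lam4)
    then show ?thesis by (rule Oh_cong) simp
  qed
  have e1: "Oh (\<mu> + 2) (\<lambda>x. (Re (c x) - 1 + S x / (2 * n)) * even_part w x)"
    by (rule Oh_mult[OF c4 even_2[OF ur]]) (use mu in auto)
  have e2: "Oh (\<mu> + 2) (\<lambda>x. S x * (even_part w x - B2 n (Re w) * S x / 2))"
    by (rule Oh_mult[OF S2 even_first[OF ur]]) (use mu in auto)
  have e3: "Oh (\<mu> + 2) (\<lambda>x. Re (c x) * Re (s x - approx w x))"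
    by (rule Oh_mult[OF Re_c_bounded Oh_Re[OF s]]) simp
  have e4: "Oh (\<mu> + 2) (\<lambda>x. Im (c x) * Im (s x - 1 / (w - 1)))"
    by (rule Oh_mult[OF Im_c_mu Oh_Im[OF s_first[OF s5]]]) simp
  have "Oh (\<mu> + 2) (\<lambda>x. - (Re (c x) - t x) / 2 + (Re (c x) - 1 + S x / (2 * n)) * even_part w x
      - S x * (even_part w x - B2 n (Re w) * S x / 2) / (2 * n) + (even_part w x - even_main (Re w) x)
      + Re (c x) * Re (s x - approx w x) - Im (c x) * Im (s x - 1 / (w - 1)))"
    by (intro Oh_add[OF Oh_add[OF Oh_diff[OF Oh_add] ], THEN Oh_diff] Oh_add Oh_diff Oh_divide_const Oh_uminus Oh_mono[OF Re_c_second[folded t_def] m] e1 e2 e3 e4 even_second[OF ur])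
  then show ?thesis
  proof (rule Oh_cong)
    fix x
    show "Re (c x * s x) - (- 1 / 2 + S x * etac n (Re w) / 2 + Lam x / (4 * n) + odd_part w x
       + second n (Re w) (S x) (p4 x))
      = - (Re (c x) - t x) / 2 + (Re (c x) - 1 + S x / (2 * n)) * even_part w x
      - S x * (even_part w x - B2 n (Re w) * S x / 2) / (2 * n) + (even_part w x - even_main (Re w) x)
      + Re (c x) * Re (s x - approx w x) - Im (c x) * Im (s x - 1 / (w - 1))"
    proof -
      define N where "N = inverse (real n)"
      show ?thesis
        unfolding Re_cs_exact[OF ur] t_def even_main_def second_def etac_def m4_def
        unfolding of_nat_mult divide_inverse inverse_mult_distrib power_inverse[symmetric] N_def[symmetric]
        by (simp add: algebra_simps power2_eq_square)
    qed
  qed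
qed

lemma norm_cs_second:
  assumes ur: "unity_root n w" and s: "Oh (\<mu> + 2) (\<lambda>x. s x - approx w x)"
  shows "Oh \<mu> (\<lambda>x. norm (c x * s x) ^ 2 - (1 + (G1 n (Re w) - 1 / n) * S x) / (2 * (1 - Re w)))"
proof -
  interpret unity_root n w by fact
  define s0 where "s0 = 1 / (w - 1)"
  define a where "a = bcoef n 2 w"
  have s5: "Oh 5 (\<lambda>x. s x - approx w x)" using s by (rule Oh_mono) (use mu in auto)
  have sb: "Oh 0 s" by (rule Oh_bounded[OF Oh_tendsto[OF s_first[OF s5]]]) simp
  have d: "Oh \<mu> (\<lambda>x. s x - (s0 + a * E 2 x))"
  proof -
    have "Oh \<mu> (\<lambda>x. (s x - approx w x) + (\<Sum>k=3..n. bcoef n k w * E k x) + kcoef n w * E 2 x ^ 2)"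
      by (intro Oh_add Oh_mono[OF s] Oh_sum Oh_cmult E_mu Oh_power[OF E2_2]) (use mu in auto)
    then show ?thesis by (rule Oh_cong) (simp add: approx_def split2 s0_def a_def)
  qed
  have lb: "Oh 0 (\<lambda>x. s0 + a * E 2 x)"
    by (intro Oh_add Oh_const Oh_cmult Oh_mono[OF E2_2]) auto
  have 1: "Oh \<mu> (\<lambda>x. norm (s x) ^ 2 - norm (s0 + a * E 2 x) ^ 2)"
    by (rule norm_sq_diff[OF d sb lb])
  have a: "a = s0 * g" unfolding a_def s0_def by (rule bcoef_2_g)
  have e: "norm (s0 + a * E 2 x) ^ 2 = norm s0 ^ 2 * (1 + 2 * (G1 n (Re w) * Re (E 2 x) - Im g * Im (E 2 x)) + norm (g * E 2 x) ^ 2)" for x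
  proof -
    have "s0 + a * E 2 x = s0 * (1 + g * E 2 x)" unfolding a by (simp add: algebra_simps)
    then have "norm (s0 + a * E 2 x) ^ 2 = norm s0 ^ 2 * norm (1 + g * E 2 x) ^ 2"
      by (simp add: norm_mult power_mult_distrib)
    then show ?thesis unfolding norm_1_plus by (simp add: Re_g)
  qed
  have N0: "norm s0 ^ 2 = 1 / (2 * (1 - Re w))" unfolding s0_def by (rule s0_norm)
  have 2: "Oh \<mu> (\<lambda>x. norm (s0 + a * E 2 x) ^ 2 - norm s0 ^ 2 * (1 + G1 n (Re w) * S x))"
  proof -
    have "Oh \<mu> (\<lambda>x. norm s0 ^ 2 * (- 2 * G1 n (Re w) * X x - 2 * Im g * Im (E 2 x) + norm (g * E 2 x) ^ 2))"
      by (intro Oh_cmult Oh_add Oh_diff Oh_mono[OF X4] Im_E2_mu Oh_power[OF Oh_norm[OF Oh_cmult[OF E2_2]]])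
        (use mu in auto)
    then show ?thesis
    proof (rule Oh_cong_ev)
      show "eventually (\<lambda>x. norm s0 ^ 2 * (- 2 * G1 n (Re w) * X x - 2 * Im g * Im (E 2 x) + norm (g * E 2 x) ^ 2)
         = norm (s0 + a * E 2 x) ^ 2 - norm s0 ^ 2 * (1 + G1 n (Re w) * S x)) F"
        using Re_E2
      proof eventually_elim
        case (elim x)
        show ?case unfolding e elim by (simp add: algebra_simps)
      qed
    qed
  qed
  have s2: "Oh \<mu> (\<lambda>x. norm (s x) ^ 2 - norm s0 ^ 2 * (1 + G1 n (Re w) * S x))"
    using Oh_add[OF 1 2] by simp
  have c2: "Oh \<mu> (\<lambda>x. norm (c x) ^ 2 - (1 - S x / n))"
  proof -
    have "Oh \<mu> (\<lambda>x. (norm (c x) ^ 2 - (1 - S x / n)) * (of_nat n + S x))"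
    proof (rule Oh_cong_ev)
      show "Oh \<mu> (\<lambda>x. S x ^ 2 / n - Lam x)"
        by (intro Oh_diff Oh_divide_const Oh_power[OF S2] Oh_mono[OF Lam4]) (use mu in auto)
      show "eventually (\<lambda>x. S x ^ 2 / n - Lam x = (norm (c x) ^ 2 - (1 - S x / n)) * (of_nat n + S x)) F"
        using mean_square
      proof eventually_elim
        case (elim x)
        have "(norm (c x) ^ 2 - (1 - S x / n)) * (of_nat n + S x)
            = (of_nat n - Lam x) - (1 - S x / n) * (of_nat n + S x)"
          unfolding left_diff_distrib[of "norm (c x) ^ 2"] elim ..
        also have "\<dots> = S x ^ 2 / n - Lam x"
          using n3 by (simp add: field_simps power2_eq_square)
        finally show ?case ..
      qed
    qed
    moreover have "((\<lambda>x. of_nat n + S x) \<longlongrightarrow> of_nat n + 0) F"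
      by (intro tendsto_intros Oh_tendsto_0[OF S2]) auto
    ultimately show ?thesis by (rule Oh_cancel) (use n3 in simp)
  qed
  have "Oh \<mu> (\<lambda>x. (norm (c x) ^ 2 - (1 - S x / n)) * norm (s x) ^ 2
      + (1 - S x / n) * (norm (s x) ^ 2 - norm s0 ^ 2 * (1 + G1 n (Re w) * S x))
      - norm s0 ^ 2 * G1 n (Re w) / n * S x ^ 2)"
    by (intro Oh_add Oh_diff Oh_mult[OF c2 Oh_power[OF Oh_norm[OF sb], where m=0]] Oh_mult[where k=0, OF _ s2]
        Oh_cmult Oh_power[OF S2] Oh_const Oh_divide_const Oh_mono[OF S2]) (use mu in auto)
  then show ?thesis
  proof (rule Oh_cong)
    fix x
    have "norm (c x * s x) ^ 2 - (1 + (G1 n (Re w) - 1 / n) * S x) / (2 * (1 - Re w))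
       = norm (c x) ^ 2 * norm (s x) ^ 2 - norm s0 ^ 2 * (1 + (G1 n (Re w) - 1 / n) * S x)"
      unfolding N0 by (simp add: norm_mult power_mult_distrib)
    also have "\<dots> = (norm (c x) ^ 2 - (1 - S x / n)) * norm (s x) ^ 2
      + (1 - S x / n) * (norm (s x) ^ 2 - norm s0 ^ 2 * (1 + G1 n (Re w) * S x))
      - norm s0 ^ 2 * G1 n (Re w) / n * S x ^ 2"
      by (simp add: algebra_simps power2_eq_square)
    finally show "norm (c x * s x) ^ 2 - (1 + (G1 n (Re w) - 1 / n) * S x) / (2 * (1 - Re w))
       = (norm (c x) ^ 2 - (1 - S x / n)) * norm (s x) ^ 2
      + (1 - S x / n) * (norm (s x) ^ 2 - norm s0 ^ 2 * (1 + G1 n (Re w) * S x))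
      - norm s0 ^ 2 * G1 n (Re w) / n * S x ^ 2" .
  qed
qed

text \<open>At an active root of unity the terms of second order cancel by the hypothesis \<open>active\<close>, and what remains is
  linear in the four unknowns: the excess \<open>d\<close> of \<open>r\<close>, the excess of \<open>S\<close>, the odd part and the fourth moment.
  The reference value \<open>p\<close> only splits the fourth moment between \<open>Zc\<close> and the last term.\<close>

lemma second_order_Phi:
  assumes ur: "unity_root n w" and s: "Oh (\<mu> + 2) (\<lambda>x. s x - approx w x)"
    and d: "Oh 4 d" and S': "Oh 4 (\<lambda>x. S x - S1 * h x ^ 2)"
    and active: "c1 + 1 + S1 * etac n (Re w) = 1 / (1 - Re w)"
  shows "Oh (\<mu> + 2) (\<lambda>x. Phi (1 - h x ^ 2) (1 + c1 * h x ^ 2 + d x) (c x * s x)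
     - (d x + (S x - S1 * h x ^ 2) * etac n (Re w) + Lam x / (2 * n) + 2 * odd_part w x
        + h x ^ 4 * Zc n (Re w) c1 S1 p + Wc n (Re w) * (p4 x - p * h x ^ 4)))"
proof -
  interpret unity_root n w by fact
  define u where "u = Re w"
  define \<eta> where "\<eta> = etac n u"
  define N where "N x = norm (c x * s x) ^ 2" for x
  define N0 where "N0 = 1 / (2 * (1 - u))"
  define G where "G = (G1 n u - 1 / n) * S1"
  define y where "y x = Re (c x * s x) + 1 / 2" for x
  define sec where "sec x = second n u (S x) (p4 x)" for x
  define y1 where "y1 x = S x * \<eta> / 2 + Lam x / (4 * n) + odd_part w x + sec x" for x
  define e where "e x = h x ^ 2" for x
  define r where "r x = 1 + c1 * e x + d x" for x
  have e2: "Oh 2 e" unfolding e_def by (rule Oh_h2)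
  have m: "\<mu> + 2 \<le> 6" "\<mu> \<le> 4" using mu by auto
  have m4_4: "Oh 4 (\<lambda>x. p4 x - S x ^ 2 / n)" by (intro Oh_diff p4_4 Oh_divide_const Oh_power[OF S2]) auto
  have sec4: "Oh 4 sec" unfolding sec_def second_def
    by (intro Oh_add Oh_diff Oh_divide_const Oh_cmult Oh_cmult_right m4_4 Oh_power[OF S2] p4_4) auto
  have yy: "Oh (\<mu> + 2) (\<lambda>x. y x - y1 x)"
    using second_order_Re[OF ur s] by (rule Oh_cong) (simp add: y_def y1_def \<eta>_def u_def sec_def)
  have y0: "Oh \<mu> (\<lambda>x. y x - S1 * \<eta> / 2 * e x)"
  proof -
    have "Oh \<mu> (\<lambda>x. (y x - y1 x) + \<eta> / 2 * (S x - S1 * h x ^ 2) + Lam x / (4 * n) + odd_part w x + sec x)"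
      by (intro Oh_add Oh_mono[OF yy] Oh_cmult Oh_mono[OF S' m(2)] Oh_divide_const Oh_mono[OF Lam4 m(2)]
          odd_mu Oh_mono[OF sec4 m(2)]) auto
    then show ?thesis by (rule Oh_cong) (simp add: y1_def e_def algebra_simps)
  qed
  have y2: "Oh 2 y"
  proof -
    have "Oh 2 (\<lambda>x. (y x - S1 * \<eta> / 2 * e x) + S1 * \<eta> / 2 * e x)"
      by (intro Oh_add Oh_mono[OF y0] Oh_cmult e2) (use mu in auto)
    then show ?thesis by (rule Oh_cong) simp
  qed
  have N1: "Oh \<mu> (\<lambda>x. N x - N0 * (1 + G * e x))"
  proof -
    have "Oh \<mu> (\<lambda>x. (norm (c x * s x) ^ 2 - (1 + (G1 n (Re w) - 1 / n) * S x) / (2 * (1 - Re w)))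
        + N0 * (G1 n u - 1 / n) * (S x - S1 * h x ^ 2))"
      by (intro Oh_add norm_cs_second[OF ur s] Oh_cmult Oh_mono[OF S' m(2)])
    then show ?thesis
      by (rule Oh_cong)
        (simp add: N_def N0_def G_def e_def u_def algebra_simps add_divide_distrib diff_divide_distrib)
  qed
  have N2: "Oh 2 (\<lambda>x. N x - N0)"
  proof -
    have "Oh 2 (\<lambda>x. (N x - N0 * (1 + G * e x)) + N0 * G * e x)"
      by (intro Oh_add Oh_mono[OF N1] Oh_cmult e2) (use mu in auto)
    then show ?thesis by (rule Oh_cong) (simp add: algebra_simps)
  qed
  have S6: "Oh 6 (\<lambda>x. S x ^ 2 - S1 ^ 2 * e x ^ 2)"
  proof -
    have "Oh 6 (\<lambda>x. (S x - S1 * h x ^ 2) * (S x + S1 * e x))"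
      by (intro Oh_mult[OF S' Oh_add[OF S2 Oh_cmult[OF e2]]]) auto
    then show ?thesis by (rule Oh_cong) (simp add: e_def algebra_simps power2_eq_square)
  qed
  define s2 where "s2 = - 3 / (16 * real n ^ 2) - B2 n u / (4 * real n)
     - (B3 n u / 2 - B2 n u / 4) / n + B4 n u / 8 + K2 n u / 4"
  have secs: "second n u T q = s2 * T ^ 2 + Wc n u / 2 * q" for T q
    unfolding second_def s2_def Wc_def divide_inverse by (simp add: algebra_simps)
  \<comment> \<open>Products that are of order \<open>\<mu> + 2\<close> once \<open>y\<close>, \<open>N\<close> and \<open>S\<close> are replaced by their leading terms.\<close>
  have T1: "Oh (\<mu> + 2) (\<lambda>x. d x * (c1 * e x))"
    by (rule Oh_mult[OF d Oh_cmult[OF e2]]) (use mu in auto)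
  have T2: "Oh (\<mu> + 2) (\<lambda>x. d x * ((c1 + 1) * e x))"
    by (rule Oh_mult[OF d Oh_cmult[OF e2]]) (use mu in auto)
  have T3: "Oh (\<mu> + 2) (\<lambda>x. d x ^ 2)"
    by (rule Oh_power[OF d]) (use mu in auto)
  have T4: "Oh (\<mu> + 2) (\<lambda>x. e x * (y x - S1 * \<eta> / 2 * e x))"
    by (rule Oh_mult[OF e2 y0]) auto
  have T5: "Oh (\<mu> + 2) (\<lambda>x. (d x - c1 * e x ^ 2 - e x * d x) * y x)"
    by (rule Oh_mult[OF Oh_diff[OF Oh_diff[OF d Oh_cmult[OF Oh_power[OF e2, where m=4]]] Oh_mult[OF e2 d, where m=4]] y2])
      (use mu in auto)
  have T6: "Oh (\<mu> + 2) (\<lambda>x. e x * (N x - N0 * (1 + G * e x)))"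
    by (rule Oh_mult[OF e2 N1]) auto
  have T7: "Oh (\<mu> + 2) (\<lambda>x. e x ^ 2 * (N x - N0))"
    by (rule Oh_mult[OF Oh_power[OF e2, where m=4] N2]) (use mu in auto)
  have "Oh (\<mu> + 2) (\<lambda>x. d x * (c1 * e x) + d x * ((c1 + 1) * e x) + d x ^ 2 + 2 * (y x - y1 x)
      + 2 * (c1 - 1) * (e x * (y x - S1 * \<eta> / 2 * e x)) + 2 * ((d x - c1 * e x ^ 2 - e x * d x) * y x)
      - 2 * (e x * (N x - N0 * (1 + G * e x))) + e x ^ 2 * (N x - N0) + 2 * s2 * (S x ^ 2 - S1 ^ 2 * e x ^ 2))"
    by (intro Oh_add Oh_diff Oh_cmult T1 T2 T3 T4 T5 T6 T7 yy Oh_mono[OF S6 m(1)])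
  then show ?thesis
  proof (rule Oh_cong)
    fix x
    have R: "Re (c x * s x) = y x - 1 / 2" by (simp add: y_def)
    have h4: "h x ^ 4 = e x ^ 2" by (simp add: e_def)
    have nz: "1 - u \<noteq> 0" using u_less by (simp add: u_def)
    have Z: "Zc n u c1 S1 p = c1 * (c1 + 1) + (c1 - 1) * S1 * \<eta> - 2 * N0 * G + N0 + 2 * s2 * S1 ^ 2 + Wc n u * p"
    proof -
      have i: "X / (1 - u) = X * (2 * N0)" for X using nz by (simp add: N0_def field_simps)
      show ?thesis
        unfolding Zc_def \<eta>_def[symmetric] G_def N0_def[symmetric] secs i by (simp add: algebra_simps)
    qed
    have act: "c1 * e x = (2 * N0 - 1 - S1 * \<eta>) * e x"
    proof -
      have "2 * N0 = 1 / (1 - u)" using nz by (simp add: N0_def field_simps)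
      then have "c1 = 2 * N0 - 1 - S1 * \<eta>"
        using active unfolding u_def[symmetric] \<eta>_def[symmetric] by linarith
      then show ?thesis by simp
    qed
    then have a0: "c1 * e x - (2 * N0 - 1 - S1 * \<eta>) * e x = 0" by simp
    have Y1: "2 * y1 x = S x * \<eta> + Lam x / (2 * n) + 2 * odd_part w x + 2 * s2 * S x ^ 2 + Wc n u * p4 x"
      unfolding y1_def sec_def secs by simp
    have P: "Phi (1 - e x) (r x) (c x * s x) = (1 + c1 * e x + d x) ^ 2 - (1 - e x) * (1 + c1 * e x + d x)
        + 2 * (1 - e x) * (1 + c1 * e x + d x) * y x - (2 * e x - e x ^ 2) * N x"
      unfolding Phi_def R N_def[symmetric] r_def by (simp add: algebra_simps power2_eq_square)
    have "Phi (1 - e x) (r x) (c x * s x)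
     - (d x + (S x - S1 * e x) * \<eta> + Lam x / (2 * n) + 2 * odd_part w x
        + e x ^ 2 * Zc n u c1 S1 p + Wc n u * (p4 x - p * e x ^ 2))
      = d x * (c1 * e x) + d x * ((c1 + 1) * e x) + d x ^ 2 + (2 * y x - 2 * y1 x)
      + 2 * (c1 - 1) * (e x * (y x - S1 * \<eta> / 2 * e x)) + 2 * ((d x - c1 * e x ^ 2 - e x * d x) * y x)
      - 2 * (e x * (N x - N0 * (1 + G * e x))) + e x ^ 2 * (N x - N0) + 2 * s2 * (S x ^ 2 - S1 ^ 2 * e x ^ 2)
      + (c1 * e x - (2 * N0 - 1 - S1 * \<eta>) * e x)"
      unfolding P Z Y1 by (simp add: field_simps power2_eq_square)
    then show "Phi (1 - h x ^ 2) (1 + c1 * h x ^ 2 + d x) (c x * s x)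
     - (d x + (S x - S1 * h x ^ 2) * etac n (Re w) + Lam x / (2 * n) + 2 * odd_part w x
        + h x ^ 4 * Zc n (Re w) c1 S1 p + Wc n (Re w) * (p4 x - p * h x ^ 4))
      = d x * (c1 * e x) + d x * ((c1 + 1) * e x) + d x ^ 2 + 2 * (y x - y1 x)
      + 2 * (c1 - 1) * (e x * (y x - S1 * \<eta> / 2 * e x)) + 2 * ((d x - c1 * e x ^ 2 - e x * d x) * y x)
      - 2 * (e x * (N x - N0 * (1 + G * e x))) + e x ^ 2 * (N x - N0) + 2 * s2 * (S x ^ 2 - S1 ^ 2 * e x ^ 2)"
      unfolding h4 e_def[symmetric] r_def[symmetric] u_def[symmetric] \<eta>_def[symmetric]
      by (simp only: a0 add_0_right right_diff_distrib[of 2 "y x" "y1 x"])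
  qed
qed

end

section \<open>From polynomials to normalized reciprocals of critical points\<close>

text \<open>\<open>Hfun\<close> is the primitive of \<open>\<Prod>(1 + v\<^sub>j x)\<close> that vanishes at 0, and \<open>Qfun\<close> is \<open>s\<^sup>n\<^sup>+\<^sup>1 Hfun (1 / s)\<close>,
  a polynomial whose leading coefficient is 1.\<close>

definition Qfun :: "nat \<Rightarrow> (nat \<Rightarrow> complex) \<Rightarrow> complex \<Rightarrow> complex" where
  "Qfun n v s = (\<Sum>k\<le>n. esym v n k / of_nat (Suc k) * s ^ (n - k))"

definition Hfun :: "nat \<Rightarrow> (nat \<Rightarrow> complex) \<Rightarrow> complex \<Rightarrow> complex" where
  "Hfun n v x = (\<Sum>k\<le>n. esym v n k / of_nat (Suc k) * x ^ Suc k)"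

definition admissible :: "nat \<Rightarrow> real \<Rightarrow> real \<Rightarrow> (nat \<Rightarrow> complex) \<Rightarrow> bool" where
  "admissible n b r v \<longleftrightarrow> (\<forall>s. s \<noteq> 0 \<longrightarrow> Qfun n v s = 0 \<longrightarrow> Phi b r s \<le> 0)"

lemma Hfun_0 [simp]: "Hfun n v 0 = 0"
  by (simp add: Hfun_def)

lemma Qfun_Hfun:
  assumes "s \<noteq> 0"
  shows "Qfun n v s = s ^ Suc n * Hfun n v (1 / s)"
proof -
  have "s ^ (n - k) = s ^ Suc n * (1 / s) ^ Suc k" if "k \<le> n" for k
  proof -
    have "s ^ Suc n = s ^ (n - k) * s ^ Suc k" using that by (simp flip: power_add)
    then show ?thesis using assms by (simp add: power_one_over field_simps)
  qed
  then show ?thesis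
    unfolding Qfun_def Hfun_def sum_distrib_left
    by (intro sum.cong refl) (simp add: mult_ac)
qed

lemma Hfun_deriv: "(Hfun n v has_field_derivative (\<Prod>j<n. 1 + v j * x)) (at x)"
proof -
  have "(Hfun n v has_field_derivative (\<Sum>k\<le>n. esym v n k / of_nat (Suc k) * (of_nat (Suc k) * x ^ k))) (at x)"
    unfolding Hfun_def[abs_def]
  proof (intro DERIV_sum DERIV_cmult)
    fix k
    show "((\<lambda>x. x ^ Suc k) has_field_derivative of_nat (Suc k) * x ^ k) (at x)"
    proof -
      have "((\<lambda>x. x ^ Suc k) has_field_derivative of_nat (Suc k) * (1 * x ^ (Suc k - Suc 0))) (at x)"
        by (rule DERIV_power[OF DERIV_ident])
      then show ?thesis by simp
    qed
  qed
  also have "(\<Sum>k\<le>n. esym v n k / of_nat (Suc k) * (of_nat (Suc k) * x ^ k)) = (\<Sum>k\<le>n. esym v n k * x ^ k)"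
    by (intro sum.cong refl) (simp del: of_nat_Suc)
  also have "\<dots> = (\<Prod>j<n. 1 + v j * x)"
    using prod_linear_eq_esym[of 1 v x n] by simp
  finally show ?thesis .
qed

lemma deriv_zero_imp_eq:
  fixes f :: "complex \<Rightarrow> complex"
  assumes "\<And>z. (f has_field_derivative 0) (at z)"
  shows "f x = f y"
proof -
  obtain c where "\<And>z. z \<in> UNIV \<Longrightarrow> f z = c"
    using has_field_derivative_zero_constant[of UNIV f] assms by (auto simp: has_field_derivative_at_within)
  then show ?thesis by simp
qed

lemma Phi_le_0_iff: "Phi b r s \<le> 0 \<longleftrightarrow> norm (of_real b * s + of_real r) \<le> norm s"
proof -
  have "norm (of_real b * s + of_real r) ^ 2 = b^2 * norm s ^ 2 + 2 * b * r * Re s + r^2"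
    unfolding cmod_power2 by (simp add: power2_eq_square algebra_simps)
  moreover have "norm (of_real b * s + of_real r) \<le> norm s
      \<longleftrightarrow> norm (of_real b * s + of_real r) ^ 2 \<le> norm s ^ 2"
    using abs_le_square_iff[of "norm (of_real b * s + of_real r)" "norm s"] by simp
  ultimately show ?thesis by (simp add: Phi_def algebra_simps)
qed

text \<open>The substitution \<open>z = b + r x\<close> turns the derivative into a multiple of \<open>\<Prod>(1 + v\<^sub>j x)\<close> with \<open>v\<^sub>j = r / (b - \<zeta>\<^sub>j)\<close>, hence
  the polynomial, which vanishes at \<open>x = 0\<close>, into a multiple of \<open>Hfun n v\<close>.\<close>

lemma admissible_of_sendov_poly:
  assumes P: "P \<in> sendov_polys (n + 1) b" and r: "crit_dist b P = r" "r > 0" and n: "n \<ge> 1"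
  shows "\<exists>v. (\<forall>j<n. v j \<noteq> 0 \<and> norm (v j) \<le> 1) \<and> admissible n b r v"
proof -
  have deg: "degree (pderiv P) = n" using P by (simp add: sendov_polys_def degree_pderiv)
  obtain \<zeta> where z: "smult (lead_coeff (pderiv P)) (\<Prod>i<n. [:-\<zeta> i, 1:]) = pderiv P"
    using complex_poly_decompose'[of "pderiv P"] unfolding deg by blast
  define l where "l = lead_coeff (pderiv P)"
  have pd: "poly (pderiv P) x = l * (\<Prod>i<n. x - \<zeta> i)" for x
    by (subst z[symmetric]) (simp add: l_def poly_prod)
  define d where "d i = of_real b - \<zeta> i" for i
  have dist: "r \<le> norm (d i)" if "i < n" for i
  proof -
    have "poly (pderiv P) (\<zeta> i) = 0" unfolding pd using that by auto
    then have "infdist (of_real b) {z. poly (pderiv P) z = 0} \<le> dist (of_real b) (\<zeta> i)"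
      by (intro infdist_le) auto
    then show ?thesis using r by (simp add: crit_dist_def d_def dist_norm)
  qed
  define v where "v i = of_real r / d i" for i
  have dn: "d i \<noteq> 0" if "i < n" for i using dist[OF that] r by auto
  have v: "v j \<noteq> 0 \<and> norm (v j) \<le> 1" if "j < n" for j
    using dist[OF that] dn[OF that] r by (auto simp: v_def norm_divide divide_le_eq_1)
  define K where "K = of_real r * l * (\<Prod>i<n. d i)"
  have PH: "poly P (of_real b + of_real r * x) = K * Hfun n v x" for x
  proof -
    have "((\<lambda>x. poly P (of_real b + of_real r * x) - K * Hfun n v x) has_field_derivative 0) (at x)" for x
    proof -
      have "((\<lambda>x. poly P (of_real b + of_real r * x) - K * Hfun n v x) has_field_derivative
          (poly (pderiv P) (of_real b + of_real r * x) * of_real r - K * (\<Prod>j<n. 1 + v j * x))) (at x)"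
        by (rule DERIV_diff[OF DERIV_chain2[OF poly_DERIV] DERIV_cmult[OF Hfun_deriv]])
          (auto intro!: derivative_eq_intros)
      moreover have "poly (pderiv P) (of_real b + of_real r * x) * of_real r = K * (\<Prod>j<n. 1 + v j * x)"
      proof -
        have "(\<Prod>i<n. of_real b + of_real r * x - \<zeta> i) = (\<Prod>i<n. d i * (1 + v i * x))"
          by (intro prod.cong refl) (use dn in \<open>auto simp: v_def field_simps d_def\<close>)
        then show ?thesis unfolding pd K_def by (simp add: prod.distrib)
      qed
      ultimately show ?thesis by simp
    qed
    from deriv_zero_imp_eq[OF this, of x 0] show ?thesis
      using P by (simp add: sendov_polys_def)
  qed
  have "admissible n b r v"
    unfolding admissible_def Phi_le_0_iff
  proof (intro allI impI)
    fix s assume s: "s \<noteq> 0" "Qfun n v s = 0"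
    then have "Hfun n v (1 / s) = 0" using Qfun_Hfun[OF s(1), of n v] by simp
    then have "poly P (of_real b + of_real r * (1 / s)) = 0"
      using PH[of "1 / s"] by simp
    then have "norm (of_real b + of_real r * (1 / s)) \<le> 1"
      using P unfolding sendov_polys_def by blast
    moreover have "of_real b * s + of_real r = (of_real b + of_real r * (1 / s)) * s"
      using s by (simp add: field_simps)
    ultimately show "norm (of_real b * s + of_real r) \<le> norm s"
      by (simp only: norm_mult) (simp add: mult_left_le_one_le)
  qed
  then show ?thesis using v by blast
qed

text \<open>The converse substitution. Since every \<open>v\<^sub>j\<close> has modulus 1, all critical points lie at distance exactly
  \<open>r\<close> from \<open>b\<close>.\<close>

lemma sendov_poly_of_admissible:
  assumes v: "\<And>j. j < n \<Longrightarrow> norm (v j) = 1" and adm: "admissible n b r v"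
    and r: "r > 0" and b: "0 \<le> b" "b \<le> 1" and n: "n \<ge> 1"
  shows "\<exists>P\<in>sendov_polys (n + 1) b. crit_dist b P = r"
proof -
  define H where "H = (\<Sum>k\<le>n. monom (esym v n k / of_nat (Suc k)) (Suc k))"
  define P where "P = H \<circ>\<^sub>p [:- of_real (b / r), of_real (1 / r):]"
  have H: "poly H x = Hfun n v x" for x
    by (simp add: H_def Hfun_def poly_sum poly_monom)
  have v0: "v j \<noteq> 0" if "j < n" for j using v[OF that] by auto
  have "coeff H (Suc n) = esym v n n / of_nat (Suc n)"
  proof -
    have "coeff H (Suc n) = (\<Sum>k\<le>n. if k = n then esym v n n / of_nat (Suc n) else 0)"
      unfolding H_def coeff_sum by (intro sum.cong refl) (auto simp: coeff_monom)
    then show ?thesis by simp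
  qed
  moreover have "esym v n n \<noteq> 0" unfolding esym_top using v0 by simp
  ultimately have "coeff H (Suc n) \<noteq> 0" by (simp del: of_nat_Suc)
  moreover have "degree H \<le> Suc n"
    unfolding H_def by (intro degree_sum_le) (auto intro: order.trans[OF degree_monom_le])
  ultimately have dH: "degree H = Suc n" by (simp add: le_antisym le_degree)
  have Pz: "poly P z = Hfun n v ((z - of_real b) / of_real r)" for z
    using r by (simp add: P_def poly_pcompose H diff_divide_distrib)
  have "degree P = n + 1" unfolding P_def degree_pcompose using r dH by simp
  moreover have "poly P (of_real b) = 0" unfolding Pz by simp
  moreover have "norm z \<le> 1" if "poly P z = 0" for z
  proof (cases "z = of_real b")
    case True
    then show ?thesis using b by simp
  next
    case False
    define s where "s = of_real r / (z - of_real b)"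
    have s: "s \<noteq> 0" using False r by (simp add: s_def)
    have "Hfun n v (1 / s) = 0" using that unfolding Pz s_def by simp
    then have "Phi b r s \<le> 0" using adm s Qfun_Hfun[OF s] unfolding admissible_def by simp
    then have "norm (of_real b * s + of_real r) \<le> norm s" unfolding Phi_le_0_iff .
    moreover have "of_real b * s + of_real r = z * s"
      using False by (simp add: s_def field_simps)
    ultimately show ?thesis using s by (simp add: norm_mult)
  qed
  ultimately have PS: "P \<in> sendov_polys (n + 1) b" by (simp add: sendov_polys_def)
  have der: "poly (pderiv P) z = (\<Prod>j<n. 1 + v j * ((z - of_real b) / of_real r)) / of_real r" for z
  proof -
    have "((\<lambda>z. Hfun n v ((z - of_real b) / of_real r)) has_field_derivative
       (\<Prod>j<n. 1 + v j * ((z - of_real b) / of_real r)) * (1 / of_real r)) (at z)"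
      by (rule DERIV_chain2[OF Hfun_deriv]) (use r in \<open>auto intro!: derivative_eq_intros\<close>)
    then have "(poly P has_field_derivative
       (\<Prod>j<n. 1 + v j * ((z - of_real b) / of_real r)) * (1 / of_real r)) (at z)"
      by (simp only: Pz[symmetric])
    from DERIV_unique[OF poly_DERIV this] show ?thesis by simp
  qed
  define C where "C = {z. poly (pderiv P) z = 0}"
  have far: "dist (of_real b) z = r" if "z \<in> C" for z
  proof -
    have "(\<Prod>j<n. 1 + v j * ((z - of_real b) / of_real r)) = 0"
      using that r unfolding C_def der by simp
    then obtain j where j: "j < n" "1 + v j * ((z - of_real b) / of_real r) = 0"
      by (subst (asm) prod_zero_iff) auto
    then have "v j * ((z - of_real b) / of_real r) = - 1" by (simp add: add_eq_0_iff)
    then have "norm (v j * ((z - of_real b) / of_real r)) = 1" by simp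
    then have "norm (z - of_real b) = r" using v[OF j(1)] r by (simp add: norm_mult norm_divide)
    then show ?thesis by (simp add: dist_norm norm_minus_commute)
  qed
  have "of_real b - of_real r / v 0 \<in> C"
  proof -
    have "1 + v 0 * ((of_real b - of_real r / v 0 - of_real b) / of_real r) = 0"
      using n v0[of 0] r by simp
    then have "(\<Prod>j<n. 1 + v j * ((of_real b - of_real r / v 0 - of_real b) / of_real r)) = 0"
      using n by (subst prod_zero_iff) auto
    then show ?thesis unfolding C_def mem_Collect_eq der by (simp only: div_0)
  qed
  then have ne: "C \<noteq> {}" by blast
  have "infdist (of_real b) C = r"
    unfolding infdist_def using ne far by (simp add: cINF_const cong: INF_cong)
  then show ?thesis using PS unfolding crit_dist_def C_def by blast
qed

section \<open>The sum rule for the roots\<close>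

lemma coeff_prod_linear:
  fixes r :: "nat \<Rightarrow> complex"
  shows "coeff (\<Prod>i<Suc m. [:-r i, 1:]) (Suc m) = 1 \<and> coeff (\<Prod>i<Suc m. [:-r i, 1:]) m = - (\<Sum>i<Suc m. r i)"
proof (induction m)
  case (Suc m)
  define p where "p = (\<Prod>i<Suc m. [:-r i, 1:])"
  have "degree p \<le> Suc m"
    unfolding p_def by (rule order.trans[OF degree_prod_sum_le]) auto
  then have "coeff p (Suc (Suc m)) = 0" by (simp add: coeff_eq_0)
  moreover have "(\<Prod>i<Suc (Suc m). [:-r i, 1:]) = p * [:-r (Suc m), 1:]"
    by (simp add: p_def)
  ultimately show ?case using Suc unfolding p_def[symmetric] by (simp add: mult.commute[of p])
qed simp

text \<open>By Vieta the zeros of \<open>Qfun n v\<close> have the sum \<open>- (\<Sum>v\<^sub>j) / 2\<close>, so adding up the inequalities \<open>Phi \<le> 0\<close>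
  bounds \<open>r\<close> and the distance of the \<open>v\<^sub>j\<close> from 1. It suffices that the zeros are bounded, by \<open>2\<^sup>n\<close>.\<close>

lemma sum_rule:
  assumes v: "\<And>j. j < n \<Longrightarrow> v j \<noteq> 0 \<and> norm (v j) \<le> 1" and adm: "admissible n b r v"
    and b: "0 \<le> b" "b \<le> 1" and n: "n \<ge> 1"
  shows "real n * r^2 - b * r * Re (\<Sum>j<n. v j) \<le> (1 - b^2) * (real n * 4 ^ n)"
proof -
  define Q where "Q = (\<Sum>k\<le>n. monom (esym v n k / of_nat (Suc k)) (n - k))"
  have Qp: "poly Q s = Qfun n v s" for s
    by (simp add: Q_def Qfun_def poly_sum poly_monom)
  have cf: "coeff Q (n - k) = esym v n k / of_nat (Suc k)" if "k \<le> n" for k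
  proof -
    have "coeff Q (n - k) = (\<Sum>i\<le>n. if i = k then esym v n k / of_nat (Suc k) else 0)"
      unfolding Q_def coeff_sum using that by (intro sum.cong refl) (auto simp: coeff_monom)
    then show ?thesis using that by simp
  qed
  have "degree Q \<le> n" unfolding Q_def
    by (intro degree_sum_le) (auto intro: order.trans[OF degree_monom_le])
  moreover have "coeff Q n = 1" using cf[of 0] by simp
  ultimately have dQ: "degree Q = n" by (metis le_antisym le_degree zero_neq_one)
  obtain s where s: "smult (lead_coeff Q) (\<Prod>i<n. [:-s i, 1:]) = Q"
    using complex_poly_decompose'[of Q] unfolding dQ by blast
  then have s: "Q = (\<Prod>i<n. [:-s i, 1:])" using \<open>coeff Q n = 1\<close> dQ by simp
  obtain m where m: "n = Suc m" using n by (cases n) auto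
  have sums: "(\<Sum>i<n. s i) = - (\<Sum>j<n. v j) / 2"
  proof -
    have "coeff Q m = - (\<Sum>i<n. s i)" using coeff_prod_linear[where r=s and m=m] unfolding s m by simp
    moreover have "coeff Q m = (\<Sum>j<n. v j) / 2"
      using cf[of 1] n by (simp add: m esym_1[unfolded m])
    ultimately show ?thesis by (simp add: minus_equation_iff)
  qed
  have root: "Qfun n v (s i) = 0" if "i < n" for i
    using that unfolding Qp[symmetric] s by (auto simp: poly_prod)
  have sne: "s i \<noteq> 0" if "i < n" for i
  proof
    assume "s i = 0"
    then have "Qfun n v 0 = 0" using root[OF that] by simp
    moreover have "Qfun n v 0 = coeff Q 0" using Qp by (simp add: poly_0_coeff_0[symmetric])
    ultimately have "esym v n n = 0" using cf[of n] by (simp del: of_nat_Suc)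
    then show False using v unfolding esym_top by auto
  qed
  have bound: "norm (s i) \<le> 2 ^ n" if "i < n" for i
  proof (rule ccontr)
    assume "\<not> ?thesis"
    then have big: "norm (s i) > 2 ^ n" by simp
    then have big1: "norm (s i) \<ge> 1" using one_le_power[of "2::real" n] by linarith
    define z where "z = s i"
    have "Qfun n v z = z ^ n + (\<Sum>k<n. esym v n (Suc k) / of_nat (Suc (Suc k)) * z ^ (n - Suc k))"
      unfolding Qfun_def by (subst sum.atMost_shift) simp
    then have "z ^ n = - (\<Sum>k<n. esym v n (Suc k) / of_nat (Suc (Suc k)) * z ^ (n - Suc k))"
      using root[OF that] unfolding z_def[symmetric] by (simp add: eq_neg_iff_add_eq_0)
    then have "norm z ^ n = norm (\<Sum>k<n. esym v n (Suc k) / of_nat (Suc (Suc k)) * z ^ (n - Suc k))"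
      by (metis norm_minus_cancel norm_power)
    also have "\<dots> \<le> (\<Sum>k<n. norm (esym v n (Suc k) / of_nat (Suc (Suc k)) * z ^ (n - Suc k)))"
      by (rule norm_sum)
    also have "\<dots> \<le> (\<Sum>k<n. esym (\<lambda>j. norm (v j)) n (Suc k) * norm z ^ (n - 1))"
    proof (intro sum_mono)
      fix k assume "k \<in> {..<n}"
      have "norm (esym v n (Suc k) / of_nat (Suc (Suc k))) \<le> norm (esym v n (Suc k)) / 1"
        unfolding norm_divide norm_of_nat by (intro divide_left_mono) auto
      also have "\<dots> \<le> esym (\<lambda>j. norm (v j)) n (Suc k)" using norm_esym_le by simp
      finally have "norm (esym v n (Suc k) / of_nat (Suc (Suc k))) \<le> esym (\<lambda>j. norm (v j)) n (Suc k)" .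
      moreover have "norm z ^ (n - Suc k) \<le> norm z ^ (n - 1)"
        using big1 unfolding z_def by (intro power_increasing) auto
      ultimately show "norm (esym v n (Suc k) / of_nat (Suc (Suc k)) * z ^ (n - Suc k))
          \<le> esym (\<lambda>j. norm (v j)) n (Suc k) * norm z ^ (n - 1)"
        unfolding norm_mult norm_power by (intro mult_mono) (auto intro: order.trans[OF norm_ge_zero norm_esym_le])
    qed
    also have "\<dots> = (\<Sum>k<n. esym (\<lambda>j. norm (v j)) n (Suc k)) * norm z ^ (n - 1)"
      by (simp add: sum_distrib_right)
    also have "\<dots> \<le> 2 ^ n * norm z ^ (n - 1)"
    proof (intro mult_right_mono)
      have "(\<Sum>k<n. esym (\<lambda>j. norm (v j)) n (Suc k)) \<le> (\<Sum>k\<le>n. esym (\<lambda>j. norm (v j)) n k)"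
        by (subst sum.atMost_shift) simp
      also have "\<dots> = (\<Prod>j<n. 1 + norm (v j))"
        using prod_linear_eq_esym[of 1 "\<lambda>j. norm (v j)" 1 n] by simp
      also have "\<dots> \<le> (\<Prod>j<n. 2)" using v by (intro prod_mono) auto
      finally show "(\<Sum>k<n. esym (\<lambda>j. norm (v j)) n (Suc k)) \<le> 2 ^ n" by simp
    qed simp
    finally have "norm z * norm z ^ (n - 1) \<le> 2 ^ n * norm z ^ (n - 1)" unfolding m by simp
    moreover have "0 < norm z ^ (n - 1)" using big1 unfolding z_def by (intro zero_less_power) linarith
    ultimately have "norm z \<le> 2 ^ n" by (rule mult_right_le_imp_le)
    then show False using big unfolding z_def by simp
  qed
  have each: "r^2 + 2 * b * r * Re (s i) \<le> (1 - b^2) * 4 ^ n" if "i < n" for i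
  proof -
    have "Phi b r (s i) \<le> 0" using adm root[OF that] sne[OF that] unfolding admissible_def by blast
    then have "r^2 + 2 * b * r * Re (s i) \<le> (1 - b^2) * norm (s i) ^ 2" by (simp add: Phi_def)
    also have "\<dots> \<le> (1 - b^2) * (2 ^ n) ^ 2"
      using b bound[OF that] by (intro mult_left_mono power_mono) (auto simp: power_le_one)
    also have "(2 ^ n) ^ 2 = (4 ^ n :: real)" by (simp add: power_mult_distrib[symmetric] power2_eq_square)
    finally show ?thesis .
  qed
  have "(\<Sum>i<n. r^2 + 2 * b * r * Re (s i)) \<le> (\<Sum>i<n. (1 - b^2) * 4 ^ n)"
    by (intro sum_mono each) auto
  moreover have "(\<Sum>i<n. r^2 + 2 * b * r * Re (s i)) = real n * r^2 + 2 * b * r * Re (\<Sum>i<n. s i)"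
    by (simp add: sum.distrib sum_distrib_left)
  moreover have "2 * b * r * Re (\<Sum>i<n. s i) = - (b * r * Re (\<Sum>j<n. v j))"
    unfolding sums by (simp del: Re_sum)
  ultimately show ?thesis by (simp add: mult_ac)
qed

section \<open>The centred coordinates\<close>

text \<open>\<open>1 + (1 + \<xi>\<^sub>j) (q - 1) = q + \<xi>\<^sub>j (q - 1)\<close>, so the product expands in powers of \<open>q - 1\<close> and \<open>q\<close>.\<close>

lemma Hfun_centred:
  assumes "esym \<xi> n (Suc 0) = 0" "n \<ge> 1"
  shows "Hfun n (\<lambda>j. 1 + \<xi> j) (q - 1) = Jprim n 0 q + (\<Sum>k=2..n. esym \<xi> n k * Jprim n k q)"
proof -
  define f where "f q = Hfun n (\<lambda>j. 1 + \<xi> j) (q - 1) - (\<Sum>k\<le>n. esym \<xi> n k * Jprim n k q)" for q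
  have "(f has_field_derivative 0) (at q)" for q
  proof -
    have J: "((\<lambda>q. \<Sum>k\<le>n. esym \<xi> n k * Jprim n k q) has_field_derivative
        (\<Sum>k\<le>n. esym \<xi> n k * ((q - 1) ^ k * q ^ (n - k)))) (at q)"
    proof (intro DERIV_sum DERIV_cmult)
      fix k assume "k \<in> {..n}"
      then show "(Jprim n k has_field_derivative (q - 1) ^ k * q ^ (n - k)) (at q)"
        using poly_DERIV[of "Jpoly n k" q] by (simp add: poly_Jpoly[abs_def] poly_pderiv_Jpoly)
    qed
    have H: "((\<lambda>q. Hfun n (\<lambda>j. 1 + \<xi> j) (q - 1)) has_field_derivative (\<Prod>j<n. 1 + (1 + \<xi> j) * (q - 1)) * 1) (at q)"
      by (rule DERIV_chain2[OF Hfun_deriv]) (auto intro!: derivative_eq_intros)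
    have "(\<Prod>j<n. 1 + (1 + \<xi> j) * (q - 1)) = (\<Prod>j<n. q + \<xi> j * (q - 1))"
      by (intro prod.cong refl) (simp add: algebra_simps)
    also have "\<dots> = (\<Sum>k\<le>n. esym \<xi> n k * ((q - 1) ^ k * q ^ (n - k)))"
      unfolding prod_linear_eq_esym by (simp add: mult_ac)
    finally show ?thesis using DERIV_diff[OF H J] unfolding f_def[abs_def] by simp
  qed
  then have "f q = f 1" by (rule deriv_zero_imp_eq)
  then have "Hfun n (\<lambda>j. 1 + \<xi> j) (q - 1) = (\<Sum>k\<le>n. esym \<xi> n k * Jprim n k q)"
    by (simp add: f_def)
  also have "{..n} = {0, 1} \<union> {2..n}" using assms(2) by auto
  also have "(\<Sum>k\<in>{0, 1} \<union> {2..n}. esym \<xi> n k * Jprim n k q) = Jprim n 0 q + (\<Sum>k=2..n. esym \<xi> n k * Jprim n k q)"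
    by (subst sum.union_disjoint) (use assms in auto)
  finally show ?thesis .
qed

lemma Qfun_scale: "Qfun n (\<lambda>j. c * v j) (c * s) = c ^ n * Qfun n v s"
  unfolding Qfun_def esym_scale sum_distrib_left
proof (intro sum.cong refl)
  fix k assume "k \<in> {..n}"
  then have "c ^ n = c ^ k * c ^ (n - k)" by (simp flip: power_add)
  then show "c ^ k * esym v n k / of_nat (Suc k) * (c * s) ^ (n - k) = c ^ n * (esym v n k / of_nat (Suc k) * s ^ (n - k))"
    by (simp add: power_mult_distrib mult_ac)
qed

lemma Qfun_cong: "(\<And>j. j < n \<Longrightarrow> v j = w j) \<Longrightarrow> Qfun n v s = Qfun n w s"
  unfolding Qfun_def using esym_cong[of n v w] by simp

lemma Qfun_centred:
  assumes "esym \<xi> n (Suc 0) = 0" "n \<ge> 1" "q \<noteq> 1" "\<And>j. j < n \<Longrightarrow> v j = c * (1 + \<xi> j)"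
  shows "Qfun n v (c * (1 / (q - 1))) =
    c ^ n * (1 / (q - 1)) ^ Suc n * (Jprim n 0 q + (\<Sum>k=2..n. esym \<xi> n k * Jprim n k q))"
proof -
  have "Qfun n v (c * (1 / (q - 1))) = Qfun n (\<lambda>j. c * (1 + \<xi> j)) (c * (1 / (q - 1)))"
    by (rule Qfun_cong) (use assms(4) in auto)
  also have "\<dots> = c ^ n * Qfun n (\<lambda>j. 1 + \<xi> j) (1 / (q - 1))" by (rule Qfun_scale)
  also have "Qfun n (\<lambda>j. 1 + \<xi> j) (1 / (q - 1)) = (1 / (q - 1)) ^ Suc n * Hfun n (\<lambda>j. 1 + \<xi> j) (q - 1)"
    using assms(3) by (subst Qfun_Hfun) auto
  finally show ?thesis unfolding Hfun_centred[OF assms(1,2)] by (simp add: mult_ac)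
qed

section \<open>The two active roots of unity\<close>

lemma cos_ge_1_minus_sq: "1 - x^2 / 2 \<le> cos x" for x :: real
proof -
  have "sin (x / 2) ^ 2 \<le> (x / 2) ^ 2"
    using abs_sin_x_le_abs_x[of "x / 2"] by (simp only: abs_le_square_iff)
  then show ?thesis using cos_double_sin[of "x / 2"] by (simp add: power2_eq_square)
qed

lemma half_le_sin:
  assumes "0 \<le> x" "x \<le> (1 :: real)"
  shows "x / 2 \<le> sin x"
proof -
  have "\<exists>y. DERIV (\<lambda>x. sin x - x / 2) z :> y \<and> 0 \<le> y" if "0 \<le> z" "z \<le> x" for z
  proof (intro exI conjI)
    show "DERIV (\<lambda>x. sin x - x / 2) z :> cos z - 1 / 2" by (auto intro!: derivative_eq_intros)
    have "z^2 \<le> 1" using that assms by (simp add: power_le_one)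
    then show "0 \<le> cos z - 1 / 2" using cos_ge_1_minus_sq[of z] by simp
  qed
  then have "sin 0 - 0 / 2 \<le> sin x - x / 2" by (rule DERIV_nonneg_imp_nondecreasing[OF assms(1)])
  then show ?thesis by simp
qed

text \<open>The two consecutive roots of unity whose real parts enclose the zero \<open>m0\<close> of \<open>\<eta>\<close>, that is,
  \<open>u2 < m0 < u1\<close>. The weights \<open>l1\<close> and \<open>l2\<close> represent \<open>m0\<close> as a convex combination, and \<open>S1\<close> and \<open>c1\<close>
  determine the slope and the position of the secant line over \<open>u1\<close> and \<open>u2\<close>.\<close>

locale active_pair =
  fixes n :: nat and k :: nat
  assumes n3: "3 \<le> n" and k_def: "k = (n + 1) div 3"
begin

definition \<theta> :: "nat \<Rightarrow> real" where "\<theta> j = 2 * pi * real j / (real n + 1)"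
definition "w1 = cis (\<theta> k)"
definition "w2 = cis (\<theta> (k + 1))"
definition "u1 = cos (\<theta> k)"
definition "u2 = cos (\<theta> (k + 1))"
definition "m0 = - (real n + 1) / (2 * real n)"
definition "l1 = (m0 - u2) / (u1 - u2)"
definition "l2 = (u1 - m0) / (u1 - u2)"
definition "S1 = (real n - 1) / ((1 - u1) * (1 - u2))"
definition "D1 = (- 2 * u1 * u2 - 1) / (2 * (1 - u1) * (1 - u2))"
definition "D2 = (- 1) / (2 * (1 - u1) * (1 - u2))"
definition "c1 = D1 + D2 / real n"

lemma Re_w [simp]: "Re w1 = u1" "Re w2 = u2"
  by (simp_all add: w1_def w2_def u1_def u2_def)

lemma k_bounds: "1 \<le> k" "3 * k \<le> n + 1" "n + 1 \<le> 3 * k + 2" "2 * (k + 1) \<le> n + 1"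
proof -
  show "1 \<le> k" and k3: "3 * k \<le> n + 1" and "n + 1 \<le> 3 * k + 2" using n3 unfolding k_def by linarith+
  show "2 * (k + 1) \<le> n + 1"
  proof (cases "n \<le> 6")
    case True
    then have "n = 3 \<or> n = 4 \<or> n = 5 \<or> n = 6" using n3 by auto
    then show ?thesis unfolding k_def by auto
  next
    case False
    then show ?thesis using k3 by presburger
  qed
qed

lemma cis_unity: "cis (\<theta> j) ^ (n + 1) = 1"
proof -
  have "real (n + 1) * \<theta> j = 2 * pi * real j" unfolding \<theta>_def using n3 by (simp add: field_simps)
  then show ?thesis unfolding Complex.DeMoivre by (simp add: cis_multiple_2pi)
qed

lemma \<theta>_less: "i < j \<Longrightarrow> \<theta> i < \<theta> j"
  unfolding \<theta>_def by (intro divide_strict_right_mono mult_strict_left_mono) auto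

lemma \<theta>_0: "0 \<le> \<theta> j"
  unfolding \<theta>_def by simp

lemma \<theta>_le_pi: "2 * j \<le> n + 1 \<Longrightarrow> \<theta> j \<le> pi"
proof -
  assume "2 * j \<le> n + 1"
  then have "pi * (2 * real j) \<le> pi * (real n + 1)" by (intro mult_left_mono) (linarith | simp)+
  then show ?thesis unfolding \<theta>_def by (simp add: field_simps)
qed

lemma \<theta>_less_pi: "2 * j < n + 1 \<Longrightarrow> \<theta> j < pi"
proof -
  assume "2 * j < n + 1"
  then have "pi * (2 * real j) < pi * (real n + 1)" by (intro mult_strict_left_mono) (linarith | simp)+
  then show ?thesis unfolding \<theta>_def by (simp add: field_simps)
qed

lemma cos_less_1: "0 < j \<Longrightarrow> 2 * j \<le> n + 1 \<Longrightarrow> cos (\<theta> j) < 1"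
  using cos_monotone_0_pi[of 0 "\<theta> j"] \<theta>_less[of 0 j] \<theta>_le_pi[of j] by (simp add: \<theta>_def)

lemma unity: "unity_root n w1" "unity_root n w2"
proof -
  have "Re w1 < 1" "Re w2 < 1" using cos_less_1[of k] cos_less_1[of "k + 1"] k_bounds by (auto simp: u1_def u2_def)
  then have "w1 \<noteq> 1" "w2 \<noteq> 1" by (auto simp del: Re_w)
  then show "unity_root n w1" "unity_root n w2"
    using n3 cis_unity by (auto simp: unity_root_def w1_def w2_def)
qed

lemma u_less_1: "u1 < 1" "u2 < 1"
  using unity_root.u_less[OF unity(1)] unity_root.u_less[OF unity(2)] by simp_all

lemma u2_less_u1: "u2 < u1"
  unfolding u1_def u2_def using k_bounds
  by (intro cos_monotone_0_pi \<theta>_0 \<theta>_less \<theta>_le_pi) auto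

lemma u1_ge: "- 1 / 2 \<le> u1"
proof -
  have "pi * (3 * real k) \<le> pi * (real n + 1)" using k_bounds by (intro mult_left_mono) (linarith | simp)+
  then have "\<theta> k \<le> 2 * pi / 3" unfolding \<theta>_def by (simp add: field_simps)
  then have "cos (2 * pi / 3) \<le> u1" unfolding u1_def
    by (intro cos_monotone_0_pi_le \<theta>_0) auto
  then show ?thesis by (simp add: cos_120)
qed

lemma u1_le: "u1 \<le> 1 / 2"
proof -
  have "pi * (real n + 1) \<le> pi * (6 * real k)" using k_bounds n3 by (intro mult_left_mono) (linarith | simp)+
  then have "pi / 3 \<le> \<theta> k" unfolding \<theta>_def by (simp add: field_simps)
  then have "u1 \<le> cos (pi / 3)" unfolding u1_def using k_bounds
    by (intro cos_monotone_0_pi_le \<theta>_le_pi) auto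
  then show ?thesis by (simp add: cos_60)
qed

lemma u2_ge: "- 1 \<le> u2" unfolding u2_def by simp

text \<open>The zero \<open>m0 = - 1 / 2 - 1 / (2 n)\<close> lies only slightly below \<open>- 1 / 2 = cos (2 \<pi> / 3)\<close>, while the angle of \<open>w2\<close> exceeds
  \<open>2 \<pi> / 3\<close> by at least \<open>x = 2 \<pi> / (3 (n + 1))\<close>, and elementary bounds for sine and cosine suffice.\<close>

lemma u2_less: "u2 < m0"
proof (cases "n = 3")
  case True
  then have "k = 1" unfolding k_def by simp
  then have "u2 = cos pi" unfolding u2_def \<theta>_def using True by simp
  then show ?thesis unfolding m0_def using True by simp
next
  case False
  then have n4: "4 \<le> n" using n3 by simp
  define x where "x = 2 * pi / (3 * (real n + 1))"
  have x: "0 < x" "x \<le> 1 / 2"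
  proof -
    show "0 < x" unfolding x_def by simp
    have "2 * pi * 2 \<le> 3 * 5" using pi_less_4 pi_approx(2) by simp
    also have "\<dots> \<le> 3 * (real n + 1)" using n4 by simp
    finally show "x \<le> 1 / 2" unfolding x_def by (simp add: field_simps)
  qed
  have "2 * pi / 3 + x = 2 * pi * ((real n + 2) / 3) / (real n + 1)"
    unfolding x_def by (simp add: field_simps)
  also have "\<dots> \<le> \<theta> (k + 1)"
  proof -
    have "n + 2 \<le> 3 * (k + 1)" using k_bounds(3) by simp
    then have "real (n + 2) \<le> real (3 * (k + 1))" by (simp only: of_nat_le_iff)
    then have "(real n + 2) / 3 \<le> real (k + 1)" by simp
    then show ?thesis unfolding \<theta>_def by (intro divide_right_mono mult_left_mono) auto
  qed
  finally have "u2 \<le> cos (2 * pi / 3 + x)" unfolding u2_def using k_bounds x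
    by (intro cos_monotone_0_pi_le \<theta>_le_pi) auto
  also have "cos (2 * pi / 3 + x) = - (cos x) / 2 - sqrt 3 / 2 * sin x"
    by (simp add: cos_add cos_120 sin_120)
  also have "\<dots> < m0"
  proof -
    have c: "1 - x^2 / 2 \<le> cos x" by (rule cos_ge_1_minus_sq)
    have s: "x / 2 \<le> sin x"
      using x by (intro half_le_sin) auto
    have "17 / 10 \<le> sqrt 3" by (rule real_le_rsqrt) (simp add: power2_eq_square)
    then have "17 / 10 * (x / 2) \<le> sqrt 3 * sin x"
      using s x by (intro mult_mono) auto
    then have 1: "(cos x) / 2 + sqrt 3 / 2 * sin x \<ge> 1 / 2 - x^2 / 4 + 17 / 40 * x" using c by simp
    have 2: "x * (real n + 1) = 2 * pi / 3" unfolding x_def by (simp add: field_simps)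
    have "2 \<le> x * (real n + 1)" "x * (real n + 1) \<le> 22 / 10" unfolding 2 using pi_approx by simp_all
    then have X: "x \<ge> 2 / (real n + 1)" "x \<le> (22 / 10) / (real n + 1)" by (simp_all add: field_simps)
    have "x * x \<le> x * (22 / 50)"
    proof -
      have "(22 / 10) / (real n + 1) \<le> 22 / 50" using n4 by (simp add: field_simps)
      then show ?thesis using X(2) x by (intro mult_left_mono) auto
    qed
    then have "x^2 / 4 \<le> x * (11 / 100)" by (simp add: power2_eq_square)
    then have "17 / 40 * x - x^2 / 4 \<ge> (63 / 200) * x" by simp
    then have "17 / 40 * x - x^2 / 4 \<ge> (63 / 200) * (2 / (real n + 1))" using X(1) by linarith
    moreover have "(63 / 100) / (real n + 1) > 1 / (2 * real n)" using n4 by (simp add: field_simps)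
    ultimately have "17 / 40 * x - x^2 / 4 > 1 / (2 * real n)" by simp
    moreover have "m0 = - 1 / 2 - 1 / (2 * real n)" unfolding m0_def using n3 by (simp add: field_simps)
    ultimately show ?thesis using 1 by simp
  qed
  finally show ?thesis .
qed

lemma m0_less: "m0 < u1"
proof -
  have "m0 < - 1 / 2" unfolding m0_def using n3 by (simp add: field_simps)
  then show ?thesis using u1_ge by simp
qed

lemma l_pos: "0 < l1" "0 < l2"
  unfolding l1_def l2_def using u2_less_u1 u2_less m0_less by auto

lemma l_sum: "l1 + l2 = 1" and l_mean: "l1 * u1 + l2 * u2 = m0"
proof -
  have d: "u1 - u2 \<noteq> 0" using u2_less_u1 by simp
  have "l1 + l2 = (u1 - u2) / (u1 - u2)"
    unfolding l1_def l2_def add_divide_distrib[symmetric] by simp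
  then show "l1 + l2 = 1" using d by simp
  have "l1 * u1 + l2 * u2 = m0 * (u1 - u2) / (u1 - u2)"
    unfolding l1_def l2_def times_divide_eq_left add_divide_distrib[symmetric] by (simp add: algebra_simps)
  then show "l1 * u1 + l2 * u2 = m0" using d by simp
qed

lemma Im_w1: "Im w1 \<noteq> 0"
proof -
  have "u1^2 < 1" using u1_ge u1_le by (auto simp: abs_square_less_1)
  then show ?thesis using unity_root.uv[OF unity(1)] by auto
qed

lemma Im_w2: "n \<noteq> 3 \<Longrightarrow> n \<noteq> 5 \<Longrightarrow> Im w2 \<noteq> 0"
proof -
  assume n: "n \<noteq> 3" "n \<noteq> 5"
  have "2 * (k + 1) < n + 1"
  proof (cases "n \<le> 6")
    case True
    then have "n = 4 \<or> n = 6" using n3 n by auto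
    then show ?thesis unfolding k_def by auto
  next
    case False
    then show ?thesis using k_bounds(2) by presburger
  qed
  then have "0 < sin (\<theta> (k + 1))"
    using \<theta>_less[of 0 "k + 1"] by (intro sin_gt_zero \<theta>_less_pi) (auto simp: \<theta>_def[of 0])
  then show ?thesis by (simp add: w2_def)
qed

lemma unity_root_angle:
  assumes "unity_root n w"
  obtains j where "2 * j \<le> n + 1" "w = cis (\<theta> j) \<or> w = cnj (cis (\<theta> j))"
proof -
  have "w \<in> {z. z ^ (n + 1) = 1}" using assms by (simp add: unity_root_def)
  then obtain i where i: "i < n + 1" "w = cis (2 * pi * real i / real (n + 1))"
  proof -
    have "(\<lambda>i. cis (2 * pi * real i / real (n + 1))) ` {..<n + 1} = {z. z ^ (n + 1) = 1}"
      using Complex.bij_betw_roots_unity[of "n + 1"] n3 unfolding bij_betw_def by simp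
    then have "w \<in> (\<lambda>i. cis (2 * pi * real i / real (n + 1))) ` {..<n + 1}"
      using \<open>w \<in> {z. z ^ (n + 1) = 1}\<close> by (simp only:)
    then show thesis using that by blast
  qed
  have w: "w = cis (\<theta> i)" unfolding i(2) \<theta>_def by (simp add: add.commute)
  show thesis
  proof (cases "2 * i \<le> n + 1")
    case True
    then show ?thesis using that w by blast
  next
    case False
    have "\<theta> (n + 1 - i) = 2 * pi - \<theta> i"
      unfolding \<theta>_def using i(1) by (simp add: of_nat_diff field_simps)
    then have "cnj (cis (\<theta> (n + 1 - i))) = w"
      unfolding w by (simp add: cis_cnj complex_eq_iff cos_diff sin_diff)
    then show ?thesis using that[of "n + 1 - i"] False by auto
  qed
qed

lemma no_root_between:
  assumes "unity_root n w" "w \<notin> {w1, cnj w1, w2, cnj w2}"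
  shows "0 < (Re w - u1) * (Re w - u2)"
proof -
  obtain j where j: "2 * j \<le> n + 1" "w = cis (\<theta> j) \<or> w = cnj (cis (\<theta> j))"
    using unity_root_angle[OF assms(1)] .
  have u: "Re w = cos (\<theta> j)" using j(2) by auto
  have "j \<noteq> k" "j \<noteq> k + 1" using j(2) assms(2) by (auto simp: w1_def w2_def)
  then consider "j < k" | "k + 1 < j" by linarith
  then show ?thesis
  proof cases
    case 1
    then have "u1 < Re w" unfolding u u1_def using k_bounds
      by (intro cos_monotone_0_pi \<theta>_0 \<theta>_less \<theta>_le_pi) auto
    then show ?thesis using u2_less_u1 by (intro mult_pos_pos) auto
  next
    case 2
    then have "Re w < u2" unfolding u u2_def using j(1)
      by (intro cos_monotone_0_pi \<theta>_0 \<theta>_less \<theta>_le_pi) auto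
    then show ?thesis using u2_less_u1 by (intro mult_neg_neg) auto
  qed
qed

lemma etac_eq: "etac n u = (1 + u) / (real n - 1) - 1 / (2 * real n)"
  unfolding etac_def B2_def using n3 by (simp add: field_simps)

text \<open>The line through the two active points of the convex curve \<open>u \<mapsto> 1 / (1 - u)\<close>; every
  other root of unity lies strictly below the curve.\<close>

lemma secant_line:
  assumes "u < 1"
  shows "c1 + 1 + S1 * etac n u - 1 / (1 - u) = - ((u - u1) * (u - u2)) / ((1 - u) * (1 - u1) * (1 - u2))"
proof -
  define t where "t = 1 / ((1 - u1) * (1 - u2))"
  have t: "t * ((1 - u1) * (1 - u2)) = 1" using u_less_1 by (simp add: t_def)
  have D: "D1 = - (2 * u1 * u2 + 1) * t / 2" "D2 = - t / 2" unfolding D1_def D2_def t_def by simp_all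
  have S: "S1 = (real n - 1) * t" unfolding S1_def t_def by simp
  have "S1 * etac n u = t * ((real n - 1) * ((1 + u) / (real n - 1) - 1 / (2 * real n)))"
    unfolding S etac_eq by simp
  also have "(real n - 1) * ((1 + u) / (real n - 1) - 1 / (2 * real n)) = 1 + u - (real n - 1) / (2 * real n)"
    using n3 by (simp add: right_diff_distrib)
  also have "\<dots> = 1 / 2 + u + 1 / (2 * real n)" using n3 by (simp add: field_simps)
  finally have "c1 + 1 + S1 * etac n u = 1 + t * (u - u1 * u2)"
    unfolding c1_def D by (simp add: field_simps)
  moreover have "1 + t * (u - u1 * u2) - 1 / (1 - u) = (t * (u - u1 * u2) * (1 - u) - u) / (1 - u)"
    using assms by (simp add: field_simps)
  moreover have "t * (u - u1 * u2) * (1 - u) - u = - ((u - u1) * (u - u2)) * t"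
  proof -
    have "u = u * (t * ((1 - u1) * (1 - u2)))" using t by simp
    then show ?thesis by (simp add: algebra_simps)
  qed
  ultimately show ?thesis by (simp add: t_def mult_ac)
qed

lemma active: "c1 + 1 + S1 * etac n u1 = 1 / (1 - u1)" "c1 + 1 + S1 * etac n u2 = 1 / (1 - u2)"
  using secant_line[of u1] secant_line[of u2] u_less_1 by simp_all

lemma eta_mean: "l1 * etac n u1 + l2 * etac n u2 = 0"
proof -
  have "l1 * etac n u1 + l2 * etac n u2 = ((l1 + l2) + (l1 * u1 + l2 * u2)) / (real n - 1) - (l1 + l2) / (2 * real n)"
    unfolding etac_eq by (simp add: field_simps add_divide_distrib)
  also have "\<dots> = 0" unfolding l_sum l_mean m0_def using n3 by (simp add: field_simps)
  finally show ?thesis .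
qed

lemma eta_diff: "etac n u1 \<noteq> etac n u2"
  unfolding etac_eq using u2_less_u1 n3 by (simp add: field_simps)

lemma S1_pos: "0 < S1"
  unfolding S1_def using u_less_1 n3 by auto

end

section \<open>The averaged second-order coefficient\<close>

text \<open>In the variable \<open>a = 1 - u\<close> all coefficients are polynomials of degree at most 3, and the only further term of \<open>Zc\<close> is a
  multiple of \<open>1 / a\<close>. Hence the average needs just the means of \<open>1, a, a\<^sup>2, a\<^sup>3, 1 / a\<close>.\<close>

lemma B2_poly: "B2 n (1 - a) = - 1 / real n + 2 / (real n - 1) - 1 / (real n - 1) * a"
proof -
  have "- x + (1 + (1 - a)) * y = - x + 2 * y - y * a" for x y :: real by (simp add: algebra_simps)
  from this[of "1 / real n" "1 / (real n - 1)"] show ?thesis unfolding B2_def by simp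
qed

lemma B3_poly: "B3 n (1 - a) = - (3 / real n - 12 / (real n - 1) + 9 / (real n - 2)) / 2
     + (6 / (real n - 2) - 3 / (real n - 1)) * a - 2 / (real n - 2) * a^2"
proof -
  have "- (3 * x - 6 * (1 + (1 - a)) * y + (1 + 2 * (1 - a))^2 * z) / 2
     = - (3 * x - 12 * y + 9 * z) / 2 + (6 * z - 3 * y) * a - 2 * z * a^2" for x y z :: real
    by (simp add: field_simps power2_eq_square)
  from this[of "1 / real n" "1 / (real n - 1)" "1 / (real n - 2)"] show ?thesis unfolding B3_def by simp
qed

lemma G1_poly: "G1 n (1 - a) = 2 / real n - 2 / (real n - 1) + 1 / (real n - 1) * a"
proof -
  have "2 * x - (1 + (1 - a)) * y = 2 * x - 2 * y + y * a" for x y :: real by (simp add: algebra_simps)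
  from this[of "1 / real n" "1 / (real n - 1)"] show ?thesis unfolding G1_def by simp
qed

lemma etac_poly: "etac n (1 - a) = - 1 / (2 * real n) + 2 / (real n - 1) - 1 / (real n - 1) * a"
proof -
  have "1 / (2 * real n) - 1 / real n = - 1 / (2 * real n)" by simp
  then show ?thesis unfolding etac_def B2_poly by linarith
qed

lemma K2_poly:
  fixes n :: nat
  defines "A \<equiv> 2 / real n - 1 / (real n - 1)" and "B \<equiv> 1 / (real n - 1)"
  shows "K2 n (1 - a) = (real n / 2 * (A - B)^2 - (A - B) * (A - 5 * B) / 2)
     + (real n / 2 * (- (A^2) + 8 * A * B - 9 * B^2) - 3 * A + 5 * B - 2 * A * B + 5 * B^2) * a
     + (real n * (- 2 * A * B + 6 * B^2) + 2 * A - 10 * B - 2 * B^2) * a^2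
     + (- 2 * real n * B^2 + 4 * B) * a^3"
proof -
  have "N / 2 * (A^2 * (1 - a) - 2 * A * B * (2 * (1 - a)^2 - 1) + B^2 * (4 * (1 - a)^3 - 3 * (1 - a)))
     + (A + B) * (2 * (1 - a)^2 - 1) - A * (1 - a) - B * (4 * (1 - a)^3 - 3 * (1 - a))
     - (A^2 - 2 * A * B * (2 * (1 - a) + 1) + B^2 * (4 * (1 - a)^2 + 2 * (1 - a) - 1)) / 2
    = (N / 2 * (A - B)^2 - (A - B) * (A - 5 * B) / 2)
     + (N / 2 * (- (A^2) + 8 * A * B - 9 * B^2) - 3 * A + 5 * B - 2 * A * B + 5 * B^2) * a
     + (N * (- 2 * A * B + 6 * B^2) + 2 * A - 10 * B - 2 * B^2) * a^2
     + (- 2 * N * B^2 + 4 * B) * a^3" for N A B :: real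
    by (simp add: field_simps power2_eq_square power3_eq_cube)
  from this[of "real n" A B] show ?thesis unfolding K2_def Let_def A_def B_def .
qed

lemma second_balanced: "second n u S (S^2 / 2) = S^2 * (- 3 / (16 * real n ^ 2) - B2 n u / (4 * real n)
     + (B3 n u / 2 - B2 n u / 4) * (1 / 2 - 1 / real n) + K2 n u / 4)"
proof -
  define i where "i = 1 / real n"
  have i: "x / (16 * real n ^ 2) = x * i^2 / 16" "x / (4 * real n) = x * i / 4" "x / real n = x * i" for x
    by (simp_all add: i_def power_divide)
  show ?thesis unfolding second_def i by (simp add: field_simps power2_eq_square)
qed

context active_pair
begin

definition "avg f = l1 * f (1 - u1) + l2 * f (1 - u2)" for f :: "real \<Rightarrow> real"

text \<open>The two values \<open>a = 1 - u1\<close> and \<open>a = 1 - u2\<close> are eliminated in favour of the symmetric quantities \<open>inv_prod = 1 / (a\<^sub>1 a\<^sub>2)\<close> and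
  \<open>inv_sum = 1 / a\<^sub>1 + 1 / a\<^sub>2\<close>. The mean \<open>M1\<close> of \<open>a\<close> is \<open>1 - m0\<close>.\<close>

definition "inv_prod = 1 / ((1 - u1) * (1 - u2))"
definition "inv_sum = ((1 - u1) + (1 - u2)) * inv_prod"
definition "M1 = (3 * real n + 1) / (2 * real n)"

lemma avg_0: "avg (\<lambda>a. 1) = 1" unfolding avg_def using l_sum by simp

lemma avg_1: "avg (\<lambda>a. a) = M1"
proof -
  have "avg (\<lambda>a. a) = (l1 + l2) - (l1 * u1 + l2 * u2)" unfolding avg_def by (simp add: algebra_simps)
  then show ?thesis unfolding l_sum l_mean m0_def M1_def using n3 by (simp add: field_simps)
qed

lemma avg_add: "avg (\<lambda>a. f a + g a) = avg f + avg g" and avg_cmult: "avg (\<lambda>a. r * f a) = r * avg f"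
  unfolding avg_def by (simp_all add: algebra_simps)

lemma inv_prod: "inv_prod * ((1 - u1) * (1 - u2)) = 1"
  using u_less_1 by (simp add: inv_prod_def)

lemma avg_2: "inv_prod^2 * avg (\<lambda>a. a^2) = inv_prod * (inv_sum * M1 - 1)"
proof -
  define s p where "s = (1 - u1) + (1 - u2)" and "p = (1 - u1) * (1 - u2)"
  have q: "(1 - u1)^2 = s * (1 - u1) - p" "(1 - u2)^2 = s * (1 - u2) - p"
    by (simp_all add: s_def p_def power2_eq_square algebra_simps)
  have e: "avg (\<lambda>a. a^2) = s * avg (\<lambda>a. a) - p * avg (\<lambda>a. 1)"
    unfolding avg_def q by (simp add: algebra_simps)
  have "inv_prod^2 * avg (\<lambda>a. a^2) = inv_prod * ((s * inv_prod) * M1 - inv_prod * p)"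
    unfolding e avg_0 avg_1 by (simp add: power2_eq_square algebra_simps)
  then show ?thesis using inv_prod by (simp add: s_def p_def inv_sum_def)
qed

lemma avg_3: "inv_prod^2 * avg (\<lambda>a. a^3) = inv_sum^2 * M1 - inv_prod * M1 - inv_sum"
proof -
  define s p where "s = (1 - u1) + (1 - u2)" and "p = (1 - u1) * (1 - u2)"
  have q: "(1 - u1)^3 = (s^2 - p) * (1 - u1) - s * p" "(1 - u2)^3 = (s^2 - p) * (1 - u2) - s * p"
    by (simp_all add: s_def p_def power2_eq_square power3_eq_cube algebra_simps)
  have e: "avg (\<lambda>a. a^3) = (s^2 - p) * avg (\<lambda>a. a) - s * p * avg (\<lambda>a. 1)"
    unfolding avg_def q by (simp add: algebra_simps)
  have "inv_prod^2 * avg (\<lambda>a. a^3) = (s * inv_prod)^2 * M1 - inv_prod * M1 * (inv_prod * p) - (s * inv_prod) * (inv_prod * p)"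
    unfolding e avg_0 avg_1 by (simp add: power2_eq_square algebra_simps)
  then show ?thesis using inv_prod by (simp add: s_def p_def inv_sum_def)
qed

lemma avg_inv: "avg (\<lambda>a. 1 / a) = inv_sum - inv_prod * M1"
proof -
  define s p where "s = (1 - u1) + (1 - u2)" and "p = (1 - u1) * (1 - u2)"
  have q: "1 / (1 - u1) = inv_prod * (s - (1 - u1))" "1 / (1 - u2) = inv_prod * (s - (1 - u2))"
    using u_less_1 by (simp_all add: s_def inv_prod_def)
  have "avg (\<lambda>a. 1 / a) = inv_prod * (s * avg (\<lambda>a. 1) - avg (\<lambda>a. a))"
    unfolding avg_def q by (simp add: algebra_simps)
  then show ?thesis unfolding avg_0 avg_1 by (simp add: s_def inv_sum_def algebra_simps)
qed

lemma D_xt: "D1 = - 1 + inv_sum - 3 / 2 * inv_prod" "D2 = - inv_prod / 2" "S1 = (real n - 1) * inv_prod"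
proof -
  have "u1 * u2 = 1 - ((1 - u1) + (1 - u2)) + (1 - u1) * (1 - u2)" by (simp add: algebra_simps)
  then have e: "- 2 * u1 * u2 - 1 = - 3 + 2 * ((1 - u1) + (1 - u2)) - 2 * ((1 - u1) * (1 - u2))" by simp
  have half: "y / (2 * (1 - u1) * (1 - u2)) = y * inv_prod / 2" for y unfolding inv_prod_def mult.assoc by simp
  have "D1 = (- 3 + 2 * ((1 - u1) + (1 - u2)) - 2 * ((1 - u1) * (1 - u2))) * inv_prod / 2"
    unfolding D1_def half e ..
  also have "\<dots> = - 3 / 2 * inv_prod + inv_sum - inv_prod * ((1 - u1) * (1 - u2))"
    unfolding inv_sum_def by (simp add: field_simps)
  finally show "D1 = - 1 + inv_sum - 3 / 2 * inv_prod" unfolding inv_prod by simp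
  show "D2 = - inv_prod / 2" unfolding D2_def inv_prod_def by simp
  show "S1 = (real n - 1) * inv_prod" unfolding S1_def inv_prod_def by simp
qed

text \<open>The constant \<open>D\<close> of the expansion, without the correction \<open>\<Delta>\<close> for \<open>n = 5\<close>.\<close>

definition "DD = (let D3 = (- 1 - 4 * D1 - 3 * D1^2 + 2 * D2^2) / 2;
   D4 = (3 * D1 - 4 * D2 + 3 * D1^2 - 2 * D1 * D2 - 6 * D2^2) / 2;
   D5 = (2 + 4 * D1 + 5 * D2 + 2 * D1^2 + 4 * D1 * D2 + 3 * D2^2) / 2;
   D6 = (2 * D2 + 2 * D1 * D2 + 3 * D2^2) / 2
   in D3 * real n + D4 + D5 / real n + D6 / (real n)^2)"

text \<open>For the fourth moment \<open>S1\<^sup>2 / 2\<close> of a pair of opposite values the averaged coefficient is \<open>- D\<close>. Both sides are rational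
  functions of \<open>n\<close>, \<open>inv_prod\<close> and \<open>inv_sum\<close>.\<close>

lemma Zc_balanced_mean: "l1 * Zc n u1 c1 S1 (S1^2 / 2) + l2 * Zc n u2 c1 S1 (S1^2 / 2) = - DD"
proof -
  define N where "N = real n"
  have N: "N \<noteq> 0" "N - 1 \<noteq> 0" "N - 2 \<noteq> 0" using n3 by (auto simp: N_def)
  define A B where "A = 2 / N - 1 / (N - 1)" and "B = 1 / (N - 1)"
  define k0 k1 k2 k3 where
    "k0 = N / 2 * (A - B)^2 - (A - B) * (A - 5 * B) / 2" and
    "k1 = N / 2 * (- (A^2) + 8 * A * B - 9 * B^2) - 3 * A + 5 * B - 2 * A * B + 5 * B^2" and
    "k2 = N * (- 2 * A * B + 6 * B^2) + 2 * A - 10 * B - 2 * B^2" and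
    "k3 = - 2 * N * B^2 + 4 * B"
  define b0 b1 where "b0 = - 1 / N + 2 / (N - 1)" and "b1 = - 1 / (N - 1)"
  define g0 g1 g2 where "g0 = - (3 / N - 12 / (N - 1) + 9 / (N - 2)) / 2"
    and "g1 = 6 / (N - 2) - 3 / (N - 1)" and "g2 = - 2 / (N - 2)"
  define q0 q1 q2 q3 where
    "q0 = - 3 / (16 * N ^ 2) - b0 / (4 * N) + (g0 / 2 - b0 / 4) * (1 / 2 - 1 / N) + k0 / 4" and
    "q1 = - b1 / (4 * N) + (g1 / 2 - b1 / 4) * (1 / 2 - 1 / N) + k1 / 4" and
    "q2 = g2 / 2 * (1 / 2 - 1 / N) + k2 / 4" and
    "q3 = k3 / 4"
  have sec: "second n (1 - a) S1 (S1^2 / 2) = S1^2 * (q0 + q1 * a + q2 * a^2 + q3 * a^3)" for a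
  proof -
    have "B2 n (1 - a) = b0 + b1 * a" unfolding B2_poly b0_def b1_def N_def by simp
    moreover have "B3 n (1 - a) = g0 + g1 * a + g2 * a^2" unfolding B3_poly g0_def g1_def g2_def N_def by simp
    moreover have "K2 n (1 - a) = k0 + k1 * a + k2 * a^2 + k3 * a^3"
      unfolding K2_poly k0_def k1_def k2_def k3_def A_def B_def N_def by simp
    ultimately show ?thesis unfolding second_balanced N_def[symmetric] q0_def q1_def q2_def q3_def
      by (simp add: distrib_left distrib_right add_divide_distrib diff_divide_distrib left_diff_distrib right_diff_distrib)
  qed
  have Z: "Zc n (1 - a) c1 S1 (S1^2 / 2) = (c1 * (c1 + 1) + (c1 - 1) * S1 * (- 1 / (2 * N) + 2 / (N - 1))
        - S1 / (N - 1) + 2 * S1^2 * q0)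
      + (- (c1 - 1) * S1 / (N - 1) + 2 * S1^2 * q1) * a + 2 * (S1^2 * q2) * a^2 + 2 * (S1^2 * q3) * a^3
      + (1 / 2 - (1 / N - 2 / (N - 1)) * S1) * (1 / a)" if "a \<noteq> 0" for a
  proof -
    define i j where "i = 1 / N" and "j = 1 / (N - 1)"
    have e: "etac n (1 - a) = - 1 / (2 * N) + 2 / (N - 1) - j * a"
      unfolding etac_poly N_def j_def by simp
    have g: "G1 n (1 - a) - 1 / N = i - 2 * j + j * a"
      unfolding G1_poly N_def j_def i_def by (simp add: add_divide_distrib diff_divide_distrib)
    define \<eta>0 where "\<eta>0 = - 1 / (2 * N) + 2 / (N - 1)"
    have "c1 * (c1 + 1) + (c1 - 1) * S1 * (\<eta>0 - j * a) - (i - 2 * j + j * a) * S1 / a + 1 / (2 * a) + 2 * (S1^2 * (q0 + q1 * a + q2 * a^2 + q3 * a^3))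
      = (c1 * (c1 + 1) + (c1 - 1) * S1 * \<eta>0 - S1 * j + 2 * S1^2 * q0)
      + (- (c1 - 1) * S1 * j + 2 * S1^2 * q1) * a + 2 * (S1^2 * q2) * a^2 + 2 * (S1^2 * q3) * a^3
      + (1 / 2 - (i - 2 * j) * S1) * (1 / a)"
      using that by (simp add: field_simps)
    then show ?thesis
      unfolding Zc_def sec e N_def[symmetric] g \<eta>0_def by (simp add: i_def j_def)
  qed
  define P where "P = N - 1"
  have P: "P \<noteq> 0" "N - 1 = P" "N = P + 1" using N by (auto simp: P_def)
  have AB: "A = (N - 2) / (N * P)" "B = 1 / P" "A - B = - 2 / (N * P)"
    unfolding A_def B_def P(2) using N(1) P(1) by (simp_all add: field_simps) (simp_all add: P_def algebra_simps)
  \<comment> \<open>The denominators \<open>n - 1\<close> cancel against the factor \<open>(n - 1)\<^sup>2\<close> of \<open>S1\<^sup>2\<close>, and the denominators \<open>n - 2\<close> against \<open>1 / 2 - 1 / n\<close>.\<close>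
  have k: "P^2 * k0 = - 2 / N - 2 / N^2" "P^2 * k1 = N + 1 - 4 / N"
    "P^2 * k2 = - 4 * N + 6 + 4 / N" "P^2 * k3 = 2 * N - 4"
    unfolding k0_def k1_def k2_def k3_def AB using P(1) N(1)
    by (simp_all add: field_simps power2_eq_square) (simp_all add: P_def algebra_simps)
  have q: "P^2 * q0 = - 3 * P^2 / (16 * N^2) - P * (N + 1) / (4 * N^2) - P * (N + 1) * (N - 2) / (8 * N^2)
       - (3 * (N - 2) * P^2 / N - 12 * (N - 2) * P + 9 * P^2) / (8 * N) + P^2 * k0 / 4"
    "P^2 * q1 = P / (4 * N) + P * (N - 2) / (8 * N) + (6 * P^2 - 3 * P * (N - 2)) / (4 * N) + P^2 * k1 / 4"
    "P^2 * q2 = - (P^2) / (2 * N) + P^2 * k2 / 4"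
    "P^2 * q3 = P^2 * k3 / 4"
  proof -
    have b: "P^2 * b0 = P * (N + 1) / N" "P^2 * b1 = - P"
      unfolding b0_def b1_def P(2) using P(1) N(1) by (simp_all add: field_simps power2_eq_square P_def)
    have g: "P^2 * g0 * (1 / 2 - 1 / N) = - (3 * (N - 2) * P^2 / N - 12 * (N - 2) * P + 9 * P^2) / (4 * N)"
       "P^2 * g1 * (1 / 2 - 1 / N) = (6 * P^2 - 3 * P * (N - 2)) / (2 * N)"
       "P^2 * g2 * (1 / 2 - 1 / N) = - (P^2) / N"
      unfolding g0_def g1_def g2_def P(2) using P(1) N(1,3) by (simp_all add: field_simps power2_eq_square)
    have h: "1 / 2 - 1 / N = (N - 2) / (2 * N)" using N(1) by (simp add: field_simps)
    have "P^2 * q0 = - 3 * P^2 / (16 * N^2) - (P^2 * b0) / (4 * N) + (P^2 * g0 * (1 / 2 - 1 / N)) / 2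
        - (P^2 * b0) * (1 / 2 - 1 / N) / 4 + P^2 * k0 / 4"
      unfolding q0_def by (simp add: algebra_simps add_divide_distrib diff_divide_distrib)
    then show "P^2 * q0 = - 3 * P^2 / (16 * N^2) - P * (N + 1) / (4 * N^2) - P * (N + 1) * (N - 2) / (8 * N^2)
       - (3 * (N - 2) * P^2 / N - 12 * (N - 2) * P + 9 * P^2) / (8 * N) + P^2 * k0 / 4"
      unfolding b g unfolding h using N(1) by (simp add: field_simps power2_eq_square)
    have "P^2 * q1 = - (P^2 * b1) / (4 * N) + (P^2 * g1 * (1 / 2 - 1 / N)) / 2
        - (P^2 * b1) * (1 / 2 - 1 / N) / 4 + P^2 * k1 / 4"
      unfolding q1_def by (simp add: algebra_simps add_divide_distrib diff_divide_distrib)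
    then show "P^2 * q1 = P / (4 * N) + P * (N - 2) / (8 * N) + (6 * P^2 - 3 * P * (N - 2)) / (4 * N) + P^2 * k1 / 4"
      unfolding b g unfolding h by simp
    have "P^2 * q2 = (P^2 * g2 * (1 / 2 - 1 / N)) / 2 + P^2 * k2 / 4"
      unfolding q2_def by (simp add: algebra_simps add_divide_distrib diff_divide_distrib)
    then show "P^2 * q2 = - (P^2) / (2 * N) + P^2 * k2 / 4" unfolding g by simp
    show "P^2 * q3 = P^2 * k3 / 4" unfolding q3_def by simp
  qed
  define t x where "t = inv_prod" and "x = inv_sum"
  have S1t: "S1 = P * t" unfolding D_xt t_def P_def N_def ..
  have "l1 * Zc n u1 c1 S1 (S1^2 / 2) + l2 * Zc n u2 c1 S1 (S1^2 / 2)
      = avg (\<lambda>a. (c1 * (c1 + 1) + (c1 - 1) * t * (2 - P / (2 * N)) - t + 2 * t^2 * (P^2 * q0)) * 1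
      + (- (c1 - 1) * t + 2 * t^2 * (P^2 * q1)) * a + 2 * (P^2 * q2) * (t^2 * a^2) + 2 * (P^2 * q3) * (t^2 * a^3)
      + (1 / 2 - (P / N - 2) * t) * (1 / a))"
  proof -
    have "Zc n (1 - a) c1 S1 (S1^2 / 2) = (c1 * (c1 + 1) + (c1 - 1) * t * (2 - P / (2 * N)) - t + 2 * t^2 * (P^2 * q0)) * 1
      + (- (c1 - 1) * t + 2 * t^2 * (P^2 * q1)) * a + 2 * (P^2 * q2) * (t^2 * a^2) + 2 * (P^2 * q3) * (t^2 * a^3)
      + (1 / 2 - (P / N - 2) * t) * (1 / a)" if "a \<noteq> 0" for a
    proof -
      have e: "S1 * (- 1 / (2 * N) + 2 / (N - 1)) = t * (2 - P / (2 * N))" "S1 / (N - 1) = t"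
        "(1 / N - 2 / (N - 1)) * S1 = (P / N - 2) * t" "S1^2 * q = t^2 * (P^2 * q)" for q
        unfolding S1t P(2) using P(1) by (simp_all add: algebra_simps power_mult_distrib)
      show ?thesis
        unfolding Z[OF that] mult.assoc[of "c1 - 1" S1] e mult.assoc[of 2 "S1^2"] times_divide_eq_right[symmetric, of _ S1]
        by (simp add: algebra_simps)
    qed
    from this[of "1 - u1"] this[of "1 - u2"] show ?thesis
      unfolding avg_def using u_less_1 by simp
  qed
  also have "\<dots> = (c1 * (c1 + 1) + (c1 - 1) * t * (2 - P / (2 * N)) - t + 2 * t^2 * (P^2 * q0))
      + (- (c1 - 1) * t + 2 * t^2 * (P^2 * q1)) * M1 + 2 * (P^2 * q2) * (t * (x * M1 - 1))
      + 2 * (P^2 * q3) * (x^2 * M1 - t * M1 - x) + (1 / 2 - (P / N - 2) * t) * (x - t * M1)"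
    unfolding avg_add avg_cmult avg_0 avg_1 unfolding t_def x_def avg_2 avg_3 avg_inv by simp
  also have "\<dots> = - DD"
    unfolding q unfolding k c1_def DD_def Let_def D_xt t_def[symmetric] x_def[symmetric] N_def[symmetric] M1_def
    unfolding P_def using N(1) by (simp add: field_simps power2_eq_square)
  finally show ?thesis .
qed

end

context active_pair
begin

text \<open>The averages of the polynomials in \<open>u\<close> that multiply \<open>1 / (n - 2)\<close> and \<open>1 / (n - 3)\<close> in \<open>Wc\<close>.\<close>

definition "T3 = l1 * (1 + 2 * u1)^2 + l2 * (1 + 2 * u2)^2"
definition "T4 = l1 * (8 * (1 + u1) * u1^2) + l2 * (8 * (1 + u2) * u2^2)"

lemma Wc_eq: "Wc n u = - (1 + u) * (1 / (real n - 1) / 2) + (1 + 2 * u)^2 * (1 / (real n - 2) / 2)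
    - (8 * (1 + u) * u^2) * (1 / (real n - 3) / 4)"
proof -
  have "2 * (- (3 * x - 6 * a * y + b * z) / 2 / 2 - (- x + a * y) / 4 - (- (4 * x - 12 * a * y + 4 * b * z - c * t) / 2) / 4)
     = - a * (y / 2) + b * (z / 2) - c * (t / 4)" for x y z t a b c :: real by (simp add: field_simps)
  from this[of "1 / real n" "1 + u" "1 / (real n - 1)" "(1 + 2 * u)^2" "1 / (real n - 2)" "8 * (1 + u) * u^2" "1 / (real n - 3)"]
  show ?thesis unfolding Wc_def B2_def B3_def B4_def by simp
qed

lemma Wc_mean: "l1 * Wc n u1 + l2 * Wc n u2 =
   - (1 / (4 * real n) - T3 / (2 * (real n - 2)) + T4 / (4 * (real n - 3)))"
proof -
  have "l1 * (- (1 + u1) * y + b * z - c * t) + l2 * (- (1 + u2) * y + b' * z - c' * t)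
     = - (((l1 + l2) + (l1 * u1 + l2 * u2)) * y) + (l1 * b + l2 * b') * z - (l1 * c + l2 * c') * t" for y z t b b' c c'
    by (simp add: algebra_simps)
  then have "l1 * Wc n u1 + l2 * Wc n u2 = - (((l1 + l2) + (l1 * u1 + l2 * u2)) * (1 / (real n - 1) / 2))
     + T3 * (1 / (real n - 2) / 2) - T4 * (1 / (real n - 3) / 4)"
    unfolding Wc_eq T3_def T4_def .
  moreover have "(l1 + l2) + (l1 * u1 + l2 * u2) = (real n - 1) / (2 * real n)"
    unfolding l_sum l_mean m0_def using n3 by (simp add: field_simps)
  ultimately have "l1 * Wc n u1 + l2 * Wc n u2 = - ((real n - 1) / (2 * real n) * (1 / (real n - 1) / 2))
     + T3 * (1 / (real n - 2) / 2) - T4 * (1 / (real n - 3) / 4)" by (simp only:)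
  also have "(real n - 1) / (2 * real n) * (1 / (real n - 1) / 2) = 1 / (4 * real n)"
    using n3 by (simp add: field_simps)
  finally show ?thesis by (simp add: mult.commute)
qed

lemma v_mean: "l1 * (1 + 2 * u1) + l2 * (1 + 2 * u2) = - 1 / real n"
proof -
  have "l1 * (1 + 2 * u1) + l2 * (1 + 2 * u2) = (l1 + l2) + 2 * (l1 * u1 + l2 * u2)"
    by (simp add: algebra_simps)
  then show ?thesis unfolding l_sum l_mean m0_def using n3 by (simp add: field_simps)
qed

lemma T3_eq: "T3 = - ((1 + 2 * u1) + (1 + 2 * u2)) / real n - (1 + 2 * u1) * (1 + 2 * u2)"
proof -
  define x y where "x = 1 + 2 * u1" and "y = 1 + 2 * u2"
  have "T3 = (x + y) * (l1 * x + l2 * y) - x * y * (l1 + l2)"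
    unfolding T3_def x_def[symmetric] y_def[symmetric] by (simp add: algebra_simps power2_eq_square)
  moreover have "l1 * x + l2 * y = - 1 / real n" unfolding x_def y_def by (rule v_mean)
  ultimately have "T3 = (x + y) * (- 1 / real n) - x * y" unfolding l_sum by simp
  also have "(x + y) * (- 1 / real n) = - (x + y) / real n" using n3 by (simp add: field_simps)
  finally show ?thesis unfolding x_def y_def .
qed

text \<open>Together with \<open>T3\<close>, the third and second moments of \<open>1 + 2 u\<close> under the weights \<open>l1, l2\<close>.\<close>

definition "V3 = l1 * (1 + 2 * u1)^3 + l2 * (1 + 2 * u2)^3"

lemma V3_eq: "V3 = ((1 + 2 * u1) + (1 + 2 * u2)) * T3 + (1 + 2 * u1) * (1 + 2 * u2) / real n"
proof -
  define x y where "x = 1 + 2 * u1" and "y = 1 + 2 * u2"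
  have "V3 = (x + y) * T3 - x * y * (l1 * x + l2 * y)"
    unfolding V3_def T3_def x_def[symmetric] y_def[symmetric]
    by (simp add: algebra_simps power2_eq_square power3_eq_cube)
  then show ?thesis unfolding x_def y_def v_mean by simp
qed

lemma T4_eq: "T4 = 1 + 1 / real n - T3 + V3"
proof -
  define x y where "x = 1 + 2 * u1" and "y = 1 + 2 * u2"
  have e: "8 * (1 + u1) * u1^2 = 1 - x - x^2 + x^3" "8 * (1 + u2) * u2^2 = 1 - y - y^2 + y^3"
    unfolding x_def y_def by (simp_all add: algebra_simps power2_eq_square power3_eq_cube)
  have "T4 = (l1 + l2) - (l1 * x + l2 * y) - T3 + V3"
    unfolding T4_def e T3_def V3_def x_def[symmetric] y_def[symmetric] by (simp add: algebra_simps)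
  then show ?thesis unfolding x_def y_def v_mean l_sum by simp
qed

lemma T4_nonneg: "0 \<le> T4"
proof -
  have "0 \<le> l1 * (8 * (1 + u1) * u1^2)" "0 \<le> l2 * (8 * (1 + u2) * u2^2)"
    using l_pos u2_ge u1_ge by (simp_all add: mult_nonneg_nonneg)
  then show ?thesis unfolding T4_def by (rule add_nonneg_nonneg)
qed

text \<open>The denominator \<open>n - 3\<close> may be enlarged to \<open>n - 2\<close> because \<open>T4 \<ge> 0\<close>; the sign is then that of a linear expression in
  the moments.\<close>

lemma Wc_nonpos_if:
  assumes "4 \<le> n" "0 \<le> 2 - 1 / real n - 3 * T3 + V3"
  shows "l1 * Wc n u1 + l2 * Wc n u2 \<le> 0"
proof -
  have "T4 / (4 * (real n - 2)) \<le> T4 / (4 * (real n - 3))"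
    using assms(1) T4_nonneg by (intro divide_left_mono) auto
  moreover have "1 / (4 * real n) - T3 / (2 * (real n - 2)) + T4 / (4 * (real n - 2))
     = ((real n - 2) / real n - 2 * T3 + T4) / (4 * (real n - 2))"
  proof -
    have "1 / (4 * N) - T3 / (2 * M) + T4 / (4 * M) = (M / N - 2 * T3 + T4) / (4 * M)"
      if "M \<noteq> 0" "N \<noteq> 0" for M N :: real using that by (simp add: field_simps)
    from this[of "real n - 2" "real n"] show ?thesis using assms(1) by force
  qed
  moreover have "(real n - 2) / real n - 2 * T3 + T4 = 2 - 1 / real n - 3 * T3 + V3"
    unfolding T4_eq using assms(1) by (simp add: field_simps)
  moreover have "0 \<le> (2 - 1 / real n - 3 * T3 + V3) / (4 * (real n - 2))"
    using assms by (intro divide_nonneg_nonneg) auto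
  ultimately show ?thesis unfolding Wc_mean by simp
qed

lemma V3_ge: "- T3 \<le> V3"
proof -
  have "- (x^2) \<le> x^3" if "- 1 \<le> x" for x :: real
  proof -
    have "0 \<le> x^2 * (1 + x)" using that by (intro mult_nonneg_nonneg) auto
    then show ?thesis by (simp add: algebra_simps power2_eq_square power3_eq_cube)
  qed
  from this[of "1 + 2 * u1"] this[of "1 + 2 * u2"] show ?thesis
    unfolding V3_def T3_def using l_pos u1_ge u2_ge
    by (auto simp: mult_left_mono intro!: order.trans[OF eq_refl add_mono[of "- (l1 * (1 + 2 * u1)^2)" _ "- (l2 * (1 + 2 * u2)^2)"]] mult_left_mono[where c=l1, of "- ((1 + 2 * u1)^2)", simplified] mult_left_mono[where c=l2, of "- ((1 + 2 * u2)^2)", simplified])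
qed

text \<open>Since \<open>1 + 2 u \<ge> - 1\<close>, the third moment is at least minus the second, and smallness of \<open>T3\<close> suffices.\<close>

lemma Wc_nonpos_if_T3:
  assumes "4 \<le> n" "4 * T3 \<le> 2 - 1 / real n"
  shows "l1 * Wc n u1 + l2 * Wc n u2 \<le> 0"
  using assms V3_ge by (intro Wc_nonpos_if) auto

text \<open>For two points the second moment is the square of the mean \<open>- 1 / n\<close> plus the product of the two deviations.\<close>

lemma T3_variance: "T3 = (1 + 2 * u1 + 1 / real n) * (- 1 / real n - (1 + 2 * u2)) + 1 / real n ^ 2"
proof -
  have "- (x + y) * i - x * y = (x + i) * (- i - y) + i^2" for x y i :: real
    by (simp add: algebra_simps power2_eq_square)
  from this[of "1 + 2 * u1" "1 + 2 * u2" "1 / real n"] show ?thesis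
    unfolding T3_eq by (simp add: power_divide)
qed

text \<open>The minimal polynomial of \<open>cos (2 \<pi> / 5)\<close>; for \<open>n = 4\<close> both \<open>u1\<close> and \<open>u2\<close> are its zeros, so their sum and product are known.\<close>

lemma unity_quintic:
  assumes "unity_root m w" "m = 4"
  shows "4 * Re w ^ 2 + 2 * Re w - 1 = 0"
proof -
  interpret unity_root 4 w using assms by simp
  have "cnj w ^ 5 = 1" using arg_cong[OF w, of cnj] by simp
  then have "(cnj w - 1) * (1 + cnj w + cnj w ^ 2 + cnj w ^ 3 + cnj w ^ 4) = 0"
    by (simp add: algebra_simps eval_nat_numeral)
  moreover have "cnj w - 1 \<noteq> 0" using w1 by (metis complex_cnj_cancel_iff complex_cnj_one eq_iff_diff_eq_0)
  ultimately have s: "1 + cnj w + cnj w ^ 2 + cnj w ^ 3 + cnj w ^ 4 = 0" by simp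
  have 3: "cnj w ^ 3 = w ^ 2" and 4: "cnj w ^ 4 = w"
    using power_cnj[of 3] power_cnj[of 4] by simp_all
  have "Re (1 + cnj w + cnj w ^ 2 + w ^ 2 + w) = 0" using s unfolding 3 4 by simp
  moreover have "Re (w ^ 2) = 2 * u^2 - 1"
    unfolding Re_cnj_powers(2)[symmetric] by (metis complex_cnj_power cnj.sel(1))
  ultimately show ?thesis unfolding plus_complex.sel Re_cnj_powers by simp
qed

text \<open>The minimal polynomial of \<open>cos (2 \<pi> / 7)\<close>, for \<open>n = 6\<close>.\<close>

lemma unity_septic:
  assumes "unity_root m w" "m = 6"
  shows "8 * Re w ^ 3 + 4 * Re w ^ 2 - 4 * Re w - 1 = 0"
proof -
  interpret unity_root 6 w using assms by simp
  have "cnj w ^ 7 = 1" using arg_cong[OF w, of cnj] by simp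
  then have "(cnj w - 1) * (1 + cnj w + cnj w ^ 2 + cnj w ^ 3 + cnj w ^ 4 + cnj w ^ 5 + cnj w ^ 6) = 0"
    by (simp add: algebra_simps eval_nat_numeral)
  moreover have "cnj w - 1 \<noteq> 0" using w1 by (metis complex_cnj_cancel_iff complex_cnj_one eq_iff_diff_eq_0)
  ultimately have s: "1 + cnj w + cnj w ^ 2 + cnj w ^ 3 + cnj w ^ 4 + cnj w ^ 5 + cnj w ^ 6 = 0" by simp
  have p: "cnj w ^ 4 = w ^ 3" "cnj w ^ 5 = w ^ 2" "cnj w ^ 6 = w"
    using power_cnj[of 4] power_cnj[of 5] power_cnj[of 6] by simp_all
  have "Re (1 + cnj w + cnj w ^ 2 + cnj w ^ 3 + w ^ 3 + w ^ 2 + w) = 0" using s unfolding p by simp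
  moreover have "Re (w ^ 2) = 2 * u^2 - 1" "Re (w ^ 3) = 4 * u^3 - 3 * u"
    unfolding Re_cnj_powers(2,3)[symmetric] by (metis complex_cnj_power cnj.sel(1))+
  ultimately show ?thesis unfolding plus_complex.sel Re_cnj_powers by simp
qed

lemma Wc_nonpos_4: "n = 4 \<Longrightarrow> l1 * Wc n u1 + l2 * Wc n u2 \<le> 0"
proof -
  assume n: "n = 4"
  have "4 * u1^2 + 2 * u1 - 1 = 0" "4 * u2^2 + 2 * u2 - 1 = 0"
    using unity_quintic[OF unity(1) n] unity_quintic[OF unity(2) n] by simp_all
  then have "(u1 - u2) * (4 * (u1 + u2) + 2) = 0" and q: "4 * u1^2 + 2 * u1 - 1 = 0"
    by (simp_all add: algebra_simps power2_eq_square)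
  then have s: "u2 = - 1 / 2 - u1" using u2_less_u1 by auto
  have "u1 * u1 = 1 / 4 - u1 / 2" using q by (simp add: power2_eq_square)
  then have e: "(1 + 2 * u1) + (1 + 2 * u2) = 1" "(1 + 2 * u1) * (1 + 2 * u2) = - 1"
    unfolding s by (simp_all add: algebra_simps)
  have "T3 = 3 / 4" unfolding T3_eq e unfolding n by simp
  moreover have "V3 = 1 / 2" unfolding V3_eq e \<open>T3 = 3 / 4\<close> unfolding n by simp
  ultimately have "T4 = 1" unfolding T4_eq unfolding n by simp
  then show ?thesis unfolding Wc_mean \<open>T3 = 3 / 4\<close> using n by simp
qed

text \<open>Here \<open>T3\<close> is too large for \<open>Wc_nonpos_if_T3\<close>. The sum and product of \<open>u1\<close> and \<open>u2\<close> are expressed through the third zero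
  \<open>z = - 1 / 2 - (u1 + u2)\<close> of the cubic, for which a rational lower bound suffices.\<close>

lemma Wc_nonpos_6: "n = 6 \<Longrightarrow> l1 * Wc n u1 + l2 * Wc n u2 \<le> 0"
proof -
  assume n: "n = 6"
  define \<sigma> where "\<sigma> = u1 + u2"
  define p where "p u = 8 * u^3 + 4 * u^2 - 4 * u - 1" for u :: real
  have r: "p u1 = 0" "p u2 = 0"
    using unity_septic[OF unity(1) n] unity_septic[OF unity(2) n] by (simp_all add: p_def)
  have "(u1 - u2) * (8 * (u1^2 + u1 * u2 + u2^2) + 4 * (u1 + u2) - 4) = p u1 - p u2"
    unfolding p_def by (simp add: algebra_simps power2_eq_square power3_eq_cube)
  then have "8 * (u1^2 + u1 * u2 + u2^2) + 4 * (u1 + u2) - 4 = 0" using r u2_less_u1 by auto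
  then have pi: "u1 * u2 = \<sigma>^2 + \<sigma> / 2 - 1 / 2"
    unfolding \<sigma>_def by (simp add: field_simps power2_eq_square)
  have third: "p (- 1 / 2 - \<sigma>) = 0"
  proof -
    have "u1^2 = \<sigma> * u1 - (\<sigma>^2 + \<sigma> / 2 - 1 / 2)"
      unfolding pi[symmetric] unfolding \<sigma>_def by (simp add: algebra_simps power2_eq_square)
    then have q: "u1 * u1 = \<sigma> * u1 - (\<sigma>^2 + \<sigma> / 2 - 1 / 2)" by (simp add: power2_eq_square)
    have "p u1 = 8 * (u1 * (u1 * u1)) + 4 * (u1 * u1) - 4 * u1 - 1"
      unfolding p_def by (simp add: power2_eq_square power3_eq_cube)
    also have "u1 * (u1 * u1) = \<sigma> * (u1 * u1) - (\<sigma>^2 + \<sigma> / 2 - 1 / 2) * u1"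
    proof -
      have "u1 * (u1 * u1) = u1 * (\<sigma> * u1 - (\<sigma>^2 + \<sigma> / 2 - 1 / 2))" using q by simp
      then show ?thesis by (simp add: algebra_simps)
    qed
    finally have "p u1 = p (- 1 / 2 - \<sigma>)"
      unfolding q p_def by (simp add: field_simps power2_eq_square power3_eq_cube)
    then show ?thesis using r by simp
  qed
  have k: "k = 2" unfolding k_def unfolding n by simp
  have s0: "\<sigma> \<le> - 6 / 7"
  proof -
    have "pi / 2 \<le> \<theta> k" unfolding \<theta>_def unfolding k n by simp
    then have "u1 \<le> cos (pi / 2)" unfolding u1_def using k_bounds
      by (intro cos_monotone_0_pi_le \<theta>_le_pi) auto
    moreover have "5 * pi / 6 \<le> \<theta> (k + 1)" unfolding \<theta>_def unfolding k n by simp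
    then have "u2 \<le> cos (5 * pi / 6)" unfolding u2_def using k_bounds
      by (intro cos_monotone_0_pi_le \<theta>_le_pi) auto
    moreover have "cos (5 * pi / 6) = - (sqrt 3 / 2)"
    proof -
      have "5 * pi / 6 = pi - pi / 6" by simp
      then show ?thesis by (simp only: cos_pi_minus cos_30)
    qed
    moreover have "17321 / 10000 > sqrt 3" by (rule real_less_lsqrt) (simp_all add: power2_eq_square)
    moreover have "12 / 7 < sqrt 3" by (rule real_less_rsqrt) (simp add: power2_eq_square)
    ultimately show ?thesis unfolding \<sigma>_def by simp
  qed
  define z where "z = - 1 / 2 - \<sigma>"
  have z: "z \<ge> 5 / 14" "p z = 0" using s0 third by (auto simp: z_def)
  \<comment> \<open>The zero is \<open>cos (2 \<pi> / 7) = 0.6234\<dots>\<close>, and the last inequality of the proof fails below about \<open>0.611\<close>.\<close>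
  have "z \<ge> 615 / 1000"
  proof (rule ccontr)
    assume "\<not> ?thesis"
    then have lt: "z < 615 / 1000" by simp
    have "p (615 / 1000) - p z = (615 / 1000 - z) * (8 * ((615/1000)^2 + 615/1000 * z + z * z) + 4 * (615/1000 + z) - 4)"
      unfolding p_def by (simp add: field_simps power2_eq_square power3_eq_cube)
    moreover have "0 < (615 / 1000 - z) * (8 * ((615/1000)^2 + 615/1000 * z + z * z) + 4 * (615/1000 + z) - 4)"
    proof (intro mult_pos_pos)
      have "0 \<le> z * z" by simp
      moreover have "8 * ((615/1000)^2 + 615/1000 * z + z * z) + 4 * (615/1000 + z) - 4
          = 7429 / 5000 + 223 / 25 * z + 8 * (z * z)"
        by (simp add: field_simps power2_eq_square)
      ultimately show "0 < 8 * ((615/1000)^2 + 615/1000 * z + z * z) + 4 * (615/1000 + z) - 4"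
        using z(1) by linarith
    qed (use lt in simp)
    moreover have "p (615 / 1000) < 0" unfolding p_def by (simp add: power2_eq_square power3_eq_cube)
    ultimately show False using z(2) by simp
  qed
  then have x: "- 2 - 2 * \<sigma> \<ge> 23 / 100" by (simp add: z_def)
  define x where "x = - 2 - 2 * \<sigma>"
  have x: "23 / 100 \<le> x" "x \<le> 1"
  proof -
    show "23 / 100 \<le> x" using x by (simp add: x_def)
    have "\<sigma> \<ge> - 3 / 2" using u1_ge u2_ge by (simp add: \<sigma>_def)
    then show "x \<le> 1" by (simp add: x_def)
  qed
  have e: "(1 + 2 * u1) + (1 + 2 * u2) = - x" "(1 + 2 * u1) * (1 + 2 * u2) = - 1 + 2 * x + x^2"
  proof -
    show "(1 + 2 * u1) + (1 + 2 * u2) = - x" by (simp add: x_def \<sigma>_def)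
    have "(1 + 2 * u1) * (1 + 2 * u2) = 1 + 2 * \<sigma> + 4 * (u1 * u2)" by (simp add: \<sigma>_def algebra_simps)
    then show "(1 + 2 * u1) * (1 + 2 * u2) = - 1 + 2 * x + x^2"
      unfolding pi x_def by (simp add: field_simps power2_eq_square)
  qed
  have T: "T3 = x / 6 + 1 - 2 * x - x^2" unfolding T3_eq e unfolding n by simp
  have V: "V3 = - x * T3 + (- 1 + 2 * x + x^2) / 6" unfolding V3_eq e unfolding n by simp
  have "0 \<le> 2 - 1 / 6 - 3 * T3 + V3"
  proof -
    have "2 - 1 / 6 - 3 * T3 + V3 = - 4 / 3 + 29 / 6 * x + 5 * x^2 + x * x^2"
      unfolding V T by (simp add: field_simps power2_eq_square)
    moreover have "(23 / 100)^2 \<le> x^2" using x by (intro power_mono) auto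
    then have x2: "529 / 10000 \<le> x^2" by (simp add: power2_eq_square)
    moreover have "23 / 100 * (529 / 10000) \<le> x * x^2" using x x2 by (intro mult_mono) auto
    ultimately show ?thesis using x by simp
  qed
  then show ?thesis using n by (intro Wc_nonpos_if) auto
qed

lemma Wc_mean_5: "n = 5 \<Longrightarrow> l1 * Wc n u1 + l2 * Wc n u2 = - 7 / 60"
  and params_5: "n = 5 \<Longrightarrow> S1 = 4 / 3"
proof -
  assume n: "n = 5"
  have k: "k = 2" unfolding k_def unfolding n by simp
  have u: "u1 = - 1 / 2" "u2 = - 1"
    unfolding u1_def u2_def \<theta>_def unfolding k n using cos_120 by simp_all
  have m: "m0 = - 6 / 10" unfolding m0_def unfolding n by simp
  have l: "l1 = 4 / 5" "l2 = 1 / 5" unfolding l1_def l2_def u m by simp_all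
  show "l1 * Wc n u1 + l2 * Wc n u2 = - 7 / 60"
    unfolding Wc_mean unfolding T3_def T4_def l u unfolding n by (simp add: power2_eq_square)
  show "S1 = 4 / 3" unfolding S1_def u unfolding n by simp
qed

text \<open>Consecutive values \<open>u1\<close> and \<open>u2\<close> differ by at most \<open>2 \<pi> / (n + 1)\<close>, which bounds the deviations in \<open>T3_variance\<close> when \<open>n \<ge> 9\<close>; the
  smaller degrees are explicit.\<close>

lemma Wc_nonpos: "4 \<le> n \<Longrightarrow> l1 * Wc n u1 + l2 * Wc n u2 \<le> 0"
proof -
  assume n4: "4 \<le> n"
  consider "n = 4" | "n = 5" | "n = 6" | "n = 7" | "n = 8" | "9 \<le> n" using n4 by linarith
  then show ?thesis
  proof cases
    case 1
    then show ?thesis by (rule Wc_nonpos_4)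
  next
    case 2
    then show ?thesis using Wc_mean_5 by simp
  next
    case 3
    then show ?thesis by (rule Wc_nonpos_6)
  next
    case 4
    have k: "k = 2" unfolding k_def unfolding 4 by simp
    have u: "u1 = 0" "u2 = - (sqrt 2 / 2)"
    proof -
      show "u1 = 0" unfolding u1_def \<theta>_def unfolding k 4 by simp
      have "2 * pi * real 3 / (real 7 + 1) = pi - pi / 4" by simp
      then have "cos (2 * pi * real 3 / (real 7 + 1)) = - (sqrt 2 / 2)"
        by (simp only: cos_pi_minus cos_45)
      then show "u2 = - (sqrt 2 / 2)" unfolding u2_def \<theta>_def unfolding k 4 by simp
    qed
    have "sqrt 2 \<le> 3 / 2" by (rule real_le_lsqrt) (simp_all add: power2_eq_square)
    then have "4 * T3 \<le> 2 - 1 / real n" unfolding T3_eq u unfolding 4 by (simp add: field_simps)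
    then show ?thesis by (rule Wc_nonpos_if_T3[OF n4])
  next
    case 5
    have k: "k = 3" unfolding k_def unfolding 5 by simp
    have "u1 = - 1 / 2" unfolding u1_def \<theta>_def unfolding k 5 using cos_120 by simp
    then have "T3 = - (1 + 2 * u2) / 8" unfolding T3_eq using 5 by simp
    moreover have "real n = 8" using 5 by simp
    ultimately have "4 * T3 \<le> 2 - 1 / real n" using u2_ge by simp
    then show ?thesis by (rule Wc_nonpos_if_T3[OF n4])
  next
    case 6
    define d where "d = 2 * pi / (real n + 1)"
    have d: "0 \<le> d" "d \<le> 63 / 100"
    proof -
      show "0 \<le> d" unfolding d_def by simp
      have "2 * pi \<le> 63 / 100 * 10" using pi_approx by simp
      also have "\<dots> \<le> 63 / 100 * (real n + 1)" using 6 by simp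
      finally show "d \<le> 63 / 100" unfolding d_def by (simp add: field_simps)
    qed
    have "u1 - u2 \<le> d"
    proof -
      have "\<bar>cos (\<theta> k) - cos (\<theta> (k + 1))\<bar> \<le> \<bar>\<theta> k - \<theta> (k + 1)\<bar>"
      proof -
        have "cos x - cos y = 2 * sin ((x + y) / 2) * sin ((y - x) / 2)" for x y :: real by (rule cos_diff_cos)
        then have "\<bar>cos (\<theta> k) - cos (\<theta> (k + 1))\<bar> = 2 * \<bar>sin ((\<theta> k + \<theta> (k + 1)) / 2)\<bar> * \<bar>sin ((\<theta> (k + 1) - \<theta> k) / 2)\<bar>"
          by (simp add: abs_mult)
        also have "\<dots> \<le> 2 * 1 * \<bar>(\<theta> (k + 1) - \<theta> k) / 2\<bar>"
          by (intro mult_mono abs_sin_x_le_abs_x) auto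
        finally show ?thesis by simp
      qed
      moreover have "\<theta> (k + 1) - \<theta> k = d" unfolding \<theta>_def d_def diff_divide_distrib[symmetric] by (simp add: algebra_simps)
      ultimately show ?thesis using d u2_less_u1 unfolding u1_def[symmetric] u2_def[symmetric] by linarith
    qed
    \<comment> \<open>The deviations of \<open>1 + 2 u1\<close> and \<open>1 + 2 u2\<close> from the mean \<open>- 1 / n\<close>; their sum is \<open>2 (u1 - u2)\<close>.\<close>
    define x y where "x = 1 + 2 * u1 + 1 / real n" and "y = - 1 / real n - (1 + 2 * u2)"
    have "x * y \<le> ((x + y) / 2) ^ 2"
    proof -
      have "0 \<le> ((x - y) / 2)^2" by simp
      then show ?thesis by (simp add: power2_eq_square field_simps)
    qed
    also have "(x + y) / 2 = u1 - u2" unfolding x_def y_def by simp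
    also have "(u1 - u2)^2 \<le> (63 / 100)^2" using u2_less_u1 \<open>u1 - u2 \<le> d\<close> d by (intro power_mono) auto
    finally have "x * y \<le> 3969 / 10000" by (simp add: power2_eq_square)
    moreover have "1 / real n \<le> 1 / 9" using 6 by (simp add: field_simps)
    then have "1 / real n ^ 2 \<le> 1 / 81" using 6 by (simp add: field_simps power2_eq_square mult_mono[of 9 "real n" 9 "real n", simplified])
    ultimately have "4 * T3 \<le> 2 - 1 / real n"
      using \<open>1 / real n \<le> 1 / 9\<close> unfolding T3_variance x_def[symmetric] y_def[symmetric] by simp
    then show ?thesis by (rule Wc_nonpos_if_T3[OF n4])
  qed
qed

end

section \<open>Fourth moments of balanced reals\<close>

lemma fourth_moment_3:
  fixes y :: "nat \<Rightarrow> real"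
  assumes "(\<Sum>j<3. y j) = 0"
  shows "(\<Sum>j<3. y j ^ 4) = (\<Sum>j<3. y j ^ 2) ^ 2 / 2"
proof -
  have e: "(\<Sum>j<3. f j) = f 0 + f 1 + f 2" for f :: "nat \<Rightarrow> real" by (simp add: eval_nat_numeral)
  have y2: "y 2 = - y 0 - y 1" using assms unfolding e by simp
  show ?thesis unfolding e y2 by (simp add: field_simps power2_eq_square power4_eq_xxxx)
qed

lemma sum_squares_ge_sum_fourth:
  fixes w :: "'b \<Rightarrow> real"
  assumes "finite I"
  shows "(\<Sum>j\<in>I. w j ^ 4) \<le> (\<Sum>j\<in>I. w j ^ 2) ^ 2"
proof -
  have "(\<Sum>j\<in>I. w j ^ 4) = (\<Sum>j\<in>I. w j ^ 2 * w j ^ 2)"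
    by (intro sum.cong refl) (simp flip: power_add)
  also have "\<dots> \<le> (\<Sum>j\<in>I. w j ^ 2 * (\<Sum>i\<in>I. w i ^ 2))"
    using assms by (intro sum_mono mult_left_mono member_le_sum) auto
  also have "\<dots> = (\<Sum>j\<in>I. w j ^ 2) ^ 2" by (simp add: sum_distrib_right power2_eq_square)
  finally show ?thesis .
qed

text \<open>The bound is attained at multiples of \<open>(4, -1, -1, -1, -1)\<close>. With the largest entry \<open>a\<close> split off, the deviations \<open>w j\<close> of the other entries from \<open>- a / 4\<close>
  have sum zero, and the difference of the two sides is a sum of nonnegative terms
  \<open>w\<^sup>2 (5/4 a\<^sup>2 + a w - 7/20 w\<^sup>2)\<close> and \<open>13/20 ((\<Sum>w\<^sup>2)\<^sup>2 - \<Sum>w\<^sup>4)\<close>.\<close>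

lemma fourth_moment_5_aux:
  fixes y :: "nat \<Rightarrow> real"
  assumes sum: "(\<Sum>j<5. y j) = 0" and m: "m < 5" and big: "\<And>j. j < 5 \<Longrightarrow> \<bar>y j\<bar> \<le> y m"
  shows "(\<Sum>j<5. y j ^ 4) \<le> 13 / 20 * (\<Sum>j<5. y j ^ 2) ^ 2"
proof -
  define a where "a = y m"
  define I where "I = {..<5} - {m}"
  have I: "finite I" "card I = 4" using m by (auto simp: I_def)
  define w where "w j = y j + a / 4" for j
  define W where "W k = (\<Sum>j\<in>I. w j ^ k)" for k
  have split: "(\<Sum>j<5. f j) = f m + (\<Sum>j\<in>I. f j)" for f :: "nat \<Rightarrow> real"
    unfolding I_def using m by (subst sum.remove[of _ m]) auto
  have y: "y j = w j - a / 4" for j by (simp add: w_def)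
  have W1: "(\<Sum>j\<in>I. w j) = 0"
    using sum unfolding split w_def sum.distrib using I by (simp add: a_def)
  have W2: "(\<Sum>j<5. y j ^ 2) = 5 / 4 * a^2 + W 2"
  proof -
    have "(\<Sum>j\<in>I. y j ^ 2) = (\<Sum>j\<in>I. w j ^ 2 - a / 2 * w j + a^2 / 16)"
      unfolding y by (intro sum.cong refl) (simp add: field_simps power2_eq_square)
    also have "\<dots> = W 2 + a^2 / 4"
      unfolding sum.distrib sum_subtractf sum_distrib_left[symmetric] W1 W_def using I by simp
    finally show ?thesis unfolding split by (simp add: a_def)
  qed
  have W4: "(\<Sum>j<5. y j ^ 4) = 65 / 64 * a^4 + 3 / 8 * a^2 * W 2 - a * W 3 + W 4"
  proof -
    have "(\<Sum>j\<in>I. y j ^ 4) = (\<Sum>j\<in>I. w j ^ 4 - a * w j ^ 3 + 3 / 8 * a^2 * w j ^ 2 - a^3 / 16 * w j + a^4 / 256)"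
      unfolding y by (intro sum.cong refl) (simp add: field_simps power2_eq_square power3_eq_cube power4_eq_xxxx)
    also have "\<dots> = W 4 - a * W 3 + 3 / 8 * a^2 * W 2 + a^4 / 64"
      unfolding sum.distrib sum_subtractf sum_distrib_left[symmetric] W1 W_def using I by simp
    finally show ?thesis unfolding split by (simp add: a_def)
  qed
  have "0 \<le> (\<Sum>j\<in>I. w j ^ 2 * (5 / 4 * a^2 + a * w j - 7 / 20 * w j ^ 2))"
  proof (intro sum_nonneg mult_nonneg_nonneg)
    fix j assume "j \<in> I"
    then have j: "- a \<le> y j" "y j \<le> a" using big[of j] by (auto simp: I_def a_def)
    then have "0 \<le> (w j + 3 / 4 * a) * (5 / 4 * a - w j)" by (simp add: w_def)
    then have 1: "w j ^ 2 \<le> a * w j / 2 + 15 / 16 * a^2"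
      by (simp add: field_simps power2_eq_square)
    have "0 \<le> a" using big[OF m] by (simp add: a_def)
    then have "0 \<le> a * (w j + 3 / 4 * a)" using j by (simp add: w_def)
    then have 2: "a * w j \<ge> - 3 / 4 * a^2" by (simp add: field_simps power2_eq_square)
    have "0 \<le> a^2" by simp
    then show "0 \<le> 5 / 4 * a^2 + a * w j - 7 / 20 * w j ^ 2" using 1 2 by linarith
  qed auto
  also have "(\<Sum>j\<in>I. w j ^ 2 * (5 / 4 * a^2 + a * w j - 7 / 20 * w j ^ 2))
      = (\<Sum>j\<in>I. 5 / 4 * a^2 * w j ^ 2 + a * w j ^ 3 - 7 / 20 * w j ^ 4)"
    by (intro sum.cong refl) (simp add: algebra_simps power2_eq_square power3_eq_cube power4_eq_xxxx)
  also have "\<dots> = 5 / 4 * a^2 * W 2 + a * W 3 - 7 / 20 * W 4"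
    unfolding sum.distrib sum_subtractf sum_distrib_left[symmetric] W_def ..
  finally have 1: "0 \<le> 5 / 4 * a^2 * W 2 + a * W 3 - 7 / 20 * W 4" .
  have 2: "W 4 \<le> (W 2)^2" unfolding W_def by (rule sum_squares_ge_sum_fourth[OF I(1)])
  have "13 / 20 * (\<Sum>j<5. y j ^ 2) ^ 2 - (\<Sum>j<5. y j ^ 4)
     = (5 / 4 * a^2 * W 2 + a * W 3 - 7 / 20 * W 4) + 13 / 20 * ((W 2)^2 - W 4)"
    unfolding W2 W4 by (simp add: field_simps power2_eq_square power4_eq_xxxx)
  moreover have "0 \<le> 13 / 20 * ((W 2)^2 - W 4)" using 2 by simp
  ultimately show ?thesis using 1 by linarith
qed

lemma exists_max_abs:
  fixes y :: "nat \<Rightarrow> real"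
  assumes "0 < n"
  obtains m where "m < n" "\<And>j. j < n \<Longrightarrow> \<bar>y j\<bar> \<le> \<bar>y m\<bar>"
proof -
  have "Max ((\<lambda>j. \<bar>y j\<bar>) ` {..<n}) \<in> (\<lambda>j. \<bar>y j\<bar>) ` {..<n}"
    using assms by (intro Max_in) auto
  then obtain m where "m < n" "Max ((\<lambda>j. \<bar>y j\<bar>) ` {..<n}) = \<bar>y m\<bar>" by auto
  moreover have "\<bar>y j\<bar> \<le> Max ((\<lambda>j. \<bar>y j\<bar>) ` {..<n})" if "j < n" for j
    using that by (intro Max_ge) auto
  ultimately show thesis using that by metis
qed

lemma fourth_moment_5:
  fixes y :: "nat \<Rightarrow> real"
  assumes sum: "(\<Sum>j<5. y j) = 0"
  shows "(\<Sum>j<5. y j ^ 4) \<le> 13 / 20 * (\<Sum>j<5. y j ^ 2) ^ 2"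
proof -
  obtain m where m: "m < 5" "\<And>j. j < 5 \<Longrightarrow> \<bar>y j\<bar> \<le> \<bar>y m\<bar>"
    using exists_max_abs[of 5 y] by auto
  show ?thesis
  proof (cases "0 \<le> y m")
    case True
    then show ?thesis using m by (intro fourth_moment_5_aux[OF sum m(1)]) auto
  next
    case False
    have "(\<Sum>j<5. (- y j) ^ 4) \<le> 13 / 20 * (\<Sum>j<5. (- y j) ^ 2) ^ 2"
      using m False sum by (intro fourth_moment_5_aux[of "\<lambda>j. - y j" m]) (auto simp: sum_negf)
    then show ?thesis by simp
  qed
qed

text \<open>If the third moment nearly vanishes, the largest entry \<open>a\<close> must nearly be balanced by the smallest entry \<open>- b\<close>, up to the
  sum of squares \<open>R2\<close> of the remaining entries: \<open>a (a\<^sup>2 - b\<^sup>2) \<le> \<bar>e\<bar> + a R2\<close>, where \<open>e\<close> is the third moment. Squaring this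
  inequality compares \<open>2 (a\<^sup>4 + b\<^sup>4)\<close> with \<open>(a\<^sup>2 + b\<^sup>2)\<^sup>2\<close>. The hypothesis on \<open>e\<close> keeps the mixed term under control,
  since \<open>a \<le> n b\<close>.\<close>

lemma fourth_moment_aux:
  fixes y :: "nat \<Rightarrow> real"
  assumes sum: "(\<Sum>j<n. y j) = 0" and m: "m < n" and big: "\<And>j. j < n \<Longrightarrow> \<bar>y j\<bar> \<le> y m"
    and small: "\<bar>\<Sum>j<n. y j ^ 3\<bar> * real n ^ 2 \<le> y m ^ 3" and pos: "0 < y m"
  shows "2 * y m ^ 2 * (\<Sum>j<n. y j ^ 4) \<le> y m ^ 2 * (\<Sum>j<n. y j ^ 2) ^ 2 + (\<Sum>j<n. y j ^ 3) ^ 2"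
proof -
  define a where "a = y m"
  define e where "e = (\<Sum>j<n. y j ^ 3)"
  have n: "0 < n" using m by simp
  obtain q where q: "q < n" "\<And>j. j < n \<Longrightarrow> y q \<le> y j"
  proof -
    have "Min (y ` {..<n}) \<in> y ` {..<n}" using n by (intro Min_in) auto
    then obtain q where "q < n" "Min (y ` {..<n}) = y q" by auto
    moreover have "Min (y ` {..<n}) \<le> y j" if "j < n" for j using that by (intro Min_le) auto
    ultimately show thesis using that by metis
  qed
  define b where "b = - y q"
  have lower: "- b \<le> y j" if "j < n" for j using q(2)[OF that] by (simp add: b_def)
  have "a \<le> real n * b"
  proof -
    have b0: "0 \<le> b"
    proof (rule ccontr)
      assume "\<not> 0 \<le> b"
      then have "0 < y j" if "j < n" for j using lower[OF that] by simp
      then have "0 < (\<Sum>j<n. y j)" using n by (intro sum_pos) auto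
      then show False using sum by simp
    qed
    have "- (real (n - 1) * b) \<le> (\<Sum>j\<in>{..<n} - {m}. y j)"
      using sum_bounded_below[of "{..<n} - {m}" "- b" y] lower m by simp
    moreover have "(\<Sum>j<n. y j) = a + (\<Sum>j\<in>{..<n} - {m}. y j)"
      unfolding a_def using m by (subst sum.remove[of _ m]) auto
    moreover have "real (n - 1) * b \<le> real n * b" using b0 by (intro mult_right_mono) auto
    ultimately show ?thesis using sum by simp
  qed
  moreover have a: "0 < a" using pos by (simp add: a_def)
  ultimately have b: "0 < b" using n by (metis mult_pos_pos mult_nonneg_nonpos not_less of_nat_0_le_iff order_less_le_trans linorder_not_less)
  have ba: "b \<le> a" using big[OF q(1)] by (simp add: a_def b_def)
  have qm: "q \<noteq> m" using a b by (auto simp: a_def b_def)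
  define R where "R = {..<n} - {m} - {q}"
  have split: "(\<Sum>j<n. f j) = f m + (f q + (\<Sum>j\<in>R. f j))" for f :: "nat \<Rightarrow> real"
  proof -
    have "(\<Sum>j<n. f j) = f m + (\<Sum>j\<in>{..<n} - {m}. f j)" using m by (subst sum.remove[of _ m]) auto
    also have "(\<Sum>j\<in>{..<n} - {m}. f j) = f q + (\<Sum>j\<in>R. f j)"
      unfolding R_def using q qm by (subst sum.remove[of _ q]) auto
    finally show ?thesis .
  qed
  define R2 R4 where "R2 = (\<Sum>j\<in>R. y j ^ 2)" and "R4 = (\<Sum>j\<in>R. y j ^ 4)"
  have yR: "\<bar>y j\<bar> \<le> a" if "j \<in> R" for j using that big by (auto simp: R_def a_def)
  have R1: "(\<Sum>j\<in>R. y j) = b - a" using sum unfolding split by (simp add: a_def b_def)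
  have e: "e = a ^ 3 - b ^ 3 + (\<Sum>j\<in>R. y j ^ 3)" unfolding e_def split by (simp add: a_def b_def)
  have R2: "0 \<le> R2" unfolding R2_def by (intro sum_nonneg) auto
  have R3: "- (a * R2) \<le> (\<Sum>j\<in>R. y j ^ 3)"
  proof -
    have "- (a * R2) = (\<Sum>j\<in>R. - a * y j ^ 2)" unfolding R2_def by (simp add: sum_distrib_left sum_negf)
    also have "\<dots> \<le> (\<Sum>j\<in>R. y j ^ 3)"
    proof (intro sum_mono)
      fix j assume "j \<in> R"
      then have "- a * y j ^ 2 \<le> y j * y j ^ 2" using yR[of j] by (intro mult_right_mono) auto
      then show "- a * y j ^ 2 \<le> y j ^ 3" by (simp add: power2_eq_square power3_eq_cube)
    qed
    finally show ?thesis .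
  qed
  have R4: "R4 \<le> a^2 * R2"
  proof -
    have "R4 \<le> (\<Sum>j\<in>R. a^2 * y j ^ 2)" unfolding R4_def
    proof (intro sum_mono)
      fix j assume "j \<in> R"
      then have "y j ^ 2 \<le> a ^ 2" using yR[of j] by (simp add: abs_le_square_iff[symmetric])
      then have "y j ^ 2 * y j ^ 2 \<le> a^2 * y j ^ 2" by (intro mult_right_mono) auto
      then show "y j ^ 4 \<le> a^2 * y j ^ 2" by (simp flip: power_add)
    qed
    then show ?thesis unfolding R2_def by (simp add: sum_distrib_left)
  qed
  have "a * (a^2 - b^2) \<le> \<bar>e\<bar> + a * R2"
  proof -
    have "0 \<le> (a - b) * b^2" using ba by (intro mult_nonneg_nonneg) auto
    then have "a * (a^2 - b^2) \<le> a^3 - b^3" by (simp add: algebra_simps power2_eq_square power3_eq_cube)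
    then show ?thesis using e R3 by linarith
  qed
  moreover have "0 \<le> a * (a^2 - b^2)" using a b ba by (simp add: power_mono)
  ultimately have "(a * (a^2 - b^2))^2 \<le> (\<bar>e\<bar> + a * R2)^2" by (intro power_mono) auto
  then have sq: "a^2 * (a^2 - b^2)^2 \<le> e^2 + 2 * \<bar>e\<bar> * (a * R2) + a^2 * R2^2"
    by (simp add: power2_eq_square algebra_simps)
  have ab: "\<bar>e\<bar> \<le> a * b^2"
  proof -
    have "\<bar>e\<bar> * real n ^ 2 \<le> a^3" using small by (simp add: e_def a_def)
    also have "a^3 = a * a^2" by (simp add: power2_eq_square power3_eq_cube)
    also have "\<dots> \<le> a * (real n * b)^2"
      using \<open>a \<le> real n * b\<close> a by (intro mult_left_mono power_mono) auto
    finally have "\<bar>e\<bar> * real n ^ 2 \<le> (a * b^2) * real n ^ 2" by (simp add: power_mult_distrib mult_ac)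
    then show ?thesis using n by (simp add: mult_le_cancel_right)
  qed
  have s2: "(\<Sum>j<n. y j ^ 2) = a^2 + (b^2 + R2)" and s4: "(\<Sum>j<n. y j ^ 4) = a^4 + (b^4 + R4)"
    unfolding split R2_def R4_def a_def b_def by simp_all
  have "a^2 * (a^2 + (b^2 + R2))^2 + e^2 - 2 * a^2 * (a^4 + (b^4 + R4))
     = (e^2 + 2 * \<bar>e\<bar> * (a * R2) + a^2 * R2^2 - a^2 * (a^2 - b^2)^2)
       + 2 * a^2 * (a^2 * R2 - R4) + 2 * a * R2 * (a * b^2 - \<bar>e\<bar>)"
    by (simp add: algebra_simps power2_eq_square power4_eq_xxxx)
  moreover have "0 \<le> 2 * a^2 * (a^2 * R2 - R4)" using R4 by (intro mult_nonneg_nonneg) auto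
  moreover have "0 \<le> 2 * a * R2 * (a * b^2 - \<bar>e\<bar>)" using a R2 ab by (intro mult_nonneg_nonneg) auto
  ultimately show ?thesis using sq unfolding s2 s4 a_def[symmetric] e_def[symmetric] by linarith
qed

text \<open>The previous bound up to a change of sign, which makes the entry of largest modulus positive; \<open>a\<close> is this modulus.\<close>

lemma fourth_moment:
  fixes y :: "nat \<Rightarrow> real"
  assumes sum: "(\<Sum>j<n. y j) = 0" and n: "0 < n"
  shows "\<exists>a\<ge>0. (\<Sum>j<n. y j ^ 2) \<le> real n * a^2 \<and>
     (\<bar>\<Sum>j<n. y j ^ 3\<bar> * real n ^ 2 \<le> a ^ 3 \<longrightarrow> 0 < a \<longrightarrow>
       2 * a^2 * (\<Sum>j<n. y j ^ 4) \<le> a^2 * (\<Sum>j<n. y j ^ 2) ^ 2 + (\<Sum>j<n. y j ^ 3) ^ 2)"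
proof -
  obtain m where m: "m < n" "\<And>j. j < n \<Longrightarrow> \<bar>y j\<bar> \<le> \<bar>y m\<bar>"
    using exists_max_abs[of n y] n by auto
  have "(\<Sum>j<n. y j ^ 2) \<le> (\<Sum>j<n. \<bar>y m\<bar> ^ 2)"
    by (intro sum_mono) (use m in \<open>auto simp: abs_le_square_iff[symmetric]\<close>)
  then have 1: "(\<Sum>j<n. y j ^ 2) \<le> real n * \<bar>y m\<bar>^2" by simp
  show ?thesis
  proof (cases "0 \<le> y m")
    case True
    show ?thesis
    proof (intro exI[of _ "y m"] conjI impI)
      assume "\<bar>\<Sum>j<n. y j ^ 3\<bar> * real n ^ 2 \<le> y m ^ 3" "0 < y m"
      then show "2 * y m ^ 2 * (\<Sum>j<n. y j ^ 4) \<le> y m ^ 2 * (\<Sum>j<n. y j ^ 2) ^ 2 + (\<Sum>j<n. y j ^ 3) ^ 2"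
        using m True by (intro fourth_moment_aux[OF sum m(1)]) auto
    qed (use 1 True in auto)
  next
    case False
    show ?thesis
    proof (intro exI[of _ "- y m"] conjI impI)
      assume "\<bar>\<Sum>j<n. y j ^ 3\<bar> * real n ^ 2 \<le> (- y m) ^ 3" "0 < - y m"
      then have "2 * (- y m) ^ 2 * (\<Sum>j<n. (- y j) ^ 4) \<le> (- y m) ^ 2 * (\<Sum>j<n. (- y j) ^ 2) ^ 2 + (\<Sum>j<n. (- y j) ^ 3) ^ 2"
        using m False sum by (intro fourth_moment_aux[of "\<lambda>j. - y j" n m]) (auto simp: sum_negf)
      then show "2 * (- y m) ^ 2 * (\<Sum>j<n. y j ^ 4) \<le> (- y m) ^ 2 * (\<Sum>j<n. y j ^ 2) ^ 2 + (\<Sum>j<n. y j ^ 3) ^ 2"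
        by (simp add: sum_negf)
    qed (use 1 False in auto)
  qed
qed

context active_pair
begin

text \<open>\<open>pstar\<close> is the largest possible value of \<open>p4 / h\<^sup>4\<close> in the limit, and \<open>c2\<close> is the resulting coefficient of \<open>h\<^sup>4\<close> in \<open>r\<close>.\<close>

definition "pstar = (if n = 5 then 13 / 20 else 1 / 2) * S1^2"
definition "c2 = - (l1 * Zc n u1 c1 S1 pstar + l2 * Zc n u2 c1 S1 pstar)"

lemma Zc_shift: "Zc n u c S p = Zc n u c S q + Wc n u * (p - q)"
proof -
  have "second n u S p = second n u S q + Wc n u / 2 * (p - q)"
    unfolding second_def Wc_def by (simp add: field_simps)
  then show ?thesis unfolding Zc_def by (simp add: field_simps)
qed

lemma c2_eq: "c2 = DD + (if n = 5 then 7 / 225 else 0)"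
proof -
  have "c2 = - (l1 * Zc n u1 c1 S1 (S1^2 / 2) + l2 * Zc n u2 c1 S1 (S1^2 / 2))
      - (l1 * Wc n u1 + l2 * Wc n u2) * (pstar - S1^2 / 2)"
    unfolding c2_def Zc_shift[of _ c1 S1 pstar "S1^2 / 2"] by (simp add: algebra_simps)
  then have c2: "c2 = DD - (l1 * Wc n u1 + l2 * Wc n u2) * (pstar - S1^2 / 2)"
    unfolding Zc_balanced_mean by simp
  show ?thesis
  proof (cases "n = 5")
    case True
    have "pstar - S1^2 / 2 = 4 / 15"
      unfolding pstar_def if_P[OF True] params_5[OF True] by (simp add: power2_eq_square)
    then show ?thesis unfolding c2 Wc_mean_5[OF True] if_P[OF True] by simp
  next
    case False
    then show ?thesis unfolding c2 pstar_def by simp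
  qed
qed

definition "\<nu> = (if n = 3 \<or> n = 5 then 3 else 4 :: nat)"

lemma nu: "3 \<le> \<nu>" "\<nu> \<le> 4" by (auto simp: \<nu>_def)

end

section \<open>The upper bound\<close>

text \<open>A family of admissible \<open>v\<close> whose radius \<open>r\<close> is not much worse than the radius to be proved optimal. Everything
  about its shape is deduced from this lower bound on \<open>r\<close>.\<close>

locale near_optimal = small_scale F h + active_pair n k
  for F :: "'a filter" and h :: "'a \<Rightarrow> real" and n k +
  fixes r :: "'a \<Rightarrow> real" and v :: "nat \<Rightarrow> 'a \<Rightarrow> complex" and K :: real
  assumes v: "j < n \<Longrightarrow> eventually (\<lambda>x. v j x \<noteq> 0 \<and> norm (v j x) \<le> 1) F"
    and adm: "eventually (\<lambda>x. admissible n (1 - h x ^ 2) (r x) (\<lambda>j. v j x)) F"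
    and r_ge: "eventually (\<lambda>x. 1 + c1 * h x ^ 2 - K * h x ^ 4 \<le> r x) F"
begin

lemma v_all: "eventually (\<lambda>x. \<forall>j<n. v j x \<noteq> 0 \<and> norm (v j x) \<le> 1) F"
proof -
  have "eventually (\<lambda>x. \<forall>j\<in>{..<n}. v j x \<noteq> 0 \<and> norm (v j x) \<le> 1) F"
    by (rule eventually_ball_finite) (use v in auto)
  then show ?thesis by eventually_elim auto
qed

definition V where "V x = Re (\<Sum>j<n. v j x)"

lemma V_le: "eventually (\<lambda>x. \<forall>j<n. norm (v j x - 1) ^ 2 \<le> 2 * (real n - V x) \<and> 1 - norm (v j x) ^ 2 \<le> 2 * (real n - V x)) F"
  using v_all
proof eventually_elim
  case (elim x)
  show ?case
  proof (intro allI impI)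
    fix j assume j: "j < n"
    have nn: "0 \<le> 1 - Re (v i x)" if "i < n" for i
      using elim that complex_Re_le_cmod[of "v i x"] by force
    have "1 - Re (v j x) \<le> (\<Sum>i<n. 1 - Re (v i x))"
      using j nn by (intro member_le_sum) auto
    also have "\<dots> = real n - V x" by (simp add: V_def sum_subtractf)
    finally have a: "1 - Re (v j x) \<le> real n - V x" .
    have nv: "norm (v j x) ^ 2 \<le> 1" using elim j by (simp add: power_le_one)
    have "norm (v j x - 1) ^ 2 = norm (v j x) ^ 2 + 1 - 2 * Re (v j x)"
      unfolding cmod_power2 by (simp add: power2_eq_square algebra_simps)
    moreover have "Re (v j x) ^ 2 \<le> norm (v j x) ^ 2" by (simp add: cmod_power2)
    moreover have "2 * Re (v j x) - 1 \<le> Re (v j x) ^ 2"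
      using zero_le_power2[of "Re (v j x) - 1"] by (simp add: power2_eq_square algebra_simps)
    moreover have "A \<le> 2 * N \<and> 1 - B \<le> 2 * N"
      if "A = B + 1 - 2 * R" "R2 \<le> B" "2 * R - 1 \<le> R2" "1 - R \<le> N" "B \<le> 1" for A B R R2 N :: real
      using that by linarith
    ultimately show "norm (v j x - 1) ^ 2 \<le> 2 * (real n - V x) \<and> 1 - norm (v j x) ^ 2 \<le> 2 * (real n - V x)"
      using a nv by blast
  qed
qed

lemma V_n: "eventually (\<lambda>x. V x \<le> real n) F"
  using V_le
proof eventually_elim
  case (elim x)
  have "0 \<le> norm (v 0 x - 1) ^ 2" by simp
  also have "\<dots> \<le> 2 * (real n - V x)" using elim n3 by auto
  finally show ?case by simp
qed

text \<open>With \<open>r \<ge> 1 - O(h\<^sup>2)\<close> the sum rule forces \<open>\<Sum>(1 - Re v\<^sub>j) = O(h\<^sup>2)\<close>, hence \<open>v\<^sub>j = 1 + O(h)\<close>, and also \<open>r \<le> 1 + O(h\<^sup>2)\<close>.\<close>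

lemma sum_rule_scaled: "eventually (\<lambda>x. real n * r x ^ 2 - (1 - h x ^ 2) * r x * V x \<le> 2 * h x ^ 2 * (real n * 4 ^ n)) F"
  using v_all adm h_pos h_less[OF zero_less_one]
proof eventually_elim
  case (elim x)
  have h1: "h x ^ 2 \<le> 1" using elim by (simp add: power_le_one)
  have "real n * r x ^ 2 - (1 - h x ^ 2) * r x * Re (\<Sum>j<n. v j x) \<le> (1 - (1 - h x ^ 2)^2) * (real n * 4 ^ n)"
    using elim h1 n3 by (intro sum_rule) auto
  also have "\<dots> \<le> 2 * h x ^ 2 * (real n * 4 ^ n)"
  proof (intro mult_right_mono)
    have "1 - (1 - h x ^ 2)^2 = 2 * h x ^ 2 - (h x ^ 2)^2" by (simp add: power2_eq_square algebra_simps)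
    then show "1 - (1 - h x ^ 2)^2 \<le> 2 * h x ^ 2" using zero_le_power2[of "h x ^ 2"] by linarith
  qed simp
  finally show ?case by (simp add: V_def)
qed

lemma r_half: "eventually (\<lambda>x. 1 / 2 \<le> r x) F"
proof -
  have "((\<lambda>x. 1 + c1 * h x ^ 2 - K * h x ^ 4) \<longlongrightarrow> 1 + c1 * 0 ^ 2 - K * 0 ^ 4) F"
    by (intro tendsto_intros h_tendsto)
  then have "eventually (\<lambda>x. 1 / 2 < 1 + c1 * h x ^ 2 - K * h x ^ 4) F"
    by (intro order_tendstoD(1)[of _ 1]) auto
  then show ?thesis using r_ge by eventually_elim simp
qed

lemma r2: "Oh 2 (\<lambda>x. r x - 1)"
proof (rule Oh_sandwich)
  show "Oh 2 (\<lambda>x. c1 * h x ^ 2 - K * h x ^ 4)"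
    by (intro Oh_diff Oh_cmult Oh_h2 Oh_mono[OF Oh_h4]) auto
  show "Oh 2 (\<lambda>x. 4 * 4 ^ n * h x ^ 2)" by (intro Oh_cmult Oh_h2)
  show "eventually (\<lambda>x. c1 * h x ^ 2 - K * h x ^ 4 \<le> r x - 1) F"
    using r_ge by eventually_elim simp
  show "eventually (\<lambda>x. r x - 1 \<le> 4 * 4 ^ n * h x ^ 2) F"
    using sum_rule_scaled r_half V_n h_pos h_less[OF zero_less_one]
  proof eventually_elim
    case (elim x)
    define b where "b = 1 - h x ^ 2"
    have b: "0 \<le> b" using elim by (simp add: b_def power_le_one)
    have "b * r x * V x \<le> b * r x * real n" using elim b by (intro mult_left_mono) auto
    then have "real n * r x ^ 2 - b * r x * real n \<le> 2 * h x ^ 2 * (real n * 4 ^ n)"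
      using elim(1) unfolding b_def[symmetric] by linarith
    then have "real n * (r x * (r x - b)) \<le> real n * (2 * h x ^ 2 * 4 ^ n)"
      by (simp add: power2_eq_square algebra_simps)
    then have 1: "r x * (r x - b) \<le> 2 * h x ^ 2 * 4 ^ n" using n3 by (simp add: mult_le_cancel_left)
    have "r x - b \<le> 4 * 4 ^ n * h x ^ 2"
    proof (cases "0 \<le> r x - b")
      case True
      then have "1 / 2 * (r x - b) \<le> r x * (r x - b)" using elim by (intro mult_right_mono) auto
      moreover have "4 * 4 ^ n * h x ^ 2 = 2 * (2 * h x ^ 2 * 4 ^ n)" by simp
      moreover have "A \<le> C" if "1 / 2 * A \<le> B" "C = 2 * D" "B \<le> D" for A B C D :: real
        using that by linarith
      ultimately show ?thesis using 1 by blast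
    next
      case False
      moreover have "0 \<le> 4 * 4 ^ n * h x ^ 2" by simp
      ultimately show ?thesis by linarith
    qed
    moreover have "r x - 1 \<le> r x - b" by (simp add: b_def)
    ultimately show ?case by (rule order.trans[rotated])
  qed
qed

lemma r_lim: "(r \<longlongrightarrow> 1) F" by (rule Oh_tendsto[OF r2]) simp

lemma V2: "Oh 2 (\<lambda>x. real n - V x)"
proof (rule Oh_cancel)
  show "Oh 2 (\<lambda>x. (real n - V x) * ((1 - h x ^ 2) * r x))"
  proof (rule Oh_sandwich)
    show "Oh 2 (\<lambda>x. 0)" by (rule Oh_zero)
    show "Oh 2 (\<lambda>x. 2 * (real n * 4 ^ n) * h x ^ 2 - real n * (r x * ((r x - 1) + h x ^ 2)))"
      by (intro Oh_diff Oh_cmult Oh_h2 Oh_mult[OF Oh_bounded[OF r_lim], where l=2] Oh_add r2) auto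
    show "eventually (\<lambda>x. 0 \<le> (real n - V x) * ((1 - h x ^ 2) * r x)) F"
      using r_half V_n h_pos h_less[OF zero_less_one]
    proof eventually_elim
      case (elim x)
      then show ?case by (intro mult_nonneg_nonneg) (auto simp: power_le_one)
    qed
    show "eventually (\<lambda>x. (real n - V x) * ((1 - h x ^ 2) * r x)
        \<le> 2 * (real n * 4 ^ n) * h x ^ 2 - real n * (r x * ((r x - 1) + h x ^ 2))) F"
      using sum_rule_scaled by eventually_elim (simp add: algebra_simps power2_eq_square)
  qed
  have "((\<lambda>x. (1 - h x ^ 2) * r x) \<longlongrightarrow> (1 - 0 ^ 2) * 1) F"
    by (intro tendsto_intros h_tendsto r_lim)
  then show "((\<lambda>x. (1 - h x ^ 2) * r x) \<longlongrightarrow> 1) F" by simp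
qed simp

lemma v1: "j < n \<Longrightarrow> Oh 1 (\<lambda>x. v j x - 1)"
proof -
  assume j: "j < n"
  obtain C where C: "C > 0" "eventually (\<lambda>x. norm (real n - V x) \<le> C * h x ^ 2) F"
    using V2 by (rule OhE)
  show ?thesis
  proof (rule OhI)
    show "eventually (\<lambda>x. norm (v j x - 1) \<le> sqrt (2 * C) * h x ^ 1) F"
      using C(2) V_le h_pos
    proof eventually_elim
      case (elim x)
      have "norm (v j x - 1) ^ 2 \<le> 2 * (real n - V x)" using elim(2) j by simp
      also have "\<dots> \<le> 2 * C * h x ^ 2" using elim(1) by simp
      also have "\<dots> = (sqrt (2 * C) * h x) ^ 2" using C(1) by (simp add: power_mult_distrib)
      finally have "norm (v j x - 1) \<le> sqrt (2 * C) * h x"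
        by (rule power2_le_imp_le) (use C(1) elim(3) in simp)
      then show ?case by simp
    qed
  qed
qed

definition c where "c x = (\<Sum>j<n. v j x) / of_nat n"
definition \<xi> where "\<xi> j x = v j x / c x - 1"

lemma Re_c: "Oh 2 (\<lambda>x. Re (c x) - 1)"
proof -
  have "Oh 2 (\<lambda>x. - (real n - V x) / real n)" by (intro Oh_divide_const Oh_uminus V2)
  then show ?thesis
  proof (rule Oh_cong)
    fix x
    have "Re (c x) = V x / real n"
      unfolding c_def V_def using Re_divide_of_real[of "\<Sum>j<n. v j x" "real n"] by simp
    then show "Re (c x) - 1 = - (real n - V x) / real n" using n3 by (simp add: field_simps)
  qed
qed

lemma c_1: "Oh 1 (\<lambda>x. c x - 1)"
proof -
  have "Oh 1 (\<lambda>x. (\<Sum>j<n. v j x - 1) / of_nat n)" by (intro Oh_divide_const Oh_sum v1) auto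
  then show ?thesis
  proof (rule Oh_cong)
    fix x
    have "(\<Sum>j<n. v j x - 1) = (\<Sum>j<n. v j x) - of_nat n" by (simp add: sum_subtractf)
    moreover have "(of_nat n :: complex) \<noteq> 0" using n3 by simp
    ultimately show "c x - 1 = (\<Sum>j<n. v j x - 1) / of_nat n"
      unfolding c_def by (simp add: field_simps)
  qed
qed

lemma c_lim: "(c \<longlongrightarrow> 1) F" by (rule Oh_tendsto[OF c_1]) simp

lemma c_ne: "eventually (\<lambda>x. c x \<noteq> 0) F" using tendsto_imp_eventually_ne[OF c_lim] by simp

lemma xi1: "j < n \<Longrightarrow> Oh 1 (\<xi> j)"
proof -
  assume j: "j < n"
  have "Oh 1 (\<lambda>x. (v j x - 1) - (c x - 1))" by (intro Oh_diff v1 j c_1)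
  then have "Oh 1 (\<lambda>x. \<xi> j x * c x)"
    by (rule Oh_cong_ev) (use c_ne in eventually_elim, simp add: \<xi>_def field_simps)
  then show ?thesis using c_lim by (rule Oh_cancel) simp
qed

lemma v_xi: "eventually (\<lambda>x. v j x = c x * (1 + \<xi> j x)) F"
  using c_ne by eventually_elim (simp add: \<xi>_def)

lemma sum0: "eventually (\<lambda>x. (\<Sum>j<n. \<xi> j x) = 0) F"
  using c_ne
proof eventually_elim
  case (elim x)
  have "(\<Sum>j<n. \<xi> j x) = (\<Sum>j<n. v j x) / c x - of_nat n"
    unfolding \<xi>_def by (simp add: sum_subtractf sum_divide_distrib)
  moreover have "(\<Sum>j<n. v j x) = c x * of_nat n" unfolding c_def using n3 by simp
  ultimately show ?case using elim by simp
qed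

lemma slack2: "j < n \<Longrightarrow> Oh 2 (\<lambda>x. 1 - norm (c x) ^ 2 * norm (1 + \<xi> j x) ^ 2)"
proof -
  assume j: "j < n"
  have "Oh 2 (\<lambda>x. 1 - norm (v j x) ^ 2)"
  proof (rule Oh_sandwich)
    show "Oh 2 (\<lambda>x. 0)" by (rule Oh_zero)
    show "Oh 2 (\<lambda>x. 2 * (real n - V x))" by (intro Oh_cmult V2)
    show "eventually (\<lambda>x. 0 \<le> 1 - norm (v j x) ^ 2) F"
      using v_all by eventually_elim (use j in \<open>auto simp: power_le_one\<close>)
    show "eventually (\<lambda>x. 1 - norm (v j x) ^ 2 \<le> 2 * (real n - V x)) F"
      using V_le by eventually_elim (use j in auto)
  qed
  then show ?thesis
    by (rule Oh_cong_ev) (use v_xi[of j] in eventually_elim, simp add: norm_mult power_mult_distrib)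
qed

definition E where "E m x = esym (\<lambda>j. \<xi> j x) n m"

lemma E_order: "Oh m (E m)"
  unfolding E_def[abs_def] by (rule esym_order) (rule xi1)

text \<open>The zero attached to \<open>w\<close>, in the coordinates of the expansion. This form depends only on the
  symmetric functions, and is therefore available before the order of \<open>Im (c x)\<close> is known.\<close>

lemma root_constraint_esym:
  assumes ur: "unity_root n w" and mu: "3 \<le> \<mu>" "\<mu> \<le> 4" and E3: "Oh \<mu> (E 3)"
  obtains s where "Oh (\<mu> + 2) (\<lambda>x. s x
        - (1 / (w - 1) + (\<Sum>m=2..n. bcoef n m w * E m x) + kcoef n w * E 2 x ^ 2))"
    "eventually (\<lambda>x. Phi (1 - h x ^ 2) (r x) (c x * s x) \<le> 0) F"
proof -
  have w: "w ^ (n + 1) = 1" "w \<noteq> 1" using ur by (auto simp: unity_root_def)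
  have Ek: "Oh \<mu> (E m)" if "m \<in> {3..n}" for m
    using E3 Oh_mono[OF E_order, of \<mu> m] that mu by (cases "m = 3") auto
  obtain q where q: "eventually (\<lambda>x. Jprim n 0 (q x) + (\<Sum>m=2..n. E m x * Jprim n m (q x)) = 0) F"
    "(q \<longlongrightarrow> w) F"
    "Oh (\<mu> + 2) (\<lambda>x. 1 / (q x - 1)
        - (1 / (w - 1) + (\<Sum>m=2..n. bcoef n m w * E m x) + kcoef n w * E 2 x ^ 2))"
    by (rule perturbed_inverse_root[where n=n and \<mu>=\<mu> and w=w and E=E, OF n3 mu w E_order[of 2] Ek])
  have "eventually (\<lambda>x. Phi (1 - h x ^ 2) (r x) (c x * (1 / (q x - 1))) \<le> 0) F"
    using q(1) tendsto_imp_eventually_ne[OF q(2) w(2)] c_ne adm sum0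
  proof eventually_elim
    case (elim x)
    have "esym (\<lambda>j. \<xi> j x) n (Suc 0) = 0" unfolding esym_1 using elim by simp
    then have "Qfun n (\<lambda>j. v j x) (c x * (1 / (q x - 1))) =
        c x ^ n * (1 / (q x - 1)) ^ Suc n * (Jprim n 0 (q x) + (\<Sum>m=2..n. esym (\<lambda>j. \<xi> j x) n m * Jprim n m (q x)))"
      using elim n3 by (intro Qfun_centred) (auto simp: \<xi>_def)
    then have "Qfun n (\<lambda>j. v j x) (c x * (1 / (q x - 1))) = 0"
      using elim(1) unfolding E_def by simp
    moreover have "c x * (1 / (q x - 1)) \<noteq> 0" using elim by auto
    ultimately show ?case using elim(4) unfolding admissible_def by blast
  qed
  from that[OF q(3) this] show thesis .
qed

text \<open>In the constraint for \<open>w\<close> every term except the product of \<open>Im c\<close> with \<open>Im (1 / (w - 1))\<close> is \<open>O(h\<^sup>2)\<close>.\<close>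

lemma Im_c_product:
  assumes ur: "unity_root n w"
  shows "\<exists>g. Oh 2 g \<and> eventually (\<lambda>x. g x \<le> 2 * ((1 - h x ^ 2) * r x) * (Im (c x) * Im (1 / (w - 1)))) F"
proof -
  interpret unity_root n w by fact
  obtain s where s: "Oh (3 + 2) (\<lambda>x. s x
        - (1 / (w - 1) + (\<Sum>m=2..n. bcoef n m w * E m x) + kcoef n w * E 2 x ^ 2))"
    and ph: "eventually (\<lambda>x. Phi (1 - h x ^ 2) (r x) (c x * s x) \<le> 0) F"
    by (rule root_constraint_esym[OF ur, of 3]) (use E_order[of 3] in auto)
  have s2: "Oh 2 (\<lambda>x. s x - 1 / (w - 1))"
  proof -
    have "Oh 2 (\<lambda>x. (s x - (1 / (w - 1) + (\<Sum>m=2..n. bcoef n m w * E m x) + kcoef n w * E 2 x ^ 2))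
       + (\<Sum>m=2..n. bcoef n m w * E m x) + kcoef n w * E 2 x ^ 2)"
      by (intro Oh_add Oh_mono[OF s] Oh_sum Oh_cmult Oh_mono[OF E_order] Oh_power[OF E_order[of 2]]) auto
    then show ?thesis by (rule Oh_cong) simp
  qed
  have sb: "Oh 0 s" by (rule Oh_bounded[OF Oh_tendsto[OF s2]]) simp
  have cb: "Oh 0 c" by (rule Oh_bounded[OF c_lim])
  have rb: "Oh 0 r" by (rule Oh_bounded[OF r_lim])
  have Rs: "Oh 2 (\<lambda>x. Re (s x) + 1 / 2)"
  proof -
    have "Oh 2 (\<lambda>x. Re (s x - 1 / (w - 1)))" by (rule Oh_Re[OF s2])
    moreover have "Re (s x - 1 / (w - 1)) = Re (s x) + 1 / 2" for x
      unfolding minus_complex.sel(1) s0_Re by simp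
    ultimately show ?thesis by (simp only:)
  qed
  define B where "B x = (1 - h x ^ 2) * r x" for x
  have B: "Oh 2 (\<lambda>x. B x - 1)"
  proof -
    have "Oh 2 (\<lambda>x. (r x - 1) - h x ^ 2 * r x)"
      by (intro Oh_diff r2 Oh_mult[OF Oh_h2 rb]) auto
    then show ?thesis by (rule Oh_cong) (simp add: B_def algebra_simps)
  qed
  have Bb: "Oh 0 B" by (rule Oh_bounded[OF Oh_tendsto[OF B]]) simp
  define g where "g x = (r x - 1) * (r x + 1) + 2 * (B x * (Re (c x) * (Re (s x) + 1 / 2)))
      - B x * (Re (c x) - 1) - (B x - 1) - 2 * (B x * (Im (c x) * Im (s x - 1 / (w - 1))))
      - h x ^ 2 * ((2 - h x ^ 2) * norm (c x * s x) ^ 2)" for x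
  have "Oh 2 g" unfolding g_def
    by (intro Oh_add Oh_diff Oh_cmult Oh_mult[OF r2, where l=0] Oh_mult[OF Bb, where l=2]
        Oh_mult[OF Oh_Re[OF cb] Rs] Re_c B Oh_mult[OF Oh_Im[OF cb] Oh_Im[OF s2]] rb Oh_const
        Oh_mult[OF Oh_h2, where l=0] Oh_mult[where k=0 and l=0, of _ "\<lambda>x. norm (c x * s x) ^ 2"]
        Oh_power[OF Oh_norm[OF Oh_mult[OF cb sb]]] Oh_mono[OF Oh_h2]) auto
  moreover have "eventually (\<lambda>x. g x \<le> 2 * ((1 - h x ^ 2) * r x) * (Im (c x) * Im (1 / (w - 1)))) F"
    using ph
  proof eventually_elim
    case (elim x)
    define i0 where "i0 = Im (1 / (w - 1))"
    define i where "i = Im (s x - 1 / (w - 1))"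
    have "Im (s x) = i0 + i" by (simp add: i0_def i_def)
    then have R: "Re (c x * s x) = Re (c x) * Re (s x) - Im (c x) * (i0 + i)" by simp
    have "Phi (1 - h x ^ 2) (r x) (c x * s x) = g x - 2 * (B x) * (Im (c x) * i0)"
      unfolding Phi_def R g_def i_def[symmetric] B_def
      by (simp add: algebra_simps power2_eq_square)
    then show ?case using elim unfolding B_def i0_def by simp
  qed
  ultimately show ?thesis by blast
qed

lemma Im_s0_w1: "Im (1 / (w1 - 1)) \<noteq> 0"
  using unity_root.s0_Im[OF unity(1)] Im_w1 u_less_1 by simp

lemma Im_inverse_cnj: "Im (1 / (cnj w - 1)) = - Im (1 / (w - 1))"
proof -
  have "1 / (cnj w - 1) = cnj (1 / (w - 1))" by simp
  then show ?thesis by (simp only: cnj.sel)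
qed

text \<open>The product in \<open>Im_c_product\<close> changes sign between \<open>w1\<close> and \<open>cnj w1\<close>, so it is bounded on both sides.\<close>

lemma Im_c2: "Oh 2 (\<lambda>x. Im (c x))"
proof -
  define i0 where "i0 = Im (1 / (w1 - 1))"
  obtain g where g: "Oh 2 g" "eventually (\<lambda>x. g x \<le> 2 * ((1 - h x ^ 2) * r x) * (Im (c x) * i0)) F"
    using Im_c_product[OF unity(1)] unfolding i0_def by blast
  obtain g' where g': "Oh 2 g'" "eventually (\<lambda>x. g' x \<le> 2 * ((1 - h x ^ 2) * r x) * (Im (c x) * (- i0))) F"
    using Im_c_product[OF unity_root_cnj[OF unity(1)]] unfolding i0_def Im_inverse_cnj by blast
  have "Oh 2 (\<lambda>x. 2 * ((1 - h x ^ 2) * r x) * (Im (c x) * i0))"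
  proof (rule Oh_sandwich[OF g(1) Oh_uminus[OF g'(1)] g(2)])
    show "eventually (\<lambda>x. 2 * ((1 - h x ^ 2) * r x) * (Im (c x) * i0) \<le> - g' x) F"
      using g'(2) by eventually_elim simp
  qed
  then have "Oh 2 (\<lambda>x. Im (c x) * (2 * i0 * ((1 - h x ^ 2) * r x)))"
    by (rule Oh_cong) (simp add: mult_ac)
  moreover have "((\<lambda>x. 2 * i0 * ((1 - h x ^ 2) * r x)) \<longlongrightarrow> 2 * i0 * ((1 - 0 ^ 2) * 1)) F"
    by (intro tendsto_intros h_tendsto r_lim)
  ultimately show ?thesis
    by (rule Oh_cancel) (use Im_s0_w1 in \<open>simp add: i0_def\<close>)
qed

sublocale conf: configuration F h n c \<xi>
  by unfold_locales (use n3 sum0 xi1 slack2 Im_c2 Re_c in auto)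

lemma conf_E: "conf.E m x = E m x"
  unfolding conf.E_def E_def ..

lemma root_constraint:
  assumes ur: "unity_root n w" and mu: "3 \<le> \<mu>" "\<mu> \<le> 4" and E3: "Oh \<mu> (conf.E 3)"
  obtains s where "Oh (\<mu> + 2) (\<lambda>x. s x - conf.approx w x)"
    "eventually (\<lambda>x. Phi (1 - h x ^ 2) (r x) (c x * s x) \<le> 0) F"
proof -
  have "Oh \<mu> (E 3)" using E3 unfolding conf_E[abs_def] .
  from root_constraint_esym[OF ur mu this] show thesis using that unfolding conf.approx_def conf_E by blast
qed

abbreviation "S \<equiv> conf.S"
abbreviation "Lam \<equiv> conf.Lam"

text \<open>The left-hand side of the first-order constraint without its odd part.\<close>

definition L where "L u x = (r x - 1) + h x ^ 2 + S x * etac n u + Lam x / (2 * n) - h x ^ 2 / (1 - u)"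

lemma first_order_constraint:
  assumes ur: "unity_root n w"
  obtains g where "Oh 4 g" "eventually (\<lambda>x. L (Re w) x + 2 * conf.odd_part w x \<le> g x) F"
proof -
  obtain s where s: "Oh (3 + 2) (\<lambda>x. s x - conf.approx w x)"
    "eventually (\<lambda>x. Phi (1 - h x ^ 2) (r x) (c x * s x) \<le> 0) F"
    by (rule root_constraint[OF ur, of 3]) (use conf.E_order[of 3] in auto)
  define g where "g x = - (Phi (1 - h x ^ 2) (r x) (c x * s x) - (L (Re w) x + 2 * conf.odd_part w x))" for x
  have "Oh 4 (\<lambda>x. - (Phi (1 - h x ^ 2) (r x) (c x * s x)
     - ((r x - 1) + h x ^ 2 + S x * etac n (Re w) + Lam x / (2 * n) + 2 * conf.odd_part w x - h x ^ 2 / (1 - Re w))))"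
    using s(1) by (intro Oh_uminus conf.first_order_Phi ur r2) simp
  then have "Oh 4 g" by (rule Oh_cong) (simp add: g_def L_def)
  moreover have "eventually (\<lambda>x. L (Re w) x + 2 * conf.odd_part w x \<le> g x) F"
    using s(2) by eventually_elim (simp add: g_def)
  ultimately show thesis using that by blast
qed

lemma first_order_pair:
  assumes ur: "unity_root n w"
  obtains g where "Oh 4 g" "eventually (\<lambda>x. L (Re w) x + \<bar>2 * conf.odd_part w x\<bar> \<le> g x) F"
proof -
  obtain g where g: "Oh 4 g" "eventually (\<lambda>x. L (Re w) x + 2 * conf.odd_part w x \<le> g x) F"
    by (rule first_order_constraint[OF ur])
  obtain g' where g': "Oh 4 g'" "eventually (\<lambda>x. L (Re w) x - 2 * conf.odd_part w x \<le> g' x) F"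
    by (rule first_order_constraint[OF unity_root_cnj[OF ur]]) (auto simp: conf.odd_part_cnj)
  have "Oh 4 (\<lambda>x. \<bar>g x\<bar> + \<bar>g' x\<bar>)" using Oh_add[OF Oh_norm[OF g(1)] Oh_norm[OF g'(1)]] by simp
  moreover have "eventually (\<lambda>x. L (Re w) x + \<bar>2 * conf.odd_part w x\<bar> \<le> \<bar>g x\<bar> + \<bar>g' x\<bar>) F"
    using g(2) g'(2) by eventually_elim linarith
  ultimately show thesis using that by blast
qed

lemma L_mean: "l1 * L u1 x + l2 * L u2 x = (r x - 1 - c1 * h x ^ 2) + Lam x / (2 * n)"
proof -
  have "l1 * L u1 x + l2 * L u2 x = (l1 + l2) * ((r x - 1) + h x ^ 2 + Lam x / (2 * n))
     + S x * (l1 * etac n u1 + l2 * etac n u2) - h x ^ 2 * (l1 * (1 / (1 - u1)) + l2 * (1 / (1 - u2)))"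
    unfolding L_def by (simp add: algebra_simps add_divide_distrib)
  also have "l1 * (1 / (1 - u1)) + l2 * (1 / (1 - u2)) = (l1 + l2) * (c1 + 1) + S1 * (l1 * etac n u1 + l2 * etac n u2)"
    unfolding active[symmetric] by (simp add: algebra_simps)
  finally show ?thesis unfolding l_sum eta_mean by (simp add: algebra_simps)
qed

lemma Lam_nonneg: "eventually (\<lambda>x. 0 \<le> Lam x \<and> (\<forall>j<n. 0 \<le> conf.sl j x \<and> conf.sl j x \<le> Lam x)) F"
  using v_all c_ne
proof eventually_elim
  case (elim x)
  have nn: "0 \<le> conf.sl j x" if "j < n" for j
  proof -
    have "norm (c x) ^ 2 * norm (1 + \<xi> j x) ^ 2 = norm (v j x) ^ 2"
      using elim(2) by (simp add: \<xi>_def flip: power_mult_distrib norm_mult)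
    moreover have "norm (v j x) ^ 2 \<le> 1" using elim(1) that by (simp add: power_le_one)
    ultimately show ?thesis unfolding conf.sl_def by simp
  qed
  moreover have "conf.sl j x \<le> Lam x" if "j < n" for j
    unfolding conf.Lam_def using that nn by (intro member_le_sum) auto
  moreover have "0 \<le> Lam x" unfolding conf.Lam_def using nn by (intro sum_nonneg) auto
  ultimately show ?case by blast
qed

text \<open>The average of the two first-order constraints is \<open>(r - 1 - c1 h\<^sup>2) + Lam / (2 n) + odd terms \<le> O(h\<^sup>4)\<close> with
  \<open>r - 1 - c1 h\<^sup>2 \<ge> - K h\<^sup>4\<close>. All other terms are nonnegative, so each of them is \<open>O(h\<^sup>4)\<close>, and both constraints are
  equalities up to \<open>O(h\<^sup>4)\<close>.\<close>

lemma first_order_estimates: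
  shows d4: "Oh 4 (\<lambda>x. r x - 1 - c1 * h x ^ 2)" and Lam4: "Oh 4 Lam"
    and L4: "Oh 4 (L u1)" "Oh 4 (L u2)"
    and odd4: "Oh 4 (conf.odd_part w1)" "Oh 4 (conf.odd_part w2)"
proof -
  obtain g1 where g1: "Oh 4 g1" "eventually (\<lambda>x. L u1 x + \<bar>2 * conf.odd_part w1 x\<bar> \<le> g1 x) F"
    using first_order_pair[OF unity(1)] by auto
  obtain g2 where g2: "Oh 4 g2" "eventually (\<lambda>x. L u2 x + \<bar>2 * conf.odd_part w2 x\<bar> \<le> g2 x) F"
    using first_order_pair[OF unity(2)] by auto
  have G: "Oh 4 (\<lambda>x. \<bar>g1 x\<bar>)" "Oh 4 (\<lambda>x. \<bar>g2 x\<bar>)" using Oh_norm[OF g1(1)] Oh_norm[OF g2(1)] by simp_all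
  have K4: "Oh 4 (\<lambda>x. \<bar>K\<bar> * h x ^ 4)" by (intro Oh_cmult Oh_h4)
  define T where "T x = l1 * \<bar>g1 x\<bar> + l2 * \<bar>g2 x\<bar> + \<bar>K\<bar> * h x ^ 4" for x
  have T: "Oh 4 T" unfolding T_def by (intro Oh_add Oh_cmult G K4)
  have main: "eventually (\<lambda>x. - \<bar>K\<bar> * h x ^ 4 \<le> r x - 1 - c1 * h x ^ 2 \<and> 0 \<le> Lam x / (2 * n) \<and>
     l1 * (L u1 x + \<bar>2 * conf.odd_part w1 x\<bar>) \<le> l1 * \<bar>g1 x\<bar> \<and>
     l2 * (L u2 x + \<bar>2 * conf.odd_part w2 x\<bar>) \<le> l2 * \<bar>g2 x\<bar> \<and>
     0 \<le> l1 * \<bar>2 * conf.odd_part w1 x\<bar> \<and> 0 \<le> l2 * \<bar>2 * conf.odd_part w2 x\<bar> \<and>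
     0 \<le> l1 * \<bar>g1 x\<bar> \<and> 0 \<le> l2 * \<bar>g2 x\<bar>) F"
    using g1(2) g2(2) Lam_nonneg r_ge
  proof eventually_elim
    case (elim x)
    have "K * h x ^ 4 \<le> \<bar>K\<bar> * h x ^ 4" by (intro mult_right_mono) auto
    moreover have "l1 * (L u1 x + \<bar>2 * conf.odd_part w1 x\<bar>) \<le> l1 * \<bar>g1 x\<bar>"
      using elim l_pos by (intro mult_left_mono) auto
    moreover have "l2 * (L u2 x + \<bar>2 * conf.odd_part w2 x\<bar>) \<le> l2 * \<bar>g2 x\<bar>"
      using elim l_pos by (intro mult_left_mono) auto
    ultimately show ?case using elim l_pos by simp
  qed
  have bounds: "eventually (\<lambda>x. - T x \<le> r x - 1 - c1 * h x ^ 2 \<and> r x - 1 - c1 * h x ^ 2 \<le> T x \<and>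
      0 \<le> Lam x / (2 * n) \<and> Lam x / (2 * n) \<le> T x \<and>
      - T x \<le> l1 * L u1 x \<and> l1 * L u1 x \<le> T x \<and> - T x \<le> l2 * L u2 x \<and> l2 * L u2 x \<le> T x \<and>
      l1 * \<bar>2 * conf.odd_part w1 x\<bar> \<le> T x \<and> l2 * \<bar>2 * conf.odd_part w2 x\<bar> \<le> T x) F"
    using main h_pos
  proof eventually_elim
    case (elim x)
    have "0 \<le> \<bar>K\<bar> * h x ^ 4" by simp
    then show ?case using elim L_mean[of x] unfolding T_def distrib_left by linarith
  qed
  have T': "Oh 4 (\<lambda>x. - T x)" by (rule Oh_uminus[OF T])
  show "Oh 4 (\<lambda>x. r x - 1 - c1 * h x ^ 2)"
    by (rule Oh_sandwich[OF T' T]) (use bounds in \<open>auto elim: eventually_mono\<close>)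
  have "Oh 4 (\<lambda>x. Lam x / (2 * n))"
    by (rule Oh_sandwich[OF Oh_zero T]) (use bounds in \<open>auto elim: eventually_mono\<close>)
  then have "Oh 4 (\<lambda>x. (2 * real n) * (Lam x / (2 * n)))" by (rule Oh_cmult)
  then show "Oh 4 Lam" by (rule Oh_cong) (use n3 in simp)
  have "Oh 4 (\<lambda>x. l1 * L u1 x)"
    by (rule Oh_sandwich[OF T' T]) (use bounds in \<open>auto elim: eventually_mono\<close>)
  then have "Oh 4 (\<lambda>x. (1 / l1) * (l1 * L u1 x))" by (rule Oh_cmult)
  then show "Oh 4 (L u1)" by (rule Oh_cong) (use l_pos in simp)
  have "Oh 4 (\<lambda>x. l2 * L u2 x)"
    by (rule Oh_sandwich[OF T' T]) (use bounds in \<open>auto elim: eventually_mono\<close>)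
  then have "Oh 4 (\<lambda>x. (1 / l2) * (l2 * L u2 x))" by (rule Oh_cmult)
  then show "Oh 4 (L u2)" by (rule Oh_cong) (use l_pos in simp)
  have "Oh 4 (\<lambda>x. l1 * \<bar>2 * conf.odd_part w1 x\<bar>)"
    by (rule Oh_sandwich[OF Oh_zero T]) (use bounds main in \<open>auto elim: eventually_mono\<close>)
  then have "Oh 4 (\<lambda>x. (1 / (2 * l1)) * (l1 * \<bar>2 * conf.odd_part w1 x\<bar>))" by (rule Oh_cmult)
  then show "Oh 4 (conf.odd_part w1)" by (rule Oh_le) (use l_pos in \<open>simp add: abs_mult\<close>)
  have "Oh 4 (\<lambda>x. l2 * \<bar>2 * conf.odd_part w2 x\<bar>)"
    by (rule Oh_sandwich[OF Oh_zero T]) (use bounds main in \<open>auto elim: eventually_mono\<close>)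
  then have "Oh 4 (\<lambda>x. (1 / (2 * l2)) * (l2 * \<bar>2 * conf.odd_part w2 x\<bar>))" by (rule Oh_cmult)
  then show "Oh 4 (conf.odd_part w2)" by (rule Oh_le) (use l_pos in \<open>simp add: abs_mult\<close>)
qed

lemma S_S1: "Oh 4 (\<lambda>x. S x - S1 * h x ^ 2)"
proof -
  have e: "Oh 4 (\<lambda>x. (S x - S1 * h x ^ 2) * etac n u)"
    if "Oh 4 (L u)" "c1 + 1 + S1 * etac n u = 1 / (1 - u)" for u
  proof -
    have "Oh 4 (\<lambda>x. L u x - (r x - 1 - c1 * h x ^ 2) - Lam x / (2 * n))"
      by (intro Oh_diff that(1) d4 Oh_divide_const Lam4)
    then show ?thesis
    proof (rule Oh_cong)
      fix x
      have "h x ^ 2 / (1 - u) = (c1 + 1 + S1 * etac n u) * h x ^ 2" unfolding that(2) by simp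
      then show "(S x - S1 * h x ^ 2) * etac n u = L u x - (r x - 1 - c1 * h x ^ 2) - Lam x / (2 * n)"
        unfolding L_def by (simp add: algebra_simps)
    qed
  qed
  have "Oh 4 (\<lambda>x. (S x - S1 * h x ^ 2) * etac n u1 - (S x - S1 * h x ^ 2) * etac n u2)"
    by (intro Oh_diff e L4 active)
  then have "Oh 4 (\<lambda>x. (S x - S1 * h x ^ 2) * (etac n u1 - etac n u2))"
    by (rule Oh_cong) (simp add: algebra_simps)
  then show ?thesis by (rule Oh_cancel[OF _ tendsto_const]) (use eta_diff in simp)
qed

sublocale conf: tight_configuration F h n c \<xi>
proof unfold_locales
  fix j assume j: "j < n"
  have "Oh 4 (conf.sl j)"
    by (rule Oh_sandwich[OF Oh_zero Lam4]) (use Lam_nonneg j in \<open>auto elim: eventually_mono\<close>)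
  then show "Oh 4 (\<lambda>x. 1 - norm (c x) ^ 2 * norm (1 + \<xi> j x) ^ 2)" unfolding conf.sl_def[abs_def] .
qed

lemma odd_reduced:
  assumes ur: "unity_root n w" and o4: "Oh 4 (conf.odd_part w)" and nz: "Im w \<noteq> 0"
  shows "Oh 4 (\<lambda>x. (2 / n - 2 * Re w / (real n - 1)) * Im (conf.E 2 x)
     + (3 / n - 6 * Re w / (real n - 1) + (4 * Re w ^ 2 - 1) / (real n - 2)) * Im (conf.E 3 x) + Im (c x))"
proof -
  interpret unity_root n w by fact
  define \<beta>2 where "\<beta>2 = 2 / n - 2 * Re w / (real n - 1)"
  define \<beta>3 where "\<beta>3 = 3 / n - 6 * Re w / (real n - 1) + (4 * Re w ^ 2 - 1) / (real n - 2)"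
  define f where "f = - Im w / (2 * (1 - Re w))"
  have f: "f \<noteq> 0" unfolding f_def using nz u_less by simp
  have I2: "Oh 3 (\<lambda>x. Im (conf.E 2 x))"
  proof -
    have "Oh 3 (\<lambda>x. (Im (conf.E 2 x) - conf.p3 x / 2) + conf.p3 x / 2)"
      by (intro Oh_add Oh_mono[OF conf.Im_E2] Oh_divide_const conf.p3_3) auto
    then show ?thesis by (rule Oh_cong) simp
  qed
  have I3: "Oh 3 (\<lambda>x. Im (conf.E 3 x))" by (rule Oh_Im[OF conf.E_order])
  define T where "T x = (\<Sum>m=4..n. Im (bcoef n m w) * Im (conf.E m x))" for x
  have T: "Oh 4 T" unfolding T_def by (intro Oh_sum Oh_cmult Oh_Im conf.E4_4)
  have R0: "Oh 0 (\<lambda>x. Re (c x))" by (rule conf.Re_c_bounded)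
  have "Oh 4 (\<lambda>x. - conf.odd_part w x - (Re (c x) - 1) * (f * \<beta>2 * Im (conf.E 2 x) + f * \<beta>3 * Im (conf.E 3 x)) - Re (c x) * T x)"
    by (intro Oh_diff Oh_uminus o4 Oh_mult[OF Re_c Oh_add[OF Oh_cmult[OF I2] Oh_cmult[OF I3]]] Oh_mult[OF R0 T]) auto
  then have "Oh 4 (\<lambda>x. (\<beta>2 * Im (conf.E 2 x) + \<beta>3 * Im (conf.E 3 x) + Im (c x)) * f)"
  proof (rule Oh_cong)
    fix x
    have split3: "(\<Sum>m=3..n. g m) = g 3 + (\<Sum>m=4..n. g m)" for g :: "nat \<Rightarrow> real"
      using n3 by (subst sum.atLeast_Suc_atMost) auto
    have "conf.odd_part w x = - Re (c x) * (f * \<beta>2 * Im (conf.E 2 x) + f * \<beta>3 * Im (conf.E 3 x) + T x) - Im (c x) * f"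
      unfolding conf.odd_part_def conf.split2 split3 T_def Im_bcoef_2 Im_bcoef_3 s0_Im f_def \<beta>2_def \<beta>3_def
      by (simp only: add.assoc)
    then show "(\<beta>2 * Im (conf.E 2 x) + \<beta>3 * Im (conf.E 3 x) + Im (c x)) * f
      = - conf.odd_part w x - (Re (c x) - 1) * (f * \<beta>2 * Im (conf.E 2 x) + f * \<beta>3 * Im (conf.E 3 x)) - Re (c x) * T x"
      by (simp add: algebra_simps)
  qed
  then show ?thesis unfolding \<beta>2_def[symmetric] \<beta>3_def[symmetric]
    by (rule Oh_cancel[OF _ tendsto_const]) (use f in simp)
qed

text \<open>To leading order the odd part is a combination of \<open>p3\<close> and \<open>Im c\<close>, since \<open>Im (E 2)\<close> and \<open>Im (E 3)\<close> are multiples of the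
  third moment.\<close>

lemma odd_p3:
  assumes ur: "unity_root n w" and o4: "Oh 4 (conf.odd_part w)" and nz: "Im w \<noteq> 0"
  shows "Oh 4 (\<lambda>x. (Re w / (real n - 1) - (4 * Re w ^ 2 - 1) / (3 * (real n - 2))) * conf.p3 x + Im (c x))"
proof -
  define \<beta>2 where "\<beta>2 = 2 / n - 2 * Re w / (real n - 1)"
  define \<beta>3 where "\<beta>3 = 3 / n - 6 * Re w / (real n - 1) + (4 * Re w ^ 2 - 1) / (real n - 2)"
  have "Oh 4 (\<lambda>x. (\<beta>2 * Im (conf.E 2 x) + \<beta>3 * Im (conf.E 3 x) + Im (c x))
     - \<beta>2 * (Im (conf.E 2 x) - conf.p3 x / 2) - \<beta>3 * (Im (conf.E 3 x) + conf.p3 x / 3))"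
    unfolding \<beta>2_def \<beta>3_def
    by (intro Oh_diff odd_reduced[OF assms] Oh_cmult Oh_mono[OF conf.Im_E2] Oh_mono[OF conf.Im_E3]) auto
  then show ?thesis
  proof (rule Oh_cong)
    fix x
    have e: "\<beta>2 / 2 - \<beta>3 / 3 = Re w / (real n - 1) - (4 * Re w ^ 2 - 1) / (3 * (real n - 2))"
    proof -
      have "(2 * a - 2 * b) / 2 - (3 * a - 6 * b + d) / 3 = b - d / 3" for a b d :: real by (simp add: field_simps)
      from this[of "1 / real n" "Re w / (real n - 1)" "(4 * Re w ^ 2 - 1) / (real n - 2)"] show ?thesis
        unfolding \<beta>2_def \<beta>3_def by (simp add: mult.commute)
    qed
    show "(Re w / (real n - 1) - (4 * Re w ^ 2 - 1) / (3 * (real n - 2))) * conf.p3 x + Im (c x)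
       = (\<beta>2 * Im (conf.E 2 x) + \<beta>3 * Im (conf.E 3 x) + Im (c x))
     - \<beta>2 * (Im (conf.E 2 x) - conf.p3 x / 2) - \<beta>3 * (Im (conf.E 3 x) + conf.p3 x / 3)"
      unfolding e[symmetric] by (simp add: field_simps)
  qed
qed

lemma Im_c3: "Oh 3 (\<lambda>x. Im (c x))"
proof -
  define \<gamma> where "\<gamma> = u1 / (real n - 1) - (4 * u1 ^ 2 - 1) / (3 * (real n - 2))"
  have "Oh 3 (\<lambda>x. (\<gamma> * conf.p3 x + Im (c x)) - \<gamma> * conf.p3 x)"
    by (intro Oh_diff Oh_cmult conf.p3_3 Oh_mono[OF odd_p3[OF unity(1) odd4(1) Im_w1, unfolded Re_w, folded \<gamma>_def]]) auto
  then show ?thesis by (rule Oh_cong) simp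
qed

text \<open>Two nonreal active roots of unity give two independent relations between \<open>p3\<close> and \<open>Im c\<close>; the
  determinant is nonzero because \<open>u1 + u2 < 0\<close>. For \<open>n = 3\<close> and \<open>n = 5\<close> the second root of unity is \<open>-1\<close>, and
  its relation is void.\<close>

lemma p3_4:
  assumes n: "n \<noteq> 3" "n \<noteq> 5"
  shows "Oh 4 conf.p3"
proof -
  define \<gamma> where "\<gamma> u = u / (real n - 1) - (4 * u ^ 2 - 1) / (3 * (real n - 2))" for u
  have "Oh 4 (\<lambda>x. (\<gamma> u1 * conf.p3 x + Im (c x)) - (\<gamma> u2 * conf.p3 x + Im (c x)))"
    using odd_p3[OF unity(1) odd4(1) Im_w1] odd_p3[OF unity(2) odd4(2) Im_w2[OF n]]
    by (intro Oh_diff) (simp_all add: \<gamma>_def)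
  then have "Oh 4 (\<lambda>x. conf.p3 x * (\<gamma> u1 - \<gamma> u2))"
    by (rule Oh_cong) (simp add: algebra_simps)
  moreover have "\<gamma> u1 - \<gamma> u2 \<noteq> 0"
  proof -
    have "\<gamma> u1 - \<gamma> u2 = (u1 - u2) * (1 / (real n - 1) + 4 * (- (u1 + u2)) / (3 * (real n - 2)))"
    proof -
      have "(u1 * a - (4 * u1^2 - 1) * b) - (u2 * a - (4 * u2^2 - 1) * b) = (u1 - u2) * (a + 4 * (- (u1 + u2)) * b)" for a b
        by (simp add: algebra_simps power2_eq_square)
      from this[of "1 / (real n - 1)" "1 / (3 * (real n - 2))"] show ?thesis unfolding \<gamma>_def by simp
    qed
    moreover have "u1 + u2 < 0"
    proof -
      have "m0 < - 1 / 2" unfolding m0_def using n3 by (simp add: field_simps)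
      then show ?thesis using u1_le u2_less by simp
    qed
    then have "0 \<le> 4 * (- (u1 + u2)) / (3 * (real n - 2))" using n3 by (intro divide_nonneg_nonneg) auto
    moreover have "0 < 1 / (real n - 1)" using n3 by simp
    then have "0 < 1 / (real n - 1) + 4 * (- (u1 + u2)) / (3 * (real n - 2))"
      using \<open>0 \<le> 4 * (- (u1 + u2)) / (3 * (real n - 2))\<close> by (rule add_pos_nonneg)
    then have "0 < (u1 - u2) * (1 / (real n - 1) + 4 * (- (u1 + u2)) / (3 * (real n - 2)))"
      using u2_less_u1 by (intro mult_pos_pos) auto
    ultimately show ?thesis by linarith
  qed
  ultimately show ?thesis by (rule Oh_cancel[OF _ tendsto_const])
qed

lemma p3_nu: "Oh \<nu> conf.p3"
  using p3_4 conf.p3_3 by (auto simp: \<nu>_def)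

lemma Im_c_nu: "Oh \<nu> (\<lambda>x. Im (c x))"
proof (cases "n = 3 \<or> n = 5")
  case True
  then show ?thesis using Im_c3 by (auto simp: \<nu>_def)
next
  case False
  define \<gamma> where "\<gamma> = u1 / (real n - 1) - (4 * u1 ^ 2 - 1) / (3 * (real n - 2))"
  have "Oh 4 (\<lambda>x. (\<gamma> * conf.p3 x + Im (c x)) - \<gamma> * conf.p3 x)"
    using False by (intro Oh_diff Oh_cmult p3_4 odd_p3[OF unity(1) odd4(1) Im_w1, unfolded Re_w, folded \<gamma>_def]) auto
  then show ?thesis using nu by (elim Oh_cong[OF Oh_mono]) auto
qed

lemma E3_nu: "Oh \<nu> (conf.E 3)"
proof (rule Oh_complexI)
  show "Oh \<nu> (\<lambda>x. Re (conf.E 3 x))" by (rule Oh_mono[OF conf.Re_E3_4 nu(2)])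
  have "Oh \<nu> (\<lambda>x. (Im (conf.E 3 x) + conf.p3 x / 3) - conf.p3 x / 3)"
    by (intro Oh_diff Oh_divide_const p3_nu Oh_mono[OF conf.Im_E3]) (use nu in auto)
  then show "Oh \<nu> (\<lambda>x. Im (conf.E 3 x))" by (rule Oh_cong) simp
qed

sublocale conf: graded_configuration F h n c \<xi> \<nu>
  by unfold_locales (use nu E3_nu Im_c_nu in auto)

lemma second_order_constraint:
  assumes ur: "unity_root n w" and act: "c1 + 1 + S1 * etac n (Re w) = 1 / (1 - Re w)"
  obtains g where "Oh (\<nu> + 2) g" "eventually (\<lambda>x. (r x - 1 - c1 * h x ^ 2) + (S x - S1 * h x ^ 2) * etac n (Re w)
     + Lam x / (2 * n) + 2 * conf.odd_part w x + h x ^ 4 * Zc n (Re w) c1 S1 pstar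
     + Wc n (Re w) * (conf.p4 x - pstar * h x ^ 4) \<le> g x) F"
proof -
  obtain s where s: "Oh (\<nu> + 2) (\<lambda>x. s x - conf.approx w x)"
    "eventually (\<lambda>x. Phi (1 - h x ^ 2) (r x) (c x * s x) \<le> 0) F"
    by (rule root_constraint[OF ur nu E3_nu])
  define X where "X x = (r x - 1 - c1 * h x ^ 2) + (S x - S1 * h x ^ 2) * etac n (Re w)
     + Lam x / (2 * n) + 2 * conf.odd_part w x + h x ^ 4 * Zc n (Re w) c1 S1 pstar
     + Wc n (Re w) * (conf.p4 x - pstar * h x ^ 4)" for x
  have "Oh (\<nu> + 2) (\<lambda>x. - (Phi (1 - h x ^ 2) (1 + c1 * h x ^ 2 + (r x - 1 - c1 * h x ^ 2)) (c x * s x) - X x))"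
    unfolding X_def by (intro Oh_uminus conf.second_order_Phi[OF ur s(1) d4 S_S1 act])
  then have "Oh (\<nu> + 2) (\<lambda>x. X x - Phi (1 - h x ^ 2) (r x) (c x * s x))"
    by (rule Oh_cong) simp
  moreover have "eventually (\<lambda>x. X x \<le> X x - Phi (1 - h x ^ 2) (r x) (c x * s x)) F"
    using s(2) by eventually_elim simp
  ultimately show thesis using that[of "\<lambda>x. X x - Phi (1 - h x ^ 2) (r x) (c x * s x)"] unfolding X_def by blast
qed

text \<open>Averaging the constraints for \<open>w\<close> and \<open>cnj w\<close> removes the odd part.\<close>

lemma second_order_pair:
  assumes ur: "unity_root n w" and act: "c1 + 1 + S1 * etac n (Re w) = 1 / (1 - Re w)"
  obtains g where "Oh (\<nu> + 2) g" "eventually (\<lambda>x. (r x - 1 - c1 * h x ^ 2) + (S x - S1 * h x ^ 2) * etac n (Re w)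
     + Lam x / (2 * n) + h x ^ 4 * Zc n (Re w) c1 S1 pstar
     + Wc n (Re w) * (conf.p4 x - pstar * h x ^ 4) \<le> g x) F"
proof -
  obtain g where g: "Oh (\<nu> + 2) g" "eventually (\<lambda>x. (r x - 1 - c1 * h x ^ 2) + (S x - S1 * h x ^ 2) * etac n (Re w)
     + Lam x / (2 * n) + 2 * conf.odd_part w x + h x ^ 4 * Zc n (Re w) c1 S1 pstar
     + Wc n (Re w) * (conf.p4 x - pstar * h x ^ 4) \<le> g x) F"
    by (rule second_order_constraint[OF ur act])
  have act': "c1 + 1 + S1 * etac n (Re (cnj w)) = 1 / (1 - Re (cnj w))" using act by simp
  obtain g' where g': "Oh (\<nu> + 2) g'" "eventually (\<lambda>x. (r x - 1 - c1 * h x ^ 2) + (S x - S1 * h x ^ 2) * etac n (Re w)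
     + Lam x / (2 * n) + 2 * (- conf.odd_part w x) + h x ^ 4 * Zc n (Re w) c1 S1 pstar
     + Wc n (Re w) * (conf.p4 x - pstar * h x ^ 4) \<le> g' x) F"
    using second_order_constraint[OF unity_root_cnj[OF ur] act'] unfolding conf.odd_part_cnj cnj.sel(1) .
  have "Oh (\<nu> + 2) (\<lambda>x. (g x + g' x) / 2)" by (intro Oh_divide_const Oh_add g g')
  moreover have "eventually (\<lambda>x. (r x - 1 - c1 * h x ^ 2) + (S x - S1 * h x ^ 2) * etac n (Re w)
     + Lam x / (2 * n) + h x ^ 4 * Zc n (Re w) c1 S1 pstar
     + Wc n (Re w) * (conf.p4 x - pstar * h x ^ 4) \<le> (g x + g' x) / 2) F"
    using g(2) g'(2) by eventually_elim (simp add: field_simps)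
  ultimately show thesis using that by blast
qed

definition P2 where "P2 x = (\<Sum>j<n. Im (\<xi> j x) ^ 2)"

lemma P2_S1: "Oh 4 (\<lambda>x. P2 x - S1 * h x ^ 2)"
proof -
  have "Oh 4 (\<lambda>x. (S x - S1 * h x ^ 2) - (S x - P2 x))"
    unfolding P2_def by (intro Oh_diff S_S1 conf.S_Im)
  then show ?thesis by (rule Oh_cong) simp
qed

lemma P2_2: "Oh 2 P2"
  unfolding P2_def[abs_def] by (intro Oh_sum Oh_power[OF Oh_Im[OF xi1]]) auto

lemma P2_sq: "Oh 6 (\<lambda>x. P2 x ^ 2 - S1 ^ 2 * h x ^ 4)"
proof -
  have "Oh 6 (\<lambda>x. (P2 x - S1 * h x ^ 2) * (P2 x + S1 * h x ^ 2))"
    by (rule Oh_mult[OF P2_S1 Oh_add[OF P2_2 Oh_cmult[OF Oh_h2]]]) simp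
  then show ?thesis by (rule Oh_cong) (simp add: algebra_simps power2_eq_square power4_eq_xxxx)
qed

text \<open>\<open>fourth_moment\<close> gives \<open>2 p4 \<le> P2\<^sup>2 + p3\<^sup>2 / a\<^sup>2\<close>, where \<open>a\<^sup>2\<close> is at least of the order of \<open>h\<^sup>2\<close> because \<open>P2\<close> is; as \<open>p3 = O(h\<^sup>4)\<close>,
  the last term is \<open>O(h\<^sup>6)\<close>.\<close>

lemma moment_bound_general:
  assumes n: "n \<noteq> 3" "n \<noteq> 5"
  shows "\<exists>g. Oh 6 g \<and> eventually (\<lambda>x. conf.p4 x - pstar * h x ^ 4 \<le> g x) F"
proof -
  obtain C where C: "C > 0" "eventually (\<lambda>x. norm (conf.p3 x) \<le> C * h x ^ 4) F"
    using p3_4[OF n] by (rule OhE)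
  obtain A where A: "A > 0" "eventually (\<lambda>x. norm (P2 x - S1 * h x ^ 2) \<le> A * h x ^ 4) F"
    using P2_S1 by (rule OhE)
  define \<kappa> where "\<kappa> = S1 / (2 * n)"
  have \<kappa>: "\<kappa> > 0" unfolding \<kappa>_def using S1_pos n3 by simp
  define g where "g x = (P2 x ^ 2 - S1 ^ 2 * h x ^ 4) / 2 + C^2 / (2 * \<kappa>) * h x ^ 6" for x
  have "Oh 6 g" unfolding g_def
    by (intro Oh_add Oh_divide_const P2_sq Oh_cmult Oh_h_power)
  moreover have "eventually (\<lambda>x. conf.p4 x - pstar * h x ^ 4 \<le> g x) F"
  proof -
    \<comment> \<open>The first bound gives \<open>P2 \<ge> S1 h\<^sup>2 / 2\<close>, the second the smallness of the third moment required by \<open>fourth_moment\<close>.\<close>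
    define \<delta> where "\<delta> = min (sqrt (S1 / (2 * A))) (sqrt \<kappa> ^ 3 / (C * real n ^ 2))"
    have \<delta>: "\<delta> > 0" unfolding \<delta>_def using S1_pos A(1) C(1) \<kappa> n3 by simp
    show ?thesis using C(2) A(2) h_pos h_less[OF \<delta>] conf.Im_sum0
    proof eventually_elim
      case (elim x)
      define y where "y j = Im (\<xi> j x)" for j
      obtain a where a: "0 \<le> a" "(\<Sum>j<n. y j ^ 2) \<le> real n * a^2"
        "\<bar>\<Sum>j<n. y j ^ 3\<bar> * real n ^ 2 \<le> a ^ 3 \<Longrightarrow> 0 < a \<Longrightarrow>
         2 * a^2 * (\<Sum>j<n. y j ^ 4) \<le> a^2 * (\<Sum>j<n. y j ^ 2) ^ 2 + (\<Sum>j<n. y j ^ 3) ^ 2"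
        using fourth_moment[of y n] elim(5) n3 unfolding y_def by auto
      have p: "(\<Sum>j<n. y j ^ 2) = P2 x" "(\<Sum>j<n. y j ^ 3) = conf.p3 x" "(\<Sum>j<n. y j ^ 4) = conf.p4 x"
        by (simp_all add: y_def P2_def conf.p3_def conf.p4_def)
      have hp: "0 < h x" by (rule elim(3))
      have hA: "A * h x ^ 2 \<le> S1 / 2"
      proof -
        have "h x < sqrt (S1 / (2 * A))" using elim(4) by (simp add: \<delta>_def)
        then have "h x ^ 2 \<le> sqrt (S1 / (2 * A)) ^ 2" using hp by (intro power_mono) auto
        then show ?thesis using A(1) S1_pos by (simp add: field_simps)
      qed
      have "A * h x ^ 4 \<le> S1 / 2 * h x ^ 2"
      proof -
        have "A * h x ^ 4 = (A * h x ^ 2) * h x ^ 2" by (simp add: power2_eq_square power4_eq_xxxx)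
        also have "\<dots> \<le> S1 / 2 * h x ^ 2" using hA by (intro mult_right_mono) auto
        finally show ?thesis .
      qed
      then have "S1 / 2 * h x ^ 2 \<le> P2 x" using elim(2) by (simp add: abs_le_iff)
      then have "S1 / 2 * h x ^ 2 \<le> real n * a^2" using a(2) unfolding p by simp
      then have ka: "\<kappa> * h x ^ 2 \<le> a^2" unfolding \<kappa>_def using n3 by (simp add: field_simps)
      then have "(sqrt \<kappa> * h x) ^ 2 \<le> a^2" using \<kappa> by (simp add: power_mult_distrib)
      then have sa: "sqrt \<kappa> * h x \<le> a" using a(1) by (rule power2_le_imp_le)
      have a0: "0 < a" using sa \<kappa> hp by (meson less_le_trans mult_pos_pos real_sqrt_gt_zero)
      have "\<bar>conf.p3 x\<bar> * real n ^ 2 \<le> C * h x ^ 4 * real n ^ 2"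
        using elim(1) by (intro mult_right_mono) auto
      also have "\<dots> = (C * real n ^ 2 * h x) * h x ^ 3" by (simp add: power4_eq_xxxx power3_eq_cube)
      also have "\<dots> \<le> sqrt \<kappa> ^ 3 * h x ^ 3"
      proof (intro mult_right_mono)
        have "h x < sqrt \<kappa> ^ 3 / (C * real n ^ 2)" using elim(4) by (simp add: \<delta>_def)
        then show "C * real n ^ 2 * h x \<le> sqrt \<kappa> ^ 3" using C(1) n3 by (simp add: field_simps)
      qed (use hp in simp)
      also have "\<dots> = (sqrt \<kappa> * h x) ^ 3" by (simp add: power_mult_distrib)
      also have "\<dots> \<le> a ^ 3" using sa \<kappa> hp by (intro power_mono) auto
      finally have main: "2 * a^2 * conf.p4 x \<le> a^2 * P2 x ^ 2 + conf.p3 x ^ 2" using a(3) a0 unfolding p by blast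
      have "conf.p3 x ^ 2 \<le> (C * h x ^ 4) ^ 2" using elim(1) by (simp add: abs_le_square_iff[symmetric])
      also have "\<dots> = (\<kappa> * h x ^ 2) * (C^2 / \<kappa> * h x ^ 6)"
        using \<kappa> by (simp add: power_mult_distrib power_add[symmetric] power_mult[symmetric])
      also have "\<dots> \<le> a^2 * (C^2 / \<kappa> * h x ^ 6)" using ka \<kappa> hp by (intro mult_right_mono) auto
      finally have "a^2 * (2 * conf.p4 x) \<le> a^2 * (P2 x ^ 2 + C^2 / \<kappa> * h x ^ 6)"
        using main by (simp add: distrib_left)
      then have "2 * conf.p4 x \<le> P2 x ^ 2 + C^2 / \<kappa> * h x ^ 6" using a0 by (simp add: mult_le_cancel_left)
      then show ?case unfolding g_def pstar_def using n by (simp add: field_simps)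
    qed
  qed
  ultimately show ?thesis by blast
qed

lemma fourth_moment_term:
  "\<exists>g. Oh 6 g \<and> eventually (\<lambda>x. - (l1 * Wc n u1 + l2 * Wc n u2) * (conf.p4 x - pstar * h x ^ 4) \<le> g x) F"
proof -
  define W where "W = - (l1 * Wc n u1 + l2 * Wc n u2)"
  have *: ?thesis if g: "Oh 6 g" "eventually (\<lambda>x. conf.p4 x - pstar * h x ^ 4 \<le> g x) F" and n4: "4 \<le> n" for g
  proof (intro exI conjI)
    show "Oh 6 (\<lambda>x. W * g x)" by (intro Oh_cmult g)
    have "0 \<le> W" unfolding W_def using Wc_nonpos[OF n4] by simp
    then show "eventually (\<lambda>x. - (l1 * Wc n u1 + l2 * Wc n u2) * (conf.p4 x - pstar * h x ^ 4) \<le> W * g x) F"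
      unfolding W_def[symmetric] using g(2) by (auto elim!: eventually_mono intro: mult_left_mono)
  qed
  consider "n = 3" | "n = 5" | "n \<noteq> 3" "n \<noteq> 5" by blast
  then show ?thesis
  proof cases
    case 1
    have ps: "pstar = S1^2 / 2" unfolding pstar_def using 1 by auto
    have "Oh 6 (\<lambda>x. W * ((P2 x ^ 2 - S1 ^ 2 * h x ^ 4) / 2))" by (intro Oh_cmult Oh_divide_const P2_sq)
    moreover have "eventually (\<lambda>x. - (l1 * Wc n u1 + l2 * Wc n u2) * (conf.p4 x - pstar * h x ^ 4)
        \<le> W * ((P2 x ^ 2 - S1 ^ 2 * h x ^ 4) / 2)) F"
      using conf.Im_sum0
    proof eventually_elim
      case (elim x)
      have lt: "{..<n} = {..<3}" using 1 by simp
      have e: "conf.p4 x = P2 x ^ 2 / 2"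
        using elim unfolding conf.p4_def P2_def lt by (rule fourth_moment_3)
      show ?case unfolding W_def[symmetric] ps e by (simp add: diff_divide_distrib)
    qed
    ultimately show ?thesis by blast
  next
    case 2
    have ps: "pstar = 13 / 20 * S1^2" unfolding pstar_def if_P[OF 2] ..
    show ?thesis
    proof (rule *)
      show "Oh 6 (\<lambda>x. 13 / 20 * (P2 x ^ 2 - S1 ^ 2 * h x ^ 4))" by (intro Oh_cmult P2_sq)
      show "eventually (\<lambda>x. conf.p4 x - pstar * h x ^ 4 \<le> 13 / 20 * (P2 x ^ 2 - S1 ^ 2 * h x ^ 4)) F"
        using conf.Im_sum0
      proof eventually_elim
        case (elim x)
        have lt: "{..<n} = {..<5}" using 2 by simp
        have "conf.p4 x \<le> 13 / 20 * P2 x ^ 2"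
          using elim unfolding conf.p4_def P2_def lt by (rule fourth_moment_5)
        then show ?case unfolding ps by (simp add: algebra_simps)
      qed
    qed (use 2 in simp)
  next
    case 3
    then show ?thesis using moment_bound_general * n3 by force
  qed
qed

text \<open>The average with the weights \<open>l1, l2\<close> removes the unknown \<open>S\<close>; the slack has the favourable sign.\<close>

lemma upper_bound: "\<exists>g. Oh (\<nu> + 2) g \<and> eventually (\<lambda>x. r x \<le> 1 + c1 * h x ^ 2 + c2 * h x ^ 4 + g x) F"
proof -
  obtain g1 where g1: "Oh (\<nu> + 2) g1" "eventually (\<lambda>x. (r x - 1 - c1 * h x ^ 2) + (S x - S1 * h x ^ 2) * etac n u1
     + Lam x / (2 * n) + h x ^ 4 * Zc n u1 c1 S1 pstar + Wc n u1 * (conf.p4 x - pstar * h x ^ 4) \<le> g1 x) F"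
    using second_order_pair[OF unity(1)] active(1) unfolding Re_w by blast
  obtain g2 where g2: "Oh (\<nu> + 2) g2" "eventually (\<lambda>x. (r x - 1 - c1 * h x ^ 2) + (S x - S1 * h x ^ 2) * etac n u2
     + Lam x / (2 * n) + h x ^ 4 * Zc n u2 c1 S1 pstar + Wc n u2 * (conf.p4 x - pstar * h x ^ 4) \<le> g2 x) F"
    using second_order_pair[OF unity(2)] active(2) unfolding Re_w by blast
  obtain g where g: "Oh 6 g" "eventually (\<lambda>x. - (l1 * Wc n u1 + l2 * Wc n u2) * (conf.p4 x - pstar * h x ^ 4) \<le> g x) F"
    using fourth_moment_term by blast
  have "Oh (\<nu> + 2) (\<lambda>x. l1 * g1 x + l2 * g2 x + g x)"
    by (intro Oh_add Oh_cmult g1 g2 Oh_mono[OF g(1)]) (use nu in simp)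
  moreover have "eventually (\<lambda>x. r x \<le> 1 + c1 * h x ^ 2 + c2 * h x ^ 4 + (l1 * g1 x + l2 * g2 x + g x)) F"
    using g1(2) g2(2) g(2) Lam_nonneg
  proof eventually_elim
    case (elim x)
    define d where "d = r x - 1 - c1 * h x ^ 2"
    define T where "T = S x - S1 * h x ^ 2"
    define p where "p = conf.p4 x - pstar * h x ^ 4"
    define m where "m = Lam x / (2 * n)"
    have m: "0 \<le> m" using elim(4) by (simp add: m_def)
    have "l1 * (d + T * etac n u1 + m + h x ^ 4 * Zc n u1 c1 S1 pstar + Wc n u1 * p) \<le> l1 * g1 x"
      using elim(1) l_pos unfolding d_def T_def p_def m_def by (intro mult_left_mono) auto
    moreover have "l2 * (d + T * etac n u2 + m + h x ^ 4 * Zc n u2 c1 S1 pstar + Wc n u2 * p) \<le> l2 * g2 x"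
      using elim(2) l_pos unfolding d_def T_def p_def m_def by (intro mult_left_mono) auto
    moreover have "l1 * (d + T * etac n u1 + m + h x ^ 4 * Zc n u1 c1 S1 pstar + Wc n u1 * p)
       + l2 * (d + T * etac n u2 + m + h x ^ 4 * Zc n u2 c1 S1 pstar + Wc n u2 * p)
       = (l1 + l2) * (d + m) + T * (l1 * etac n u1 + l2 * etac n u2) - c2 * h x ^ 4
         - (- (l1 * Wc n u1 + l2 * Wc n u2) * p)"
      unfolding c2_def by (simp add: algebra_simps)
    ultimately have "d \<le> c2 * h x ^ 4 + (l1 * g1 x + l2 * g2 x + g x)"
      using elim(3) m unfolding l_sum eta_mean p_def[symmetric] by simp
    then show ?case by (simp add: d_def)
  qed
  ultimately show ?thesis by blast
qed

end

section \<open>Realizing a configuration by a polynomial\<close>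

text \<open>\<open>Qfun n v\<close> has degree \<open>n\<close> in \<open>s\<close>, so \<open>n\<close> distinct zeros exhaust its zeros.\<close>

lemma admissible_of_roots:
  assumes inj: "inj_on s R" and R: "card R = n" "finite R" "1 \<le> n"
    and root: "\<And>w. w \<in> R \<Longrightarrow> Qfun n v (s w) = 0"
    and Phi: "\<And>w. w \<in> R \<Longrightarrow> Phi b r (s w) \<le> 0"
  shows "admissible n b r v"
proof -
  define Q where "Q = (\<Sum>k\<le>n. monom (esym v n k / of_nat (Suc k)) (n - k))"
  have Qp: "poly Q s = Qfun n v s" for s
    by (simp add: Q_def Qfun_def poly_sum poly_monom)
  have "coeff Q n = (\<Sum>i\<le>n. if i = 0 then 1 else 0)"
    unfolding Q_def coeff_sum using R(3) by (intro sum.cong refl) (auto simp: coeff_monom)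
  then have "coeff Q n = 1" by simp
  then have Q0: "Q \<noteq> 0" by auto
  have dQ: "degree Q \<le> n" unfolding Q_def
    by (intro degree_sum_le) (auto intro: order.trans[OF degree_monom_le])
  have fin: "finite {z. poly Q z = 0}" by (rule poly_roots_finite[OF Q0])
  have "card {z. poly Q z = 0} \<le> card (s ` R)"
    using card_poly_roots_bound[OF Q0] dQ card_image[OF inj] R by simp
  moreover have "s ` R \<subseteq> {z. poly Q z = 0}" using root by (auto simp: Qp)
  ultimately have "s ` R = {z. poly Q z = 0}" by (rule card_seteq[OF fin, rotated])
  then have "z \<in> s ` R" if "Qfun n v z = 0" for z using that by (simp add: Qp)
  then show ?thesis unfolding admissible_def using Phi by blast
qed

lemma Phi_decrease:
  "Phi b (r - \<delta>) s = Phi b r s - \<delta> * (2 * r - \<delta> + 2 * b * Re s)"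
  unfolding Phi_def by (simp add: algebra_simps power2_eq_square)

text \<open>Configurations on the unit circle that satisfy both active constraints with equality up to the error term.
  The second-order coefficient \<open>S2\<close> of the variance is at disposal to equalize the two constraints.\<close>

locale extremal_family = small_scale F h + conf: graded_configuration F h n c \<xi> \<mu> + active_pair n k
  for F :: "'a filter" and h :: "'a \<Rightarrow> real" and n c \<xi> \<mu> k +
  fixes S2 :: real
  assumes unit: "j < n \<Longrightarrow> eventually (\<lambda>x. norm (c x * (1 + \<xi> j x)) = 1) F"
    and S_eq: "eventually (\<lambda>x. conf.S x = S1 * h x ^ 2 + S2 * h x ^ 4) F"
    and S2_1: "c2 + S2 * etac n u1 + Zc n u1 c1 S1 pstar = 0"
    and S2_2: "c2 + S2 * etac n u2 + Zc n u2 c1 S1 pstar = 0"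
    and odd1: "Oh (\<mu> + 2) (conf.odd_part w1)"
    and odd2: "Oh (\<mu> + 2) (conf.odd_part w2)"
    and p4: "Oh (\<mu> + 2) (\<lambda>x. conf.p4 x - pstar * h x ^ 4)"
begin

definition v where "v j x = c x * (1 + \<xi> j x)"

lemma unit_all: "eventually (\<lambda>x. \<forall>j\<in>{..<n}. norm (v j x) = 1) F"
  by (rule eventually_ball_finite) (use unit in \<open>auto simp: v_def\<close>)

lemma sl_0: "eventually (\<lambda>x. \<forall>j\<in>{..<n}. conf.sl j x = 0) F"
  using unit_all
proof eventually_elim
  case (elim x)
  have "norm (c x) ^ 2 * norm (1 + \<xi> j x) ^ 2 = norm (v j x) ^ 2" for j
    by (simp add: v_def norm_mult power_mult_distrib)
  then show ?case using elim unfolding conf.sl_def by simp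
qed

lemma Lam_0: "eventually (\<lambda>x. conf.Lam x = 0) F"
  using sl_0 by eventually_elim (simp add: conf.Lam_def)

lemma S_S1: "Oh 4 (\<lambda>x. conf.S x - S1 * h x ^ 2)"
proof -
  have "Oh 4 (\<lambda>x. S2 * h x ^ 4)" by (intro Oh_cmult Oh_h4)
  then show ?thesis by (rule Oh_cong_ev) (use S_eq in eventually_elim, simp)
qed

definition r0 where "r0 x = 1 + c1 * h x ^ 2 + c2 * h x ^ 4"

lemma root_family:
  assumes ur: "unity_root n w"
  obtains s where "Oh (\<mu> + 2) (\<lambda>x. s x - conf.approx w x)"
    "eventually (\<lambda>x. Qfun n (\<lambda>j. v j x) (c x * s x) = 0) F"
proof -
  have w: "w ^ (n + 1) = 1" "w \<noteq> 1" using ur by (auto simp: unity_root_def)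
  obtain q where q: "eventually (\<lambda>x. Jprim n 0 (q x) + (\<Sum>k=2..n. conf.E k x * Jprim n k (q x)) = 0) F"
    "(q \<longlongrightarrow> w) F"
    "Oh (\<mu> + 2) (\<lambda>x. 1 / (q x - 1) - (1 / (w - 1) + (\<Sum>k=2..n. bcoef n k w * conf.E k x) + kcoef n w * conf.E 2 x ^ 2))"
    by (rule perturbed_inverse_root[where E=conf.E, OF n3 conf.mu w conf.E2_2 conf.E_mu])
  have "eventually (\<lambda>x. Qfun n (\<lambda>j. v j x) (c x * (1 / (q x - 1))) = 0) F"
    using q(1) tendsto_imp_eventually_ne[OF q(2) w(2)] conf.sum0
  proof eventually_elim
    case (elim x)
    have e1: "esym (\<lambda>j. \<xi> j x) n (Suc 0) = 0" using elim(3) by (simp only: esym_1)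
    have "Qfun n (\<lambda>j. v j x) (c x * (1 / (q x - 1))) = c x ^ n * (1 / (q x - 1)) ^ Suc n *
       (Jprim n 0 (q x) + (\<Sum>k=2..n. esym (\<lambda>j. \<xi> j x) n k * Jprim n k (q x)))"
      by (rule Qfun_centred[OF e1 _ elim(2)]) (use n3 in \<open>auto simp: v_def\<close>)
    then show ?case using elim(1) unfolding conf.E_def by simp
  qed
  with q(3) show thesis using that[of "\<lambda>x. 1 / (q x - 1)"] unfolding conf.approx_def by blast
qed

lemma active_Phi:
  assumes ur: "unity_root n w" and s: "Oh (\<mu> + 2) (\<lambda>x. s x - conf.approx w x)"
    and act: "c1 + 1 + S1 * etac n (Re w) = 1 / (1 - Re w)"
    and S2: "c2 + S2 * etac n (Re w) + Zc n (Re w) c1 S1 pstar = 0"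
    and odd: "Oh (\<mu> + 2) (conf.odd_part w)"
  shows "Oh (\<mu> + 2) (\<lambda>x. Phi (1 - h x ^ 2) (r0 x) (c x * s x))"
proof -
  define R where "R x = c2 * h x ^ 4 + (conf.S x - S1 * h x ^ 2) * etac n (Re w)
     + conf.Lam x / (2 * n) + 2 * conf.odd_part w x + h x ^ 4 * Zc n (Re w) c1 S1 pstar
     + Wc n (Re w) * (conf.p4 x - pstar * h x ^ 4)" for x
  have 1: "Oh (\<mu> + 2) (\<lambda>x. Phi (1 - h x ^ 2) (1 + c1 * h x ^ 2 + c2 * h x ^ 4) (c x * s x) - R x)"
    unfolding R_def by (intro conf.second_order_Phi ur s S_S1 act Oh_cmult Oh_h4)
  have "Oh (\<mu> + 2) (\<lambda>x. 2 * conf.odd_part w x + Wc n (Re w) * (conf.p4 x - pstar * h x ^ 4))"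
    by (intro Oh_add Oh_cmult odd p4)
  then have "Oh (\<mu> + 2) R"
  proof (rule Oh_cong_ev)
    show "eventually (\<lambda>x. 2 * conf.odd_part w x + Wc n (Re w) * (conf.p4 x - pstar * h x ^ 4) = R x) F"
      using Lam_0 S_eq
    proof eventually_elim
      case (elim x)
      have "R x = (c2 + S2 * etac n (Re w) + Zc n (Re w) c1 S1 pstar) * h x ^ 4
         + (2 * conf.odd_part w x + Wc n (Re w) * (conf.p4 x - pstar * h x ^ 4))"
        unfolding R_def elim by (simp add: algebra_simps)
      then show ?case unfolding S2 by simp
    qed
  qed
  from Oh_add[OF 1 this] show ?thesis by (rule Oh_cong) (simp add: r0_def)
qed

text \<open>The secant line lies below the convex curve by a fixed amount at the other roots of unity, which
  leaves room of order \<open>h\<^sup>2\<close>.\<close>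

lemma inactive_Phi:
  assumes ur: "unity_root n w" and s: "Oh (\<mu> + 2) (\<lambda>x. s x - conf.approx w x)"
    and w: "w \<notin> {w1, cnj w1, w2, cnj w2}"
  shows "eventually (\<lambda>x. Phi (1 - h x ^ 2) (r0 x) (c x * s x) \<le> 0) F"
proof -
  have s5: "Oh 5 (\<lambda>x. s x - conf.approx w x)" using s by (rule Oh_mono) (use conf.mu in auto)
  define \<gamma> where "\<gamma> = - (c1 + 1 + S1 * etac n (Re w) - 1 / (1 - Re w))"
  have u: "Re w < 1" by (rule unity_root.u_less[OF ur])
  have \<gamma>: "0 < \<gamma>"
    unfolding \<gamma>_def secant_line[OF u] using no_root_between[OF ur w] u u_less_1 by simp
  have "Oh 2 (\<lambda>x. c1 * h x ^ 2 + c2 * h x ^ 4)"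
    by (intro Oh_add Oh_cmult Oh_h2 Oh_mono[OF Oh_h4]) simp
  then have r2: "Oh 2 (\<lambda>x. r0 x - 1)" by (rule Oh_cong) (simp add: r0_def)
  define R where "R x = (r0 x - 1) + h x ^ 2 + conf.S x * etac n (Re w) + conf.Lam x / (2 * n)
     + 2 * conf.odd_part w x - h x ^ 2 / (1 - Re w)" for x
  have 1: "Oh 4 (\<lambda>x. Phi (1 - h x ^ 2) (r0 x) (c x * s x) - R x)"
    unfolding R_def by (rule conf.first_order_Phi[OF ur s5 r2])
  have odd3: "Oh 3 (conf.odd_part w)" by (rule Oh_mono[OF conf.odd_mu conf.mu(1)])
  have "Oh 3 (\<lambda>x. (Phi (1 - h x ^ 2) (r0 x) (c x * s x) - R x) + c2 * h x ^ 4
     + (conf.S x - S1 * h x ^ 2) * etac n (Re w) + conf.Lam x / (2 * n) + 2 * conf.odd_part w x)"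
    by (intro Oh_add Oh_cmult Oh_cmult_right Oh_divide_const Oh_mono[OF 1] Oh_mono[OF Oh_h4] Oh_mono[OF S_S1]
        Oh_mono[OF conf.Lam4] odd3) auto
  then have "Oh 3 (\<lambda>x. Phi (1 - h x ^ 2) (r0 x) (c x * s x) + \<gamma> * h x ^ 2)"
    by (rule Oh_cong) (simp add: R_def \<gamma>_def r0_def algebra_simps)
  then obtain C where C: "C > 0" "eventually (\<lambda>x. norm (Phi (1 - h x ^ 2) (r0 x) (c x * s x) + \<gamma> * h x ^ 2) \<le> C * h x ^ 3) F"
    by (rule OhE)
  have "\<gamma> / C > 0" using C \<gamma> by simp
  show ?thesis using C(2) h_pos h_less[OF \<open>\<gamma> / C > 0\<close>]
  proof eventually_elim
    case (elim x)
    have "C * h x ^ 3 = (C * h x) * h x ^ 2" by (simp add: power3_eq_cube power2_eq_square)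
    also have "\<dots> \<le> \<gamma> * h x ^ 2"
      using elim(3) C(1) by (intro mult_right_mono) (simp_all add: field_simps)
    finally show ?case using elim(1) by (simp add: abs_le_iff)
  qed
qed

lemma Phi_bound:
  assumes ur: "unity_root n w"
  obtains s M where "Oh (\<mu> + 2) (\<lambda>x. s x - conf.approx w x)"
    "eventually (\<lambda>x. Qfun n (\<lambda>j. v j x) (c x * s x) = 0) F" "0 < M"
    "eventually (\<lambda>x. Phi (1 - h x ^ 2) (r0 x) (c x * s x) \<le> M * h x ^ (\<mu> + 2)) F"
proof -
  obtain s where s: "Oh (\<mu> + 2) (\<lambda>x. s x - conf.approx w x)"
    "eventually (\<lambda>x. Qfun n (\<lambda>j. v j x) (c x * s x) = 0) F"
    by (rule root_family[OF ur])
  show thesis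
  proof (cases "w \<in> {w1, cnj w1, w2, cnj w2}")
    case True
    have oc: "Oh (\<mu> + 2) (conf.odd_part (cnj w1))" "Oh (\<mu> + 2) (conf.odd_part (cnj w2))"
      unfolding conf.odd_part_cnj[abs_def] by (intro Oh_uminus odd1 odd2)+
    have "Re w = u1 \<or> Re w = u2" using True by auto
    then have "c1 + 1 + S1 * etac n (Re w) = 1 / (1 - Re w)"
        "c2 + S2 * etac n (Re w) + Zc n (Re w) c1 S1 pstar = 0"
      using active S2_1 S2_2 by auto
    moreover have "Oh (\<mu> + 2) (conf.odd_part w)" using True oc odd1 odd2 by auto
    ultimately have "Oh (\<mu> + 2) (\<lambda>x. Phi (1 - h x ^ 2) (r0 x) (c x * s x))"
      by (rule active_Phi[OF ur s(1)])
    then obtain M where "M > 0"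
      "eventually (\<lambda>x. norm (Phi (1 - h x ^ 2) (r0 x) (c x * s x)) \<le> M * h x ^ (\<mu> + 2)) F" by (rule OhE)
    then show thesis by (intro that[OF s]) (auto elim!: eventually_mono)
  next
    case False
    have "eventually (\<lambda>x. Phi (1 - h x ^ 2) (r0 x) (c x * s x) \<le> 1 * h x ^ (\<mu> + 2)) F"
      using inactive_Phi[OF ur s(1) False] h_pos
    proof eventually_elim
      case (elim x)
      have "0 \<le> 1 * h x ^ (\<mu> + 2)" using elim(2) by (intro mult_nonneg_nonneg zero_le_power) auto
      with elim(1) show ?case by (rule order.trans)
    qed
    then show thesis using that[OF s, of 1] by simp
  qed
qed

text \<open>At the radius \<open>r0\<close> the constraints may be violated by \<open>O(h\<^sup>\<mu>\<^sup>+\<^sup>2)\<close>. As \<open>Phi\<close> increases in \<open>r\<close> with slope close to 1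
  at these points, a smaller radius satisfies all of them.\<close>

lemma extremal_polynomials:
  "\<exists>K. eventually (\<lambda>x. \<exists>P\<in>sendov_polys (n + 1) (1 - h x ^ 2).
      crit_dist (1 - h x ^ 2) P = r0 x - K * h x ^ (\<mu> + 2)) F"
proof -
  define R where "R = {w :: complex. w ^ (n + 1) = 1} - {1}"
  have R: "finite R" "card R = n" "w \<in> R \<longleftrightarrow> unity_root n w" for w
  proof -
    have "finite {w :: complex. w ^ (n + 1) = 1}" using finite_roots_unity[of "n + 1"] by simp
    moreover have "card {w :: complex. w ^ (n + 1) = 1} = n + 1" using card_roots_unity_eq[of "n + 1"] by simp
    ultimately show "finite R" "card R = n" unfolding R_def by simp_all
    show "w \<in> R \<longleftrightarrow> unity_root n w" using n3 unfolding R_def by (auto simp: unity_root_def)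
  qed
  have "\<forall>w\<in>R. \<exists>s M. Oh (\<mu> + 2) (\<lambda>x. s x - conf.approx w x) \<and>
    eventually (\<lambda>x. Qfun n (\<lambda>j. v j x) (c x * s x) = 0) F \<and> 0 < M \<and>
    eventually (\<lambda>x. Phi (1 - h x ^ 2) (r0 x) (c x * s x) \<le> M * h x ^ (\<mu> + 2)) F"
  proof
    fix w assume "w \<in> R"
    then have "unity_root n w" using R(3) by blast
    then show "\<exists>s M. Oh (\<mu> + 2) (\<lambda>x. s x - conf.approx w x) \<and>
      eventually (\<lambda>x. Qfun n (\<lambda>j. v j x) (c x * s x) = 0) F \<and> 0 < M \<and>
      eventually (\<lambda>x. Phi (1 - h x ^ 2) (r0 x) (c x * s x) \<le> M * h x ^ (\<mu> + 2)) F"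
      by (rule Phi_bound) blast
  qed
  then obtain s where "\<forall>w\<in>R. \<exists>M. Oh (\<mu> + 2) (\<lambda>x. s w x - conf.approx w x) \<and>
      eventually (\<lambda>x. Qfun n (\<lambda>j. v j x) (c x * s w x) = 0) F \<and> 0 < M \<and>
      eventually (\<lambda>x. Phi (1 - h x ^ 2) (r0 x) (c x * s w x) \<le> M * h x ^ (\<mu> + 2)) F"
    unfolding bchoice_iff by blast
  then obtain M where "\<forall>w\<in>R. Oh (\<mu> + 2) (\<lambda>x. s w x - conf.approx w x) \<and>
      eventually (\<lambda>x. Qfun n (\<lambda>j. v j x) (c x * s w x) = 0) F \<and> 0 < M w \<and>
      eventually (\<lambda>x. Phi (1 - h x ^ 2) (r0 x) (c x * s w x) \<le> M w * h x ^ (\<mu> + 2)) F"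
    unfolding bchoice_iff by blast
  then have s: "\<And>w. w \<in> R \<Longrightarrow> Oh (\<mu> + 2) (\<lambda>x. s w x - conf.approx w x)"
    "\<And>w. w \<in> R \<Longrightarrow> eventually (\<lambda>x. Qfun n (\<lambda>j. v j x) (c x * s w x) = 0) F"
    "\<And>w. w \<in> R \<Longrightarrow> 0 < M w"
    "\<And>w. w \<in> R \<Longrightarrow> eventually (\<lambda>x. Phi (1 - h x ^ 2) (r0 x) (c x * s w x) \<le> M w * h x ^ (\<mu> + 2)) F"
    by blast+
  define K where "K = 2 * (\<Sum>w\<in>R. M w)"
  have MK: "M w \<le> K / 2" if "w \<in> R" for w
    unfolding K_def using member_le_sum[of w R M] that s(3) R(1) by (auto simp: less_imp_le)
  have lim: "((\<lambda>x. c x * s w x) \<longlongrightarrow> 1 / (w - 1)) F" if "w \<in> R" for w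
    by (rule Oh_tendsto[OF conf.cs_first[OF Oh_mono[OF s(1)[OF that]]]]) (use conf.mu in auto)
  have h0: "((\<lambda>x. h x) \<longlongrightarrow> 0) F" by (rule h_tendsto)
  have r0: "(r0 \<longlongrightarrow> 1 + c1 * 0^2 + c2 * 0^4) F" unfolding r0_def[abs_def] by (intro tendsto_intros h0)
  have inj: "eventually (\<lambda>x. \<forall>w\<in>R. \<forall>w'\<in>R - {w}. c x * s w x - c x * s w' x \<noteq> 0) F"
  proof (intro eventually_ball_finite ballI)
    fix w w' assume w: "w \<in> R" "w' \<in> R - {w}"
    have "((\<lambda>x. c x * s w x - c x * s w' x) \<longlongrightarrow> 1 / (w - 1) - 1 / (w' - 1)) F"
      by (intro tendsto_diff lim) (use w in auto)
    moreover have "1 / (w - 1) - 1 / (w' - 1) \<noteq> 0"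
      using w by (auto simp: R_def)
    ultimately show "eventually (\<lambda>x. c x * s w x - c x * s w' x \<noteq> 0) F"
      by (rule tendsto_imp_eventually_ne)
  qed (use R in auto)
  \<comment> \<open>The slope of \<open>Phi\<close> in \<open>r\<close> tends to \<open>2 + 2 Re (1 / (w - 1)) = 1\<close>.\<close>
  have slope: "eventually (\<lambda>x. \<forall>w\<in>R. 1 / 2 < 2 * r0 x - K * h x ^ (\<mu> + 2) + 2 * (1 - h x ^ 2) * Re (c x * s w x)) F"
  proof (intro eventually_ball_finite ballI)
    fix w assume w: "w \<in> R"
    have "((\<lambda>x. 2 * r0 x - K * h x ^ (\<mu> + 2) + 2 * (1 - h x ^ 2) * Re (c x * s w x)) \<longlongrightarrow>
        2 * (1 + c1 * 0^2 + c2 * 0^4) - K * 0 ^ (\<mu> + 2) + 2 * (1 - 0^2) * Re (1 / (w - 1))) F"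
      by (intro tendsto_intros r0 h0 lim w)
    moreover have "Re (1 / (w - 1)) = - 1 / 2" using unity_root.s0_Re R(3) w by blast
    ultimately show "eventually (\<lambda>x. 1 / 2 < 2 * r0 x - K * h x ^ (\<mu> + 2) + 2 * (1 - h x ^ 2) * Re (c x * s w x)) F"
      by (intro order_tendstoD(1)) auto
  qed (use R in auto)
  have pos: "eventually (\<lambda>x. 0 < r0 x - K * h x ^ (\<mu> + 2)) F"
  proof -
    have "((\<lambda>x. r0 x - K * h x ^ (\<mu> + 2)) \<longlongrightarrow> (1 + c1 * 0^2 + c2 * 0^4) - K * 0 ^ (\<mu> + 2)) F"
      by (intro tendsto_intros r0 h0)
    then show ?thesis by (intro order_tendstoD(1)) auto
  qed
  have Q: "eventually (\<lambda>x. \<forall>w\<in>R. Qfun n (\<lambda>j. v j x) (c x * s w x) = 0) F"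
    and P: "eventually (\<lambda>x. \<forall>w\<in>R. Phi (1 - h x ^ 2) (r0 x) (c x * s w x) \<le> M w * h x ^ (\<mu> + 2)) F"
    using R(1) s(2,4) by (auto intro: eventually_ball_finite)
  have "eventually (\<lambda>x. \<exists>P\<in>sendov_polys (n + 1) (1 - h x ^ 2).
      crit_dist (1 - h x ^ 2) P = r0 x - K * h x ^ (\<mu> + 2)) F"
    using inj slope pos Q P unit_all h_pos h_less[OF zero_less_one]
  proof eventually_elim
    case (elim x)
    have h1: "h x ^ 2 \<le> 1" using elim by (simp add: power_le_one)
    have hm: "0 < h x ^ (\<mu> + 2)" using elim(7) by (rule zero_less_power)
    have "admissible n (1 - h x ^ 2) (r0 x - K * h x ^ (\<mu> + 2)) (\<lambda>j. v j x)"
    proof (rule admissible_of_roots)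
      show "inj_on (\<lambda>w. c x * s w x) R" using elim(1) by (force simp: inj_on_def)
      fix w assume w: "w \<in> R"
      show "Qfun n (\<lambda>j. v j x) (c x * s w x) = 0" using elim(4) w by blast
      have K0: "0 < K" using MK[OF w] s(3)[OF w] by simp
      have "K * h x ^ (\<mu> + 2) * (1 / 2)
         \<le> K * h x ^ (\<mu> + 2) * (2 * r0 x - K * h x ^ (\<mu> + 2) + 2 * (1 - h x ^ 2) * Re (c x * s w x))"
        using elim(2) w K0 hm by (intro mult_left_mono) (auto simp: less_imp_le simp del: times_complex.sel)
      moreover have "Phi (1 - h x ^ 2) (r0 x) (c x * s w x) \<le> K / 2 * h x ^ (\<mu> + 2)"
        using elim(5) w MK[OF w] mult_right_mono[OF MK[OF w] less_imp_le[OF hm]] by force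
      ultimately show "Phi (1 - h x ^ 2) (r0 x - K * h x ^ (\<mu> + 2)) (c x * s w x) \<le> 0"
        unfolding Phi_decrease by simp
    qed (use R n3 in auto)
    then show ?case
      using elim h1 n3 by (intro sendov_poly_of_admissible[where v="\<lambda>j. v j x"]) auto
  qed
  then show ?thesis by blast
qed

end

section \<open>Extremal configurations\<close>

lemma (in small_scale) Oh_sqrt:
  assumes "Oh 2 f"
  shows "Oh 1 (\<lambda>x. sqrt (f x))"
proof -
  obtain C where C: "C > 0" "eventually (\<lambda>x. norm (f x) \<le> C * h x ^ 2) F" using assms by (rule OhE)
  show ?thesis
  proof (rule OhI)
    show "eventually (\<lambda>x. norm (sqrt (f x)) \<le> sqrt C * h x ^ 1) F"
      using C(2) h_pos
    proof eventually_elim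
      case (elim x)
      have "norm (sqrt (f x)) = sqrt \<bar>f x\<bar>" by (cases "0 \<le> f x") (simp_all add: real_sqrt_minus)
      also have "\<dots> \<le> sqrt (C * h x ^ 2)" using elim by simp
      finally show ?case using elim(2) by (simp add: real_sqrt_mult)
    qed
  qed
qed

context active_pair
begin

text \<open>The solution of the two linear equations that make both active constraints equalities for \<open>r = 1 + c1 h\<^sup>2 + c2 h\<^sup>4\<close>; they are compatible
  by the choice of \<open>c2\<close> as a weighted mean.\<close>

definition "S2 = (Zc n u2 c1 S1 pstar - Zc n u1 c1 S1 pstar) / (etac n u1 - etac n u2)"

lemma S2: "c2 + S2 * etac n u1 + Zc n u1 c1 S1 pstar = 0" "c2 + S2 * etac n u2 + Zc n u2 c1 S1 pstar = 0"
proof -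
  define a b where "a = etac n u1" and "b = etac n u2"
  have nz: "a - b \<noteq> 0" using eta_diff by (simp add: a_def b_def)
  have m: "l1 * a + l2 * b = 0" using eta_mean by (simp add: a_def b_def)
  have "l2 * (a - b) = (l1 + l2) * a - (l1 * a + l2 * b)" by (simp add: algebra_simps)
  then have a: "a / (a - b) = l2" using nz unfolding m l_sum by (simp add: field_simps)
  have "l1 * (a - b) = (l1 * a + l2 * b) - (l1 + l2) * b" by (simp add: algebra_simps)
  then have b: "b / (a - b) = - l1" using nz unfolding m l_sum by (simp add: field_simps)
  define Z1 Z2 where "Z1 = Zc n u1 c1 S1 pstar" and "Z2 = Zc n u2 c1 S1 pstar"
  have "S2 * a = (Z2 - Z1) * (a / (a - b))" "S2 * b = (Z2 - Z1) * (b / (a - b))"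
    unfolding S2_def a_def b_def Z1_def Z2_def by simp_all
  then have e: "S2 * a = (Z2 - Z1) * l2" "S2 * b = - ((Z2 - Z1) * l1)" unfolding a b by simp_all
  have l: "l1 = 1 - l2" using l_sum by simp
  show "c2 + S2 * etac n u1 + Zc n u1 c1 S1 pstar = 0" "c2 + S2 * etac n u2 + Zc n u2 c1 S1 pstar = 0"
    unfolding c2_def a_def[symmetric] b_def[symmetric] Z1_def[symmetric] Z2_def[symmetric] e l
    by (simp_all add: algebra_simps)
qed

end

locale near_one = small_scale F h + active_pair n k
  for F :: "'a filter" and h :: "'a \<Rightarrow> real" and n k
begin

definition \<sigma> where "\<sigma> x = (S1 * h x ^ 2 + S2 * h x ^ 4) / n"

lemma \<sigma>_order: "Oh 2 \<sigma>"
  unfolding \<sigma>_def[abs_def] by (intro Oh_divide_const Oh_add Oh_cmult Oh_h2 Oh_mono[OF Oh_h4]) simp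

lemma \<sigma>_pos: "eventually (\<lambda>x. 0 < \<sigma> x) F"
proof -
  have "((\<lambda>x. S1 + S2 * h x ^ 2) \<longlongrightarrow> S1 + S2 * 0 ^ 2) F" by (intro tendsto_intros h_tendsto)
  then have "eventually (\<lambda>x. 0 < S1 + S2 * h x ^ 2) F" using S1_pos by (intro order_tendstoD(1)) auto
  then show ?thesis using h_pos
  proof eventually_elim
    case (elim x)
    have "0 < (S1 + S2 * h x ^ 2) * h x ^ 2 / n" using elim n3 by simp
    then show ?case unfolding \<sigma>_def by (simp add: algebra_simps power2_eq_square power4_eq_xxxx)
  qed
qed

end

text \<open>A choice of the \<open>\<xi>\<^sub>j\<close> with all \<open>\<bar>1 + \<xi>\<^sub>j\<bar>\<close> equal, so that a suitable modulus of \<open>c\<close> puts every \<open>v\<^sub>j\<close> on the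
  unit circle; the common value makes the variance exactly \<open>S1 h\<^sup>2 + S2 h\<^sup>4\<close>. The assumption \<open>symmetric\<close> lists the two ways in which the odd
  part at \<open>w2\<close> can vanish: \<open>w2 = -1\<close>, or real symmetric functions.\<close>

locale level_family = near_one F h n k
  for F :: "'a filter" and h :: "'a \<Rightarrow> real" and n k +
  fixes \<xi> :: "nat \<Rightarrow> 'a \<Rightarrow> complex" and \<mu> :: nat
  assumes mu: "3 \<le> \<mu>" "\<mu> \<le> 4"
    and sum0: "eventually (\<lambda>x. (\<Sum>j<n. \<xi> j x) = 0) F"
    and level: "j < n \<Longrightarrow> eventually (\<lambda>x. norm (1 + \<xi> j x) ^ 2 = 1 + \<sigma> x) F"
    and xi1: "j < n \<Longrightarrow> Oh 1 (\<xi> j)"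
    and Im_E: "m \<in> {2..n} \<Longrightarrow> Oh \<mu> (\<lambda>x. Im (esym (\<lambda>j. \<xi> j x) n m))"
    and symmetric: "cnj w2 = w2 \<or> (\<forall>m. eventually (\<lambda>x. Im (esym (\<lambda>j. \<xi> j x) n m) = 0) F)"
    and fourth: "\<exists>q. pstar = q * S1^2 \<and>
        eventually (\<lambda>x. (\<Sum>j<n. Im (\<xi> j x) ^ 4) = q * (\<Sum>j<n. Im (\<xi> j x) ^ 2) ^ 2) F"
begin

text \<open>The argument of \<open>c\<close> is chosen to cancel the odd part at \<open>w1\<close> exactly.\<close>

definition T where "T x = (\<Sum>m=2..n. Im (bcoef n m w1) * Im (esym (\<lambda>j. \<xi> j x) n m))"
definition \<tau> where "\<tau> x = T x / Im (1 / (w1 - 1))"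
definition A where "A x = (1 + \<sigma> x) * (1 + \<tau> x ^ 2)"
definition c where "c x = Complex (1 / sqrt (A x)) (- \<tau> x / sqrt (A x))"

lemma T_order: "Oh \<mu> T"
  unfolding T_def[abs_def] by (intro Oh_sum Oh_cmult Im_E) auto

lemma \<tau>_order: "Oh \<mu> \<tau>"
  unfolding \<tau>_def[abs_def] by (intro Oh_divide_const T_order)

lemma A_order: "Oh 2 (\<lambda>x. A x - 1)"
proof -
  have "Oh 2 (\<lambda>x. \<sigma> x * (1 + \<tau> x ^ 2) + \<tau> x ^ 2)"
    by (intro Oh_add Oh_mult[OF \<sigma>_order, where l=0] Oh_const Oh_power[OF \<tau>_order]) (use mu in auto)
  then show ?thesis by (rule Oh_cong) (simp add: A_def algebra_simps)
qed

lemma A_lim: "(A \<longlongrightarrow> 1) F"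
  by (rule Oh_tendsto[OF A_order]) simp

lemma A_pos: "eventually (\<lambda>x. 0 < A x) F"
  by (rule order_tendstoD[OF A_lim]) simp

lemma inv_lim: "((\<lambda>x. 1 / sqrt (A x)) \<longlongrightarrow> 1) F"
proof -
  have "((\<lambda>x. 1 / sqrt (A x)) \<longlongrightarrow> 1 / sqrt 1) F" by (intro tendsto_intros A_lim) auto
  then show ?thesis by simp
qed

lemma Im_c_mu: "Oh \<mu> (\<lambda>x. Im (c x))"
proof -
  have "Oh \<mu> (\<lambda>x. - \<tau> x * (1 / sqrt (A x)))"
    by (intro Oh_mult[OF Oh_uminus[OF \<tau>_order] Oh_bounded[OF inv_lim]]) simp
  then show ?thesis by (rule Oh_cong) (simp add: c_def)
qed

lemma Re_c: "Oh 2 (\<lambda>x. Re (c x) - 1)"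
proof -
  have "Oh 2 (\<lambda>x. - (A x - 1))" by (intro Oh_uminus A_order)
  then have "Oh 2 (\<lambda>x. (Re (c x) - 1) * (sqrt (A x) * (1 + sqrt (A x))))"
  proof (rule Oh_cong_ev)
    show "eventually (\<lambda>x. - (A x - 1) = (Re (c x) - 1) * (sqrt (A x) * (1 + sqrt (A x)))) F"
      using A_pos
    proof eventually_elim
      case (elim x)
      have "(1 / s - 1) * (s * (1 + s)) = 1 - s * s" if "s \<noteq> 0" for s :: real
        using that by (simp add: field_simps)
      from this[of "sqrt (A x)"] show ?case using elim by (simp add: c_def)
    qed
  qed
  moreover have "((\<lambda>x. sqrt (A x) * (1 + sqrt (A x))) \<longlongrightarrow> sqrt 1 * (1 + sqrt 1)) F"
    by (intro tendsto_intros A_lim)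
  ultimately show ?thesis by (rule Oh_cancel) simp
qed

lemma norm_c: "eventually (\<lambda>x. norm (c x) ^ 2 * (1 + \<sigma> x) = 1) F"
  using A_pos
proof eventually_elim
  case (elim x)
  have "norm (c x) ^ 2 = (1 + \<tau> x ^ 2) / A x"
    using elim unfolding cmod_power2 c_def by (simp add: power_divide add_divide_distrib)
  also have "\<dots> * (1 + \<sigma> x) = A x / A x" by (simp add: A_def)
  finally show ?case using elim by simp
qed

lemma unit: "j < n \<Longrightarrow> eventually (\<lambda>x. norm (c x) ^ 2 * norm (1 + \<xi> j x) ^ 2 = 1) F"
  using norm_c level[of j] by (auto elim: eventually_elim2)

lemma slack: "j < n \<Longrightarrow> Oh m (\<lambda>x. 1 - norm (c x) ^ 2 * norm (1 + \<xi> j x) ^ 2)"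
  by (rule Oh_cong_ev[OF Oh_zero]) (use unit[of j] in \<open>auto elim: eventually_mono\<close>)

sublocale conf0: configuration F h n c \<xi>
  by unfold_locales (use n3 sum0 xi1 slack Re_c Oh_mono[OF Im_c_mu] mu in auto)

sublocale conf: graded_configuration F h n c \<xi> \<mu>
proof unfold_locales
  have "Oh \<mu> (\<lambda>x. Im (conf0.E 3 x))" unfolding conf0.E_def by (rule Im_E) (use n3 in auto)
  then show "Oh \<mu> (conf0.E 3)"
    by (intro Oh_complexI Oh_mono[OF conf0.Re_E3_4 mu(2)])
qed (use slack mu Im_c_mu in auto)

lemma S_\<sigma>: "eventually (\<lambda>x. conf0.S x = n * \<sigma> x) F"
proof -
  have "eventually (\<lambda>x. \<forall>j\<in>{..<n}. norm (c x) ^ 2 * norm (1 + \<xi> j x) ^ 2 = 1) F"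
    by (rule eventually_ball_finite) (use unit in auto)
  then show ?thesis using conf0.mean_square norm_c
  proof eventually_elim
    case (elim x)
    have L: "conf0.Lam x = 0" using elim(1) unfolding conf0.Lam_def conf0.sl_def by simp
    have "norm (c x) ^ 2 * (n + conf0.S x) = norm (c x) ^ 2 * (n + n * \<sigma> x)"
    proof -
      have "norm (c x) ^ 2 * (n + n * \<sigma> x) = n * (norm (c x) ^ 2 * (1 + \<sigma> x))" by (simp add: algebra_simps)
      then show ?thesis using elim(2) unfolding L elim(3) by simp
    qed
    moreover have "norm (c x) ^ 2 \<noteq> 0" using elim(3) by auto
    ultimately show ?case by simp
  qed
qed

lemma S_exact: "eventually (\<lambda>x. conf0.S x = S1 * h x ^ 2 + S2 * h x ^ 4) F"
  using S_\<sigma> by eventually_elim (use n3 in \<open>simp add: \<sigma>_def\<close>)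

lemma odd_1: "conf0.odd_part w1 x = 0"
proof -
  have "Im (1 / (w1 - 1)) \<noteq> 0"
    unfolding unity_root.s0_Im[OF unity(1)] using Im_w1 u_less_1 by simp
  then have "\<tau> x * Im (1 / (w1 - 1)) = T x" unfolding \<tau>_def by simp
  moreover have "conf0.odd_part w1 x = (\<tau> x * Im (1 / (w1 - 1)) - T x) / sqrt (A x)"
    unfolding conf0.odd_part_def T_def conf0.E_def c_def complex.sel by (simp add: diff_divide_distrib)
  ultimately show ?thesis by simp
qed

lemma odd_2: "eventually (\<lambda>x. conf0.odd_part w2 x = 0) F"
  using symmetric
proof
  assume "cnj w2 = w2"
  then have "conf0.odd_part w2 x = 0" for x using conf0.odd_part_cnj[of w2 x] by simp
  then show ?thesis by simp
next
  assume e: "\<forall>m. eventually (\<lambda>x. Im (esym (\<lambda>j. \<xi> j x) n m) = 0) F"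
  have "eventually (\<lambda>x. \<forall>m\<in>{2..n}. Im (esym (\<lambda>j. \<xi> j x) n m) = 0) F"
    by (rule eventually_ball_finite) (use e in auto)
  then show ?thesis
  proof eventually_elim
    case (elim x)
    then have "T x = 0" unfolding T_def by simp
    then have "\<tau> x = 0" unfolding \<tau>_def by simp
    then show ?case using elim unfolding conf0.odd_part_def conf0.E_def c_def by simp
  qed
qed

lemma p4_order: "Oh (\<mu> + 2) (\<lambda>x. conf0.p4 x - pstar * h x ^ 4)"
proof -
  obtain q where q: "pstar = q * S1^2"
    "eventually (\<lambda>x. (\<Sum>j<n. Im (\<xi> j x) ^ 4) = q * (\<Sum>j<n. Im (\<xi> j x) ^ 2) ^ 2) F" using fourth by blast
  define P2 where "P2 x = (\<Sum>j<n. Im (\<xi> j x) ^ 2)" for x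
  have S4: "Oh 4 (\<lambda>x. S2 * h x ^ 4 - (conf0.S x - P2 x))"
    unfolding P2_def by (intro Oh_diff conf0.S_Im Oh_cmult Oh_h4)
  have P: "Oh 4 (\<lambda>x. P2 x - S1 * h x ^ 2)"
    by (rule Oh_cong_ev[OF S4]) (use S_exact in eventually_elim, simp)
  have P2: "Oh 2 P2"
    unfolding P2_def[abs_def] by (intro Oh_sum Oh_power[OF Oh_Im[OF xi1]]) auto
  have "Oh 6 (\<lambda>x. q * ((P2 x - S1 * h x ^ 2) * (P2 x + S1 * h x ^ 2)))"
    by (rule Oh_cmult[OF Oh_mult[OF P Oh_add[OF P2 Oh_cmult[OF Oh_h2]]]]) simp
  then have "Oh 6 (\<lambda>x. conf0.p4 x - pstar * h x ^ 4)"
  proof (rule Oh_cong_ev)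
    show "eventually (\<lambda>x. q * ((P2 x - S1 * h x ^ 2) * (P2 x + S1 * h x ^ 2)) = conf0.p4 x - pstar * h x ^ 4) F"
      using q(2)
    proof eventually_elim
      case (elim x)
      then show ?case unfolding conf0.p4_def P2_def[symmetric] q(1)
        by (simp add: algebra_simps power2_eq_square power4_eq_xxxx)
    qed
  qed
  then show ?thesis by (rule Oh_mono) (use mu in simp)
qed

sublocale ext: extremal_family F h n c \<xi> \<mu> k S2
proof unfold_locales
  fix j assume "j < n"
  from unit[OF this] show "eventually (\<lambda>x. norm (c x * (1 + \<xi> j x)) = 1) F"
    by eventually_elim (simp add: norm_mult flip: power_mult_distrib, simp add: power2_eq_1_iff, 
      metis abs_norm_cancel abs_minus_cancel abs_one norm_mult)
next
  show "Oh (\<mu> + 2) (conf0.odd_part w1)" by (rule Oh_cong[OF Oh_zero]) (rule odd_1)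
  show "Oh (\<mu> + 2) (conf0.odd_part w2)" by (rule Oh_cong_ev[OF Oh_zero]) (use odd_2 in eventually_elim, simp)
qed (use S_exact S2 p4_order in auto)

end

lemma esym_conj_pair_real:
  assumes "y 1 = cnj (y 0)" "\<And>j. 2 \<le> j \<Longrightarrow> Im (y j) = 0" "2 \<le> n"
  shows "Im (esym y n m) = 0"
  using assms(3)
proof (induction n arbitrary: m rule: nat_induct_at_least)
  case base
  have two: "esym y 2 m = esym y (Suc (Suc 0)) m" by (simp add: numeral_2_eq_2)
  consider "m = 0" | "m = Suc 0" | "m = Suc (Suc 0)" | l where "m = Suc (Suc (Suc l))"
    by (metis not0_implies_Suc)
  then show ?case using assms(1) unfolding two by cases simp_all
next
  case (Suc n)
  then show ?case using assms(2)[of n] by (cases m) simp_all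
qed

context near_one
begin

definition extremal where
  "extremal K x \<longleftrightarrow> (\<exists>P\<in>sendov_polys (n + 1) (1 - h x ^ 2).
      crit_dist (1 - h x ^ 2) P = 1 + c1 * h x ^ 2 + c2 * h x ^ 4 - K * h x ^ (\<nu> + 2))"

text \<open>One conjugate pair \<open>\<xi>\<^sub>0, \<xi>\<^sub>1 = a + b i, a - b i\<close> and \<open>n - 2\<close> equal real values \<open>e\<close>. All symmetric functions are real,
  and the imaginary parts are a pair of opposite values.\<close>

lemma conjugate_pair_family:
  assumes n5: "n \<noteq> 5"
  shows "\<exists>K. eventually (extremal K) F"
proof -
  define e where "e x = sqrt (1 + \<sigma> x) - 1" for x
  define a where "a x = - (real n - 2) * e x / 2" for x
  define B where "B x = (e x - a x) * (2 + e x + a x)" for x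
  define b where "b x = sqrt (B x)" for x
  define \<xi> where "\<xi> j x = (if j = 0 then Complex (a x) (b x) else if j = 1 then Complex (a x) (- b x)
      else of_real (e x))" for j :: nat and x
  obtain m where m: "n = Suc (Suc m)" using n3 by (cases n; cases "n - 1") auto
  have e2: "Oh 2 e"
  proof (rule Oh_le_ev[OF \<sigma>_order])
    show "eventually (\<lambda>x. norm (e x) \<le> norm (\<sigma> x)) F"
      using \<sigma>_pos
    proof eventually_elim
      case (elim x)
      have "sqrt (1 + \<sigma> x) \<le> sqrt ((1 + \<sigma> x) ^ 2)"
        using elim by (intro real_sqrt_le_mono) (simp add: power2_eq_square algebra_simps)
      then show ?case using elim by (simp add: e_def)
    qed
  qed
  have a2: "Oh 2 a" unfolding a_def[abs_def] by (intro Oh_divide_const Oh_cmult e2)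
  have B2: "Oh 2 B" unfolding B_def[abs_def]
    by (intro Oh_mult[OF Oh_diff[OF e2 a2], where l=0] Oh_add Oh_const Oh_mono[OF e2] Oh_mono[OF a2]) auto
  have b1: "Oh 1 b" unfolding b_def[abs_def] by (rule Oh_sqrt[OF B2])
  have B0: "eventually (\<lambda>x. 0 \<le> B x) F"
  proof -
    have "((\<lambda>x. 2 + e x + a x) \<longlongrightarrow> 2 + 0 + 0) F"
      by (intro tendsto_intros Oh_tendsto_0[OF e2] Oh_tendsto_0[OF a2]) auto
    then have "eventually (\<lambda>x. 0 < 2 + e x + a x) F" by (rule order_tendstoD) simp
    then show ?thesis using \<sigma>_pos
    proof eventually_elim
      case (elim x)
      have "0 \<le> e x" using elim by (simp add: e_def)
      then have "0 \<le> real n / 2 * e x" by simp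
      also have "\<dots> = e x - a x" unfolding a_def by (simp add: field_simps)
      finally have "0 \<le> e x - a x" .
      then show ?case using elim unfolding B_def by (intro mult_nonneg_nonneg) auto
    qed
  qed
  have E0: "Im (esym (\<lambda>j. \<xi> j x) n i) = 0" for i x
    by (rule esym_conj_pair_real) (use n3 in \<open>auto simp: \<xi>_def complex_eq_iff\<close>)
  interpret level_family F h n k \<xi> \<nu>
  proof unfold_locales
    show "3 \<le> \<nu>" "\<nu> \<le> 4" by (rule nu)+
    have "(\<Sum>j<n. \<xi> j x) = 0" for x
    proof -
      have "(\<Sum>j<n. \<xi> j x) = of_real (2 * a x + real m * e x)"
        unfolding m sum.lessThan_Suc_shift by (simp add: \<xi>_def complex_eq_iff)
      also have "2 * a x + real m * e x = 0" unfolding a_def m by (simp add: algebra_simps)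
      finally show ?thesis by simp
    qed
    then show "eventually (\<lambda>x. (\<Sum>j<n. \<xi> j x) = 0) F" by simp
    show "eventually (\<lambda>x. norm (1 + \<xi> j x) ^ 2 = 1 + \<sigma> x) F" if "j < n" for j
      using B0 \<sigma>_pos
    proof eventually_elim
      case (elim x)
      have l: "(1 + e x) ^ 2 = 1 + \<sigma> x" using elim by (simp add: e_def)
      have bb: "b x ^ 2 = B x" using elim by (simp add: b_def)
      have "(1 + a x) ^ 2 + b x ^ 2 = 1 + \<sigma> x"
        unfolding bb l[symmetric] B_def by (simp add: algebra_simps power2_eq_square)
      then show ?case unfolding \<xi>_def cmod_power2 using l by simp
    qed
    show "Oh 1 (\<xi> j)" for j
    proof (rule Oh_complexI)
      show "Oh 1 (\<lambda>x. Re (\<xi> j x))" unfolding \<xi>_def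
        using Oh_mono[OF a2, of 1] Oh_mono[OF e2, of 1] by (cases "j = 0"; cases "j = 1") simp_all
      show "Oh 1 (\<lambda>x. Im (\<xi> j x))" unfolding \<xi>_def
        using b1 Oh_uminus[OF b1] Oh_zero[of 1] by (cases "j = 0"; cases "j = 1") simp_all
    qed
    show "Oh \<nu> (\<lambda>x. Im (esym (\<lambda>j. \<xi> j x) n i))" for i unfolding E0 by (rule Oh_zero)
    show "cnj w2 = w2 \<or> (\<forall>m. eventually (\<lambda>x. Im (esym (\<lambda>j. \<xi> j x) n m) = 0) F)" unfolding E0 by simp
    have p: "(\<Sum>j<n. Im (\<xi> j x) ^ 4) = 1 / 2 * (\<Sum>j<n. Im (\<xi> j x) ^ 2) ^ 2" for x
      unfolding m sum.lessThan_Suc_shift by (simp add: \<xi>_def power2_eq_square power4_eq_xxxx algebra_simps)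
    have "pstar = 1 / 2 * S1 ^ 2" unfolding pstar_def using n5 by simp
    then show "\<exists>q. pstar = q * S1^2 \<and>
        eventually (\<lambda>x. (\<Sum>j<n. Im (\<xi> j x) ^ 4) = q * (\<Sum>j<n. Im (\<xi> j x) ^ 2) ^ 2) F"
      using p by (intro exI[of _ "1 / 2"]) simp
  qed
  show ?thesis using ext.extremal_polynomials unfolding ext.r0_def extremal_def[abs_def] .
qed

text \<open>The multiples \<open>(4, -1, -1, -1, -1) \<zeta>\<close>, where \<open>\<bar>\<zeta>\<bar>\<^sup>2 = z\<close> and \<open>Re \<zeta> = - 3 z / 2\<close> is the condition \<open>\<bar>1 + 4 \<zeta>\<bar> = \<bar>1 - \<zeta>\<bar>\<close>; both
  squared moduli are \<open>1 + 4 z\<close>.\<close>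

lemma one_against_four_family:
  assumes n5: "n = 5"
  shows "\<exists>K. eventually (extremal K) F"
proof -
  define z where "z x = \<sigma> x / 4" for x
  define Y where "Y x = z x - 9 / 4 * z x ^ 2" for x
  define \<zeta> where "\<zeta> x = Complex (- 3 / 2 * z x) (sqrt (Y x))" for x
  define \<xi> where "\<xi> j x = (if j = 0 then 4 else - 1) * \<zeta> x" for j :: nat and x
  have z2: "Oh 2 z" unfolding z_def[abs_def] by (intro Oh_divide_const \<sigma>_order)
  have Y2: "Oh 2 Y" unfolding Y_def[abs_def] by (intro Oh_diff z2 Oh_cmult Oh_power[OF z2]) auto
  have Re2: "Oh 2 (\<lambda>x. Re (\<zeta> x))" unfolding \<zeta>_def complex.sel by (intro Oh_cmult z2)
  have Im1: "Oh 1 (\<lambda>x. Im (\<zeta> x))" unfolding \<zeta>_def complex.sel by (rule Oh_sqrt[OF Y2])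
  have \<zeta>1: "Oh 1 \<zeta>" by (intro Oh_complexI Oh_mono[OF Re2] Im1) auto
  have Y0: "eventually (\<lambda>x. 0 \<le> Y x) F"
  proof -
    have "(z \<longlongrightarrow> 0) F" by (rule Oh_tendsto_0[OF z2]) simp
    then have "eventually (\<lambda>x. z x < 4 / 9) F" by (rule order_tendstoD) simp
    then show ?thesis using \<sigma>_pos
    proof eventually_elim
      case (elim x)
      have "0 \<le> z x * (1 - 9 / 4 * z x)" using elim by (intro mult_nonneg_nonneg) (simp_all add: z_def)
      then show ?case by (simp add: Y_def algebra_simps power2_eq_square)
    qed
  qed
  have lt: "{..<n} = {0, 1, 2, 3, 4}" using n5 by auto
  have xi1: "Oh 1 (\<xi> j)" for j unfolding \<xi>_def by (intro Oh_cmult \<zeta>1)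
  have sum0: "(\<Sum>j<n. \<xi> j x) = 0" for x unfolding lt by (simp add: \<xi>_def)
  interpret level_family F h n k \<xi> \<nu>
  proof unfold_locales
    show "3 \<le> \<nu>" "\<nu> \<le> 4" by (rule nu)+
    show "eventually (\<lambda>x. (\<Sum>j<n. \<xi> j x) = 0) F" using sum0 by simp
    show "eventually (\<lambda>x. norm (1 + \<xi> j x) ^ 2 = 1 + \<sigma> x) F" for j
      using Y0
    proof eventually_elim
      case (elim x)
      have Y: "sqrt (Y x) ^ 2 = Y x" using elim by simp
      have s: "\<sigma> x = 4 * z x" by (simp add: z_def)
      show ?case unfolding \<xi>_def cmod_power2 s
        by (simp add: \<zeta>_def power_mult_distrib Y, simp add: Y_def power2_eq_square algebra_simps)
    qed
    show "Oh 1 (\<xi> j)" for j by (rule xi1)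
    have nu3: "\<nu> = 3" unfolding \<nu>_def using n5 by simp
    show "Oh \<nu> (\<lambda>x. Im (esym (\<lambda>j. \<xi> j x) n i))" if i: "i \<in> {2..n}" for i
    proof (cases "i = 2")
      case True
      have "Oh 3 (\<lambda>x. - 20 * (Re (\<zeta> x) * Im (\<zeta> x)))"
        by (intro Oh_cmult Oh_mult[OF Re2 Im1]) simp
      moreover have "Im (esym (\<lambda>j. \<xi> j x) n 2) = - 20 * (Re (\<zeta> x) * Im (\<zeta> x))" for x
      proof -
        have "2 * esym (\<lambda>j. \<xi> j x) n 2 = - (\<Sum>j<n. \<xi> j x ^ 2)"
          using esym_2[of "\<lambda>j. \<xi> j x" n] sum0[of x] by simp
        also have "\<dots> = - 20 * \<zeta> x ^ 2" unfolding lt by (simp add: \<xi>_def power2_eq_square)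
        finally have "esym (\<lambda>j. \<xi> j x) n 2 = - 10 * \<zeta> x ^ 2" by simp
        then show ?thesis by (simp add: power2_eq_square)
      qed
      ultimately show ?thesis unfolding True nu3 by simp
    next
      case False
      have "Oh i (\<lambda>x. Im (esym (\<lambda>j. \<xi> j x) n i))" by (rule Oh_Im[OF esym_order[OF xi1]])
      then show ?thesis unfolding nu3 by (rule Oh_mono) (use False i in auto)
    qed
    have "cnj w2 = w2"
    proof -
      have "k = 2" using n5 k_def by simp
      then have "\<theta> (k + 1) = pi" unfolding \<theta>_def using n5 by simp
      then show ?thesis unfolding w2_def by simp
    qed
    then show "cnj w2 = w2 \<or> (\<forall>m. eventually (\<lambda>x. Im (esym (\<lambda>j. \<xi> j x) n m) = 0) F)" ..
    have p: "(\<Sum>j<n. Im (\<xi> j x) ^ 4) = 13 / 20 * (\<Sum>j<n. Im (\<xi> j x) ^ 2) ^ 2" for x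
      unfolding lt by (simp add: \<xi>_def power2_eq_square power4_eq_xxxx algebra_simps)
    have "pstar = 13 / 20 * S1 ^ 2" unfolding pstar_def if_P[OF n5] ..
    then show "\<exists>q. pstar = q * S1^2 \<and>
        eventually (\<lambda>x. (\<Sum>j<n. Im (\<xi> j x) ^ 4) = q * (\<Sum>j<n. Im (\<xi> j x) ^ 2) ^ 2) F"
      using p by (intro exI[of _ "13 / 20"]) simp
  qed
  show ?thesis using ext.extremal_polynomials unfolding ext.r0_def extremal_def[abs_def] .
qed

lemma lower_bound: "\<exists>K. eventually (extremal K) F"
  using conjugate_pair_family one_against_four_family by blast

end

section \<open>The expansion of the maximal distance\<close>

context active_pair
begin

text \<open>The filter consists of \<open>\<beta> \<rightarrow> 1\<close> restricted to the triples \<open>(\<beta>, r, v)\<close> for which \<open>v\<close> is admissible and \<open>r\<close> is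
  at least the radius to be proved. Along it the bound holds eventually, which by the
  definition of the filter is a bound uniform in \<open>r\<close> and \<open>v\<close>. Polynomials with a smaller radius satisfy the bound trivially.\<close>

lemma upper_bound_uniform:
  "\<exists>C b0. 0 \<le> C \<and> 0 \<le> b0 \<and> b0 < 1 \<and> (\<forall>\<beta>. b0 < \<beta> \<and> \<beta> < 1 \<longrightarrow> (\<forall>P\<in>sendov_polys (n + 1) \<beta>.
      crit_dist \<beta> P \<le> 1 + c1 * (1 - \<beta>) + c2 * (1 - \<beta>)^2 + C * sqrt (1 - \<beta>) ^ (\<nu> + 2)))"
proof -
  define h :: "real \<times> real \<times> (nat \<Rightarrow> complex) \<Rightarrow> real" where "h x = sqrt (1 - fst x)" for x
  define r :: "real \<times> real \<times> (nat \<Rightarrow> complex) \<Rightarrow> real" where "r x = fst (snd x)" for x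
  define v :: "nat \<Rightarrow> real \<times> real \<times> (nat \<Rightarrow> complex) \<Rightarrow> complex" where "v j x = snd (snd x) j" for j x
  define near where "near = {x. (\<forall>j<n. v j x \<noteq> 0 \<and> norm (v j x) \<le> 1) \<and> admissible n (fst x) (r x) (\<lambda>j. v j x)
     \<and> 1 + c1 * (1 - fst x) + c2 * (1 - fst x)^2 \<le> r x}"
  define F where "F = inf (filtercomap fst (at_left 1)) (principal near)"
  have fst1: "filterlim fst (at_left 1) F"
    unfolding F_def by (rule filterlim_mono[OF filterlim_filtercomap order_refl inf_le1])
  have less1: "eventually (\<lambda>x. fst x < 1) F"
    by (rule eventually_compose_filterlim[OF _ fst1]) (auto intro: eventually_at_leftI[of 0])
  have near_F: "eventually (\<lambda>x. x \<in> near) F"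
    unfolding F_def eventually_inf_principal by simp
  have hsq: "h x ^ 2 = 1 - fst x" "h x ^ 4 = (1 - fst x) ^ 2" if "fst x < 1" for x
  proof -
    show *: "h x ^ 2 = 1 - fst x" using that by (simp add: h_def)
    have "h x ^ 4 = (h x ^ 2) ^ 2" by simp
    then show "h x ^ 4 = (1 - fst x) ^ 2" unfolding * .
  qed
  interpret near_optimal F h n k r v "\<bar>c2\<bar>"
  proof unfold_locales
    show "eventually (\<lambda>x. 0 < h x) F" using less1 by eventually_elim (simp add: h_def)
    have "((\<lambda>b::real. sqrt (1 - b)) \<longlongrightarrow> sqrt (1 - 1)) (at_left 1)" by (intro tendsto_intros)
    then have "((\<lambda>b::real. sqrt (1 - b)) \<longlongrightarrow> 0) (at_left 1)" by simp
    from filterlim_compose[OF this fst1] show "(h \<longlongrightarrow> 0) F" unfolding h_def[abs_def] .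
    show "eventually (\<lambda>x. v j x \<noteq> 0 \<and> norm (v j x) \<le> 1) F" if "j < n" for j
      using near_F by eventually_elim (use that in \<open>auto simp: near_def\<close>)
    show "eventually (\<lambda>x. admissible n (1 - h x ^ 2) (r x) (\<lambda>j. v j x)) F"
      using near_F less1
    proof eventually_elim
      case (elim x)
      have "1 - h x ^ 2 = fst x" using hsq(1)[OF elim(2)] by simp
      then show ?case using elim(1) unfolding near_def by simp
    qed
    show "eventually (\<lambda>x. 1 + c1 * h x ^ 2 - \<bar>c2\<bar> * h x ^ 4 \<le> r x) F"
      using near_F less1
    proof eventually_elim
      case (elim x)
      have "- \<bar>c2\<bar> * (1 - fst x)^2 \<le> c2 * (1 - fst x)^2" by (intro mult_right_mono) auto
      moreover have "1 + c1 * (1 - fst x) + c2 * (1 - fst x)^2 \<le> r x" using elim(1) by (simp add: near_def)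
      ultimately show ?case unfolding hsq[OF elim(2)] by linarith
    qed
  qed
  obtain g where g: "Oh (\<nu> + 2) g" "eventually (\<lambda>x. r x \<le> 1 + c1 * h x ^ 2 + c2 * h x ^ 4 + g x) F"
    using upper_bound by blast
  obtain C where C: "C > 0" "eventually (\<lambda>x. norm (g x) \<le> C * h x ^ (\<nu> + 2)) F" using g(1) by (rule OhE)
  have "eventually (\<lambda>x. r x \<le> 1 + c1 * (1 - fst x) + c2 * (1 - fst x)^2 + C * sqrt (1 - fst x) ^ (\<nu> + 2)) F"
    using g(2) C(2) less1
  proof eventually_elim
    case (elim x)
    then show ?case unfolding hsq[OF elim(3)] h_def[symmetric] by (simp add: abs_le_iff)
  qed
  then obtain Q where Q: "eventually Q (at_left 1)"
    "\<And>x. Q (fst x) \<Longrightarrow> x \<in> near \<Longrightarrow>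
       r x \<le> 1 + c1 * (1 - fst x) + c2 * (1 - fst x)^2 + C * sqrt (1 - fst x) ^ (\<nu> + 2)"
    unfolding F_def eventually_inf_principal eventually_filtercomap by blast
  have "((\<lambda>b. 1 + c1 * (1 - b) + c2 * (1 - b)^2) \<longlongrightarrow> 1 + c1 * (1 - 1) + c2 * (1 - 1)^2) (at_left 1)"
    by (intro tendsto_intros)
  then have "eventually (\<lambda>b. 0 < 1 + c1 * (1 - b) + c2 * (1 - b)^2) (at_left 1)"
    by (rule order_tendstoD) simp
  then have "eventually (\<lambda>b. Q b \<and> 0 < 1 + c1 * (1 - b) + c2 * (1 - b)^2) (at_left 1)"
    using Q(1) by eventually_elim simp
  then obtain b where b: "b < 1" "\<And>y. b < y \<Longrightarrow> y < 1 \<Longrightarrow> Q y \<and> 0 < 1 + c1 * (1 - y) + c2 * (1 - y)^2"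
    unfolding eventually_at_left[OF zero_less_one] by blast
  have "crit_dist \<beta> P \<le> 1 + c1 * (1 - \<beta>) + c2 * (1 - \<beta>)^2 + C * sqrt (1 - \<beta>) ^ (\<nu> + 2)"
    if \<beta>: "max b 0 < \<beta>" "\<beta> < 1" and P: "P \<in> sendov_polys (n + 1) \<beta>" for \<beta> P
  proof (cases "1 + c1 * (1 - \<beta>) + c2 * (1 - \<beta>)^2 \<le> crit_dist \<beta> P")
    case True
    have Qb: "Q \<beta>" "0 < crit_dist \<beta> P" using b(2)[of \<beta>] \<beta> True by auto
    obtain w where w: "\<forall>j<n. w j \<noteq> 0 \<and> norm (w j) \<le> 1" "admissible n \<beta> (crit_dist \<beta> P) w"
      using admissible_of_sendov_poly[OF P refl Qb(2)] n3 by auto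
    have "(\<beta>, crit_dist \<beta> P, w) \<in> near" using w True by (simp add: near_def r_def v_def)
    from Q(2)[OF _ this] Qb(1) show ?thesis by (simp add: r_def)
  next
    case False
    have "0 \<le> C * sqrt (1 - \<beta>) ^ (\<nu> + 2)" using C(1) \<beta> by (intro mult_nonneg_nonneg zero_le_power) auto
    then show ?thesis using False by linarith
  qed
  then show ?thesis using C(1) b(1) by (intro exI[of _ C] exI[of _ "max b 0"]) auto
qed

lemma lower_bound_uniform:
  "\<exists>K b0. 0 \<le> b0 \<and> b0 < 1 \<and> (\<forall>\<beta>. b0 < \<beta> \<and> \<beta> < 1 \<longrightarrow> (\<exists>P\<in>sendov_polys (n + 1) \<beta>.
      crit_dist \<beta> P = 1 + c1 * (1 - \<beta>) + c2 * (1 - \<beta>)^2 - K * sqrt (1 - \<beta>) ^ (\<nu> + 2)))"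
proof -
  interpret near_one "at_right (0 :: real)" "\<lambda>x. x" n k
    by unfold_locales (auto intro: tendsto_ident_at simp: eventually_at_right_less)
  obtain K where "eventually (extremal K) (at_right 0)" using lower_bound by blast
  then obtain d where d: "0 < d" "\<And>x. 0 < x \<Longrightarrow> x < d \<Longrightarrow> extremal K x"
    unfolding eventually_at_right[OF zero_less_one] by blast
  define b0 where "b0 = max 0 (1 - d^2)"
  have "\<exists>P\<in>sendov_polys (n + 1) \<beta>.
      crit_dist \<beta> P = 1 + c1 * (1 - \<beta>) + c2 * (1 - \<beta>)^2 - K * sqrt (1 - \<beta>) ^ (\<nu> + 2)"
    if \<beta>: "b0 < \<beta>" "\<beta> < 1" for \<beta>
  proof -
    have "sqrt (1 - \<beta>) < sqrt (d^2)" using \<beta> unfolding b0_def by (intro real_sqrt_less_mono) auto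
    then have "sqrt (1 - \<beta>) < d" using d(1) by simp
    then have e: "extremal K (sqrt (1 - \<beta>))" using \<beta> by (intro d(2)) auto
    have s: "sqrt (1 - \<beta>) ^ 2 = 1 - \<beta>" using \<beta> by simp
    have "sqrt (1 - \<beta>) ^ 4 = (sqrt (1 - \<beta>) ^ 2) ^ 2" by simp
    then have s4: "sqrt (1 - \<beta>) ^ 4 = (1 - \<beta>) ^ 2" unfolding s .
    show ?thesis using e unfolding extremal_def s s4 by simp
  qed
  then show ?thesis using d(1) by (intro exI[of _ K] exI[of _ b0]) (auto simp: b0_def)
qed

lemma sendov_radius_expansion:
  "\<exists>C b0. 0 \<le> b0 \<and> b0 < 1 \<and> (\<forall>\<beta>. b0 < \<beta> \<and> \<beta> < 1 \<longrightarrow>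
     \<bar>sendov_radius (n + 1) \<beta> - (1 + c1 * (1 - \<beta>) + c2 * (1 - \<beta>)^2)\<bar> \<le> C * sqrt (1 - \<beta>) ^ (\<nu> + 2))"
proof -
  obtain C b where u: "0 \<le> C" "0 \<le> b" "b < 1" "\<And>\<beta> P. b < \<beta> \<Longrightarrow> \<beta> < 1 \<Longrightarrow> P \<in> sendov_polys (n + 1) \<beta> \<Longrightarrow>
      crit_dist \<beta> P \<le> 1 + c1 * (1 - \<beta>) + c2 * (1 - \<beta>)^2 + C * sqrt (1 - \<beta>) ^ (\<nu> + 2)"
    using upper_bound_uniform by blast
  obtain K b' where l: "0 \<le> b'" "b' < 1" "\<And>\<beta>. b' < \<beta> \<Longrightarrow> \<beta> < 1 \<Longrightarrow> \<exists>P\<in>sendov_polys (n + 1) \<beta>.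
      crit_dist \<beta> P = 1 + c1 * (1 - \<beta>) + c2 * (1 - \<beta>)^2 - K * sqrt (1 - \<beta>) ^ (\<nu> + 2)"
    using lower_bound_uniform by blast
  have "\<bar>sendov_radius (n + 1) \<beta> - (1 + c1 * (1 - \<beta>) + c2 * (1 - \<beta>)^2)\<bar> \<le> max C K * sqrt (1 - \<beta>) ^ (\<nu> + 2)"
    if \<beta>: "max b b' < \<beta>" "\<beta> < 1" for \<beta>
  proof -
    define M where "M = 1 + c1 * (1 - \<beta>) + c2 * (1 - \<beta>)^2"
    define s where "s = sqrt (1 - \<beta>) ^ (\<nu> + 2)"
    have s0: "0 \<le> s" unfolding s_def using \<beta> by (intro zero_le_power) auto
    have up: "crit_dist \<beta> P \<le> M + C * s" if "P \<in> sendov_polys (n + 1) \<beta>" for P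
      using u(4)[OF _ _ that] \<beta> by (simp add: M_def s_def)
    obtain P where P: "P \<in> sendov_polys (n + 1) \<beta>" "crit_dist \<beta> P = M - K * s"
      using l(3)[of \<beta>] \<beta> by (auto simp: M_def s_def)
    have "sendov_radius (n + 1) \<beta> \<le> M + C * s"
      unfolding sendov_radius_def by (rule cSUP_least) (use P up in auto)
    moreover have "M - K * s \<le> sendov_radius (n + 1) \<beta>"
      unfolding sendov_radius_def P(2)[symmetric]
      by (rule cSUP_upper[OF P(1)]) (rule bdd_aboveI2, rule up)
    moreover have "C * s \<le> max C K * s" "K * s \<le> max C K * s"
      using s0 by (auto intro: mult_right_mono)
    ultimately show ?thesis unfolding M_def[symmetric] s_def[symmetric] by linarith
  qed
  then show ?thesis using u(2,3) l(1,2) by (intro exI[of _ "max C K"] exI[of _ "max b b'"]) auto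
qed

end

theorem theorem1:
  fixes n :: nat and k :: int
    and u1 u2 D1 D2 D3 D4 D5 D6 D \<alpha> \<Delta> :: real
  assumes "n \<ge> 3"
    and "k = \<lfloor>(real n + 1) / 3\<rfloor>"
    and "u1 = cos (2 * pi * of_int k / (real n + 1))"
    and "u2 = cos (2 * pi * (of_int k + 1) / (real n + 1))"
    and "D1 = (- 2 * u1 * u2 - 1) / (2 * (1 - u1) * (1 - u2))"
    and "D2 = (- 1) / (2 * (1 - u1) * (1 - u2))"
    and "D3 = (- 1 - 4 * D1 - 3 * D1^2 + 2 * D2^2) / 2"
    and "D4 = (3 * D1 - 4 * D2 + 3 * D1^2 - 2 * D1 * D2 - 6 * D2^2) / 2"
    and "D5 = (2 + 4 * D1 + 5 * D2 + 2 * D1^2 + 4 * D1 * D2 + 3 * D2^2) / 2"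
    and "D6 = (2 * D2 + 2 * D1 * D2 + 3 * D2^2) / 2"
    and "D = D3 * real n + D4 + D5 / real n + D6 / (real n)^2"
    and "\<alpha> = (if n = 3 \<or> n = 5 then 3 / 2 else 2)"
    and "\<Delta> = (if n = 5 then 7 / 225 else 0)"
  shows "\<exists>C \<beta>\<^sub>0. 0 \<le> \<beta>\<^sub>0 \<and> \<beta>\<^sub>0 < 1 \<and>
    (\<forall>\<beta>. \<beta>\<^sub>0 < \<beta> \<and> \<beta> < 1 \<longrightarrow>
      \<bar>sendov_radius (n + 1) \<beta>
        - (1 + (D1 + D2 / real n) * (1 - \<beta>) + (D + \<Delta>) * (1 - \<beta>)^2)\<bar>
      \<le> C * (1 - \<beta>) powr (\<alpha> + 1))"
proof -
  define kk where "kk = (n + 1) div 3"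
  have k: "k = int kk"
    unfolding assms(2) kk_def using floor_divide_of_nat_eq[of "n + 1" 3, where 'a=real] by (simp add: add.commute)
  interpret ap: active_pair n kk
    by unfold_locales (use assms(1) kk_def in auto)
  have u: "ap.u1 = u1" "ap.u2 = u2"
    unfolding ap.u1_def ap.u2_def ap.\<theta>_def assms(3,4) k by (simp_all add: add.commute)
  have D: "ap.D1 = D1" "ap.D2 = D2"
    unfolding ap.D1_def ap.D2_def u assms(5,6) by (rule refl)+
  have c1: "ap.c1 = D1 + D2 / real n" unfolding ap.c1_def D ..
  have c2: "ap.c2 = D + \<Delta>"
    unfolding ap.c2_eq ap.DD_def Let_def D assms(13) assms(11) assms(7-10) ..
  \<comment> \<open>The half-integral exponent \<open>5 / 2\<close> is the fifth power of \<open>h = sqrt (1 - \<beta>)\<close>, and 3 is its sixth.\<close>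
  have pow: "sqrt (1 - \<beta>) ^ (ap.\<nu> + 2) = (1 - \<beta>) powr (\<alpha> + 1)" if "\<beta> < 1" for \<beta>
  proof -
    have "sqrt (1 - \<beta>) ^ (ap.\<nu> + 2) = ((1 - \<beta>) powr (1 / 2)) powr real (ap.\<nu> + 2)"
      using that by (subst powr_realpow) (simp_all add: powr_half_sqrt)
    also have "\<dots> = (1 - \<beta>) powr (1 / 2 * real (ap.\<nu> + 2))" by (rule powr_powr)
    also have "1 / 2 * real (ap.\<nu> + 2) = \<alpha> + 1" unfolding ap.\<nu>_def assms(12) by simp
    finally show ?thesis .
  qed
  obtain C b where b: "0 \<le> b" "b < 1" "\<And>\<beta>. b < \<beta> \<Longrightarrow> \<beta> < 1 \<Longrightarrow>
     \<bar>sendov_radius (n + 1) \<beta> - (1 + ap.c1 * (1 - \<beta>) + ap.c2 * (1 - \<beta>)^2)\<bar> \<le> C * sqrt (1 - \<beta>) ^ (ap.\<nu> + 2)"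
    using ap.sendov_radius_expansion by blast
  show ?thesis
  proof (rule exI[of _ C], rule exI[of _ b], intro conjI allI impI)
    fix \<beta> assume "b < \<beta> \<and> \<beta> < 1"
    then show "\<bar>sendov_radius (n + 1) \<beta> - (1 + (D1 + D2 / real n) * (1 - \<beta>) + (D + \<Delta>) * (1 - \<beta>)^2)\<bar>
      \<le> C * (1 - \<beta>) powr (\<alpha> + 1)"
      using b(3)[of \<beta>] pow[of \<beta>] unfolding c1 c2 by simp
  qed (use b in auto)
qed

end
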